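(* Let $d\in\mathbb N$, let $\mathbf Q$ be a word in $\mathcal E_{P_1(A)}$, and let $\mathbf i,\mathbf j\in\Lambda_{d,\mathbf Q}$. Then the set ${}_{\mathbf j}\mathcal C_{\mathbf i}=\{\mathbf a_{\mathbf j}\,\mathbf x_{\mathbf j}^{\alpha}\,T_{\mathbf j,w,\mathbf i} : \mathbf a\in B^{\otimes d},\ \alpha\in\mathbb Z^d,\ w\in S_d\}$ is a $\Bbbk$-basis of $\operatorname{Hom}_{\mathcal{LAH}(A,z)}(\mathbf i,\mathbf j)$.
   Context: Conventions. $\Bbbk$ is a commutative ring and $z\in\Bbbk$ is fixed. All algebras are associative unital $\Bbbk$-superalgebras; $\bar f\in\mathbb Z_2$ is the parity of $f$; formulas with parities are for homogeneous elements and extended linearly. $\mathbb N=\{0,1,\dots\}$. Tensor products of superalgebras: $(f'\otimes g)(f\otimes g')=(-1)^{\bar f\bar g}f'f\otimes gg'$. For an algebra $F$, $Z(F)=\{f: fg=(-1)^{\bar f\bar g}gf\ \forall g\in F\}$; $f\in F$ is regular if it is neither a left nor a right zero-divisor. $\mathcal E_F$ is the set of even, central, regular elements of $F$, and $\widehat{\mathcal E}_F=\mathcal E_F\cup\{\mathsf I\}$ with $\mathsf I$ a formal symbol. $A$ is a symmetric Frobenius superalgebra with parity-preserving trace map, free over $\Bbbk$ with homogeneous (finite) basis $B$: the trace $\operatorname{tr}\colon A\to\Bbbk$ is even, $\operatorname{tr}(ab)=(-1)^{\bar a\bar b}\operatorname{tr}(ba)$, and there is a left dual basis $\{b^\vee:b\in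 B\}$ with $\operatorname{tr}(b^\vee c)=\delta_{b,c}$. For $a\in A$, $a_i=1^{\otimes(i-1)}\otimes a\otimes1^{\otimes(n-i)}\in A^{\otimes n}$. $B^{\otimes d}=\{b_1\otimes\cdots\otimes b_d:b_k\in B\}$. $P_n(A)=A^{\otimes n}\otimes\Bbbk[X_1^{\pm1},\dots,X_n^{\pm1}]$ ($X_i$ even, commuting with $A^{\otimes n}$); write $X=X_1\in P_1(A)$. For $f=\sum_k a_{(k)}X^k\in P_1(A)$, $f_i=\sum_k(a_{(k)})_iX_i^k\in P_n(A)$. With $t_{i,j}=\sum_{b\in B}b_i(b^\vee)_j$, the $\Bbbk$-linear operators $\Delta_i$ on $P_n(A)$ ($1\le i\le n-1$) are given by $\Delta_i(\mathbf ap)=t_{i,i+1}\mathbf a\,\dfrac{X_{i+1}(s_i(p)-p)}{X_i-X_{i+1}}$ for $\mathbf a\in A^{\otimes n}$, $p\in\Bbbk[X_1^{\pm1},\dots,X_n^{\pm1}]$, where $s_i$ swaps $X_i$ and $X_{i+1}$. A strict $\Bbbk$-linear monoidal supercategory is a strict monoidal category enriched in $\Bbbk$-supermodules with super interchange law $(f'\otimes g)\circ(f\otimes g')=(-1)^{\bar f\bar g}(f'\circ f)\otimes(g\circ g')$; juxtaposition denotes composition. $\mathcal{LAH}(A,z)$ (higher-level affine Frobenius Hecke category) is the strict $\Bbbk$-linear monoidal supercategory whose objects are generated by $\widehat{\mathcal E}_{P_1(A)}$ (objects are words in this set, tensor product is concatenation), with generating morphisms: even $T_+,T_-\colon\mathsf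 I\otimes\mathsf I\to\mathsf I\otimes\mathsf I$ (positive and negative black-black crossings), $\langle a\rangle\colon\mathsf I\to\mathsf I$ for $a\in A$ (token, parity $\bar a$), even $\mathsf X,\mathsf X^{-1}\colon\mathsf I\to\mathsf I$ (dot and inverse dot), and even $\rho_Q\colon Q\otimes\mathsf I\to\mathsf I\otimes Q$, $\lambda_Q\colon\mathsf I\otimes Q\to Q\otimes\mathsf I$ (red-black crossings) for $Q\in\mathcal E_{P_1(A)}$. For $f=\sum_ra_{(r)}X^r\in P_1(A)$ put $[f]=\sum_r\langle a_{(r)}\rangle\mathsf X^r$. For $f=\sum\mu_{b,c,r,s}(b\otimes c)X_1^rX_2^s\in P_2(A)$ put $[f]_Q=\sum\mu_{b,c,r,s}(\langle b\rangle\otimes1_Q\otimes\langle c\rangle)(\mathsf X^r\otimes1_Q\otimes\mathsf X^s)\in\operatorname{End}(\mathsf I\otimes Q\otimes\mathsf I)$. Relations, for all $a,b\in A$, $\lambda,\mu\in\Bbbk$, $Q\in\mathcal E_{P_1(A)}$: $\langle1\rangle=1_{\mathsf I}$, $\lambda\langle a\rangle+\mu\langle b\rangle=\langle\lambda a+\mu b\rangle$, $\langle a\rangle\langle b\rangle=\langle ab\rangle$; $\mathsf X\mathsf X^{-1}=\mathsf X^{-1}\mathsf X=1_{\mathsf I}$, $\langle a\rangle\mathsf X=\mathsf X\langle a\rangle$; $T_+T_-=T_-T_+=1$; $(T_+\otimes1_{\mathsf I})(1_{\mathsf I}\otimes T_+)(T_+\otimes1_{\mathsf I})=(1_{\mathsf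 I}\otimes T_+)(T_+\otimes1_{\mathsf I})(1_{\mathsf I}\otimes T_+)$; $T_+(\langle a\rangle\otimes1_{\mathsf I})=(1_{\mathsf I}\otimes\langle a\rangle)T_+$; $T_+-T_-=z\sum_{b\in B}\langle b\rangle\otimes\langle b^\vee\rangle$; $T_+(\mathsf X\otimes1_{\mathsf I})=(1_{\mathsf I}\otimes\mathsf X)T_-$; $\lambda_Q(\langle a\rangle\otimes1_Q)=(1_Q\otimes\langle a\rangle)\lambda_Q$; $\rho_Q(1_Q\otimes\langle a\rangle)=(\langle a\rangle\otimes1_Q)\rho_Q$; the same two relations with $\langle a\rangle$ replaced by $\mathsf X$; $\rho_Q\lambda_Q=[Q]\otimes1_Q$; $\lambda_Q\rho_Q=1_Q\otimes[Q]$; $(T_+\otimes1_Q)(1_{\mathsf I}\otimes\rho_Q)(\rho_Q\otimes1_{\mathsf I})=(1_{\mathsf I}\otimes\rho_Q)(\rho_Q\otimes1_{\mathsf I})(1_Q\otimes T_+)$; $(\lambda_Q\otimes1_{\mathsf I})(1_{\mathsf I}\otimes\lambda_Q)(T_+\otimes1_Q)=(1_Q\otimes T_+)(\lambda_Q\otimes1_{\mathsf I})(1_{\mathsf I}\otimes\lambda_Q)$; $(\rho_Q\otimes1_{\mathsf I})(1_Q\otimes T_+)(\lambda_Q\otimes1_{\mathsf I})=(1_{\mathsf I}\otimes\lambda_Q)(T_+\otimes1_Q)(1_{\mathsf I}\otimes\rho_Q)+z[\Delta_1(Q_1)]_Q$. Shuffles. For a word $\mathbf Q$ in $\mathcal E_{P_1(A)}$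 (of length $|\mathbf Q|$), $\Lambda_{d,\mathbf Q}$ is the set of words of length $d+|\mathbf Q|$ in $\widehat{\mathcal E}_{P_1(A)}$ containing both $\mathsf I^d$ and $\mathbf Q$ as subwords (a subword is obtained by deleting some, not necessarily consecutive, letters). Letters $\mathsf I$ correspond to black strands and letters in $\mathcal E_{P_1(A)}$ to red strands; strands are numbered from left to right. Chosen diagrams. For each $\mathbf i,\mathbf j\in\Lambda_{d,\mathbf Q}$ and $w\in S_d$, fix a diagram $T_{\mathbf j,w,\mathbf i}\in\operatorname{Hom}_{\mathcal{LAH}(A,z)}(\mathbf i,\mathbf j)$, i.e. a composite of morphisms $1\otimes g\otimes1$ with $g$ one of $T_+,\rho_Q,\lambda_Q$ (no tokens, no (inverse) dots, no negative black-black crossings), such that the sequence of transpositions on the black strands (the crossing of the $r$-th and $(r+1)$-st black strands giving $s_r$, multiplied in the order of composition) is a reduced expression for $w$, and each pair of a red and a black strand crosses at most once. The choice is arbitrary. For $\mathbf i\in\Lambda_{d,\mathbf Q}$, $\mathbf a\mapsto\mathbf a_{\mathbf i}$ is the algebra homomorphism $A^{\otimes d}\to\operatorname{End}_{\mathcal{LAH}(A,z)}(\mathbf i)$ sending $a_k$ to the token $\langle a\rangle$ on the $k$-th black strand; $x_{k,\mathbf i}$ is the (invertible) dot $\mathsf X$ on the $k$-th black strand; $\mathbf x_{\mathbf i}^\alpha=(x_{1,\mathbf i})^{\alpha_1}\cdots(x_{d,\mathbf i})^{\alpha_d}$ for $\alpha\in\mathbb Z^d$. *)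

theory Defs
  imports
    "HOL-Library.Z2"
    "HOL-Library.Poly_Mapping"
    "HOL-Library.Product_Plus"
    "HOL-Library.Sublist"
    "HOL-Combinatorics.Permutations"
    "HOL-Algebra.Module"
    "HOL-Algebra.Algebraic_Closure_Type"
begin

section \<open>Bases of modules\<close>

definition lin_indep :: "('r, 'm) ring_scheme \<Rightarrow> ('r, 'v, 'n) module_scheme \<Rightarrow> 'v set \<Rightarrow> bool" where
  "lin_indep R M S \<longleftrightarrow>
     (\<forall>F c. finite F \<longrightarrow> F \<subseteq> S \<longrightarrow> c \<in> F \<rightarrow> carrier R \<longrightarrow>
        (\<Oplus>\<^bsub>M\<^esub>v\<in>F. c v \<odot>\<^bsub>M\<^esub> v) = \<zero>\<^bsub>M\<^esub> \<longrightarrow> (\<forall>v\<in>F. c v = \<zero>\<^bsub>R\<^esub>))"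

definition generates :: "('r, 'm) ring_scheme \<Rightarrow> ('r, 'v, 'n) module_scheme \<Rightarrow> 'v set \<Rightarrow> bool" where
  "generates R M S \<longleftrightarrow>
     (\<forall>x\<in>carrier M. \<exists>F c. finite F \<and> F \<subseteq> S \<and> c \<in> F \<rightarrow> carrier R \<and>
        x = (\<Oplus>\<^bsub>M\<^esub>v\<in>F. c v \<odot>\<^bsub>M\<^esub> v))"

definition module_basis :: "('r, 'm) ring_scheme \<Rightarrow> ('r, 'v, 'n) module_scheme \<Rightarrow> 'v set \<Rightarrow> bool" where
  "module_basis R M S \<longleftrightarrow> S \<subseteq> carrier M \<and> lin_indep R M S \<and> generates R M S"


section \<open>Symmetric Frobenius superalgebras\<close>

definition koszul :: "bit \<Rightarrow> bit \<Rightarrow> 'r::ring_1" where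
  "koszul p q = (if p * q = 1 then - 1 else 1)"

text \<open>\<open>gr p\<close> is the homogeneous component of parity \<open>p\<close>.\<close>

locale superalgebra = Modules.module scale
  for scale :: "'k::comm_ring_1 \<Rightarrow> 'a::ring_1 \<Rightarrow> 'a" (infixr \<open>*s\<close> 75) +
  fixes gr :: "bit \<Rightarrow> 'a set"
  assumes scale_mult_left: "(r *s x) * y = r *s (x * y)"
    and scale_mult_right: "x * (r *s y) = r *s (x * y)"
    and gr_subspace: "subspace (gr p)"
    and gr_direct: "\<exists>!y. y \<in> gr 0 \<and> x - y \<in> gr 1"
    and gr_one: "1 \<in> gr 0"
    and gr_mult: "x \<in> gr p \<Longrightarrow> y \<in> gr q \<Longrightarrow> x * y \<in> gr (p + q)"

locale symmetric_frobenius_superalgebra = superalgebra scale gr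
  for scale :: "'k::comm_ring_1 \<Rightarrow> 'a::ring_1 \<Rightarrow> 'a" (infixr \<open>*s\<close> 75)
    and gr :: "bit \<Rightarrow> 'a set" +
  fixes tr :: "'a \<Rightarrow> 'k" and B :: "'a set" and dual :: "'a \<Rightarrow> 'a"
  assumes tr_linear: "module_hom scale (*) tr"
    and tr_even: "x \<in> gr 1 \<Longrightarrow> tr x = 0"
    and tr_symmetric: "x \<in> gr p \<Longrightarrow> y \<in> gr q \<Longrightarrow> tr (x * y) = koszul p q * tr (y * x)"
    and B_finite: "finite B"
    and B_homogeneous: "b \<in> B \<Longrightarrow> \<exists>p. b \<in> gr p"
    and B_independent: "independent B"
    and B_span: "span B = UNIV"
    and dual_inj: "inj_on dual B"
    and dual_independent: "independent (dual ` B)"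
    and dual_span: "span (dual ` B) = UNIV"
    and dual_tr: "b \<in> B \<Longrightarrow> c \<in> B \<Longrightarrow> tr (dual b * c) = (if b = c then 1 else 0)"


section \<open>The algebras \<open>P\<^sub>1(A)\<close> and \<open>P\<^sub>2(A)\<close>\<close>

text \<open>The Laurent polynomial \<open>\<Sum>\<^sub>r a\<^sub>r X\<^sup>r\<close> is the finitely supported function \<open>r \<mapsto> a\<^sub>r\<close>; the product
  of \<^theory>\<open>HOL-Library.Poly_Mapping\<close> is convolution, so \<open>X\<close> commutes with the coefficients.\<close>

type_synonym 'a P1 = "int \<Rightarrow>\<^sub>0 'a"

text \<open>Coordinates with respect to the elements \<open>b \<otimes> c\<close>, with \<open>b\<close> and \<open>c\<close> in the basis of \<open>A\<close>.\<close>

type_synonym ('a, 'k) A2 = "('a \<times> 'a) \<Rightarrow>\<^sub>0 'k"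

text \<open>\<open>\<k>[X\<^sub>1\<^sup>\<plusminus>, X\<^sub>2\<^sup>\<plusminus>]\<close>\<close>

type_synonym 'k laurent2 = "(int \<times> int) \<Rightarrow>\<^sub>0 'k"

text \<open>The coefficient at \<open>(b, c, r, s)\<close> is that of \<open>(b \<otimes> c) X\<^sub>1\<^sup>r X\<^sub>2\<^sup>s\<close>.\<close>

type_synonym ('a, 'k) P2 = "('a \<times> 'a \<times> int \<times> int) \<Rightarrow>\<^sub>0 'k"

abbreviation lookup :: "('i \<Rightarrow>\<^sub>0 'c::zero) \<Rightarrow> 'i \<Rightarrow> 'c" where "lookup \<equiv> Poly_Mapping.lookup"
abbreviation keys :: "('i \<Rightarrow>\<^sub>0 'c::zero) \<Rightarrow> 'i set" where "keys \<equiv> Poly_Mapping.keys"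
abbreviation single :: "'i \<Rightarrow> 'c \<Rightarrow> 'i \<Rightarrow>\<^sub>0 'c::zero" where "single \<equiv> Poly_Mapping.single"

definition regular :: "'r::ring \<Rightarrow> bool" where
  "regular f \<longleftrightarrow> (\<forall>g. f * g = 0 \<longrightarrow> g = 0) \<and> (\<forall>g. g * f = 0 \<longrightarrow> g = 0)"

context superalgebra
begin

definition P1_gr :: "bit \<Rightarrow> 'a P1 set" where
  "P1_gr p = {f. \<forall>r. lookup f r \<in> gr p}"

text \<open>The homogeneous elements of parity \<open>p\<close> in the supercentre.\<close>

definition P1_center :: "bit \<Rightarrow> 'a P1 set" where
  "P1_center p = {f \<in> P1_gr p. \<forall>q. \<forall>g \<in> P1_gr q. f * g = koszul p q * (g * f)}"

text \<open>The even, central, regular elements of \<open>P\<^sub>1(A)\<close>\<close>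

definition E :: "'a P1 set" where
  "E = {f \<in> P1_center 0. regular f}"

end

definition X1 :: "'k::comm_ring_1 laurent2" where "X1 = single (1, 0) 1"

definition X2 :: "'k::comm_ring_1 laurent2" where "X2 = single (0, 1) 1"

definition swap_vars :: "'k::comm_ring_1 laurent2 \<Rightarrow> 'k laurent2" where
  "swap_vars p = Poly_Mapping.map_key prod.swap p"

text \<open>\<open>X\<^sub>2 (s\<^sub>1(p) - p) / (X\<^sub>1 - X\<^sub>2)\<close>; the quotient exists and is unique.\<close>

definition demazure :: "'k::comm_ring_1 laurent2 \<Rightarrow> 'k laurent2" where
  "demazure p = (THE h. (X1 - X2) * h = X2 * (swap_vars p - p))"

text \<open>The element \<open>u \<otimes> p\<close> of \<open>A\<^bsup>\<otimes>2\<^esup> \<otimes> \<k>[X\<^sub>1\<^sup>\<plusminus>, X\<^sub>2\<^sup>\<plusminus>]\<close>\<close>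

definition P2_of :: "('a, 'k::comm_ring_1) A2 \<Rightarrow> 'k laurent2 \<Rightarrow> ('a, 'k) P2" where
  "P2_of u p = (\<Sum>(b, c)\<in>keys u. \<Sum>(r, s)\<in>keys p.
     single (b, c, r, s) (lookup u (b, c) * lookup p (r, s)))"

context symmetric_frobenius_superalgebra
begin

text \<open>\<open>x \<otimes> y\<close> in coordinates\<close>

definition tens :: "'a \<Rightarrow> 'a \<Rightarrow> ('a, 'k) A2" where
  "tens x y = (\<Sum>b\<in>B. \<Sum>c\<in>B.
     single (b, c) (representation B x b * representation B y c))"

text \<open>Only used for elements of \<open>B\<close>, which are homogeneous and nonzero.\<close>

definition parity :: "'a \<Rightarrow> bit" where
  "parity b = (THE p. b \<in> gr p)"

text \<open>The product \<open>(b \<otimes> c)(b' \<otimes> c') = \<plusminus> bb' \<otimes> cc'\<close>, where the sign comes from \<open>c\<close> and \<open>b'\<close>.\<close>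

definition A2_mult :: "('a, 'k) A2 \<Rightarrow> ('a, 'k) A2 \<Rightarrow> ('a, 'k) A2" where
  "A2_mult u v = (\<Sum>(b, c)\<in>keys u. \<Sum>(b', c')\<in>keys v.
     Poly_Mapping.map ((*) (koszul (parity c) (parity b') * lookup u (b, c) * lookup v (b', c')))
       (tens (b * b') (c * c')))"

definition t12 :: "('a, 'k) A2" where
  "t12 = (\<Sum>b\<in>B. A2_mult (tens b 1) (tens 1 (dual b)))"

text \<open>\<open>f\<^sub>1 = \<Sum>\<^sub>r (a\<^sub>r)\<^sub>1 X\<^sub>1\<^sup>r\<close>\<close>

definition P2_first :: "'a P1 \<Rightarrow> ('a, 'k) P2" where
  "P2_first f = (\<Sum>r\<in>keys f. P2_of (tens (lookup f r) 1) (single (r, 0) 1))"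

definition Delta1 :: "('a, 'k) P2 \<Rightarrow> ('a, 'k) P2" where
  "Delta1 F = (\<Sum>(b, c, r, s)\<in>keys F.
     P2_of (A2_mult t12 (tens b c)) (demazure (single (r, s) (lookup F (b, c, r, s)))))"

end


section \<open>Terms for the morphisms\<close>

text \<open>\<open>Black\<close> is the object \<open>I\<close>; red letters are taken from a type \<open>'q\<close>, which is \<open>'a P1\<close> below.\<close>

datatype 'q letter = Black | Red 'q

text \<open>In a composite \<open>f \<bullet> g\<close>, \<open>g\<close> comes first.\<close>

datatype ('q, 'a, 'k) mor_term =
    Ident "'q letter list"
  | Tpos | Tneg | Token 'a | Dot | DotInv | Rho 'q | Lam 'q
  | Comp "('q, 'a, 'k) mor_term" "('q, 'a, 'k) mor_term" (infixr \<open>\<bullet>\<close> 65)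
  | Tensor "('q, 'a, 'k) mor_term" "('q, 'a, 'k) mor_term" (infixr \<open>\<boxtimes>\<close> 70)
  | Zero "'q letter list" "'q letter list"
  | Add "('q, 'a, 'k) mor_term" "('q, 'a, 'k) mor_term" (infixl \<open>\<boxplus>\<close> 60)
  | Scale 'k "('q, 'a, 'k) mor_term"

type_synonym 'a obj = "'a P1 letter list"
type_synonym ('a, 'k) mor = "('a P1, 'a, 'k) mor_term"

text \<open>The sum of \<open>t x\<close> over a finite set \<open>S\<close>; the terms are listed in an arbitrary order, which is
  immaterial modulo the congruence \<open>eqv\<close> below.\<close>

definition term_sum :: "'a::zero obj \<Rightarrow> 'a obj \<Rightarrow> 's set \<Rightarrow> ('s \<Rightarrow> ('a, 'k) mor) \<Rightarrow> ('a, 'k) mor" where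
  "term_sum i j S t =
     foldr (\<lambda>x f. t x \<boxplus> f) (SOME xs. distinct xs \<and> set xs = S) (Zero i j)"

definition term_power :: "'a::zero obj \<Rightarrow> ('a, 'k) mor \<Rightarrow> nat \<Rightarrow> ('a, 'k) mor" where
  "term_power i f n = ((\<lambda>g. f \<bullet> g) ^^ n) (Ident i)"

text \<open>\<open>f\<^sup>m\<close> for an endomorphism \<open>f\<close> of \<open>i\<close> with inverse \<open>f'\<close>.\<close>

definition term_powi ::
  "'a::zero obj \<Rightarrow> ('a, 'k) mor \<Rightarrow> ('a, 'k) mor \<Rightarrow> int \<Rightarrow> ('a, 'k) mor" where
  "term_powi i f f' m =
     (if 0 \<le> m then term_power i f (nat m) else term_power i f' (nat (- m)))"

definition dot_powi :: "int \<Rightarrow> ('a::zero, 'k) mor" where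
  "dot_powi m = term_powi [Black] Dot DotInv m"

definition bracket :: "'a::zero P1 \<Rightarrow> ('a, 'k) mor" where
  "bracket f = term_sum [Black] [Black] (keys f) (\<lambda>r. Token (lookup f r) \<bullet> dot_powi r)"

definition bracket_red :: "'a::zero P1 \<Rightarrow> ('a, 'k::comm_ring_1) P2 \<Rightarrow> ('a, 'k) mor" where
  "bracket_red Q F = term_sum [Black, Red Q, Black] [Black, Red Q, Black] (keys F)
     (\<lambda>(b, c, r, s). Scale (lookup F (b, c, r, s))
        ((Token b \<boxtimes> Ident [Red Q] \<boxtimes> Token c) \<bullet> (dot_powi r \<boxtimes> Ident [Red Q] \<boxtimes> dot_powi s)))"


section \<open>The higher-level affine Frobenius Hecke category\<close>

definition (in superalgebra) objects :: "'a obj set" where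
  "objects = lists (insert Black (Red ` E))"

locale LAH = symmetric_frobenius_superalgebra scale gr tr B dual
  for scale :: "'k::comm_ring_1 \<Rightarrow> 'a::ring_1 \<Rightarrow> 'a" (infixr \<open>*s\<close> 75)
    and gr :: "bit \<Rightarrow> 'a set" and tr :: "'a \<Rightarrow> 'k" and B :: "'a set" and dual :: "'a \<Rightarrow> 'a" +
  fixes z :: 'k
begin

text \<open>\<open>arrow f i j\<close>: the term \<open>f\<close> denotes a morphism from \<open>i\<close> to \<open>j\<close>.\<close>

inductive arrow :: "('a, 'k) mor \<Rightarrow> 'a obj \<Rightarrow> 'a obj \<Rightarrow> bool" where
  arrow_Ident: "i \<in> objects \<Longrightarrow> arrow (Ident i) i i"
| arrow_Tpos: "arrow Tpos [Black, Black] [Black, Black]"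
| arrow_Tneg: "arrow Tneg [Black, Black] [Black, Black]"
| arrow_Token: "arrow (Token a) [Black] [Black]"
| arrow_Dot: "arrow Dot [Black] [Black]"
| arrow_DotInv: "arrow DotInv [Black] [Black]"
| arrow_Rho: "Q \<in> E \<Longrightarrow> arrow (Rho Q) [Red Q, Black] [Black, Red Q]"
| arrow_Lam: "Q \<in> E \<Longrightarrow> arrow (Lam Q) [Black, Red Q] [Red Q, Black]"
| arrow_Comp: "arrow g i j \<Longrightarrow> arrow f j k \<Longrightarrow> arrow (f \<bullet> g) i k"
| arrow_Tensor: "arrow f i j \<Longrightarrow> arrow g k l \<Longrightarrow> arrow (f \<boxtimes> g) (i @ k) (j @ l)"
| arrow_Zero: "i \<in> objects \<Longrightarrow> j \<in> objects \<Longrightarrow> arrow (Zero i j) i j"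
| arrow_Add: "arrow f i j \<Longrightarrow> arrow g i j \<Longrightarrow> arrow (f \<boxplus> g) i j"
| arrow_Scale: "arrow f i j \<Longrightarrow> arrow (Scale c f) i j"

text \<open>\<open>has_parity f p\<close>: the term \<open>f\<close> denotes a homogeneous morphism of parity \<open>p\<close>.\<close>

inductive has_parity :: "('a, 'k) mor \<Rightarrow> bit \<Rightarrow> bool" where
  par_Ident: "has_parity (Ident i) 0"
| par_Tpos: "has_parity Tpos 0"
| par_Tneg: "has_parity Tneg 0"
| par_Token: "a \<in> gr p \<Longrightarrow> has_parity (Token a) p"
| par_Dot: "has_parity Dot 0"
| par_DotInv: "has_parity DotInv 0"
| par_Rho: "has_parity (Rho Q) 0"
| par_Lam: "has_parity (Lam Q) 0"
| par_Comp: "has_parity f p \<Longrightarrow> has_parity g q \<Longrightarrow> has_parity (f \<bullet> g) (p + q)"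
| par_Tensor: "has_parity f p \<Longrightarrow> has_parity g q \<Longrightarrow> has_parity (f \<boxtimes> g) (p + q)"
| par_Zero: "has_parity (Zero i j) p"
| par_Add: "has_parity f p \<Longrightarrow> has_parity g p \<Longrightarrow> has_parity (f \<boxplus> g) p"
| par_Scale: "has_parity f p \<Longrightarrow> has_parity (Scale c f) p"

abbreviation "idB \<equiv> (Ident [Black] :: ('a, 'k) mor)"
abbreviation idR :: "'a P1 \<Rightarrow> ('a, 'k) mor" where "idR Q \<equiv> Ident [Red Q]"

text \<open>The defining relations, with the source and the target of both sides.\<close>

inductive def_rel :: "'a obj \<Rightarrow> 'a obj \<Rightarrow> ('a, 'k) mor \<Rightarrow> ('a, 'k) mor \<Rightarrow> bool" where
  token_one: "def_rel [Black] [Black] (Token 1) idB"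
| token_linear: "def_rel [Black] [Black]
    (Scale l (Token a) \<boxplus> Scale m (Token b)) (Token (l *s a + m *s b))"
| token_mult: "def_rel [Black] [Black] (Token a \<bullet> Token b) (Token (a * b))"
| dot_inv_right: "def_rel [Black] [Black] (Dot \<bullet> DotInv) idB"
| dot_inv_left: "def_rel [Black] [Black] (DotInv \<bullet> Dot) idB"
| token_dot: "def_rel [Black] [Black] (Token a \<bullet> Dot) (Dot \<bullet> Token a)"
| cross_inv_right: "def_rel [Black, Black] [Black, Black] (Tpos \<bullet> Tneg) (Ident [Black, Black])"
| cross_inv_left: "def_rel [Black, Black] [Black, Black] (Tneg \<bullet> Tpos) (Ident [Black, Black])"
| braid: "def_rel [Black, Black, Black] [Black, Black, Black]
    ((Tpos \<boxtimes> idB) \<bullet> (idB \<boxtimes> Tpos) \<bullet> (Tpos \<boxtimes> idB))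
    ((idB \<boxtimes> Tpos) \<bullet> (Tpos \<boxtimes> idB) \<bullet> (idB \<boxtimes> Tpos))"
| cross_token: "def_rel [Black, Black] [Black, Black]
    (Tpos \<bullet> (Token a \<boxtimes> idB)) ((idB \<boxtimes> Token a) \<bullet> Tpos)"
| skein: "def_rel [Black, Black] [Black, Black]
    (Tpos \<boxplus> Scale (- 1) Tneg)
    (Scale z (term_sum [Black, Black] [Black, Black] B (\<lambda>b. Token b \<boxtimes> Token (dual b))))"
| cross_dot: "def_rel [Black, Black] [Black, Black]
    (Tpos \<bullet> (Dot \<boxtimes> idB)) ((idB \<boxtimes> Dot) \<bullet> Tneg)"
| lam_token: "Q \<in> E \<Longrightarrow> def_rel [Black, Red Q] [Red Q, Black]
    (Lam Q \<bullet> (Token a \<boxtimes> idR Q)) ((idR Q \<boxtimes> Token a) \<bullet> Lam Q)"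
| rho_token: "Q \<in> E \<Longrightarrow> def_rel [Red Q, Black] [Black, Red Q]
    (Rho Q \<bullet> (idR Q \<boxtimes> Token a)) ((Token a \<boxtimes> idR Q) \<bullet> Rho Q)"
| lam_dot: "Q \<in> E \<Longrightarrow> def_rel [Black, Red Q] [Red Q, Black]
    (Lam Q \<bullet> (Dot \<boxtimes> idR Q)) ((idR Q \<boxtimes> Dot) \<bullet> Lam Q)"
| rho_dot: "Q \<in> E \<Longrightarrow> def_rel [Red Q, Black] [Black, Red Q]
    (Rho Q \<bullet> (idR Q \<boxtimes> Dot)) ((Dot \<boxtimes> idR Q) \<bullet> Rho Q)"
| rho_lam: "Q \<in> E \<Longrightarrow> def_rel [Black, Red Q] [Black, Red Q]
    (Rho Q \<bullet> Lam Q) (bracket Q \<boxtimes> idR Q)"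
| lam_rho: "Q \<in> E \<Longrightarrow> def_rel [Red Q, Black] [Red Q, Black]
    (Lam Q \<bullet> Rho Q) (idR Q \<boxtimes> bracket Q)"
| cross_rho: "Q \<in> E \<Longrightarrow> def_rel [Red Q, Black, Black] [Black, Black, Red Q]
    ((Tpos \<boxtimes> idR Q) \<bullet> (idB \<boxtimes> Rho Q) \<bullet> (Rho Q \<boxtimes> idB))
    ((idB \<boxtimes> Rho Q) \<bullet> (Rho Q \<boxtimes> idB) \<bullet> (idR Q \<boxtimes> Tpos))"
| lam_cross: "Q \<in> E \<Longrightarrow> def_rel [Black, Black, Red Q] [Red Q, Black, Black]
    ((Lam Q \<boxtimes> idB) \<bullet> (idB \<boxtimes> Lam Q) \<bullet> (Tpos \<boxtimes> idR Q))
    ((idR Q \<boxtimes> Tpos) \<bullet> (Lam Q \<boxtimes> idB) \<bullet> (idB \<boxtimes> Lam Q))"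
| red_braid: "Q \<in> E \<Longrightarrow> def_rel [Black, Red Q, Black] [Black, Red Q, Black]
    ((Rho Q \<boxtimes> idB) \<bullet> (idR Q \<boxtimes> Tpos) \<bullet> (Lam Q \<boxtimes> idB))
    (((idB \<boxtimes> Lam Q) \<bullet> (Tpos \<boxtimes> idR Q) \<bullet> (idB \<boxtimes> Rho Q))
       \<boxplus> Scale z (bracket_red Q (Delta1 (P2_first Q))))"

text \<open>\<open>eqv i j f g\<close>: the terms \<open>f\<close> and \<open>g\<close> denote the same morphism from \<open>i\<close> to \<open>j\<close>. This is the
  smallest congruence that contains the defining relations and satisfies the axioms of a strict
  \<open>\<k>\<close>-linear monoidal supercategory.\<close>

inductive eqv :: "'a obj \<Rightarrow> 'a obj \<Rightarrow> ('a, 'k) mor \<Rightarrow> ('a, 'k) mor \<Rightarrow> bool" where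
  \<comment> \<open>congruence\<close>
  eqv_refl: "arrow f i j \<Longrightarrow> eqv i j f f"
| eqv_sym: "eqv i j f g \<Longrightarrow> eqv i j g f"
| eqv_trans: "eqv i j f g \<Longrightarrow> eqv i j g h \<Longrightarrow> eqv i j f h"
| eqv_Comp: "eqv i j g g' \<Longrightarrow> eqv j k f f' \<Longrightarrow> eqv i k (f \<bullet> g) (f' \<bullet> g')"
| eqv_Tensor: "eqv i j f f' \<Longrightarrow> eqv k l g g' \<Longrightarrow> eqv (i @ k) (j @ l) (f \<boxtimes> g) (f' \<boxtimes> g')"
| eqv_Add: "eqv i j f f' \<Longrightarrow> eqv i j g g' \<Longrightarrow> eqv i j (f \<boxplus> g) (f' \<boxplus> g')"
| eqv_Scale: "eqv i j f f' \<Longrightarrow> eqv i j (Scale c f) (Scale c f')"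
  \<comment> \<open>the morphisms from \<open>i\<close> to \<open>j\<close> form a \<open>\<k>\<close>-module\<close>
| add_assoc: "arrow f i j \<Longrightarrow> arrow g i j \<Longrightarrow> arrow h i j \<Longrightarrow>
    eqv i j ((f \<boxplus> g) \<boxplus> h) (f \<boxplus> (g \<boxplus> h))"
| add_comm: "arrow f i j \<Longrightarrow> arrow g i j \<Longrightarrow> eqv i j (f \<boxplus> g) (g \<boxplus> f)"
| add_zero: "arrow f i j \<Longrightarrow> eqv i j (f \<boxplus> Zero i j) f"
| add_neg: "arrow f i j \<Longrightarrow> eqv i j (f \<boxplus> Scale (- 1) f) (Zero i j)"
| scale_one: "arrow f i j \<Longrightarrow> eqv i j (Scale 1 f) f"
| scale_scale: "arrow f i j \<Longrightarrow> eqv i j (Scale c (Scale c' f)) (Scale (c * c') f)"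
| scale_add_left: "arrow f i j \<Longrightarrow> eqv i j (Scale (c + c') f) (Scale c f \<boxplus> Scale c' f)"
| scale_add_right: "arrow f i j \<Longrightarrow> arrow g i j \<Longrightarrow>
    eqv i j (Scale c (f \<boxplus> g)) (Scale c f \<boxplus> Scale c g)"
  \<comment> \<open>category\<close>
| comp_id_left: "arrow f i j \<Longrightarrow> eqv i j (Ident j \<bullet> f) f"
| comp_id_right: "arrow f i j \<Longrightarrow> eqv i j (f \<bullet> Ident i) f"
| comp_assoc: "arrow h i j \<Longrightarrow> arrow g j k \<Longrightarrow> arrow f k l \<Longrightarrow>
    eqv i l ((f \<bullet> g) \<bullet> h) (f \<bullet> (g \<bullet> h))"
  \<comment> \<open>composition is bilinear\<close>
| comp_add_left: "arrow h i j \<Longrightarrow> arrow f j k \<Longrightarrow> arrow g j k \<Longrightarrow>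
    eqv i k ((f \<boxplus> g) \<bullet> h) ((f \<bullet> h) \<boxplus> (g \<bullet> h))"
| comp_add_right: "arrow f i j \<Longrightarrow> arrow g i j \<Longrightarrow> arrow h j k \<Longrightarrow>
    eqv i k (h \<bullet> (f \<boxplus> g)) ((h \<bullet> f) \<boxplus> (h \<bullet> g))"
| comp_scale_left: "arrow g i j \<Longrightarrow> arrow f j k \<Longrightarrow>
    eqv i k (Scale c f \<bullet> g) (Scale c (f \<bullet> g))"
| comp_scale_right: "arrow g i j \<Longrightarrow> arrow f j k \<Longrightarrow>
    eqv i k (f \<bullet> Scale c g) (Scale c (f \<bullet> g))"
  \<comment> \<open>tensor product is bilinear\<close>
| tensor_add_left: "arrow f i j \<Longrightarrow> arrow g i j \<Longrightarrow> arrow h k l \<Longrightarrow>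
    eqv (i @ k) (j @ l) ((f \<boxplus> g) \<boxtimes> h) ((f \<boxtimes> h) \<boxplus> (g \<boxtimes> h))"
| tensor_add_right: "arrow f k l \<Longrightarrow> arrow g k l \<Longrightarrow> arrow h i j \<Longrightarrow>
    eqv (i @ k) (j @ l) (h \<boxtimes> (f \<boxplus> g)) ((h \<boxtimes> f) \<boxplus> (h \<boxtimes> g))"
| tensor_scale_left: "arrow f i j \<Longrightarrow> arrow g k l \<Longrightarrow>
    eqv (i @ k) (j @ l) (Scale c f \<boxtimes> g) (Scale c (f \<boxtimes> g))"
| tensor_scale_right: "arrow f i j \<Longrightarrow> arrow g k l \<Longrightarrow>
    eqv (i @ k) (j @ l) (f \<boxtimes> Scale c g) (Scale c (f \<boxtimes> g))"
  \<comment> \<open>strict monoidal structure with the super interchange law\<close>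
| tensor_assoc: "arrow f i j \<Longrightarrow> arrow g k l \<Longrightarrow> arrow h m n \<Longrightarrow>
    eqv (i @ k @ m) (j @ l @ n) ((f \<boxtimes> g) \<boxtimes> h) (f \<boxtimes> (g \<boxtimes> h))"
| tensor_unit_left: "arrow f i j \<Longrightarrow> eqv i j (Ident [] \<boxtimes> f) f"
| tensor_unit_right: "arrow f i j \<Longrightarrow> eqv i j (f \<boxtimes> Ident []) f"
| tensor_ident: "i \<in> objects \<Longrightarrow> j \<in> objects \<Longrightarrow>
    eqv (i @ j) (i @ j) (Ident i \<boxtimes> Ident j) (Ident (i @ j))"
| interchange: "arrow f i j \<Longrightarrow> arrow f' j k \<Longrightarrow> arrow g' l m \<Longrightarrow> arrow g m n \<Longrightarrow>
    has_parity f p \<Longrightarrow> has_parity g q \<Longrightarrow>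
    eqv (i @ l) (k @ n) ((f' \<boxtimes> g) \<bullet> (f \<boxtimes> g')) (Scale (koszul p q) ((f' \<bullet> f) \<boxtimes> (g \<bullet> g')))"
  \<comment> \<open>defining relations\<close>
| eqv_def_rel: "def_rel i j f g \<Longrightarrow> eqv i j f g"

text \<open>\<open>cls i j f\<close> is the morphism denoted by \<open>f\<close>.\<close>

definition cls :: "'a obj \<Rightarrow> 'a obj \<Rightarrow> ('a, 'k) mor \<Rightarrow> ('a, 'k) mor set" where
  "cls i j f = {(f, g). eqv i j f g} `` {f}"

text \<open>The fields \<open>mult\<close> and \<open>one\<close> of the record play no role for a module.\<close>

definition Hom :: "'a obj \<Rightarrow> 'a obj \<Rightarrow> ('k, ('a, 'k) mor set) module" where
  "Hom i j = \<lparr>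
     carrier = {f. arrow f i j} // {(f, g). eqv i j f g},
     monoid.mult = (\<lambda>_ _. undefined),
     one = undefined,
     ring.zero = cls i j (Zero i j),
     add = (\<lambda>F G. \<Union>f\<in>F. \<Union>g\<in>G. cls i j (f \<boxplus> g)),
     module.smult = (\<lambda>c F. \<Union>f\<in>F. cls i j (Scale c f))\<rparr>"

end


section \<open>Shuffles, diagrams and the elements of the basis\<close>

definition (in superalgebra) shuffle_words :: "nat \<Rightarrow> 'a P1 list \<Rightarrow> 'a obj set" where
  "shuffle_words d Qs = {i \<in> objects. length i = d + length Qs \<and>
     subseq (replicate d Black) i \<and> subseq (map Red Qs) i}"

definition num_black :: "'a::zero obj \<Rightarrow> nat" where
  "num_black u = length (filter ((=) Black) u)"

text \<open>Strands carry labels, so that they can be followed through a diagram. In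
  \<open>diagram L L' f rs cs\<close>, \<open>L\<close> and \<open>L'\<close> are the bottom and the top of the diagram, \<open>f\<close> is the composite,
  \<open>rs\<close> lists the transpositions on the black strands in the order of composition (last crossing
  first), where \<open>r\<close> stands for a crossing of two neighbouring black strands with \<open>r\<close> black strands to
  their left, and \<open>cs\<close> lists the pairs (red strand, black strand) that cross.\<close>

inductive diagram :: "('a::zero P1 letter \<times> nat) list \<Rightarrow> ('a P1 letter \<times> nat) list \<Rightarrow> ('a, 'k) mor \<Rightarrow>
    nat list \<Rightarrow> (nat \<times> nat) list \<Rightarrow> bool" where
  diagram_Ident: "diagram L L (Ident (map fst L)) [] []"
| diagram_Tpos: "diagram L (u @ (Black, a) # (Black, b) # v) f rs cs \<Longrightarrow>
    diagram L (u @ (Black, b) # (Black, a) # v)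
      ((Ident (map fst u) \<boxtimes> Tpos \<boxtimes> Ident (map fst v)) \<bullet> f) (num_black (map fst u) # rs) cs"
| diagram_Rho: "diagram L (u @ (Red Q, a) # (Black, b) # v) f rs cs \<Longrightarrow>
    diagram L (u @ (Black, b) # (Red Q, a) # v)
      ((Ident (map fst u) \<boxtimes> Rho Q \<boxtimes> Ident (map fst v)) \<bullet> f) rs ((a, b) # cs)"
| diagram_Lam: "diagram L (u @ (Black, b) # (Red Q, a) # v) f rs cs \<Longrightarrow>
    diagram L (u @ (Red Q, a) # (Black, b) # v)
      ((Ident (map fst u) \<boxtimes> Lam Q \<boxtimes> Ident (map fst v)) \<bullet> f) rs ((a, b) # cs)"

text \<open>\<open>S\<^sub>d\<close> acts on \<open>{..<d}\<close>, and \<open>r\<close> stands for the transposition of \<open>r\<close> and \<open>r + 1\<close>.\<close>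

definition word_perm :: "nat list \<Rightarrow> nat \<Rightarrow> nat" where
  "word_perm rs = foldr (\<lambda>r w. transpose r (Suc r) \<circ> w) rs id"

definition expression_for :: "nat \<Rightarrow> (nat \<Rightarrow> nat) \<Rightarrow> nat list \<Rightarrow> bool" where
  "expression_for d w rs \<longleftrightarrow> (\<forall>r\<in>set rs. Suc r < d) \<and> word_perm rs = w"

definition reduced_expression :: "nat \<Rightarrow> (nat \<Rightarrow> nat) \<Rightarrow> nat list \<Rightarrow> bool" where
  "reduced_expression d w rs \<longleftrightarrow>
     expression_for d w rs \<and> (\<forall>rs'. expression_for d w rs' \<longrightarrow> length rs \<le> length rs')"

definition diagram_for ::
  "nat \<Rightarrow> 'a::zero obj \<Rightarrow> (nat \<Rightarrow> nat) \<Rightarrow> 'a obj \<Rightarrow> ('a, 'k) mor \<Rightarrow> bool" where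
  "diagram_for d j w i f \<longleftrightarrow> (\<exists>L rs cs. diagram (zip i [0..<length i]) L f rs cs \<and>
     map fst L = j \<and> reduced_expression d w rs \<and> distinct cs)"

definition black_positions :: "'a::zero obj \<Rightarrow> nat list" where
  "black_positions i = filter (\<lambda>p. i ! p = Black) [0..<length i]"

text \<open>Black strands are numbered from \<open>0\<close>.\<close>

definition on_strand :: "'a::zero obj \<Rightarrow> nat \<Rightarrow> ('a, 'k) mor \<Rightarrow> ('a, 'k) mor" where
  "on_strand i k g = (let p = black_positions i ! k in
     Ident (take p i) \<boxtimes> g \<boxtimes> Ident (drop (Suc p) i))"

text \<open>The image of \<open>a\<^sub>1 \<otimes> \<dots> \<otimes> a\<^sub>d = (a\<^sub>1)\<^sub>1 \<cdots> (a\<^sub>d)\<^sub>d\<close>\<close>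

definition tokens :: "'a::zero obj \<Rightarrow> 'a list \<Rightarrow> ('a, 'k) mor" where
  "tokens i as = foldr (\<lambda>k f. on_strand i k (Token (as ! k)) \<bullet> f) [0..<length as] (Ident i)"

definition dots :: "'a::zero obj \<Rightarrow> int list \<Rightarrow> ('a, 'k) mor" where
  "dots i \<alpha> = foldr (\<lambda>k f. term_powi i (on_strand i k Dot) (on_strand i k DotInv) (\<alpha> ! k) \<bullet> f)
     [0..<length \<alpha>] (Ident i)"

text \<open>The element \<open>b\<^sub>1 \<otimes> \<dots> \<otimes> b\<^sub>d\<close> of \<open>B\<^bsup>\<otimes>d\<^esup>\<close> is given by the list of the \<open>b\<^sub>k\<close>.\<close>

definition basis_index :: "nat \<Rightarrow> 'a set \<Rightarrow> ('a list \<times> int list \<times> (nat \<Rightarrow> nat)) set" where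
  "basis_index d B =
     {as. length as = d \<and> set as \<subseteq> B} \<times> {\<alpha>. length \<alpha> = d} \<times> {w. w permutes {..<d}}"

context LAH
begin

definition basis_element ::
  "'a obj \<Rightarrow> 'a obj \<Rightarrow> ((nat \<Rightarrow> nat) \<Rightarrow> ('a, 'k) mor) \<Rightarrow>
    'a list \<times> int list \<times> (nat \<Rightarrow> nat) \<Rightarrow> ('a, 'k) mor set" where
  "basis_element j i T = (\<lambda>(as, \<alpha>, w). cls i j (tokens j as \<bullet> dots j \<alpha> \<bullet> T w))"

end

end

theory Submission
  imports Defs "HOL-Combinatorics.Perm"
begin

text \<open>Independence is read off from an action on \<open>A\<^bsup>\<otimes>d\<^esup> \<otimes> \<k>[X\<^sub>1\<^sup>\<plusminus>, \<dots>, X\<^sub>d\<^sup>\<plusminus>]\<close>, tensored with the free module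
  on labels from a symmetric group. A black crossing acts by a signed transposition, which also changes the label, plus
  \<open>z\<close> times a Casimir element times a Demazure operator; the two red crossings act by \<open>1\<close> and by multiplication by
  \<open>Q\<close>. A diagram of a reduced expression for \<open>w\<close> sends the unit vector to a product of elements \<open>Q\<close>, which is
  regular, with a label that determines \<open>w\<close>, plus terms whose labels have shorter expressions.

  For the spanning property one strand at a time is pulled to the left end. The combinations of morphisms that start
  with such a pull and keep the pulled strand at the left are stable under composition with the generators; the essential
  case is that of two pulls followed by a crossing of the two strands, where the braid relations apply. Iterated pulls are
  diagrams of reduced expressions, so they span together with tokens and dots. They may be replaced by the
  chosen diagrams: the two diagrams for \<open>w\<close> have the same leading term in the action, and the coefficients in the
  expansion of their difference must vanish except at shorter permutations.\<close>


section \<open>The ring of linear operators on functions\<close>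

text \<open>The module is the left regular representation which the expected basis predicts. A basis
  vector stands for a token tensor times a monomial p times a diagram of w, and its label is the
  inverse of w. A crossing T for the simple transposition s turns p T_w into s(p) T T_w + z t D(p)
  T_w, where t is the Casimir element and D the Demazure quotient; and T T_w is T_sw if sw is longer
  than w, and T_sw + z t T_w otherwise. So the operators have to know whether the label is inverted
  at two neighbouring strands. That these formulas satisfy the quadratic and braid relations is the
  main computation. It is avoided in general degree: the difference of the two sides carries dots to
  dots, and dots are invertible, so it suffices to compare in degree zero, where the Demazure part
  becomes the indicator of an inversion.

  The scalars form an arbitrary commutative ring, so ranks are of no help, and the elements Q need
  not be invertible; their regularity is all that keeps leading terms independent. No word problem
  for diagrams is solved either: which coefficients relate two diagrams of one permutation is read
  off from the action.\<close>

typedef (overloaded) ('i, 'k::comm_ring_1) lop =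
  "{F :: ('i \<Rightarrow> 'k) \<Rightarrow> 'i \<Rightarrow> 'k.
     (\<forall>\<phi> \<psi>. F (\<lambda>x. \<phi> x + \<psi> x) = (\<lambda>x. F \<phi> x + F \<psi> x)) \<and> (\<forall>c \<phi>. F (\<lambda>x. c * \<phi> x) = (\<lambda>x. c * F \<phi> x))}"
  morphisms app Lop
  by (rule exI[of _ "\<lambda>\<phi>. \<phi>"]) auto

setup_lifting type_definition_lop

lemma app_add: "app F (\<lambda>x. \<phi> x + \<psi> x) x = app F \<phi> x + app F \<psi> x"
  using app[of F] by (auto simp: fun_eq_iff)

lemma app_scale: "app F (\<lambda>x. c * \<phi> x) x = c * app F \<phi> x"
  using app[of F] by (auto simp: fun_eq_iff)

lemma app_zero_fun [simp]: "app F (\<lambda>x. 0) x = 0"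
  using app_scale[of F 0 "\<lambda>x. 0" x] by simp

lemma app_uminus: "app F (\<lambda>x. - \<phi> x) x = - app F \<phi> x"
  using app_scale[of F "-1" \<phi> x] by simp

lemma lop_eqI: "(\<And>\<phi> x. app F \<phi> x = app G \<phi> x) \<Longrightarrow> F = G"
  by (metis app_inject ext)

text \<open>Operators act on functions on a basis, that is, on the dual of the free module: hence the
  reversed order in the product, which makes \<open>F * G\<close> the composite on the free module itself.\<close>

instantiation lop :: (type, comm_ring_1) ring_1
begin

lift_definition zero_lop :: "('a, 'b) lop" is "\<lambda>\<phi> x. 0" by simp
lift_definition one_lop :: "('a, 'b) lop" is "\<lambda>\<phi>. \<phi>" by simp
lift_definition plus_lop :: "('a, 'b) lop \<Rightarrow> ('a, 'b) lop \<Rightarrow> ('a, 'b) lop"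
  is "\<lambda>F G \<phi> x. F \<phi> x + G \<phi> x" by (auto simp: algebra_simps fun_eq_iff)
lift_definition minus_lop :: "('a, 'b) lop \<Rightarrow> ('a, 'b) lop \<Rightarrow> ('a, 'b) lop"
  is "\<lambda>F G \<phi> x. F \<phi> x - G \<phi> x" by (auto simp: algebra_simps fun_eq_iff)
lift_definition uminus_lop :: "('a, 'b) lop \<Rightarrow> ('a, 'b) lop"
  is "\<lambda>F \<phi> x. - F \<phi> x" by (auto simp: algebra_simps fun_eq_iff)
lift_definition times_lop :: "('a, 'b) lop \<Rightarrow> ('a, 'b) lop \<Rightarrow> ('a, 'b) lop"
  is "\<lambda>F G \<phi>. G (F \<phi>)" by auto

instance
proof
  show "(0 :: ('a, 'b) lop) \<noteq> 1"
  proof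
    assume "(0 :: ('a, 'b) lop) = 1"
    then have "app (0 :: ('a, 'b) lop) (\<lambda>_. 1) undefined = app 1 (\<lambda>_. 1) undefined" by simp
    then show False by (simp add: zero_lop.rep_eq one_lop.rep_eq)
  qed
qed (transfer; auto simp: algebra_simps fun_eq_iff)+

end

lemmas app_simps [simp] = zero_lop.rep_eq one_lop.rep_eq plus_lop.rep_eq minus_lop.rep_eq
  uminus_lop.rep_eq times_lop.rep_eq

lemma app_sum_lop: "app (sum F A) \<phi> x = (\<Sum>a\<in>A. app (F a) \<phi> x)"
  by (induction A rule: infinite_finite_induct) auto

lift_definition sc :: "'k \<Rightarrow> ('i, 'k::comm_ring_1) lop" is "\<lambda>c \<phi> x. c * \<phi> x"
  by (auto simp: algebra_simps fun_eq_iff)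

lemma app_sc [simp]: "app (sc c) \<phi> x = c * \<phi> x"
  by (simp add: sc.rep_eq)

lemma sc_commute: "F * sc c = sc c * F"
  by (rule lop_eqI) (simp add: app_scale sc.rep_eq)

lemma sc_left_commute: "F * (sc c * G) = sc c * (F * G)"
  by (metis mult.assoc sc_commute)

lemma sc_mult: "sc c * sc c' = sc (c * c')"
  by (rule lop_eqI) (simp add: sc.rep_eq ac_simps)

lemma sc_one [simp]: "sc 1 = 1"
  by (rule lop_eqI) simp

lemma sc_add: "sc (a + b) = sc a + sc b"
  by (rule lop_eqI) (simp add: algebra_simps)

lemma sc_uminus: "sc (- a) = - sc a"
  by (rule lop_eqI) simp

lemma sc_koszul: "sc (koszul p q) = koszul p q"
  by (simp add: koszul_def sc_uminus)


section \<open>Signs and coordinates\<close>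

lemma koszul_zero [simp]: "koszul 0 q = 1" "koszul p 0 = 1"
  by (auto simp: koszul_def)

lemma koszul_sym: "koszul p q = koszul q p"
  by (simp add: koszul_def mult.commute)

lemma koszul_add_left: "koszul (p + p') q = (koszul p q * koszul p' q :: 'r::ring_1)"
  by (cases p; cases p'; cases q) (auto simp: koszul_def)

lemma koszul_add_right: "koszul q (p + p') = (koszul q p * koszul q p' :: 'r::ring_1)"
  by (cases p; cases p'; cases q) (auto simp: koszul_def)

lemma koszul_square [simp]: "koszul p q * koszul p q = (1 :: 'r::ring_1)"
  by (auto simp: koszul_def)

lemma koszul_square_left [simp]: "koszul p q * (koszul p q * x) = (x :: 'r::ring_1)"
  by (auto simp: koszul_def)

lemma bit_add_self [simp]: "p + p = (0::bit)"
  by (cases p) auto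

context symmetric_frobenius_superalgebra
begin

abbreviation rep :: "'a \<Rightarrow> 'a \<Rightarrow> 'k" where "rep \<equiv> representation B"

lemma rep_add: "rep (x + y) b = rep x b + rep y b"
  using B_independent B_span by (simp add: representation_add)

lemma rep_scale: "rep (c *s x) b = c * rep x b"
  using B_independent B_span by (simp add: representation_scale)

lemma rep_sum: "rep (\<Sum>i\<in>I. f i) b = (\<Sum>i\<in>I. rep (f i) b)"
  using B_independent B_span by (simp add: representation_sum)

lemma rep_zero [simp]: "rep 0 b = 0"
  by (simp add: representation_zero)

lemma rep_basis: "b \<in> B \<Longrightarrow> rep b c = (if c = b then 1 else 0)"
  using B_independent by (simp add: representation_basis)

lemma rep_expand: "(\<Sum>b\<in>B. rep x b *s b) = x"
  using B_independent B_span B_finite by (simp add: sum_representation_eq)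

lemma rep_ext: "(\<And>b. b \<in> B \<Longrightarrow> rep x b = rep y b) \<Longrightarrow> x = y"
  by (metis (no_types, lifting) rep_expand sum.cong)

lemma rep_mult: "rep (x * y) b = (\<Sum>c\<in>B. rep y c * rep (x * c) b)"
proof -
  have "x * y = (\<Sum>c\<in>B. rep y c *s (x * c))"
    by (subst rep_expand[of y, symmetric]) (simp only: sum_distrib_left scale_mult_right)
  then show ?thesis by (simp add: rep_sum rep_scale)
qed

lemma zero_notin_B: "0 \<notin> B"
  using B_independent dependent_zero by blast

lemma gr_zero_mem [simp]: "0 \<in> gr p"
  using gr_subspace subspace_0 by blast

lemma gr_inter: "x \<in> gr p \<Longrightarrow> x \<in> gr q \<Longrightarrow> p \<noteq> q \<Longrightarrow> x = 0"
proof -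
  assume "x \<in> gr p" "x \<in> gr q" "p \<noteq> q"
  then have x: "x \<in> gr 0" "x \<in> gr 1" by (cases p; cases q; auto)+
  obtain y where "\<And>y'. y' \<in> gr 0 \<and> x - y' \<in> gr 1 \<Longrightarrow> y' = y" using gr_direct[of x] by blast
  from this[of x] this[of 0] x show ?thesis by simp
qed

lemma parity_eq: "b \<in> gr p \<Longrightarrow> b \<noteq> 0 \<Longrightarrow> parity b = p"
  unfolding parity_def using gr_inter by blast

lemma parity_mem: "b \<in> B \<Longrightarrow> b \<in> gr (parity b)"
  using B_homogeneous zero_notin_B parity_eq by metis

lemma gr_sum_mem: "(\<And>i. i \<in> I \<Longrightarrow> f i \<in> gr p) \<Longrightarrow> sum f I \<in> gr p"
  using gr_subspace subspace_sum by blast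

lemma gr_scale_mem: "x \<in> gr p \<Longrightarrow> c *s x \<in> gr p"
  using gr_subspace subspace_scale by blast

lemma gr_add_mem: "x \<in> gr p \<Longrightarrow> y \<in> gr p \<Longrightarrow> x + y \<in> gr p"
  using gr_subspace subspace_add by blast

text \<open>Split the expansion of x into its two parity parts. The part of the wrong parity is a
  difference of elements of \<open>gr p\<close>, so it lies in both components and is zero; but its
  coordinate at b is that of x.\<close>

lemma rep_homogeneous: assumes x: "x \<in> gr p" and b: "b \<in> B" "rep x b \<noteq> 0" shows "parity b = p"
proof (rule ccontr)
  assume ne: "parity b \<noteq> p"
  define y where "y q = (\<Sum>c\<in>{c\<in>B. parity c = q}. rep x c *s c)" for q
  have mem: "y q \<in> gr q" for q unfolding y_def by (intro gr_sum_mem gr_scale_mem) (auto dest: parity_mem)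
  have "B = {c\<in>B. parity c = p} \<union> {c\<in>B. parity c = p + 1}" by (cases p) auto
  then have "x = (\<Sum>c\<in>{c\<in>B. parity c = p} \<union> {c\<in>B. parity c = p + 1}. rep x c *s c)"
    using rep_expand[of x] by simp
  also have "\<dots> = y p + y (p + 1)" unfolding y_def by (rule sum.union_disjoint) (use B_finite in auto)
  finally have e: "x = y p + y (p + 1)" .
  then have "y (p + 1) = x + (- 1) *s y p" by simp
  also have "\<dots> \<in> gr p" by (intro gr_add_mem gr_scale_mem mem x)
  finally have "y (p + 1) = 0" using gr_inter mem by (cases p) (metis bit_not_zero_iff add_0 zero_neq_one bit_add_self)+
  moreover have "rep (y (p + 1)) b = (\<Sum>c\<in>{c\<in>B. parity c = p + 1}. rep x c * rep c b)"
    unfolding y_def by (simp add: rep_sum rep_scale)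
  moreover have "\<dots> = (\<Sum>c\<in>{c\<in>B. parity c = p + 1}. if c = b then rep x b else 0)"
    by (rule sum.cong) (auto simp: rep_basis)
  moreover have "\<dots> = rep x b" using b ne B_finite by (cases p) auto
  ultimately show False using b by simp
qed

section \<open>Dual bases\<close>

lemma tr_add: "tr (x + y) = tr x + tr y" using tr_linear by (rule module_hom.add)
lemma tr_scale: "tr (c *s x) = c * tr x" using tr_linear by (rule module_hom.scale)
lemma tr_sum: "tr (\<Sum>i\<in>I. f i) = (\<Sum>i\<in>I. tr (f i))" using tr_linear by (rule module_hom.sum)

lemma tr_dual: "b \<in> B \<Longrightarrow> tr (dual b * x) = rep x b"
proof -
  assume b: "b \<in> B"
  have "dual b * x = (\<Sum>c\<in>B. rep x c *s (dual b * c))"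
    by (subst rep_expand[of x, symmetric]) (simp only: sum_distrib_left scale_mult_right)
  then show ?thesis using b B_finite by (simp add: tr_sum tr_scale dual_tr if_distrib cong: if_cong)
qed

text \<open>Pairing with c in \<open>B\<close> on the right reads off the coordinate of x at
  \<open>dual c\<close>. This is where nondegeneracy of the trace form comes from.\<close>

lemma dual_expand: "(\<Sum>b\<in>B. tr (x * b) *s dual b) = x"
proof -
  have "x \<in> span (dual ` B)" using dual_span by simp
  then obtain u where "x = (\<Sum>v\<in>dual ` B. u v *s v)"
    using span_finite[of "dual ` B"] B_finite by auto
  then have x: "x = (\<Sum>b\<in>B. u (dual b) *s dual b)" using dual_inj by (simp add: sum.reindex)
  have "tr (x * c) = u (dual c)" if "c \<in> B" for c
    by (subst x) (simp add: sum_distrib_right scale_mult_left tr_sum tr_scale dual_tr that B_finite if_distrib cong: if_cong)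
  then show ?thesis using x by simp
qed

lemma tr_nondegenerate: "(\<And>b. b \<in> B \<Longrightarrow> tr (x * b) = 0) \<Longrightarrow> x = 0"
  using dual_expand[of x] by simp

lemma gr_decomp: obtains y where "y \<in> gr p" "x - y \<in> gr (p + 1)"
proof -
  obtain y where y: "y \<in> gr 0" "x - y \<in> gr 1" using gr_direct by blast
  show ?thesis
  proof (cases p)
    case zero
    then show ?thesis using that y by auto
  next
    case one
    then show ?thesis using that[of "x - y"] y by auto
  qed
qed

text \<open>The component of \<open>dual b\<close> of the wrong parity pairs to zero with every c in
  \<open>B\<close>: if c has the parity of b, the product is odd and the trace is even; otherwise c
  differs from b, and the component of the right parity also pairs to zero with c. Nondegeneracy
  finishes the argument.\<close>

lemma dual_parity: assumes b: "b \<in> B" shows "dual b \<in> gr (parity b)"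
proof -
  let ?p = "parity b"
  obtain y where y: "y \<in> gr ?p" "dual b - y \<in> gr (?p + 1)" using gr_decomp by blast
  have "tr ((dual b - y) * c) = 0" if c: "c \<in> B" for c
  proof (cases "parity c = ?p")
    case True
    then have "(dual b - y) * c \<in> gr 1"
      using gr_mult[OF y(2) parity_mem[OF c]] by (cases ?p) auto
    then show ?thesis by (rule tr_even)
  next
    case False
    then have "parity c = ?p + 1" by (cases ?p; cases "parity c") auto
    then have "y * c \<in> gr 1" using gr_mult[OF y(1) parity_mem[OF c]] by (cases ?p) auto
    then have "tr (y * c) = 0" by (rule tr_even)
    moreover have "tr (dual b * c) = 0" using False b c by (auto simp: dual_tr)
    ultimately show ?thesis
      using tr_add[of "y * c" "(dual b - y) * c"] by (simp add: algebra_simps)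
  qed
  then have "dual b - y = 0" by (rule tr_nondegenerate)
  then show ?thesis using y by simp
qed

end

section \<open>Operators on a faithful module\<close>

declare add_bit_eq_xor [simp del] mult_bit_eq_and [simp del]

text \<open>Index, exponent and label on infinitely many strands at once. One operator then serves
  diagrams with any number of strands, and forming a tensor product only shifts the strand
  number.\<close>

type_synonym st = "(nat \<Rightarrow> nat) \<times> (nat \<Rightarrow> int) \<times> nat perm"

lemma st_eqI: "(\<And>\<phi> \<beta> \<alpha> v. app F \<phi> (\<beta>, \<alpha>, v) = app G \<phi> (\<beta>, \<alpha>, v)) \<Longrightarrow> F = G"
  by (rule lop_eqI) (metis prod_cases3)

abbreviation \<tau> :: "nat \<Rightarrow> nat \<Rightarrow> nat" where "\<tau> i \<equiv> transpose i (Suc i)"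

lemma upd_comp_transpose: "\<beta>(k := x) \<circ> \<tau> i = (\<beta> \<circ> \<tau> i)(\<tau> i k := x)"
  by (auto simp: fun_eq_iff transpose_def)

lemma comp_tau_tau: "f \<circ> \<tau> i \<circ> \<tau> i = f"
  by (auto simp: fun_eq_iff)

text \<open>The coefficient of X_i^k X_(i+1)^(a+b-k) in the Demazure quotient of X_i^a X_(i+1)^b: a
  geometric sum whose sign depends on which exponent is larger. The flag w adds the swapped
  monomial, at k = b. \<open>ec_left\<close> and \<open>ec_right\<close> are the twisted Leibniz
  rules for multiplication by X_i and X_(i+1), in terms of coefficients.\<close>

definition ec :: "int \<Rightarrow> int \<Rightarrow> bool \<Rightarrow> int \<Rightarrow> 'k::comm_ring_1" where
  "ec a b w k = of_bool (a \<le> k \<and> k < b) - of_bool (b \<le> k \<and> k < a) + of_bool (k = b \<and> w)"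

lemma ec_left: "ec (a + 1) b w k = ec a b w k - of_bool (k = a)"
  by (auto simp: ec_def)

lemma ec_right: "ec a (b + 1) w k = ec a b w (k - 1) + of_bool (k = a)"
  by (auto simp: ec_def)

lemma ec_outside: "k < min a b \<or> max a b < k \<Longrightarrow> ec a b w k = 0"
  by (auto simp: ec_def)

context symmetric_frobenius_superalgebra
begin

lemma B_nonempty: "B \<noteq> {}"
  using B_span span_empty by (metis UNIV_I singletonD zero_neq_one)

lemma card_B_pos [simp]: "0 < card B"
  using B_nonempty B_finite by (simp add: card_gt_0_iff)

text \<open>The indices \<open>nat\<close> enumerate a basis of a countable direct sum of copies of \<open>A\<close>. A single copy
  would do, but its basis \<open>B\<close> is not a type.\<close>

definition en :: "nat \<Rightarrow> 'a" where "en = (SOME e. bij_betw e {..<card B} B)"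

lemma en_bij: "bij_betw en {..<card B} B"
  using someI_ex[OF ex_bij_betw_nat_finite[OF B_finite]] by (simp add: en_def atLeast0LessThan)

definition el :: "nat \<Rightarrow> 'a" where "el i = en (i mod card B)"

text \<open>The quotient by \<open>card B\<close> names the copy of A and is kept, so a second
  replacement in the same slot overrides the first.\<close>

definition put :: "nat \<Rightarrow> 'a \<Rightarrow> nat" where
  "put i c = card B * (i div card B) + inv_into {..<card B} en c"

abbreviation par :: "nat \<Rightarrow> bit" where "par i \<equiv> parity (el i)"

lemma el_mem [simp]: "el i \<in> B"
  using en_bij by (auto simp: el_def bij_betw_def)

lemma inv_en_less: "c \<in> B \<Longrightarrow> inv_into {..<card B} en c < card B"
  using en_bij by (metis bij_betw_def inv_into_into lessThan_iff)

lemma put_div: "c \<in> B \<Longrightarrow> put i c div card B = i div card B"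
  using inv_en_less[of c] by (simp add: put_def)

lemma el_put [simp]: "c \<in> B \<Longrightarrow> el (put i c) = c"
  using inv_en_less[of c] en_bij by (simp add: put_def el_def bij_betw_def f_inv_into_f)

lemma put_put [simp]: "c \<in> B \<Longrightarrow> put (put i c) c' = put i c'"
  using put_div[of c i] by (simp add: put_def)

lemma put_el [simp]: "put i (el i) = i"
proof -
  have "inv_into {..<card B} en (en (i mod card B)) = i mod card B"
    using en_bij by (intro inv_into_f_f) (auto simp: bij_betw_def)
  then show ?thesis by (simp add: put_def el_def)
qed

lemma rep_el: "c \<in> B \<Longrightarrow> rep (el i) c = of_bool (c = el i)"
  by (simp add: rep_basis)

text \<open>The total parity of the factors to the left of strand k. A token on strand k has to pass
  them, which is the source of all signs in \<open>tok\<close>.\<close>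

definition J :: "nat \<Rightarrow> (nat \<Rightarrow> nat) \<Rightarrow> bit" where "J k \<beta> = (\<Sum>l<k. par (\<beta> l))"

lemma J_upd_ge: "k \<le> l \<Longrightarrow> J k (\<beta>(l := x)) = J k \<beta>"
  by (auto simp: J_def intro!: sum.cong)

lemma J_upd_less: "k < l \<Longrightarrow> J l (\<beta>(k := x)) = J l \<beta> + par (\<beta> k) + par x"
proof -
  assume k: "k < l"
  then have "J l \<gamma> = par (\<gamma> k) + (\<Sum>m\<in>{..<l} - {k}. par (\<gamma> m))" for \<gamma>
    by (auto simp: J_def sum.remove[of "{..<l}" k])
  moreover have "(\<Sum>m\<in>{..<l} - {k}. par ((\<beta>(k := x)) m)) = (\<Sum>m\<in>{..<l} - {k}. par (\<beta> m))"
    by (rule sum.cong) auto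
  ultimately show ?thesis by (simp add: algebra_simps)
qed

lemma J_tau: "k \<noteq> Suc i \<Longrightarrow> J k (\<beta> \<circ> \<tau> i) = J k \<beta>"
proof -
  assume k: "k \<noteq> Suc i"
  have "\<tau> i ` {..<k} = {..<k}"
    using k by (auto simp: image_iff transpose_def)
  then have "bij_betw (\<tau> i) {..<k} {..<k}" by (auto simp: bij_betw_def inj_on_def transpose_def split: if_splits)
  then show ?thesis unfolding J_def by (simp add: sum.reindex_bij_betw[of "\<tau> i" _ _ "\<lambda>l. par (\<beta> l)"])
qed

lemma J_Suc: "J (Suc i) \<beta> = J i \<beta> + par (\<beta> i)"
  by (simp add: J_def)

lemma J_tau_Suc: "J (Suc i) (\<beta> \<circ> \<tau> i) = J i \<beta> + par (\<beta> (Suc i))"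
  by (simp add: J_Suc J_tau del: o_apply) simp

text \<open>Only the component of a of parity \<open>parity c + par (\<beta> k)\<close> contributes
  to the entry at c. So the sign is the one for moving this component past the first k factors, and
  a need not be split into homogeneous parts.\<close>

definition tok :: "nat \<Rightarrow> 'a \<Rightarrow> (st, 'k) lop" where
  "tok k a = Lop (\<lambda>\<phi> (\<beta>, \<alpha>, v). \<Sum>c\<in>B. rep (a * el (\<beta> k)) c *
     koszul (parity c + par (\<beta> k)) (J k \<beta>) * \<phi> (\<beta>(k := put (\<beta> k) c), \<alpha>, v))"

definition dot :: "nat \<Rightarrow> (st, 'k) lop" where
  "dot k = Lop (\<lambda>\<phi> (\<beta>, \<alpha>, v). \<phi> (\<beta>, \<alpha>(k := \<alpha> k + 1), v))"

definition dotinv :: "nat \<Rightarrow> (st, 'k) lop" where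
  "dotinv k = Lop (\<lambda>\<phi> (\<beta>, \<alpha>, v). \<phi> (\<beta>, \<alpha>(k := \<alpha> k - 1), v))"

text \<open>Labels are inverses of permutations: multiplying w by a simple transposition on the left
  multiplies the label by it on the right, and this shortens w exactly if the label is inverted at i
  and i + 1.\<close>

definition swp :: "nat \<Rightarrow> (st, 'k) lop" where
  "swp i = Lop (\<lambda>\<phi> (\<beta>, \<alpha>, v). koszul (par (\<beta> i)) (par (\<beta> (Suc i))) *
     \<phi> (\<beta> \<circ> \<tau> i, \<alpha> \<circ> \<tau> i, v * Perm.swap i (Suc i)))"

text \<open>\<open>X\<^sub>i\<^sup>a X\<^sub>i\<^sub>+\<^sub>1\<^sup>b\<close> is sent to the \<open>i\<close>-th Demazure quotient, plus
  \<open>X\<^sub>i\<^sup>b X\<^sub>i\<^sub>+\<^sub>1\<^sup>a\<close> if the labels at \<open>i\<close> and \<open>i + 1\<close> are inverted.\<close>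

definition dem :: "nat \<Rightarrow> (st, 'k) lop" where
  "dem i = Lop (\<lambda>\<phi> (\<beta>, \<alpha>, v). \<Sum>k\<in>{min (\<alpha> i) (\<alpha> (Suc i))..max (\<alpha> i) (\<alpha> (Suc i))}.
     ec (\<alpha> i) (\<alpha> (Suc i)) (Perm.apply v (Suc i) < Perm.apply v i) k *
     \<phi> (\<beta>, \<alpha>(i := k, Suc i := \<alpha> i + \<alpha> (Suc i) - k), v))"

lemma app_tok: "app (tok k a) \<phi> (\<beta>, \<alpha>, v) = (\<Sum>c\<in>B. rep (a * el (\<beta> k)) c *
     koszul (parity c + par (\<beta> k)) (J k \<beta>) * \<phi> (\<beta>(k := put (\<beta> k) c), \<alpha>, v))"
  unfolding tok_def
  by (subst Lop_inverse) (auto simp: fun_eq_iff algebra_simps sum.distrib sum_distrib_left)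

lemma app_dot: "app (dot k) \<phi> (\<beta>, \<alpha>, v) = \<phi> (\<beta>, \<alpha>(k := \<alpha> k + 1), v)"
  unfolding dot_def by (subst Lop_inverse) (auto simp: fun_eq_iff)

lemma app_dotinv: "app (dotinv k) \<phi> (\<beta>, \<alpha>, v) = \<phi> (\<beta>, \<alpha>(k := \<alpha> k - 1), v)"
  unfolding dotinv_def by (subst Lop_inverse) (auto simp: fun_eq_iff)

lemma app_swp: "app (swp i) \<phi> (\<beta>, \<alpha>, v) = koszul (par (\<beta> i)) (par (\<beta> (Suc i))) *
     \<phi> (\<beta> \<circ> \<tau> i, \<alpha> \<circ> \<tau> i, v * Perm.swap i (Suc i))"
  unfolding swp_def by (subst Lop_inverse) (auto simp: fun_eq_iff algebra_simps)

lemma app_dem: "app (dem i) \<phi> (\<beta>, \<alpha>, v) = (\<Sum>k\<in>{min (\<alpha> i) (\<alpha> (Suc i))..max (\<alpha> i) (\<alpha> (Suc i))}.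
     ec (\<alpha> i) (\<alpha> (Suc i)) (Perm.apply v (Suc i) < Perm.apply v i) k *
     \<phi> (\<beta>, \<alpha>(i := k, Suc i := \<alpha> i + \<alpha> (Suc i) - k), v))"
  unfolding dem_def
  by (subst Lop_inverse) (auto simp: fun_eq_iff algebra_simps sum.distrib sum_distrib_left)

text \<open>The range of summation in \<open>dem\<close> depends on the exponents. With a common
  larger range, sums for different exponents can be compared term by term.\<close>

lemma app_dem': "finite K \<Longrightarrow> {min (\<alpha> i) (\<alpha> (Suc i))..max (\<alpha> i) (\<alpha> (Suc i))} \<subseteq> K \<Longrightarrow>
    app (dem i) \<phi> (\<beta>, \<alpha>, v) = (\<Sum>k\<in>K. ec (\<alpha> i) (\<alpha> (Suc i)) (Perm.apply v (Suc i) < Perm.apply v i) k *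
     \<phi> (\<beta>, \<alpha>(i := k, Suc i := \<alpha> i + \<alpha> (Suc i) - k), v))"
  unfolding app_dem by (rule sum.mono_neutral_left) (auto simp: ec_outside not_le)

lemmas app_ops = app_tok app_dot app_dotinv app_swp


subsection \<open>Tokens and dots\<close>

lemma tok_mult: "tok k a * tok k b = tok k (a * b)"
proof (rule st_eqI)
  fix \<phi> :: "st \<Rightarrow> 'k" and \<beta> :: "nat \<Rightarrow> nat" and \<alpha> :: "nat \<Rightarrow> int" and v :: "nat perm"
  let ?p = "par (\<beta> k)" let ?J = "J k \<beta>"
  have "app (tok k a * tok k b) \<phi> (\<beta>, \<alpha>, v) =
     (\<Sum>c\<in>B. \<Sum>d\<in>B. rep (b * el (\<beta> k)) c * rep (a * c) d * koszul (parity d + ?p) ?J *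
       \<phi> (\<beta>(k := put (\<beta> k) d), \<alpha>, v))"
    unfolding times_lop.rep_eq app_tok
    by (auto simp: sum_distrib_left J_upd_ge koszul_add_left ac_simps intro!: sum.cong)
  also have "\<dots> = (\<Sum>d\<in>B. (\<Sum>c\<in>B. rep (b * el (\<beta> k)) c * rep (a * c) d) * koszul (parity d + ?p) ?J *
       \<phi> (\<beta>(k := put (\<beta> k) d), \<alpha>, v))"
    by (subst sum.swap) (simp add: sum_distrib_right)
  also have "\<dots> = app (tok k (a * b)) \<phi> (\<beta>, \<alpha>, v)"
    unfolding app_tok by (simp add: rep_mult[of a, symmetric] mult.assoc)
  finally show "app (tok k a * tok k b) \<phi> (\<beta>, \<alpha>, v) = app (tok k (a * b)) \<phi> (\<beta>, \<alpha>, v)" .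
qed

lemma tok_one [simp]: "tok k 1 = 1"
  by (rule st_eqI) (simp add: app_tok rep_el B_finite mult.assoc sum_of_bool_eq)

lemma tok_add: "tok k (a + b) = tok k a + tok k b"
  by (rule st_eqI) (simp add: app_tok rep_add algebra_simps sum.distrib)

lemma tok_scale: "tok k (c *s a) = sc c * tok k a"
  by (rule st_eqI) (simp add: app_tok rep_scale algebra_simps sum_distrib_left scale_mult_left)

lemma tok_zero [simp]: "tok k 0 = 0"
  by (rule st_eqI) (simp add: app_tok)

lemma tok_sum: "tok k (\<Sum>i\<in>I. f i) = (\<Sum>i\<in>I. tok k (f i))"
  by (induction I rule: infinite_finite_induct) (auto simp: tok_add)

lemma rep_mult_parity: "a \<in> gr p \<Longrightarrow> c \<in> B \<Longrightarrow> rep (a * el i) c \<noteq> 0 \<Longrightarrow> parity c = p + par i"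
  using rep_homogeneous[OF gr_mult[OF _ parity_mem]] el_mem by blast

lemma tok_sign: "a \<in> gr p \<Longrightarrow> c \<in> B \<Longrightarrow>
    rep (a * el i) c * koszul (parity c + par i) y = rep (a * el i) c * koszul p y"
proof (cases "rep (a * el i) c = 0")
  case False
  assume "a \<in> gr p" "c \<in> B"
  with False have "parity c = p + par i" by (rule_tac rep_mult_parity)
  then show ?thesis by (simp add: add.assoc)
qed simp

lemma app_tok_homogeneous: "a \<in> gr p \<Longrightarrow> app (tok k a) \<phi> (\<beta>, \<alpha>, v) =
    (\<Sum>c\<in>B. rep (a * el (\<beta> k)) c * koszul p (J k \<beta>) * \<phi> (\<beta>(k := put (\<beta> k) c), \<alpha>, v))"
  unfolding app_tok by (rule sum.cong) (simp_all add: tok_sign)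

text \<open>A token on a lower strand changes the parity to the left of strand l by its own parity.
  This accounts for the whole sign when tokens on different strands are exchanged.\<close>

lemma J_sign: "a \<in> gr p \<Longrightarrow> c \<in> B \<Longrightarrow> k < l \<Longrightarrow>
    rep (a * el (\<beta> k)) c * koszul q (J l (\<beta>(k := put (\<beta> k) c))) =
    koszul q p * (rep (a * el (\<beta> k)) c * koszul q (J l \<beta>))"
proof (cases "rep (a * el (\<beta> k)) c = 0")
  case False
  assume a: "a \<in> gr p" "c \<in> B" "k < l"
  then have "parity c = p + par (\<beta> k)" using False by (rule_tac rep_mult_parity)
  then have "J l (\<beta>(k := put (\<beta> k) c)) = p + J l \<beta>" using a by (simp add: J_upd_less algebra_simps)
  then show ?thesis by (simp add: koszul_add_right ac_simps)
qed simp

lemma tok_commute_less: assumes "k < l" "a \<in> gr p" "b \<in> gr q"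
  shows "tok k a * tok l b = koszul p q * (tok l b * tok k a)"
proof (rule st_eqI)
  fix \<phi> :: "st \<Rightarrow> 'k" and \<beta> :: "nat \<Rightarrow> nat" and \<alpha> :: "nat \<Rightarrow> int" and v :: "nat perm"
  have "app (koszul p q * (tok l b * tok k a)) \<phi> (\<beta>, \<alpha>, v) =
      koszul p q * (\<Sum>d\<in>B. rep (a * el (\<beta> k)) d * koszul p (J k \<beta>) *
       (\<Sum>c\<in>B. rep (b * el (\<beta> l)) c * koszul q (J l (\<beta>(k := put (\<beta> k) d))) *
          \<phi> (\<beta>(k := put (\<beta> k) d, l := put (\<beta> l) c), \<alpha>, v)))"
    using assms(1)
    by (simp add: app_tok_homogeneous[OF assms(2)] app_tok_homogeneous[OF assms(3)] koszul_def app_uminus sum_negf)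
  also have "\<dots> = koszul p q * (\<Sum>d\<in>B. \<Sum>c\<in>B. (rep (a * el (\<beta> k)) d * koszul q (J l (\<beta>(k := put (\<beta> k) d)))) *
       (koszul p (J k \<beta>) * rep (b * el (\<beta> l)) c *
          \<phi> (\<beta>(k := put (\<beta> k) d, l := put (\<beta> l) c), \<alpha>, v)))"
    by (simp only: sum_distrib_left ac_simps)
  also have "\<dots> = koszul p q * (\<Sum>d\<in>B. \<Sum>c\<in>B. (koszul q p * (rep (a * el (\<beta> k)) d * koszul q (J l \<beta>))) *
       (koszul p (J k \<beta>) * rep (b * el (\<beta> l)) c *
          \<phi> (\<beta>(k := put (\<beta> k) d, l := put (\<beta> l) c), \<alpha>, v)))"
    by (simp only: J_sign[OF assms(2) _ assms(1)] cong: sum.cong)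
  also have "\<dots> = (\<Sum>d\<in>B. \<Sum>c\<in>B. koszul p q * koszul q p * ((rep (a * el (\<beta> k)) d * koszul q (J l \<beta>)) *
       (koszul p (J k \<beta>) * rep (b * el (\<beta> l)) c *
          \<phi> (\<beta>(k := put (\<beta> k) d, l := put (\<beta> l) c), \<alpha>, v))))"
    by (simp only: sum_distrib_left ac_simps)
  also have "\<dots> = (\<Sum>c\<in>B. \<Sum>d\<in>B. rep (b * el (\<beta> l)) c * koszul q (J l \<beta>) *
       (rep (a * el (\<beta> k)) d * koszul p (J k \<beta>) * \<phi> (\<beta>(l := put (\<beta> l) c, k := put (\<beta> k) d), \<alpha>, v)))"
    using assms(1) by (subst sum.swap) (simp add: koszul_sym[of q p] fun_upd_twist ac_simps)
  also have "\<dots> = app (tok k a * tok l b) \<phi> (\<beta>, \<alpha>, v)"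
    using assms(1)
    by (simp add: app_tok_homogeneous[OF assms(2)] app_tok_homogeneous[OF assms(3)] J_upd_ge sum_distrib_left)
  finally show "app (tok k a * tok l b) \<phi> (\<beta>, \<alpha>, v) = app (koszul p q * (tok l b * tok k a)) \<phi> (\<beta>, \<alpha>, v)"
    by simp
qed

lemma tok_commute: assumes "k \<noteq> l" "a \<in> gr p" "b \<in> gr q"
  shows "tok k a * tok l b = koszul p q * (tok l b * tok k a)"
proof (cases "k < l")
  case False
  then have "tok l b * tok k a = koszul q p * (tok k a * tok l b)" using assms by (intro tok_commute_less) auto
  then show ?thesis by (simp add: koszul_sym[of q p])
qed (use assms tok_commute_less in blast)

lemma dot_tok: "dot k * tok l a = tok l a * dot k"
  by (rule st_eqI) (simp add: app_tok app_dot)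

lemma dotinv_tok: "dotinv k * tok l a = tok l a * dotinv k"
  by (rule st_eqI) (simp add: app_tok app_dotinv)

lemma dot_dotinv [simp]: "dot k * dotinv k = 1" "dotinv k * dot k = 1"
  by (rule st_eqI, simp add: app_dot app_dotinv)+

lemma dot_dot: "dot k * dot l = dot l * dot k"
  by (rule st_eqI) (cases "k = l"; simp add: app_dot fun_upd_twist)

lemma dotinv_dot: "k \<noteq> l \<Longrightarrow> dotinv k * dot l = dot l * dotinv k"
  by (rule st_eqI) (simp add: app_dot app_dotinv fun_upd_twist)

lemma dotinv_dotinv: "dotinv k * dotinv l = dotinv l * dotinv k"
  by (rule st_eqI) (cases "k = l"; simp add: app_dotinv fun_upd_twist)


subsection \<open>Signed transpositions\<close>

lemma swp_tok: "swp i * tok k a = tok (\<tau> i k) a * swp i"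
proof (rule st_eqI)
  fix \<phi> :: "st \<Rightarrow> 'k" and \<beta> :: "nat \<Rightarrow> nat" and \<alpha> :: "nat \<Rightarrow> int" and v :: "nat perm"
  consider "k = i" | "k = Suc i" | "k \<noteq> i" "k \<noteq> Suc i" by blast
  then show "app (swp i * tok k a) \<phi> (\<beta>, \<alpha>, v) = app (tok (\<tau> i k) a * swp i) \<phi> (\<beta>, \<alpha>, v)"
  proof cases
    case 1
    then show ?thesis
      by (auto simp: app_tok app_swp upd_comp_transpose J_tau_Suc koszul_add_left koszul_add_right sum_distrib_left
        ac_simps koszul_sym[of _ "par (\<beta> i)"] intro!: sum.cong)
  next
    case 2
    then show ?thesis
      by (auto simp: app_tok app_swp upd_comp_transpose J_Suc J_tau koszul_add_left koszul_add_right sum_distrib_left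
        ac_simps koszul_sym[of "par (\<beta> i)"] intro!: sum.cong)
  next
    case 3
    then show ?thesis
      by (auto simp: app_tok app_swp upd_comp_transpose J_tau sum_distrib_left ac_simps intro!: sum.cong)
  qed
qed

lemma swp_dot: "swp i * dot k = dot (\<tau> i k) * swp i"
  by (rule st_eqI) (simp add: app_dot app_swp upd_comp_transpose)

lemma swp_swp [simp]: "swp i * swp i = 1"
proof (rule st_eqI)
  fix \<phi> :: "st \<Rightarrow> 'k" and \<beta> :: "nat \<Rightarrow> nat" and \<alpha> :: "nat \<Rightarrow> int" and v :: "nat perm"
  have "v * Perm.swap i (Suc i) * Perm.swap i (Suc i) = v"
    by (rule perm_eqI) (simp add: apply_times Perm.swap.rep_eq)
  then show "app (swp i * swp i) \<phi> (\<beta>, \<alpha>, v) = app 1 \<phi> (\<beta>, \<alpha>, v)"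
    by (simp add: app_swp comp_tau_tau koszul_sym[of "par (\<beta> i)"])
qed

lemma swp_far: "Suc i < j \<Longrightarrow> swp i * swp j = swp j * swp i"
proof (rule st_eqI)
  fix \<phi> :: "st \<Rightarrow> 'k" and \<beta> :: "nat \<Rightarrow> nat" and \<alpha> :: "nat \<Rightarrow> int" and v :: "nat perm"
  assume ij: "Suc i < j"
  have 1: "Perm.swap i (Suc i) * Perm.swap j (Suc j) = Perm.swap j (Suc j) * Perm.swap i (Suc i)"
    using ij by (intro perm_eqI) (auto simp: apply_times Perm.swap.rep_eq transpose_def)
  have 2: "f \<circ> \<tau> i \<circ> \<tau> j = f \<circ> \<tau> j \<circ> \<tau> i" for f :: "nat \<Rightarrow> 'x"
    using ij by (auto simp: fun_eq_iff transpose_def)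
  show "app (swp i * swp j) \<phi> (\<beta>, \<alpha>, v) = app (swp j * swp i) \<phi> (\<beta>, \<alpha>, v)"
    using ij by (simp add: app_swp 1 2 ac_simps)
qed

lemma swp_braid: "swp i * swp (Suc i) * swp i = swp (Suc i) * swp i * swp (Suc i)"
proof (rule st_eqI)
  fix \<phi> :: "st \<Rightarrow> 'k" and \<beta> :: "nat \<Rightarrow> nat" and \<alpha> :: "nat \<Rightarrow> int" and v :: "nat perm"
  have 1: "Perm.swap i (Suc i) * (Perm.swap (Suc i) (Suc (Suc i)) * Perm.swap i (Suc i)) =
    Perm.swap (Suc i) (Suc (Suc i)) * (Perm.swap i (Suc i) * Perm.swap (Suc i) (Suc (Suc i)))"
    by (intro perm_eqI) (auto simp: apply_times Perm.swap.rep_eq transpose_def)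
  have 2: "f \<circ> \<tau> i \<circ> \<tau> (Suc i) \<circ> \<tau> i = f \<circ> \<tau> (Suc i) \<circ> \<tau> i \<circ> \<tau> (Suc i)" for f :: "nat \<Rightarrow> 'x"
    by (auto simp: fun_eq_iff transpose_def)
  show "app (swp i * swp (Suc i) * swp i) \<phi> (\<beta>, \<alpha>, v) =
      app (swp (Suc i) * swp i * swp (Suc i)) \<phi> (\<beta>, \<alpha>, v)"
    by (simp add: app_swp 1 2 ac_simps) 
qed


subsection \<open>Demazure operators\<close>

lemma dem_tok: "dem i * tok k a = tok k a * dem i"
  by (rule st_eqI) (simp add: app_tok app_dem sum_distrib_left ac_simps, subst sum.swap, rule refl)

lemma dem_dot_other: "k \<noteq> i \<Longrightarrow> k \<noteq> Suc i \<Longrightarrow> dem i * dot k = dot k * dem i"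
  by (rule st_eqI) (simp add: app_dot app_dem fun_upd_twist)

lemma sum_shift_int: "(\<Sum>k\<in>{a..b}. f (k - 1)) = (\<Sum>k\<in>{a - 1..b - (1::int)}. f k)"
  by (rule sum.reindex_bij_witness[of _ "\<lambda>k. k + 1" "\<lambda>k. k - 1"]) auto

text \<open>The twisted Leibniz rule D(X_i p) = X_(i+1) D(p) - X_(i+1) p. The swapped monomial which
  an inverted label adds satisfies s(X_i p) = X_(i+1) s(p), so the rule is the same for all
  labels.\<close>

lemma dem_dot_left: "dem i * dot i = dot (Suc i) * dem i - dot (Suc i)"
proof (rule st_eqI)
  fix \<phi> :: "st \<Rightarrow> 'k" and \<beta> :: "nat \<Rightarrow> nat" and \<alpha> :: "nat \<Rightarrow> int" and v :: "nat perm"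
  let ?a = "\<alpha> i" let ?b = "\<alpha> (Suc i)" let ?w = "Perm.apply v (Suc i) < Perm.apply v i"
  define K where "K = {min ?a ?b - 1..max ?a ?b + 1}"
  have K: "finite K" "?a \<in> K" by (auto simp: K_def)
  let ?\<phi> = "\<lambda>k. \<phi> (\<beta>, \<alpha>(i := k, Suc i := ?a + ?b - k + 1), v)"
  have "app (dem i * dot i) \<phi> (\<beta>, \<alpha>, v) = (\<Sum>k\<in>K. ec (?a + 1) ?b ?w k * ?\<phi> k)"
    by (simp add: app_dot, subst app_dem'[of K]) (auto simp: K_def algebra_simps)
  also have "\<dots> = (\<Sum>k\<in>K. ec ?a ?b ?w k * ?\<phi> k) - (\<Sum>k\<in>K. of_bool (k = ?a) * ?\<phi> k)"
    by (simp add: ec_left left_diff_distrib sum_subtractf)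
  also have "(\<Sum>k\<in>K. of_bool (k = ?a) * ?\<phi> k) = ?\<phi> ?a"
    using K by (subst sum.remove[of K ?a]) (auto intro!: sum.neutral)
  also have "(\<Sum>k\<in>K. ec ?a ?b ?w k * ?\<phi> k) - ?\<phi> ?a = app (dot (Suc i) * dem i - dot (Suc i)) \<phi> (\<beta>, \<alpha>, v)"
    by (simp add: app_dot, subst app_dem'[of K]) (auto simp: K_def app_dot algebra_simps)
  finally show "app (dem i * dot i) \<phi> (\<beta>, \<alpha>, v) = app (dot (Suc i) * dem i - dot (Suc i)) \<phi> (\<beta>, \<alpha>, v)" .
qed

lemma dem_dot_right: "dem i * dot (Suc i) = dot i * dem i + dot (Suc i)"
proof (rule st_eqI)
  fix \<phi> :: "st \<Rightarrow> 'k" and \<beta> :: "nat \<Rightarrow> nat" and \<alpha> :: "nat \<Rightarrow> int" and v :: "nat perm"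
  let ?a = "\<alpha> i" let ?b = "\<alpha> (Suc i)" let ?w = "Perm.apply v (Suc i) < Perm.apply v i"
  define K where "K = {min ?a ?b - 1..max ?a ?b + 2}"
  define K' where "K' = {min ?a ?b - 2..max ?a ?b + 1}"
  have K: "finite K" "?a \<in> K" "finite K'" by (auto simp: K_def K'_def)
  let ?\<phi> = "\<lambda>k. \<phi> (\<beta>, \<alpha>(i := k, Suc i := ?a + ?b - k + 1), v)"
  have "app (dem i * dot (Suc i)) \<phi> (\<beta>, \<alpha>, v) = (\<Sum>k\<in>K. ec ?a (?b + 1) ?w k * ?\<phi> k)"
    by (simp add: app_dot, subst app_dem'[of K]) (auto simp: K_def algebra_simps)
  also have "\<dots> = (\<Sum>k\<in>K. ec ?a ?b ?w (k - 1) * ?\<phi> (k - 1 + 1)) + (\<Sum>k\<in>K. of_bool (k = ?a) * ?\<phi> k)"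
    by (simp add: ec_right distrib_right sum.distrib)
  also have "(\<Sum>k\<in>K. of_bool (k = ?a) * ?\<phi> k) = ?\<phi> ?a"
    using K by (subst sum.remove[of K ?a]) (auto intro!: sum.neutral)
  also have "(\<Sum>k\<in>K. ec ?a ?b ?w (k - 1) * ?\<phi> (k - 1 + 1)) = (\<Sum>k\<in>K'. ec ?a ?b ?w k * ?\<phi> (k + 1))"
    unfolding K_def by (subst sum_shift_int) (simp add: K'_def add.commute)
  also have "\<dots> + ?\<phi> ?a = app (dot i * dem i + dot (Suc i)) \<phi> (\<beta>, \<alpha>, v)"
    by (simp add: app_dot, subst app_dem'[of K']) (auto simp: K'_def app_dot algebra_simps fun_upd_twist)
  finally show "app (dem i * dot (Suc i)) \<phi> (\<beta>, \<alpha>, v) = app (dot i * dem i + dot (Suc i)) \<phi> (\<beta>, \<alpha>, v)" .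
qed

lemma dem_swp_far: "Suc i < j \<or> Suc j < i \<Longrightarrow> dem i * swp j = swp j * dem i"
  by (rule st_eqI) (auto simp: app_swp app_dem sum_distrib_left ac_simps upd_comp_transpose apply_times transpose_def
      Perm.swap.rep_eq intro!: sum.cong)

lemma dem_far: "Suc i < j \<Longrightarrow> dem i * dem j = dem j * dem i"
  by (rule st_eqI) (simp add: app_dem sum_distrib_left, subst sum.swap, auto simp: fun_upd_twist ac_simps intro!: sum.cong)

lemma app_dem_zero: "\<alpha> i = 0 \<Longrightarrow> \<alpha> (Suc i) = 0 \<Longrightarrow>
    app (dem i) \<phi> (\<beta>, \<alpha>, v) = of_bool (Perm.apply v (Suc i) < Perm.apply v i) * \<phi> (\<beta>, \<alpha>, v)"
proof -
  assume "\<alpha> i = 0" "\<alpha> (Suc i) = 0"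
  moreover from this have "\<alpha>(i := 0, Suc i := 0) = \<alpha>" by auto
  ultimately show ?thesis by (simp add: app_dem ec_def)
qed

end

lemma twisted_mult:
  fixes F :: "'r::semigroup_mult"
  shows "F * x = x' * G \<Longrightarrow> G * y = y' * H \<Longrightarrow> F * (x * y) = x' * y' * H"
  by (simp add: mult.assoc flip: mult.assoc) (simp add: mult.assoc)

context symmetric_frobenius_superalgebra
begin

subsection \<open>Casimir elements\<close>

definition cas :: "nat \<Rightarrow> nat \<Rightarrow> (st, 'k) lop" where
  "cas p q = (\<Sum>b\<in>B. tok p b * tok q (dual b))"

lemma dual_mult: "c \<in> B \<Longrightarrow> dual c * a = (\<Sum>b\<in>B. rep (a * b) c *s dual b)"
  using dual_expand[of "dual c * a"] by (simp add: mult.assoc tr_dual)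

text \<open>By the trace form, left multiplication by a on \<open>B\<close> and right multiplication
  by a on the dual basis have transposed matrices.\<close>

lemma cas_tok_second: "cas p q * tok q a = tok p a * cas p q"
proof -
  have "tok p a * cas p q = (\<Sum>b\<in>B. tok p (\<Sum>c\<in>B. rep (a * b) c *s c) * tok q (dual b))"
    by (simp add: cas_def sum_distrib_left tok_mult rep_expand flip: mult.assoc)
  also have "\<dots> = (\<Sum>b\<in>B. \<Sum>c\<in>B. sc (rep (a * b) c) * (tok p c * tok q (dual b)))"
    by (simp add: tok_sum tok_scale sum_distrib_right mult.assoc)
  also have "\<dots> = (\<Sum>c\<in>B. tok p c * tok q (\<Sum>b\<in>B. rep (a * b) c *s dual b))"
    by (subst sum.swap) (simp add: tok_sum tok_scale sum_distrib_left sc_left_commute)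
  also have "\<dots> = cas p q * tok q a"
    by (simp add: cas_def sum_distrib_right mult.assoc tok_mult dual_mult)
  finally show ?thesis by simp
qed

text \<open>Both coordinates are traces of products of \<open>dual b\<close> and
  \<open>dual c\<close>, in opposite orders. So they differ by the sign of the supersymmetric trace,
  and they vanish unless the parities of b and c agree.\<close>

lemma rep_dual_dual: assumes "b \<in> B" "c \<in> B"
  shows "koszul (parity b) (parity b) * rep (dual b) c = rep (dual c) b"
proof (cases "rep (dual b) c = 0")
  case True
  have "rep (dual c) b = koszul (parity b) (parity c) * rep (dual b) c"
    using assms tr_symmetric[OF dual_parity dual_parity, of b c] by (simp add: tr_dual)
  with True show ?thesis by simp
next
  case False
  then have "parity c = parity b" using rep_homogeneous[OF dual_parity] assms by blast
  then show ?thesis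
    using assms tr_symmetric[OF dual_parity dual_parity, of b c] by (simp add: tr_dual)
qed

lemma cas_sym: assumes "p \<noteq> q" shows "cas p q = cas q p"
proof -
  have dual: "tok k (dual b) = (\<Sum>c\<in>B. sc (rep (dual b) c) * tok k c)" for k b
    by (subst rep_expand[of "dual b", symmetric]) (simp add: tok_sum tok_scale)
  have "cas q p = (\<Sum>b\<in>B. koszul (parity b) (parity b) * (tok p (dual b) * tok q b))"
    unfolding cas_def using assms by (intro sum.cong refl tok_commute) (auto intro: parity_mem dual_parity)
  also have "\<dots> = (\<Sum>b\<in>B. \<Sum>c\<in>B. sc (koszul (parity b) (parity b) * rep (dual b) c) * (tok p c * tok q b))"
    by (simp add: dual sum_distrib_left sum_distrib_right mult.assoc sc_koszul flip: sc_mult)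
  also have "\<dots> = (\<Sum>b\<in>B. \<Sum>c\<in>B. sc (rep (dual c) b) * (tok p c * tok q b))"
    by (intro sum.cong refl) (simp add: rep_dual_dual)
  also have "\<dots> = cas p q"
    unfolding cas_def dual by (subst sum.swap) (simp add: sum_distrib_left sc_left_commute)
  finally show ?thesis by simp
qed

lemma cas_tok_first: "p \<noteq> q \<Longrightarrow> cas p q * tok p a = tok q a * cas p q"
  by (metis cas_sym cas_tok_second)

lemma gr_cases: obtains x y where "x \<in> gr 0" "y \<in> gr 1" "a = x + y"
  using gr_decomp[of 0 a] by (metis add.left_neutral add_diff_cancel_left' diff_add_cancel add.commute)

lemma cas_tok_other: assumes "r \<noteq> p" "r \<noteq> q" shows "cas p q * tok r a = tok r a * cas p q"
proof -
  have hom: "cas p q * tok r x = tok r x * cas p q" if x: "x \<in> gr s" for x s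
  proof -
    have "tok p b * tok q (dual b) * tok r x = tok r x * (tok p b * tok q (dual b))" if b: "b \<in> B" for b
    proof -
      have "tok p b * tok q (dual b) * tok r x = koszul (parity b) s * (tok p b * tok r x * tok q (dual b))"
        using tok_commute[OF assms(2)[symmetric] dual_parity[OF b] x] by (simp add: mult.assoc koszul_def)
      also have "tok p b * tok r x = koszul (parity b) s * (tok r x * tok p b)"
        using tok_commute[OF assms(1)[symmetric] parity_mem[OF b] x] .
      finally show ?thesis by (simp add: mult.assoc)
    qed
    then show ?thesis by (simp add: cas_def sum_distrib_left sum_distrib_right)
  qed
  obtain x y where "x \<in> gr 0" "y \<in> gr 1" "a = x + y" by (rule gr_cases)
  then show ?thesis using hom by (simp add: tok_add distrib_left distrib_right)
qed

lemma twist_cas: "(\<And>k a. F * tok k a = tok (f k) a * F) \<Longrightarrow> F * cas p q = cas (f p) (f q) * F"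
proof -
  assume F: "\<And>k a. F * tok k a = tok (f k) a * F"
  have "F * (tok p b * tok q (dual b)) = tok (f p) b * tok (f q) (dual b) * F" for b
    by (rule twisted_mult[OF F F])
  then show ?thesis by (simp add: cas_def sum_distrib_left sum_distrib_right)
qed

lemma cas_dot: "dot k * cas p q = cas p q * dot k"
  using twist_cas[of "dot k" id p q] dot_tok by simp

lemma dem_cas: "dem i * cas p q = cas p q * dem i"
  using twist_cas[of "dem i" id p q] dem_tok by simp

text \<open>With respect to tokens, \<open>cas p q\<close> behaves like a transposition: it carries
  tokens on q to p and passes tokens on the third strand r without change.\<close>

lemma cas_cas:
  assumes "p \<noteq> q" "p \<noteq> r" "q \<noteq> r"
  shows "cas p q * cas q r = cas p r * cas p q" "cas p r * cas p q = cas q r * cas p r"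
proof -
  have *: "cas p q * cas q r = cas p r * cas p q" if "p \<noteq> r" "q \<noteq> r" for p q r
  proof -
    have "cas p q * (tok q b * tok r (dual b)) = tok p b * tok r (dual b) * cas p q" for b
      by (rule twisted_mult[OF cas_tok_second cas_tok_other]) (use that in auto)
    then show ?thesis by (simp add: cas_def[of q r] cas_def[of p r] sum_distrib_left sum_distrib_right)
  qed
  show "cas p q * cas q r = cas p r * cas p q" using * assms by blast
  have "cas r p * cas p q = cas r q * cas r p" using *[of r q p] assms by blast
  then show "cas p r * cas p q = cas q r * cas p r" using assms cas_sym by metis
qed

subsection \<open>Inversions of the labels\<close>

text \<open>The projection onto the labels that are inverted at p and q. For neighbouring strands
  this is what remains of \<open>dem\<close> in degree zero; for the outer pair of three strands it
  arises by conjugation with \<open>swp\<close>.\<close>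

definition inv_op :: "nat \<Rightarrow> nat \<Rightarrow> (st, 'k) lop" where
  "inv_op p q = Lop (\<lambda>\<phi> (\<beta>, \<alpha>, v). of_bool (Perm.apply v q < Perm.apply v p) * \<phi> (\<beta>, \<alpha>, v))"

lemma app_inv_op: "app (inv_op p q) \<phi> (\<beta>, \<alpha>, v) = of_bool (Perm.apply v q < Perm.apply v p) * \<phi> (\<beta>, \<alpha>, v)"
  unfolding inv_op_def by (subst Lop_inverse) (auto simp: fun_eq_iff algebra_simps)

lemma inv_op_tok: "inv_op p q * tok k a = tok k a * inv_op p q"
  by (rule st_eqI) (simp add: app_tok app_inv_op sum_distrib_left ac_simps)

lemma inv_op_cas: "inv_op p q * cas k l = cas k l * inv_op p q"
  using twist_cas[of "inv_op p q" id k l] inv_op_tok by simp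

lemma inv_op_idem: "inv_op p q * inv_op p q = inv_op p q"
  by (rule st_eqI) (simp add: app_inv_op)

lemma inv_op_commute: "inv_op p q * inv_op k l = inv_op k l * inv_op p q"
  by (rule st_eqI) (simp add: app_inv_op)

lemma inv_op_flip: "p \<noteq> q \<Longrightarrow> inv_op q p = 1 - inv_op p q"
proof (rule st_eqI)
  fix \<phi> :: "st \<Rightarrow> 'k" and \<beta> :: "nat \<Rightarrow> nat" and \<alpha> :: "nat \<Rightarrow> int" and v :: "nat perm"
  assume "p \<noteq> q"
  then have "Perm.apply v p \<noteq> Perm.apply v q" by (simp add: apply_inj)
  then show "app (inv_op q p) \<phi> (\<beta>, \<alpha>, v) = app (1 - inv_op p q) \<phi> (\<beta>, \<alpha>, v)"
    by (auto simp: app_inv_op)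
qed

lemma swp_inv_op: "swp i * inv_op p q = inv_op (\<tau> i p) (\<tau> i q) * swp i"
  by (rule st_eqI) (simp add: app_inv_op app_swp apply_times Perm.swap.rep_eq)

text \<open>The labels at p, q, r are linearly ordered: if p and r are inverted, so is one of the
  other two pairs, and if both of these are inverted, so are p and r. In degree zero the braid
  relation rests on these identities between indicator functions.\<close>

lemma inv_op_three:
  assumes "p \<noteq> q" "p \<noteq> r" "q \<noteq> r"
  shows "inv_op p q * inv_op q r + inv_op p r * (1 - inv_op p q) = inv_op q r * inv_op p r"
    "inv_op p q * inv_op q r + inv_op p r * (1 - inv_op q r) = inv_op p q * inv_op p r"
proof -
  have ne: "Perm.apply v p \<noteq> Perm.apply v q" "Perm.apply v p \<noteq> Perm.apply v r" "Perm.apply v q \<noteq> Perm.apply v r" for v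
    using assms by (simp_all add: apply_inj)
  show "inv_op p q * inv_op q r + inv_op p r * (1 - inv_op p q) = inv_op q r * inv_op p r"
  proof (rule st_eqI)
    fix \<phi> :: "st \<Rightarrow> 'k" and \<beta> :: "nat \<Rightarrow> nat" and \<alpha> :: "nat \<Rightarrow> int" and v :: "nat perm"
    show "app (inv_op p q * inv_op q r + inv_op p r * (1 - inv_op p q)) \<phi> (\<beta>, \<alpha>, v) =
        app (inv_op q r * inv_op p r) \<phi> (\<beta>, \<alpha>, v)"
      using ne[of v] by (auto simp: app_inv_op of_bool_def)
  qed
  show "inv_op p q * inv_op q r + inv_op p r * (1 - inv_op q r) = inv_op p q * inv_op p r"
  proof (rule st_eqI)
    fix \<phi> :: "st \<Rightarrow> 'k" and \<beta> :: "nat \<Rightarrow> nat" and \<alpha> :: "nat \<Rightarrow> int" and v :: "nat perm"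
    show "app (inv_op p q * inv_op q r + inv_op p r * (1 - inv_op q r)) \<phi> (\<beta>, \<alpha>, v) =
        app (inv_op p q * inv_op p r) \<phi> (\<beta>, \<alpha>, v)"
      using ne[of v] by (auto simp: app_inv_op of_bool_def)
  qed
qed

subsection \<open>Reduction to degree zero\<close>

definition degree_zero :: "nat set \<Rightarrow> st set" where
  "degree_zero P = {(\<beta>, \<alpha>, v). \<forall>p\<in>P. \<alpha> p = 0}"

text \<open>\<open>F * dot p = dot q * F\<close> compares F at the exponents \<alpha> p + 1 and
  \<alpha> p. As dots are invertible, vanishing at one is equivalent to vanishing at the other, so
  the exponents in P can be shifted to 0 one after the other.\<close>

lemma zero_if_zero_in_degree_zero:
  assumes "finite P" and zero: "\<And>\<phi> x. x \<in> degree_zero P \<Longrightarrow> app F \<phi> x = 0"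
    and dots: "\<And>p. p \<in> P \<Longrightarrow> \<exists>q. F * dot p = dot q * F"
  shows "F = 0"
proof -
  have step: "(\<forall>\<phi>. app F \<phi> (\<beta>, \<alpha>, v) = 0) \<longleftrightarrow> (\<forall>\<phi>. app F \<phi> (\<beta>, \<alpha>(p := \<alpha> p + 1), v) = 0)"
    if p: "p \<in> P" for \<beta> \<alpha> v p
  proof -
    obtain q where q: "F * dot p = dot q * F" using dots p by blast
    have e: "app F \<phi> (\<beta>, \<alpha>(p := \<alpha> p + 1), v) = app F (app (dot q) \<phi>) (\<beta>, \<alpha>, v)" for \<phi>
      using arg_cong[OF q, of "\<lambda>G. app G \<phi> (\<beta>, \<alpha>, v)"] by (simp add: app_dot)
    \<comment> \<open>Every test function is thus of the form \<open>app (dot q) \<psi>\<close>, so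
      vanishing for all test functions is the same condition at both exponents.\<close>
    have "app (dot q) (app (dotinv q) \<phi>) = \<phi>" for \<phi>
      using dot_dotinv(2)[of q] by (metis times_lop.rep_eq one_lop.rep_eq)
    then show ?thesis unfolding e by metis
  qed
  have shift: "(\<forall>\<phi>. app F \<phi> (\<beta>, \<alpha>(p := m), v) = 0) \<longleftrightarrow> (\<forall>\<phi>. app F \<phi> (\<beta>, \<alpha>(p := 0), v) = 0)"
    if p: "p \<in> P" for \<beta> \<alpha> v p m
  proof -
    define V where "V m \<longleftrightarrow> (\<forall>\<phi>. app F \<phi> (\<beta>, \<alpha>(p := m), v) = 0)" for m
    have V: "V m \<longleftrightarrow> V (m + 1)" for m
      unfolding V_def using step[OF p, of \<beta> "\<alpha>(p := m)" v] by simp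
    have "V m \<longleftrightarrow> V 0"
    proof (induction m rule: int_induct[where k = 0])
      case (step2 i)
      then show ?case using V[of "i - 1"] by simp
    qed (use V in auto)
    then show ?thesis by (simp add: V_def)
  qed
  have "finite Q \<Longrightarrow> Q \<subseteq> P \<Longrightarrow> (\<forall>p\<in>P - Q. \<alpha> p = 0) \<Longrightarrow> \<forall>\<phi>. app F \<phi> (\<beta>, \<alpha>, v) = 0" for Q \<alpha> \<beta> v
  proof (induction Q arbitrary: \<alpha> rule: finite_induct)
    case empty
    then show ?case using zero by (auto simp: degree_zero_def)
  next
    case (insert p Q)
    have "\<forall>\<phi>. app F \<phi> (\<beta>, \<alpha>(p := 0), v) = 0"
      by (rule insert.IH) (use insert.prems in auto)
    then show ?case using shift[of p \<beta> \<alpha> "\<alpha> p" v] insert.prems by simp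
  qed
  from this[of P] show ?thesis using assms(1) by (intro st_eqI) auto
qed

text \<open>Since \<phi> and \<psi> may differ outside degree zero, the condition also says that F
  and G do not leave degree zero. This makes it compatible with products.\<close>

definition zeq :: "nat set \<Rightarrow> (st, 'k) lop \<Rightarrow> (st, 'k) lop \<Rightarrow> bool" where
  "zeq P F G \<longleftrightarrow> (\<forall>\<phi> \<psi>. \<forall>x\<in>degree_zero P. (\<forall>y\<in>degree_zero P. \<phi> y = \<psi> y) \<longrightarrow> app F \<phi> x = app G \<psi> x)"

lemma zeq_mult: "zeq P F F' \<Longrightarrow> zeq P G G' \<Longrightarrow> zeq P (F * G) (F' * G')"
  by (simp add: zeq_def)

lemma zeq_add: "zeq P F F' \<Longrightarrow> zeq P G G' \<Longrightarrow> zeq P (F + G) (F' + G')"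
  unfolding zeq_def app_simps by (intro allI ballI impI arg_cong2[where f="(+)"]) blast+

lemma zeq_diff: "zeq P F F' \<Longrightarrow> zeq P G G' \<Longrightarrow> zeq P (F - G) (F' - G')"
  unfolding zeq_def app_simps by (intro allI ballI impI arg_cong2[where f="(-)"]) blast+

lemma zeq_one: "zeq P 1 1"
  by (simp add: zeq_def)

lemma zeq_sc: "zeq P (sc c) (sc c)"
  by (simp add: zeq_def)

lemma zeq_sum: "(\<And>a. a \<in> I \<Longrightarrow> zeq P (F a) (G a)) \<Longrightarrow> zeq P (sum F I) (sum G I)"
  unfolding zeq_def app_sum_lop by (intro allI ballI impI sum.cong refl) blast

lemma zeq_tok: "zeq P (tok k a) (tok k a)"
  by (auto simp: zeq_def degree_zero_def app_tok)

lemma zeq_cas: "zeq P (cas p q) (cas p q)"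
  unfolding cas_def by (intro zeq_sum zeq_mult zeq_tok)

lemma zeq_swp: "i \<in> P \<Longrightarrow> Suc i \<in> P \<Longrightarrow> zeq P (swp i) (swp i)"
  by (auto simp: zeq_def degree_zero_def app_swp transpose_def)

lemma zeq_dem: "i \<in> P \<Longrightarrow> Suc i \<in> P \<Longrightarrow> zeq P (dem i) (inv_op i (Suc i))"
  by (auto simp: zeq_def degree_zero_def app_dem_zero app_inv_op)

lemma zeq_imp_eq:
  assumes "zeq P F G" "G = 0" "finite P" "\<And>p. p \<in> P \<Longrightarrow> \<exists>q. F * dot p = dot q * F"
  shows "F = 0"
  by (rule zero_if_zero_in_degree_zero[OF assms(3) _ assms(4)]) (use assms(1,2) in \<open>auto simp: zeq_def\<close>)

end

context LAH
begin

subsection \<open>Crossings\<close>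

definition T :: "nat \<Rightarrow> (st, 'k) lop" where
  "T i = swp i + sc z * (cas i (Suc i) * dem i)"

text \<open>The form is forced by the skein relation; that this operator inverts \<open>T i\<close>
  is then the quadratic relation.\<close>

definition Ti :: "nat \<Rightarrow> (st, 'k) lop" where
  "Ti i = T i - sc z * cas i (Suc i)"

lemma T_tok: "T i * tok k a = tok (\<tau> i k) a * T i"
proof -
  have "cas i (Suc i) * tok k a = tok (\<tau> i k) a * cas i (Suc i)"
    by (cases "k = i"; cases "k = Suc i") (auto simp: cas_tok_first cas_tok_second cas_tok_other)
  then have "cas i (Suc i) * dem i * tok k a = tok (\<tau> i k) a * (cas i (Suc i) * dem i)"
    by (simp add: mult.assoc dem_tok) (simp flip: mult.assoc)
  then show ?thesis
    unfolding T_def by (simp add: distrib_left distrib_right swp_tok sc_left_commute mult.assoc)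
qed

lemma T_cas: "T i * cas p q = cas (\<tau> i p) (\<tau> i q) * T i"
  by (rule twist_cas) (rule T_tok)

lemma T_dot_left: "T i * dot i = dot (Suc i) * T i - sc z * (cas i (Suc i) * dot (Suc i))"
proof -
  have "cas i (Suc i) * dem i * dot i = dot (Suc i) * (cas i (Suc i) * dem i) - cas i (Suc i) * dot (Suc i)"
    by (simp add: mult.assoc dem_dot_left right_diff_distrib) (simp flip: mult.assoc add: cas_dot)
  then show ?thesis
    unfolding T_def by (simp add: distrib_left distrib_right swp_dot sc_left_commute mult.assoc right_diff_distrib)
qed

lemma T_dot_right: "T i * dot (Suc i) = dot i * T i + sc z * (cas i (Suc i) * dot (Suc i))"
proof -
  have "cas i (Suc i) * dem i * dot (Suc i) = dot i * (cas i (Suc i) * dem i) + cas i (Suc i) * dot (Suc i)"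
    by (simp add: mult.assoc dem_dot_right distrib_left) (simp flip: mult.assoc add: cas_dot)
  then show ?thesis
    unfolding T_def by (simp add: distrib_left distrib_right swp_dot sc_left_commute mult.assoc)
qed

lemma T_dot_other: "k \<noteq> i \<Longrightarrow> k \<noteq> Suc i \<Longrightarrow> T i * dot k = dot k * T i"
proof -
  assume k: "k \<noteq> i" "k \<noteq> Suc i"
  then have "cas i (Suc i) * dem i * dot k = dot k * (cas i (Suc i) * dem i)"
    by (simp add: mult.assoc dem_dot_other) (simp flip: mult.assoc add: cas_dot)
  then show ?thesis
    using k unfolding T_def by (simp add: distrib_left distrib_right swp_dot sc_left_commute mult.assoc)
qed

lemma T_far: assumes "Suc i < j" shows "T i * T j = T j * T i"
proof -
  have 1: "swp i * (cas j (Suc j) * dem j) = cas j (Suc j) * dem j * swp i"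
    by (rule twisted_mult) (use assms twist_cas[OF swp_tok, of i j "Suc j"] dem_swp_far[of j i] in auto)
  have 2: "swp j * (cas i (Suc i) * dem i) = cas i (Suc i) * dem i * swp j"
    by (rule twisted_mult) (use assms twist_cas[OF swp_tok, of j i "Suc i"] dem_swp_far[of i j] in auto)
  have cc: "cas i (Suc i) * cas j (Suc j) = cas j (Suc j) * cas i (Suc i)"
    unfolding cas_def[of j] sum_distrib_left sum_distrib_right
    using assms by (intro sum.cong refl twisted_mult[OF cas_tok_other cas_tok_other]) auto
  have "cas i (Suc i) * dem i * cas j (Suc j) = cas j (Suc j) * (cas i (Suc i) * dem i)"
    by (simp add: mult.assoc dem_cas) (simp flip: mult.assoc add: cc)
  moreover have "cas i (Suc i) * dem i * dem j = dem j * (cas i (Suc i) * dem i)"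
    by (simp only: mult.assoc dem_far[OF assms]) (simp only: dem_cas mult.assoc[symmetric])
  ultimately have 3: "cas i (Suc i) * dem i * (cas j (Suc j) * dem j) = cas j (Suc j) * dem j * (cas i (Suc i) * dem i)"
    by (rule twisted_mult)
  have "(s + \<zeta> * A) * (s' + \<zeta> * A') = (s' + \<zeta> * A') * (s + \<zeta> * A)"
    if "s * s' = s' * s" "s * A' = A' * s" "s' * A = A * s'" "A * A' = A' * A" "\<And>F. F * \<zeta> = \<zeta> * F"
    for s s' A A' \<zeta> :: "(st, 'k) lop"
  proof -
    have "F * (\<zeta> * G) = \<zeta> * (F * G)" for F G by (simp only: that(5) mult.assoc[symmetric])
    from this[of s] this[of s'] this[of A] this[of A'] show ?thesis
      by (simp add: distrib_left distrib_right mult.assoc that(1-4) add_ac)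
  qed
  from this[OF swp_far[OF assms] 1 2 3 sc_commute] show ?thesis unfolding T_def .
qed

text \<open>The difference F of the two sides commutes with both dots, because the corrections from
  moving a dot through \<open>T i\<close> cancel. In degree zero \<open>T i\<close> becomes s + z c
  n with n the inversion projection, and the claim follows from s n = (1 - n) s and n n = n.\<close>

lemma T_square: "T i * T i = 1 + sc z * (cas i (Suc i) * T i)"
proof -
  define c where "c = cas i (Suc i)"
  define \<zeta> where "\<zeta> = (sc z :: (st, 'k) lop)"
  define s where "s = swp i"
  define n where "n = inv_op i (Suc i)"
  define x where "x = dot i"
  define y where "y = dot (Suc i)"
  have z: "G * \<zeta> = \<zeta> * G" "G * (\<zeta> * h) = \<zeta> * (G * h)" for G h
    unfolding \<zeta>_def by (rule sc_commute sc_left_commute)+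
  define F where "F = T i * T i - \<zeta> * (c * T i) - 1"
  have Tx: "T i * x = y * T i - \<zeta> * (c * y)" "T i * (x * h) = y * (T i * h) - \<zeta> * (c * (y * h))" for h
    using T_dot_left[of i] unfolding x_def y_def c_def \<zeta>_def
    by (simp_all add: left_diff_distrib mult.assoc flip: mult.assoc)
  have Ty: "T i * y = x * T i + \<zeta> * (c * y)" "T i * (y * h) = x * (T i * h) + \<zeta> * (c * (y * h))" for h
    using T_dot_right[of i] unfolding x_def y_def c_def \<zeta>_def
    by (simp_all add: distrib_right mult.assoc flip: mult.assoc)
  have xc: "x * c = c * x" "x * (c * h) = c * (x * h)" "y * c = c * y" "y * (c * h) = c * (y * h)" for h
    unfolding x_def y_def c_def by (simp_all add: cas_dot mult.assoc flip: mult.assoc)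
  have Tc: "T i * c = c * T i" "T i * (c * h) = c * (T i * h)" for h
    using T_cas[of i i "Suc i"] cas_sym[of i "Suc i"] unfolding c_def by (simp_all flip: mult.assoc)
  \<comment> \<open>In the product \<open>T i * T i\<close> a dot changes strand twice, so each dot
    returns to its own strand.\<close>
  have "F * x = x * F" "F * y = y * F"
    unfolding F_def by (simp_all add: algebra_simps Tx Ty Tc xc z[of x] z[of y] z[of "T i"] z[of c])
  then have comm: "\<exists>q. F * dot p = dot q * F" if "p \<in> {i, Suc i}" for p
    using that unfolding x_def y_def by auto
  let ?T0 = "s + \<zeta> * (c * n)"
  have T0: "zeq {i, Suc i} (T i) ?T0"
    unfolding T_def s_def \<zeta>_def c_def n_def
    by (intro zeq_add zeq_mult zeq_sc zeq_cas zeq_swp zeq_dem) auto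
  have "zeq {i, Suc i} F (?T0 * ?T0 - \<zeta> * (c * ?T0) - 1)"
    unfolding F_def using T0 zeq_cas zeq_sc by (intro zeq_diff zeq_mult zeq_one) (auto simp: c_def \<zeta>_def)
  moreover have "?T0 * ?T0 - \<zeta> * (c * ?T0) - 1 = 0"
  proof -
    have ss: "s * s = 1" "s * (s * h) = h" for h unfolding s_def by (simp_all flip: mult.assoc)
    have sc: "s * c = c * s" "s * (c * h) = c * (s * h)" for h
      using twist_cas[OF swp_tok, of i i "Suc i"] cas_sym[of i "Suc i"] unfolding s_def c_def by (simp_all flip: mult.assoc)
    have sn: "s * n = s - n * s" "s * (n * h) = s * h - n * (s * h)" for h
      using swp_inv_op[of i i "Suc i"] inv_op_flip[of i "Suc i"] unfolding s_def n_def
      by (simp_all add: left_diff_distrib mult.assoc flip: mult.assoc)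
    have nn: "n * n = n" "n * (n * h) = n * h" for h
      unfolding n_def by (simp_all add: inv_op_idem flip: mult.assoc)
    have nc: "n * c = c * n" "n * (c * h) = c * (n * h)" for h
      unfolding n_def c_def by (simp_all add: inv_op_cas flip: mult.assoc)
    show ?thesis by (simp add: algebra_simps ss sc sn nn nc z[of s] z[of n] z[of c])
  qed
  ultimately have "F = 0" by (rule zeq_imp_eq[OF _ _ _ comm]) simp
  then show ?thesis unfolding F_def \<zeta>_def c_def by (simp add: algebra_simps)
qed

lemma T_Ti [simp]: "T i * Ti i = 1" "Ti i * T i = 1"
proof -
  have "T i * (sc z * cas i (Suc i)) = sc z * (cas i (Suc i) * T i)"
    unfolding sc_left_commute using T_cas[of i i "Suc i"] cas_sym[of i "Suc i"] by simp
  then show "T i * Ti i = 1" "Ti i * T i = 1"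
    unfolding Ti_def right_diff_distrib left_diff_distrib T_square by (simp_all add: mult.assoc)
qed

text \<open>Same method as for the quadratic relation, now on three strands. The letters a, b, e are
  the Casimir elements of the pairs (i, j), (j, k), (i, k), and n, m, l below are the inversion
  projections of the same pairs.\<close>

lemma T_braid: "T i * T (Suc i) * T i = T (Suc i) * T i * T (Suc i)"
proof -
  define j where "j = Suc i"
  define k where "k = Suc j"
  define a where "a = cas i j"
  define b where "b = cas j k"
  define e where "e = cas i k"
  define \<zeta> where "\<zeta> = (sc z :: (st, 'k) lop)"
  define x where "x = dot i"
  define y where "y = dot j"
  define w where "w = dot k"
  define t where "t = T i"
  define u where "u = T j"
  note defs = j_def k_def a_def b_def e_def \<zeta>_def x_def y_def w_def t_def u_def
  have z0: "G * \<zeta> = \<zeta> * G" "G * (\<zeta> * h) = \<zeta> * (G * h)" for G h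
    unfolding \<zeta>_def by (rule sc_commute sc_left_commute)+
  note z = z0[of a] z0[of b] z0[of e] z0[of x] z0[of y] z0[of w] z0[of t] z0[of u]
  have assocI: "F * G * h = K * h" if "F * G = K" for F G K h :: "(st, 'k) lop" using that by simp
  have cd: "x * a = a * x" "x * b = b * x" "x * e = e * x" "y * a = a * y" "y * b = b * y" "y * e = e * y"
    "w * a = a * w" "w * b = b * w" "w * e = e * w"
    unfolding defs by (rule cas_dot)+
  have tc: "t * a = a * t" "t * b = e * t" "t * e = b * t" "u * b = b * u" "u * a = e * u" "u * e = a * u"
    using T_cas[of i i j] T_cas[of i j k] T_cas[of i i k] T_cas[of j j k] T_cas[of j i j] T_cas[of j i k]
      cas_sym[of i j] cas_sym[of j k] unfolding defs by (simp_all add: transpose_def)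
  have td: "t * x = y * t - \<zeta> * (a * y)" "t * y = x * t + \<zeta> * (a * y)" "t * w = w * t"
    "u * y = w * u - \<zeta> * (b * w)" "u * w = y * u + \<zeta> * (b * w)" "u * x = x * u"
    using T_dot_left[of i] T_dot_right[of i] T_dot_other[of k i] T_dot_left[of j] T_dot_right[of j] T_dot_other[of i j]
    unfolding defs by simp_all
  have sq: "t * t = 1 + \<zeta> * (a * t)" "u * u = 1 + \<zeta> * (b * u)"
    using T_square[of i] T_square[of j] unfolding defs by simp_all
  have cc: "e * a = a * b" "b * e = a * b" "a * e = b * a" "e * b = b * a"
    using cas_cas[of i j k] cas_cas[of k j i] cas_sym[of i j] cas_sym[of j k] cas_sym[of i k]
    unfolding defs by (simp_all)
  have cc3: "b * (a * b) = a * (b * a)"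
    using cc by (metis mult.assoc)
  note rules = cd tc td sq cc cd[THEN assocI, unfolded mult.assoc] tc[THEN assocI, unfolded mult.assoc]
     td[THEN assocI, unfolded mult.assoc left_diff_distrib distrib_right]
     sq[THEN assocI, unfolded mult.assoc left_diff_distrib distrib_right mult_1_left]
     cc[THEN assocI, unfolded mult.assoc] cc3 cc3[THEN assocI, unfolded mult.assoc]
  define F where "F = t * u * t - u * t * u"
  \<comment> \<open>Both braid words exchange the outer strands and keep the middle one, so the dots
    x and w trade places and y stays.\<close>
  have "F * x = w * F" unfolding F_def by (simp add: algebra_simps rules z)
  moreover have "F * y = y * F" unfolding F_def by (simp add: algebra_simps rules z)
  moreover have "F * w = x * F" unfolding F_def by (simp add: algebra_simps rules z)
  ultimately have comm: "\<exists>q. F * dot p = dot q * F" if "p \<in> {i, j, k}" for p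
    using that unfolding x_def y_def w_def by auto
  define s where "s = swp i"
  define r where "r = swp j"
  define n where "n = inv_op i j"
  define m where "m = inv_op j k"
  define l where "l = inv_op i k"
  note z' = z0[of a] z0[of b] z0[of e] z0[of s] z0[of r] z0[of n] z0[of m] z0[of l]
  let ?t = "s + \<zeta> * (a * n)" and ?u = "r + \<zeta> * (b * m)"
  have t: "zeq {i, j, k} t ?t" and u: "zeq {i, j, k} u ?u"
    unfolding T_def s_def r_def n_def m_def defs
    by (intro zeq_add zeq_mult zeq_sc zeq_cas zeq_swp zeq_dem; simp)+
  have "zeq {i, j, k} F (?t * ?u * ?t - ?u * ?t * ?u)"
    unfolding F_def using t u by (intro zeq_diff zeq_mult)
  moreover have "?t * ?u * ?t - ?u * ?t * ?u = 0"
  proof -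
    have sc: "s * a = a * s" "s * b = e * s" "s * e = b * s" "r * b = b * r" "r * a = e * r" "r * e = a * r"
      using twist_cas[OF swp_tok, of i i j] twist_cas[OF swp_tok, of i j k] twist_cas[OF swp_tok, of i i k]
        twist_cas[OF swp_tok, of j j k] twist_cas[OF swp_tok, of j i j] twist_cas[OF swp_tok, of j i k]
        cas_sym[of i j] cas_sym[of j k] unfolding s_def r_def defs by (simp_all add: transpose_def)
    have ss: "s * s = 1" "r * r = 1" unfolding s_def r_def by simp_all
    have braid: "r * (s * r) = s * (r * s)" using swp_braid[of i] unfolding s_def r_def defs by (simp add: mult.assoc)
    have sn: "s * n = s - n * s" "s * m = l * s" "s * l = m * s" "r * m = r - m * r" "r * n = l * r" "r * l = n * r"
      using swp_inv_op[of i i j] swp_inv_op[of i j k] swp_inv_op[of i i k] swp_inv_op[of j j k] swp_inv_op[of j i j]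
        swp_inv_op[of j i k] inv_op_flip[of i j] inv_op_flip[of j k]
      unfolding s_def r_def n_def m_def l_def defs by (simp_all add: transpose_def left_diff_distrib)
    have nn: "n * n = n" "m * m = m" "l * l = l" "m * n = n * m" "l * n = n * l" "l * m = m * l"
      unfolding n_def m_def l_def by (rule inv_op_idem inv_op_commute)+
    have nc: "n * a = a * n" "n * b = b * n" "n * e = e * n" "m * a = a * m" "m * b = b * m" "m * e = e * m"
      "l * a = a * l" "l * b = b * l" "l * e = e * l"
      unfolding n_def m_def l_def defs by (rule inv_op_cas)+
    \<comment> \<open>The order relation between three labels, oriented so that rewriting eliminates
      the product of m and l.\<close>
    have n3: "m * l = n * m + l - n * l"
      using inv_op_three(1)[of i j k] nn unfolding n_def m_def l_def defs by (simp add: right_diff_distrib add_diff_eq)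
    note rules = sc sn nn nc ss cc braid sc[THEN assocI, unfolded mult.assoc] cc3
      sn[THEN assocI, unfolded mult.assoc left_diff_distrib] nn[THEN assocI, unfolded mult.assoc]
      nc[THEN assocI, unfolded mult.assoc] ss[THEN assocI, unfolded mult_1_left mult.assoc]
      cc[THEN assocI, unfolded mult.assoc] braid[THEN assocI, unfolded mult.assoc] cc3[THEN assocI, unfolded mult.assoc]
    show ?thesis
      by (simp add: algebra_simps rules z' n3 n3[THEN assocI, unfolded mult.assoc left_diff_distrib distrib_right]) 
  qed
  ultimately have "F = 0" by (rule zeq_imp_eq[OF _ _ _ comm]) simp
  then show ?thesis unfolding F_def t_def u_def j_def by simp
qed

end

section \<open>Typing of the terms\<close>

context superalgebra
begin

lemma objects_simps [simp]:
  "[] \<in> objects" "(Black # i) \<in> objects \<longleftrightarrow> i \<in> objects"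
  "(Red Q # i) \<in> objects \<longleftrightarrow> Q \<in> E \<and> i \<in> objects"
  "i @ j \<in> objects \<longleftrightarrow> i \<in> objects \<and> j \<in> objects"
  by (auto simp: objects_def)

lemma objects_Cons: "(y # i) \<in> objects \<longleftrightarrow> [y] \<in> objects \<and> i \<in> objects"
  by (cases y) auto

end

text \<open>Source and target can be computed from the term, so \<open>arrow\<close> splits into two
  functions and the check \<open>wt\<close>, which are open to simplification.\<close>

fun dom_of :: "('a::zero, 'k) mor \<Rightarrow> 'a obj" and cod_of :: "('a, 'k) mor \<Rightarrow> 'a obj" where
  "dom_of (Ident i) = i" | "cod_of (Ident i) = i"
| "dom_of Tpos = [Black, Black]" | "cod_of Tpos = [Black, Black]"
| "dom_of Tneg = [Black, Black]" | "cod_of Tneg = [Black, Black]"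
| "dom_of (Token a) = [Black]" | "cod_of (Token a) = [Black]"
| "dom_of Dot = [Black]" | "cod_of Dot = [Black]"
| "dom_of DotInv = [Black]" | "cod_of DotInv = [Black]"
| "dom_of (Rho Q) = [Red Q, Black]" | "cod_of (Rho Q) = [Black, Red Q]"
| "dom_of (Lam Q) = [Black, Red Q]" | "cod_of (Lam Q) = [Red Q, Black]"
| "dom_of (f \<bullet> g) = dom_of g" | "cod_of (f \<bullet> g) = cod_of f"
| "dom_of (f \<boxtimes> g) = dom_of f @ dom_of g" | "cod_of (f \<boxtimes> g) = cod_of f @ cod_of g"
| "dom_of (Zero i j) = i" | "cod_of (Zero i j) = j"
| "dom_of (f \<boxplus> g) = dom_of f" | "cod_of (f \<boxplus> g) = cod_of f"
| "dom_of (Scale c f) = dom_of f" | "cod_of (Scale c f) = cod_of f"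

context LAH
begin

fun wt :: "('a, 'k) mor \<Rightarrow> bool" where
  "wt (Ident i) \<longleftrightarrow> i \<in> objects"
| "wt Tpos \<longleftrightarrow> True" | "wt Tneg \<longleftrightarrow> True" | "wt (Token a) \<longleftrightarrow> True" | "wt Dot \<longleftrightarrow> True" | "wt DotInv \<longleftrightarrow> True"
| "wt (Rho Q) \<longleftrightarrow> Q \<in> E" | "wt (Lam Q) \<longleftrightarrow> Q \<in> E"
| "wt (f \<bullet> g) \<longleftrightarrow> wt f \<and> wt g \<and> cod_of g = dom_of f"
| "wt (f \<boxtimes> g) \<longleftrightarrow> wt f \<and> wt g"
| "wt (Zero i j) \<longleftrightarrow> i \<in> objects \<and> j \<in> objects"
| "wt (f \<boxplus> g) \<longleftrightarrow> wt f \<and> wt g \<and> dom_of g = dom_of f \<and> cod_of g = cod_of f"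
| "wt (Scale c f) \<longleftrightarrow> wt f"

lemma arrow_iff: "arrow f i j \<longleftrightarrow> wt f \<and> dom_of f = i \<and> cod_of f = j"
proof
  show "arrow f i j \<Longrightarrow> wt f \<and> dom_of f = i \<and> cod_of f = j"
    by (induction rule: arrow.induct) auto
  have "wt f \<Longrightarrow> arrow f (dom_of f) (cod_of f)"
    by (induction f) (auto intro: arrow.intros)
  then show "wt f \<and> dom_of f = i \<and> cod_of f = j \<Longrightarrow> arrow f i j" by auto
qed

lemma wt_objects: "wt f \<Longrightarrow> dom_of f \<in> objects \<and> cod_of f \<in> objects"
  by (induction f) auto

text \<open>The order of summation is an unspecified choice. Properties of \<open>term_sum\<close>
  are therefore proved by induction for an arbitrary list of the elements.\<close>

lemma term_sum_cases:
  assumes "finite S"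
  obtains xs where "distinct xs" "set xs = S" "term_sum i j S t = foldr (\<lambda>x f. t x \<boxplus> f) xs (Zero i j)"
  using someI_ex[OF finite_distinct_list[OF assms, THEN exE[of _ "\<exists>xs. distinct xs \<and> set xs = S"]]]
  unfolding term_sum_def by blast

lemma dom_term_sum: assumes "finite S" "\<And>x. x \<in> S \<Longrightarrow> dom_of (t x) = i"
  shows "dom_of (term_sum i j S t) = i"
proof -
  obtain xs where xs: "set xs = S" "term_sum i j S t = foldr (\<lambda>x f. t x \<boxplus> f) xs (Zero i j)"
    using term_sum_cases[OF assms(1)] by metis
  have "set xs \<subseteq> S \<Longrightarrow> dom_of (foldr (\<lambda>x f. t x \<boxplus> f) xs (Zero i j)) = i"
    by (induction xs) (auto simp: assms)
  then show ?thesis using xs by simp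
qed

lemma cod_term_sum: assumes "finite S" "\<And>x. x \<in> S \<Longrightarrow> cod_of (t x) = j"
  shows "cod_of (term_sum i j S t) = j"
proof -
  obtain xs where xs: "set xs = S" "term_sum i j S t = foldr (\<lambda>x f. t x \<boxplus> f) xs (Zero i j)"
    using term_sum_cases[OF assms(1)] by metis
  have "set xs \<subseteq> S \<Longrightarrow> cod_of (foldr (\<lambda>x f. t x \<boxplus> f) xs (Zero i j)) = j"
    by (induction xs) (auto simp: assms)
  then show ?thesis using xs by simp
qed

lemma wt_term_sum:
  assumes "finite S" "i \<in> objects" "j \<in> objects"
    "\<And>x. x \<in> S \<Longrightarrow> wt (t x) \<and> dom_of (t x) = i \<and> cod_of (t x) = j"
  shows "wt (term_sum i j S t)"
proof -
  obtain xs where xs: "set xs = S" "term_sum i j S t = foldr (\<lambda>x f. t x \<boxplus> f) xs (Zero i j)"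
    using term_sum_cases[OF assms(1)] by metis
  have "set xs \<subseteq> S \<Longrightarrow> wt (foldr (\<lambda>x f. t x \<boxplus> f) xs (Zero i j)) \<and>
      dom_of (foldr (\<lambda>x f. t x \<boxplus> f) xs (Zero i j)) = i \<and> cod_of (foldr (\<lambda>x f. t x \<boxplus> f) xs (Zero i j)) = j"
    using assms by (induction xs) auto
  then show ?thesis using xs by simp
qed

lemma arrow_term_sum:
  "finite S \<Longrightarrow> i \<in> objects \<Longrightarrow> j \<in> objects \<Longrightarrow> (\<And>x. x \<in> S \<Longrightarrow> arrow (t x) i j) \<Longrightarrow> arrow (term_sum i j S t) i j"
  by (auto simp: arrow_iff intro!: wt_term_sum dom_term_sum cod_term_sum)

lemma term_power_Suc: "term_power i f (Suc n) = f \<bullet> term_power i f n"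
  by (simp add: term_power_def)

lemma term_power_0 [simp]: "term_power i f 0 = Ident i"
  by (simp add: term_power_def)

lemma arrow_term_power: "i \<in> objects \<Longrightarrow> arrow f i i \<Longrightarrow> arrow (term_power i f n) i i"
  by (induction n) (auto simp: term_power_Suc intro: arrow.intros)

lemma arrow_term_powi: "i \<in> objects \<Longrightarrow> arrow f i i \<Longrightarrow> arrow f' i i \<Longrightarrow> arrow (term_powi i f f' n) i i"
  by (auto simp: term_powi_def arrow_term_power)

lemma arrow_dot_powi: "arrow (dot_powi r) [Black] [Black]"
  unfolding dot_powi_def by (rule arrow_term_powi) (auto intro: arrow.intros)

lemma dot_powi_simps [simp]: "wt (dot_powi r)" "dom_of (dot_powi r :: ('a, 'k) mor) = [Black]" "cod_of (dot_powi r :: ('a, 'k) mor) = [Black]"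
  using arrow_dot_powi by (auto simp: arrow_iff)

lemma arrow_bracket: "arrow (bracket f) [Black] [Black]"
  unfolding bracket_def by (rule arrow_term_sum) (auto simp: arrow_iff)

lemma bracket_simps [simp]: "wt (bracket f)" "dom_of (bracket f :: ('a, 'k) mor) = [Black]" "cod_of (bracket f :: ('a, 'k) mor) = [Black]"
  using arrow_bracket by (auto simp: arrow_iff)

lemma arrow_bracket_red: "Q \<in> E \<Longrightarrow> arrow (bracket_red Q F) [Black, Red Q, Black] [Black, Red Q, Black]"
  unfolding bracket_red_def by (rule arrow_term_sum) (auto simp: arrow_iff)

lemma bracket_red_simps [simp]: "Q \<in> E \<Longrightarrow> wt (bracket_red Q F)"
  "Q \<in> E \<Longrightarrow> dom_of (bracket_red Q F) = [Black, Red Q, Black]"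
  "Q \<in> E \<Longrightarrow> cod_of (bracket_red Q F) = [Black, Red Q, Black]"
  using arrow_bracket_red by (auto simp: arrow_iff)

lemma def_rel_arrow: "def_rel i j f g \<Longrightarrow> arrow f i j \<and> arrow g i j"
  by (induction rule: def_rel.induct)
     (auto simp: arrow_iff B_finite intro!: wt_term_sum dom_term_sum cod_term_sum)

lemma eqv_arrow: "eqv i j f g \<Longrightarrow> arrow f i j \<and> arrow g i j"
proof (induction rule: eqv.induct)
  case (eqv_def_rel i j f g)
  then show ?case by (rule def_rel_arrow)
qed (auto simp: arrow_iff wt_objects)

end

section \<open>The action of the terms\<close>

definition dpow :: "nat \<Rightarrow> int \<Rightarrow> (st, 'k::comm_ring_1) lop" where
  "dpow k r = Lop (\<lambda>\<phi> (\<beta>, \<alpha>, v). \<phi> (\<beta>, \<alpha>(k := \<alpha> k + r), v))"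

lemma app_dpow: "app (dpow k r) \<phi> (\<beta>, \<alpha>, v) = \<phi> (\<beta>, \<alpha>(k := \<alpha> k + r), v)"
  unfolding dpow_def by (subst Lop_inverse) (auto simp: fun_eq_iff)

lemma dpow_0 [simp]: "dpow k 0 = 1"
  by (rule st_eqI) (simp add: app_dpow)

lemma dpow_add: "dpow k (r + s) = dpow k r * dpow k s"
  by (rule st_eqI) (simp add: app_dpow algebra_simps)

lemma dpow_commute: "dpow k r * dpow l s = dpow l s * dpow k r"
  by (rule st_eqI) (cases "k = l"; simp add: app_dpow fun_upd_twist algebra_simps)

section \<open>Additive extension to finitely supported functions\<close>

definition pmsum :: "('i \<Rightarrow> 'c::zero \<Rightarrow> 'b::comm_monoid_add) \<Rightarrow> ('i \<Rightarrow>\<^sub>0 'c) \<Rightarrow> 'b" where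
  "pmsum G f = (\<Sum>i\<in>keys f. G i (lookup f i))"

text \<open>Additivity of G forces \<open>G i 0 = 0\<close>, so the sum may run over any finite set
  containing the keys. This handles cancellation, where the keys of a sum are fewer than those of
  the summands.\<close>

locale pm_additive =
  fixes G :: "'i \<Rightarrow> 'c::ab_group_add \<Rightarrow> 'b::ab_group_add"
  assumes G_add: "G i (a + b) = G i a + G i b"
begin

lemma G_0 [simp]: "G i 0 = 0"
  using G_add[of i 0 0] by simp

lemma pmsum_superset: "finite K \<Longrightarrow> keys f \<subseteq> K \<Longrightarrow> pmsum G f = (\<Sum>i\<in>K. G i (lookup f i))"
  unfolding pmsum_def by (rule sum.mono_neutral_left) (auto simp: in_keys_iff)

lemma pmsum_add: "pmsum G (f + g) = pmsum G f + pmsum G g"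
proof -
  let ?K = "keys f \<union> keys g"
  have "pmsum G (f + g) = (\<Sum>i\<in>?K. G i (lookup (f + g) i))" "pmsum G f = (\<Sum>i\<in>?K. G i (lookup f i))"
    "pmsum G g = (\<Sum>i\<in>?K. G i (lookup g i))"
    using keys_add[of f g] by (auto intro!: pmsum_superset)
  then show ?thesis by (simp add: lookup_add G_add sum.distrib)
qed

lemma pmsum_zero [simp]: "pmsum G 0 = 0"
  by (simp add: pmsum_def)

lemma pmsum_sum: "pmsum G (\<Sum>a\<in>A. f a) = (\<Sum>a\<in>A. pmsum G (f a))"
  by (induction A rule: infinite_finite_induct) (auto simp: pmsum_add)

lemma pmsum_single [simp]: "pmsum G (single i c) = G i c"
  by (cases "c = 0") (simp_all add: pmsum_def)

end

lemma pm_expand: "(\<Sum>i\<in>keys f. single i (lookup f i)) = f"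
  by (rule poly_mapping_eqI)
    (auto simp: lookup_sum lookup_single when_def in_keys_iff if_distrib sum.delta' cong: if_cong intro!: sum.neutral)

definition klin :: "('i \<Rightarrow> (st, 'k::comm_ring_1) lop) \<Rightarrow> ('i \<Rightarrow>\<^sub>0 'k) \<Rightarrow> (st, 'k) lop" where
  "klin G = pmsum (\<lambda>i c. sc c * G i)"

lemma klin_additive:
  fixes G :: "'i \<Rightarrow> (st, 'k::comm_ring_1) lop"
  shows "pm_additive (\<lambda>i c. sc c * G i)"
  by unfold_locales (simp add: sc_add distrib_right)

lemmas klin_add = pm_additive.pmsum_add[OF klin_additive, folded klin_def]
lemmas klin_sum = pm_additive.pmsum_sum[OF klin_additive, folded klin_def]
lemmas klin_single [simp] = pm_additive.pmsum_single[OF klin_additive, folded klin_def]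
lemmas klin_superset = pm_additive.pmsum_superset[OF klin_additive, folded klin_def]
lemmas klin_zero [simp] = pm_additive.pmsum_zero[OF klin_additive, folded klin_def]

lemma klin_unfold: "klin G f = (\<Sum>i\<in>keys f. sc (lookup f i) * G i)"
  by (simp add: klin_def pmsum_def)

lemma klin_minus: "klin G (f - g) = klin G f - klin G g"
  using klin_add[of G "f - g" g] by (simp add: algebra_simps)

lemma klin_map: "klin G (Poly_Mapping.map ((*) c) f) = sc c * klin G f"
proof -
  have "keys (Poly_Mapping.map ((*) c) f) \<subseteq> keys f"
    by (auto simp: in_keys_iff Poly_Mapping.map.rep_eq)
  then have "klin G (Poly_Mapping.map ((*) c) f) =
      (\<Sum>i\<in>keys f. sc (lookup (Poly_Mapping.map ((*) c) f) i) * G i)"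
    by (intro klin_superset) auto
  also have "\<dots> = (\<Sum>i\<in>keys f. sc c * (sc (lookup f i) * G i))"
    by (rule sum.cong) (auto simp: Poly_Mapping.map.rep_eq in_keys_iff sc_mult simp flip: mult.assoc)
  finally show ?thesis by (simp add: klin_unfold sum_distrib_left)
qed

subsection \<open>Demazure quotients\<close>

text \<open>Multiplication by a Laurent polynomial, with X1 and X2 in the roles of the variables of
  strands m and m + 1.\<close>

definition \<chi> :: "nat \<Rightarrow> 'k::comm_ring_1 laurent2 \<Rightarrow> (st, 'k) lop" where
  "\<chi> m = klin (\<lambda>(r, s). dpow m r * dpow (Suc m) s)"

lemma \<chi>_add: "\<chi> m (p + q) = \<chi> m p + \<chi> m q" and \<chi>_minus: "\<chi> m (p - q) = \<chi> m p - \<chi> m q"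
  and \<chi>_single: "\<chi> m (single (r, s) c) = sc c * (dpow m r * dpow (Suc m) s)"
  by (simp_all add: \<chi>_def klin_add klin_minus)

lemma \<chi>_mult_single:
  fixes p :: "'k::comm_ring_1 laurent2"
  shows "\<chi> m (p * single (r, s) 1) = \<chi> m p * (dpow m r * dpow (Suc m) s)"
proof -
  have "p * single (r, s) 1 = (\<Sum>i\<in>keys p. single (i + (r, s)) (lookup p i))"
    by (subst pm_expand[of p, symmetric]) (simp only: sum_distrib_right mult_single mult_1_right)
  moreover have "\<chi> m (single (i + (r, s)) c) = \<chi> m (single i c) * (dpow m r * dpow (Suc m) s)" for i and c :: 'k
  proof (cases i)
    case (Pair r' s')
    have "dpow m r' * dpow m r * (dpow (Suc m) s' * dpow (Suc m) s) =
        dpow m r' * dpow (Suc m) s' * (dpow m r * dpow (Suc m) s :: (st, 'k) lop)"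
      using dpow_commute[of m r "Suc m" s'] by (metis (no_types, lifting) mult.assoc)
    then show ?thesis by (simp add: Pair \<chi>_single dpow_add mult.assoc)
  qed
  ultimately have "\<chi> m (p * single (r, s) 1) = (\<Sum>i\<in>keys p. \<chi> m (single i (lookup p i))) * (dpow m r * dpow (Suc m) s)"
    by (simp add: \<chi>_def klin_sum sum_distrib_right)
  also have "(\<Sum>i\<in>keys p. \<chi> m (single i (lookup p i))) = \<chi> m p"
    unfolding \<chi>_def klin_sum[symmetric] pm_expand ..
  finally show ?thesis .
qed

lemma lookup_mult_single: "lookup (p * single i c) (j + i) = lookup p j * (c :: 'c::ring_1)"
  for i :: "'i::ab_group_add"
proof -
  have "p * single i c = (\<Sum>k\<in>keys p. single (k + i) (lookup p k * c))"
    by (subst pm_expand[of p, symmetric]) (simp only: sum_distrib_right mult_single)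
  also have "lookup \<dots> (j + i) = (\<Sum>k\<in>keys p. if k = j then lookup p k * c else 0)"
    by (auto simp: lookup_sum lookup_single when_def intro!: sum.cong)
  also have "\<dots> = lookup p j * c" by (auto simp: in_keys_iff)
  finally show ?thesis .
qed

text \<open>If X1 g = X2 g, the coefficients of g are constant along each antidiagonal of the
  exponent lattice; a nonzero coefficient would then give infinitely many.\<close>

lemma X1_minus_X2_cancel: assumes "(X1 - X2) * h = (X1 - X2) * h'" shows "h = h'"
proof (rule ccontr)
  let ?g = "h - h'"
  assume "h \<noteq> h'"
  then obtain r s where rs: "lookup ?g (r, s) \<noteq> 0"
    by (metis eq_iff_diff_eq_0 poly_mapping_eqI lookup_zero surj_pair)
  have g: "?g * X1 = ?g * X2" using assms by (simp add: algebra_simps)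
  have step: "lookup ?g (a, b) = lookup ?g (a + 1, b - 1)" for a b
    using lookup_mult_single[of ?g "(1, 0)" 1 "(a, b)"] lookup_mult_single[of ?g "(0, 1)" 1 "(a + 1, b - 1)"] g
    by (simp add: X1_def X2_def)
  have "lookup ?g (r + int n, s - int n) = lookup ?g (r, s)" for n
    by (induction n) (simp_all add: step[of "r + int n" "s - int n" for n] algebra_simps)
  then have "range (\<lambda>n. (r + int n, s - int n)) \<subseteq> keys ?g" using rs by (auto simp: in_keys_iff)
  moreover have "inj (\<lambda>n. (r + int n, s - int n))" by (auto intro: injI)
  ultimately show False by (meson finite_keys finite_subset range_inj_infinite)
qed

lemma swap_vars_single [simp]: "swap_vars (single (r, s) c) = single (s, r) c"
  unfolding swap_vars_def using map_key_single[of prod.swap "(s, r)" c] by simp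

text \<open>Induction on r in both directions. The witnesses come from the Leibniz rule D(X1^(i+1))
  = X1 D(X1^i) - X2^(i+1), solved for D(X1^i) in the downward step.\<close>

lemma demazure_exists: "\<exists>h. (X1 - X2) * h = X2 * (single (0, r) 1 - single (r, 0) (1 :: 'k::comm_ring_1))"
proof (induction r rule: int_induct[where k = 0])
  case base
  then show ?case by (intro exI[of _ 0]) simp
next
  case (step1 i)
  then obtain h where h: "(X1 - X2) * h = X2 * (single (0, i) 1 - single (i, 0) (1 :: 'k))" by blast
  have "(X1 - X2) * (X1 * h - single (0, i + 1) 1) = X1 * ((X1 - X2) * h) - (X1 - X2) * single (0, i + 1) 1"
    by (simp add: algebra_simps)
  also have "\<dots> = X2 * (single (0, i + 1) 1 - single (i + 1, 0) 1)"
    unfolding h by (simp add: X1_def X2_def algebra_simps mult_single)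
  finally show ?case by blast
next
  case (step2 i)
  then obtain h where h: "(X1 - X2) * h = X2 * (single (0, i) 1 - single (i, 0) (1 :: 'k))" by blast
  have "(X1 - X2) * (single (-1, 0) 1 * (h + single (0, i) 1)) =
      single (-1, 0) 1 * ((X1 - X2) * h + (X1 - X2) * single (0, i) 1)"
    by (simp add: algebra_simps)
  also have "\<dots> = X2 * (single (0, i - 1) 1 - single (i - 1, 0) 1)"
    unfolding h by (simp add: X1_def X2_def algebra_simps mult_single)
  finally show ?case by blast
qed

lemma demazure_eq: "(X1 - X2) * demazure (single (r, 0) c) = X2 * (single (0, r) c - single (r, 0) (c :: 'k::comm_ring_1))"
proof -
  obtain h where h: "(X1 - X2) * h = X2 * (single (0, r) 1 - single (r, 0) (1 :: 'k))"
    using demazure_exists by blast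
  have "(X1 - X2) * (single (0, 0) c * h) = single (0, 0) c * ((X1 - X2) * h)"
    by (simp add: algebra_simps)
  also have "\<dots> = X2 * (single (0, r) c - single (r, 0) c)"
    unfolding h by (simp add: algebra_simps mult_single)
  finally have "\<exists>!h. (X1 - X2) * h = X2 * (single (0, r) c - single (r, 0) c)"
    using X1_minus_X2_cancel by metis
  then show ?thesis unfolding demazure_def swap_vars_single by (rule theI')
qed

text \<open>Powers of X1 suffice: \<open>Delta1\<close> is applied to \<open>P2_first Q\<close>, and
  for powers of X2 the quotient is the negative.\<close>

abbreviation dmz :: "int \<Rightarrow> 'k::comm_ring_1 laurent2" where "dmz r \<equiv> demazure (single (r, 0) 1)"

lemma demazure_scale: "demazure (single (r, 0) c) = single (0, 0) c * dmz r"
proof (rule X1_minus_X2_cancel)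
  have "(X1 - X2) * (single (0, 0) c * dmz r) = single (0, 0) c * ((X1 - X2) * dmz r)"
    by (simp add: algebra_simps)
  then show "(X1 - X2) * demazure (single (r, 0) c) = (X1 - X2) * (single (0, 0) c * dmz r)"
    unfolding demazure_eq by (simp add: algebra_simps mult_single)
qed

lemma dmz_0 [simp]: "dmz 0 = 0"
  by (rule X1_minus_X2_cancel) (simp add: demazure_eq)

text \<open>The Leibniz rule with the factor X1 split off. \<open>dmz_Suc'\<close> splits off X2
  instead; the two forms match the movement of the dots on strands m and m + 1 through
  \<open>T m\<close>.\<close>

lemma dmz_Suc: "dmz (r + 1) = (dmz r * single (1, 0) 1 - single (0, r + 1) 1 :: 'k::comm_ring_1 laurent2)"
proof (rule X1_minus_X2_cancel)
  have "(X1 - X2 :: 'k laurent2) * (dmz r * single (1, 0) 1 - single (0, r + 1) 1) =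
      single (1, 0) 1 * ((X1 - X2) * dmz r) - (X1 - X2) * single (0, r + 1) 1"
    by (simp add: algebra_simps)
  then show "(X1 - X2 :: 'k laurent2) * dmz (r + 1) = (X1 - X2) * (dmz r * single (1, 0) 1 - single (0, r + 1) 1)"
    unfolding demazure_eq by (simp add: X1_def X2_def algebra_simps mult_single)
qed

lemma dmz_Suc': "dmz (r + 1) = (dmz r * single (0, 1) 1 - single (r, 1) 1 :: 'k::comm_ring_1 laurent2)"
proof (rule X1_minus_X2_cancel)
  have "(X1 - X2 :: 'k laurent2) * (dmz r * single (0, 1) 1 - single (r, 1) 1) =
      single (0, 1) 1 * ((X1 - X2) * dmz r) - (X1 - X2) * single (r, 1) 1"
    by (simp add: algebra_simps)
  then show "(X1 - X2 :: 'k laurent2) * dmz (r + 1) = (X1 - X2) * (dmz r * single (0, 1) 1 - single (r, 1) 1)"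
    unfolding demazure_eq by (simp add: X1_def X2_def algebra_simps mult_single)
qed

context symmetric_frobenius_superalgebra
begin

lemma dpow_1: "dpow k 1 = dot k" and dpow_minus_1: "dpow k (- 1) = dotinv k"
  by (rule st_eqI, simp add: app_dpow app_dot app_dotinv)+

lemma dpow_tok: "dpow k r * tok l a = tok l a * dpow k r"
  by (rule st_eqI) (simp add: app_tok app_dpow)

lemma dpow_cas: "dpow k r * cas p q = cas p q * dpow k r"
  using twist_cas[of "dpow k r" id p q] dpow_tok by simp

definition pol :: "nat \<Rightarrow> 'a P1 \<Rightarrow> (st, 'k) lop" where
  "pol m = pmsum (\<lambda>r a. tok m a * dpow m r)"

end

context LAH
begin

text \<open>Meant for R the difference of two sides of an identity in which r is an exponent. Since
  dots are invertible, the recursion can also be followed downwards, to negative r.\<close>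

lemma dpow_ind:
  fixes R :: "int \<Rightarrow> (st, 'k) lop"
  assumes "R 0 = 0" and step: "\<And>r. R (r + 1) = R r * dot k"
  shows "R r = 0"
proof -
  have iff: "R r = 0 \<longleftrightarrow> R (r + 1) = 0" for r
  proof
    assume "R (r + 1) = 0"
    then have "R r * dot k * dotinv k = 0" by (simp add: step)
    then show "R r = 0" by (simp add: mult.assoc)
  qed (simp add: step)
  show ?thesis
  proof (induction r rule: int_induct[where k = 0])
    case (step2 i)
    then show ?case using iff[of "i - 1"] by simp
  qed (use assms(1) iff in auto)
qed

text \<open>Both sides satisfy the same recursion in r: on the left by the rule for one dot, on the
  right by the Leibniz rule for \<open>dmz\<close>.\<close>

lemma T_dpow_left: "T m * dpow m r = dpow (Suc m) r * T m + sc z * (cas m (Suc m) * \<chi> m (dmz r))"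
proof -
  let ?c = "cas m (Suc m)"
  define R where "R r = T m * dpow m r - dpow (Suc m) r * T m - sc z * (?c * \<chi> m (dmz r))" for r
  have "R (r + 1) = R r * dot m" for r
  proof -
    have a: "\<chi> m (dmz (r + 1)) = \<chi> m (dmz r) * dot m - dpow (Suc m) (r + 1)"
      unfolding dmz_Suc \<chi>_minus \<chi>_mult_single by (simp add: \<chi>_single dpow_1)
    have b: "dpow (Suc m) r * T m * dot m = dpow (Suc m) (r + 1) * T m - sc z * (?c * dpow (Suc m) (r + 1))"
      unfolding mult.assoc T_dot_left right_diff_distrib dpow_add dpow_1 sc_left_commute
      by (simp flip: mult.assoc add: dpow_cas)
    show ?thesis
      unfolding R_def left_diff_distrib b a by (simp add: right_diff_distrib dpow_add dpow_1 mult.assoc)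
  qed
  from dpow_ind[of R m, OF _ this] have "R r = 0" by (simp add: R_def \<chi>_def)
  then show ?thesis unfolding R_def by (simp add: algebra_simps)
qed

lemma T_dpow_right: "T m * dpow (Suc m) r = dpow m r * T m - sc z * (cas m (Suc m) * \<chi> m (dmz r))"
proof -
  let ?c = "cas m (Suc m)"
  define R where "R r = T m * dpow (Suc m) r - dpow m r * T m + sc z * (?c * \<chi> m (dmz r))" for r
  have "R (r + 1) = R r * dot (Suc m)" for r
  proof -
    have a: "\<chi> m (dmz (r + 1)) = \<chi> m (dmz r) * dot (Suc m) - dpow m r * dot (Suc m)"
      unfolding dmz_Suc' \<chi>_minus \<chi>_mult_single by (simp add: \<chi>_single dpow_1)
    have b: "dpow m r * T m * dot (Suc m) = dpow m (r + 1) * T m + sc z * (?c * (dpow m r * dot (Suc m)))"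
      unfolding mult.assoc T_dot_right distrib_left dpow_add dpow_1 sc_left_commute
      by (simp flip: mult.assoc add: dpow_cas)
    show ?thesis
      unfolding R_def left_diff_distrib distrib_right b a by (simp add: right_diff_distrib dpow_add dpow_1 mult.assoc)
  qed
  from dpow_ind[of R "Suc m", OF _ this] have "R r = 0" by (simp add: R_def \<chi>_def)
  then show ?thesis unfolding R_def by (simp add: algebra_simps)
qed

end

context symmetric_frobenius_superalgebra
begin

lemmas op_sc = sc_left_commute[of "tok k a" for k a] sc_left_commute[of "cas p q" for p q]
  sc_left_commute[of "dpow k r" for k r] sc_left_commute[of "\<chi> k r" for k r] sc_left_commute[of "pol k r" for k r]

subsection \<open>Even central coefficients\<close>

lemma E_coeff_even: "Q \<in> E \<Longrightarrow> lookup Q r \<in> gr 0"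
  by (simp add: E_def P1_center_def P1_gr_def)

text \<open>Centrality of Q is tested on constants; there is no sign as Q is even.\<close>

lemma E_coeff_central: assumes Q: "Q \<in> E" shows "lookup Q r * a = a * lookup Q r"
proof -
  have hom: "lookup Q r * x = x * lookup Q r" if x: "x \<in> gr q" for x q
  proof -
    have "single 0 x \<in> P1_gr q" using x by (auto simp: P1_gr_def lookup_single when_def)
    then have *: "Q * single 0 x = single 0 x * Q" using Q by (auto simp: E_def P1_center_def)
    have "single 0 x * Q = (\<Sum>k\<in>keys Q. single k (x * lookup Q k))"
      by (subst pm_expand[of Q, symmetric]) (simp add: sum_distrib_left mult_single)
    then have "lookup (single 0 x * Q) r = (\<Sum>k\<in>keys Q. if k = r then x * lookup Q k else 0)"
      by (auto simp: lookup_sum lookup_single when_def intro!: sum.cong)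
    also have "\<dots> = x * lookup Q r" by (auto simp: in_keys_iff)
    finally show ?thesis using * lookup_mult_single[of Q 0 x r] by simp
  qed
  obtain x y where "x \<in> gr 0" "y \<in> gr 1" "a = x + y" by (rule gr_cases)
  then show ?thesis using hom by (simp add: distrib_left distrib_right)
qed

lemma tok_even_commute:
  assumes "x \<in> gr 0" "\<And>a. x * a = a * x" shows "tok k x * tok l a = tok l a * tok k x"
proof (cases "k = l")
  case False
  obtain y y' where y: "y \<in> gr 0" "y' \<in> gr 1" "a = y + y'" by (rule gr_cases)
  then show ?thesis
    using tok_commute[OF False assms(1)] by (simp add: tok_add distrib_left distrib_right)
qed (simp add: tok_mult assms(2))

lemma pol_unfold: "pol m Q = (\<Sum>r\<in>keys Q. tok m (lookup Q r) * dpow m r)"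
  by (simp add: pol_def pmsum_def)

lemma pol_tok: assumes "Q \<in> E" shows "pol m Q * tok l a = tok l a * pol m Q"
proof -
  have "tok m (lookup Q r) * dpow m r * tok l a = tok l a * (tok m (lookup Q r) * dpow m r)" for r
    using tok_even_commute[OF E_coeff_even E_coeff_central, OF assms assms]
    by (simp add: mult.assoc dpow_tok) (simp flip: mult.assoc)
  then show ?thesis by (simp add: pol_unfold sum_distrib_left sum_distrib_right)
qed

lemma pol_dpow: "pol m Q * dpow k s = dpow k s * pol m Q"
proof -
  have "tok m a * dpow m r * dpow k s = dpow k s * (tok m a * dpow m r)" for a r
    by (simp add: mult.assoc dpow_commute[of m r]) (simp flip: mult.assoc add: dpow_tok)
  then show ?thesis by (simp add: pol_unfold sum_distrib_left sum_distrib_right)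
qed

lemma pol_dot: "pol m Q * dot k = dot k * pol m Q" and pol_dotinv: "pol m Q * dotinv k = dotinv k * pol m Q"
  using pol_dpow[of m Q k 1] pol_dpow[of m Q k "- 1"] by (simp_all add: dpow_1 dpow_minus_1)

lemma pol_cas: "Q \<in> E \<Longrightarrow> pol m Q * cas p q = cas p q * pol m Q"
  using twist_cas[of "pol m Q" id p q] pol_tok by simp

lemma pol_\<chi>: "pol m Q * \<chi> k p = \<chi> k p * pol m Q"
proof -
  have "pol m Q * (sc c * (dpow k r * dpow (Suc k) s)) = sc c * (dpow k r * dpow (Suc k) s) * pol m Q" for c r s
    using twisted_mult[OF pol_dpow pol_dpow, of m Q k r "Suc k" s] by (simp add: op_sc mult.assoc)
  then show ?thesis by (auto simp: \<chi>_def klin_unfold sum_distrib_left sum_distrib_right intro!: sum.cong)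
qed

lemma pol_pol: assumes "Q' \<in> E" shows "pol m Q * pol k Q' = pol k Q' * pol m Q"
proof -
  have "pol k Q' * (tok m a * dpow m r) = tok m a * dpow m r * pol k Q'" for a r
    by (rule twisted_mult[OF pol_tok[OF assms] pol_dpow])
  then show ?thesis by (simp add: pol_unfold[of m] sum_distrib_left sum_distrib_right)
qed

subsection \<open>Terms with tokens and dots only\<close>

text \<open>\<open>\<Phi> m\<close> and \<open>\<Psi> m\<close> let the tensor square of A and the
  algebra P_2(A), both given by coordinates, act on the strands m and m + 1.\<close>

definition \<Phi> :: "nat \<Rightarrow> ('a, 'k) A2 \<Rightarrow> (st, 'k) lop" where
  "\<Phi> m = klin (\<lambda>(b, c). tok m b * tok (Suc m) c)"

definition \<Psi> :: "nat \<Rightarrow> ('a, 'k) P2 \<Rightarrow> (st, 'k) lop" where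
  "\<Psi> m = klin (\<lambda>(b, c, r, s). tok m b * tok (Suc m) c * (dpow m r * dpow (Suc m) s))"

lemma \<Phi>_tens: "\<Phi> m (tens x y) = tok m x * tok (Suc m) y"
proof -
  have t: "tok k x = (\<Sum>b\<in>B. sc (rep x b) * tok k b)" for k x
    by (subst rep_expand[of x, symmetric]) (simp add: tok_sum tok_scale)
  have "\<Phi> m (tens x y) = (\<Sum>b\<in>B. \<Sum>c\<in>B. sc (rep x b) * (sc (rep y c) * (tok m b * tok (Suc m) c)))"
    by (simp add: \<Phi>_def tens_def klin_sum mult.assoc flip: sc_mult)
  also have "\<dots> = tok m x * tok (Suc m) y"
    unfolding t[of m x] t[of "Suc m" y] by (simp add: sum_product op_sc mult.assoc)
  finally show ?thesis .
qed

lemma keys_sum_subset: "(\<And>a. a \<in> A \<Longrightarrow> keys (f a) \<subseteq> K) \<Longrightarrow> keys (sum f A) \<subseteq> K"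
  by (induction A rule: infinite_finite_induct) (auto dest: set_mp[OF keys_add])

lemma keys_tens: "keys (tens x y) \<subseteq> B \<times> B"
  unfolding tens_def by (intro keys_sum_subset) (auto split: if_splits)

lemma keys_A2_mult: "keys (A2_mult u v) \<subseteq> B \<times> B"
proof -
  have "keys (Poly_Mapping.map ((*) c) (tens x y)) \<subseteq> B \<times> B" for c x y
    using keys_tens[of x y] by (auto simp: in_keys_iff Poly_Mapping.map.rep_eq)
  then show ?thesis unfolding A2_mult_def case_prod_unfold by (intro keys_sum_subset)
qed

text \<open>The sign in \<open>A2_mult\<close> is the one for exchanging tokens on two strands. The
  keys have to lie in \<open>B\<close> because it is defined through \<open>parity\<close>, which is
  meaningful for nonzero homogeneous elements.\<close>

lemma \<Phi>_mult: assumes "keys u \<subseteq> B \<times> B" "keys v \<subseteq> B \<times> B"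
  shows "\<Phi> m (A2_mult u v) = \<Phi> m u * \<Phi> m v"
proof -
  have eq: "tok m (b * b') * tok (Suc m) (c * c') =
      sc (koszul (parity c) (parity b')) * (tok m b * (tok (Suc m) c * (tok m b' * tok (Suc m) c')))"
    if "c \<in> B" "b' \<in> B" for b b' c c'
  proof -
    have "tok (Suc m) c * tok m b' = koszul (parity c) (parity b') * (tok m b' * tok (Suc m) c)"
      by (rule tok_commute) (use that parity_mem in auto)
    then have "tok m b * tok (Suc m) c * (tok m b' * tok (Suc m) c') =
        koszul (parity c) (parity b') * (tok m b * (tok m b' * tok (Suc m) c * tok (Suc m) c'))"
      by (simp add: koszul_def mult.assoc flip: mult.assoc[of "tok (Suc m) c"])
    then show ?thesis by (simp add: tok_mult[symmetric] mult.assoc sc_koszul)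
  qed
  have summand: "sc (koszul (parity c) (parity b') * x * y) * (tok m (b * b') * tok (Suc m) (c * c')) =
      sc x * (tok m b * tok (Suc m) c) * (sc y * (tok m b' * tok (Suc m) c'))"
    if "c \<in> B" "b' \<in> B" for b b' c c' x y
  proof -
    let ?\<kappa> = "koszul (parity c) (parity b') :: 'k"
    have "sc (?\<kappa> * x * y) * (sc ?\<kappa> * F) = sc x * (sc y * F)" for F :: "(st, 'k) lop"
      by (simp add: sc_mult ac_simps flip: mult.assoc[of "sc _"])
    then show ?thesis unfolding eq[OF that] by (simp add: op_sc mult.assoc)
  qed
  have "\<Phi> m (A2_mult u v) = (\<Sum>(b, c)\<in>keys u. \<Sum>(b', c')\<in>keys v.
      sc (koszul (parity c) (parity b') * lookup u (b, c) * lookup v (b', c')) *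
      (tok m (b * b') * tok (Suc m) (c * c')))"
    unfolding A2_mult_def \<Phi>_def klin_sum case_prod_unfold klin_map \<Phi>_tens[unfolded \<Phi>_def case_prod_unfold] ..
  also have "\<dots> = (\<Sum>(b, c)\<in>keys u. \<Sum>(b', c')\<in>keys v.
      sc (lookup u (b, c)) * (tok m b * tok (Suc m) c) * (sc (lookup v (b', c')) * (tok m b' * tok (Suc m) c')))"
    unfolding case_prod_unfold using assms by (intro sum.cong refl summand) auto
  also have "\<dots> = \<Phi> m u * \<Phi> m v"
    unfolding \<Phi>_def klin_unfold sum_product case_prod_unfold by simp
  finally show ?thesis .
qed

lemma \<Phi>_t12: "\<Phi> m t12 = cas m (Suc m)"
  unfolding t12_def \<Phi>_def klin_sum
  by (simp add: \<Phi>_def[symmetric] \<Phi>_mult keys_tens \<Phi>_tens cas_def)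

lemma keys_t12: "keys t12 \<subseteq> B \<times> B"
  unfolding t12_def by (intro keys_sum_subset keys_A2_mult)

lemma \<Psi>_P2_of: "\<Psi> m (P2_of u p) = \<Phi> m u * \<chi> m p"
proof -
  have "\<Psi> m (P2_of u p) = (\<Sum>(b, c)\<in>keys u. \<Sum>(r, s)\<in>keys p.
      sc (lookup u (b, c)) * (tok m b * tok (Suc m) c) * (sc (lookup p (r, s)) * (dpow m r * dpow (Suc m) s)))"
    unfolding P2_of_def \<Psi>_def klin_sum case_prod_unfold
    by (simp add: mult.assoc op_sc flip: sc_mult)
  then show ?thesis unfolding \<Phi>_def \<chi>_def klin_unfold sum_product case_prod_unfold by simp
qed

text \<open>\<open>P2_first Q\<close> contains powers of X1 only, so the Demazure quotients are the
  \<open>dmz r\<close>. The coefficients of Q are even and central and can be moved to the front,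
  past the Casimir element.\<close>

lemma \<Psi>_Delta1: assumes "Q \<in> E"
  shows "\<Psi> m (Delta1 (P2_first Q)) = (\<Sum>r\<in>keys Q. tok m (lookup Q r) * (cas m (Suc m) * \<chi> m (dmz r)))"
proof -
  let ?F = "P2_first Q"
  define G where "G = (\<lambda>(b, c, r, s :: int). cas m (Suc m) * (tok m b * tok (Suc m) c) * \<chi> m (dmz r))"
  have keys: "b \<in> B \<and> c \<in> B \<and> s = 0" if "(b, c, r, s) \<in> keys ?F" for b c r s
  proof -
    have "keys ?F \<subseteq> {(b, c, r, s). b \<in> B \<and> c \<in> B \<and> s = 0}"
      unfolding P2_first_def P2_of_def by (intro keys_sum_subset) (auto split: if_splits dest!: set_mp[OF keys_tens])
    then show ?thesis using that by auto
  qed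
  have "\<Psi> m (Delta1 ?F) = (\<Sum>(b, c, r, s)\<in>keys ?F. \<Phi> m (A2_mult t12 (tens b c)) *
      \<chi> m (demazure (single (r, s) (lookup ?F (b, c, r, s)))))"
    unfolding Delta1_def \<Psi>_def klin_sum case_prod_unfold \<Psi>_P2_of[unfolded \<Psi>_def case_prod_unfold] ..
  also have "\<dots> = klin G ?F"
    unfolding klin_unfold
  proof (intro sum.cong refl)
    fix x assume x: "x \<in> keys ?F"
    obtain b c r s where [simp]: "x = (b, c, r, s)" by (cases x)
    have [simp]: "s = 0" using keys x by simp
    have "\<chi> m (single (0, 0) d * p) = sc d * \<chi> m p" for d :: 'k and p
    proof -
      have "single (0, 0) d * p = Poly_Mapping.map ((*) d) p"
        using mult_map_scale_conv_mult[of d p] by (simp add: zero_prod_def)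
      then show ?thesis by (simp add: \<chi>_def klin_map)
    qed
    then show "(case x of (b, c, r, s) \<Rightarrow> \<Phi> m (A2_mult t12 (tens b c)) * \<chi> m (demazure (single (r, s) (lookup ?F (b, c, r, s))))) =
        sc (lookup ?F x) * G x"
      by (simp add: G_def \<Phi>_mult keys_t12 keys_tens \<Phi>_t12 \<Phi>_tens demazure_scale[of r "lookup ?F (b, c, r, 0)"] op_sc mult.assoc)
  qed
  also have "\<dots> = (\<Sum>r\<in>keys Q. klin G (P2_of (tens (lookup Q r) 1) (single (r, 0) 1)))"
    unfolding P2_first_def klin_sum ..
  also have "\<dots> = (\<Sum>r\<in>keys Q. tok m (lookup Q r) * (cas m (Suc m) * \<chi> m (dmz r)))"
  proof (rule sum.cong[OF refl])
    fix r
    let ?u = "tens (lookup Q r) 1"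
    have "klin G (P2_of ?u (single (r, 0) 1)) = (\<Sum>(b, c)\<in>keys ?u. sc (lookup ?u (b, c)) *
        (cas m (Suc m) * (tok m b * tok (Suc m) c) * \<chi> m (dmz r)))"
      unfolding P2_of_def klin_sum case_prod_unfold by (simp add: G_def)
    also have "\<dots> = cas m (Suc m) * \<Phi> m ?u * \<chi> m (dmz r)"
      unfolding \<Phi>_def klin_unfold sum_distrib_left sum_distrib_right
      by (auto simp: mult.assoc op_sc intro!: sum.cong)
    also have "cas m (Suc m) * \<Phi> m ?u = tok m (lookup Q r) * cas m (Suc m)"
      using twist_cas[of "tok m (lookup Q r)" id m "Suc m"]
        tok_even_commute[OF E_coeff_even[OF assms] E_coeff_central[OF assms], of m r]
      by (simp add: \<Phi>_tens)
    finally show "klin G (P2_of ?u (single (r, 0) 1)) = tok m (lookup Q r) * (cas m (Suc m) * \<chi> m (dmz r))"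
      by (simp add: mult.assoc)
  qed
  finally show ?thesis .
qed

end

context LAH
begin

text \<open>This is the relation \<open>red_braid\<close> once \<open>Rho Q\<close> acts by Q and
  \<open>Lam Q\<close> by 1.\<close>

lemma T_pol_right: assumes "Q \<in> E"
  shows "T m * pol (Suc m) Q = pol m Q * T m - sc z * \<Psi> m (Delta1 (P2_first Q))"
proof -
  have "T m * (tok (Suc m) a * dpow (Suc m) r) =
      tok m a * dpow m r * T m - sc z * (tok m a * (cas m (Suc m) * \<chi> m (dmz r)))" for a r
  proof -
    have "T m * (tok (Suc m) a * dpow (Suc m) r) = tok m a * (T m * dpow (Suc m) r)"
      using T_tok[of m "Suc m" a] by (simp flip: mult.assoc)
    then show ?thesis by (simp add: T_dpow_right right_diff_distrib mult.assoc op_sc)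
  qed
  then show ?thesis
    by (simp add: \<Psi>_Delta1[OF assms] pol_unfold sum_distrib_left sum_distrib_right sum_subtractf)
qed

lemma T_pol_left: assumes "Q \<in> E"
  shows "T m * pol m Q = pol (Suc m) Q * T m + sc z * \<Psi> m (Delta1 (P2_first Q))"
proof -
  have c: "tok (Suc m) (lookup Q r) * cas m (Suc m) = tok m (lookup Q r) * cas m (Suc m)" for r
    using cas_tok_first[of m "Suc m" "lookup Q r"] twist_cas[of "tok m (lookup Q r)" id m "Suc m"]
        tok_even_commute[OF E_coeff_even[OF assms] E_coeff_central[OF assms], of m r] by simp
  have "T m * (tok m (lookup Q r) * dpow m r) =
      tok (Suc m) (lookup Q r) * dpow (Suc m) r * T m + sc z * (tok m (lookup Q r) * (cas m (Suc m) * \<chi> m (dmz r)))" for r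
  proof -
    have "T m * (tok m (lookup Q r) * dpow m r) = tok (Suc m) (lookup Q r) * (T m * dpow m r)"
      using T_tok[of m m "lookup Q r"] by (simp flip: mult.assoc)
    also have "\<dots> = tok (Suc m) (lookup Q r) * dpow (Suc m) r * T m +
        sc z * (tok (Suc m) (lookup Q r) * cas m (Suc m) * \<chi> m (dmz r))"
      by (simp add: T_dpow_left distrib_left mult.assoc op_sc)
    finally show ?thesis unfolding c by (simp add: mult.assoc)
  qed
  then show ?thesis
    by (simp add: \<Psi>_Delta1[OF assms] pol_unfold sum_distrib_left sum_distrib_right sum.distrib)
qed

lemma \<Psi>_Delta1_pol: assumes "Q \<in> E"
  shows "\<Psi> m (Delta1 (P2_first Q)) * pol k Q = pol k Q * \<Psi> m (Delta1 (P2_first Q))"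
proof -
  have "pol k Q * (tok m a * (cas m (Suc m) * \<chi> m p)) = tok m a * (cas m (Suc m) * \<chi> m p) * pol k Q" for a p
    by (intro twisted_mult[OF pol_tok[OF assms] twisted_mult[OF pol_cas[OF assms] pol_\<chi>]])
  then show ?thesis by (simp add: \<Psi>_Delta1[OF assms] sum_distrib_left sum_distrib_right)
qed

text \<open>The corrections from the two factors have opposite signs and cancel. This is the
  relation \<open>cross_rho\<close>, where each \<open>Rho Q\<close> acts by Q.\<close>

lemma T_pol_pol: assumes "Q \<in> E" shows "T m * (pol (Suc m) Q * pol m Q) = pol (Suc m) Q * pol m Q * T m"
proof -
  let ?D = "\<Psi> m (Delta1 (P2_first Q))"
  have "T m * (pol (Suc m) Q * pol m Q) = (pol m Q * T m - sc z * ?D) * pol m Q"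
    unfolding T_pol_right[OF assms, symmetric] by (simp add: mult.assoc)
  also have "\<dots> = pol m Q * (pol (Suc m) Q * T m + sc z * ?D) - sc z * ?D * pol m Q"
    unfolding T_pol_left[OF assms, symmetric] by (simp add: left_diff_distrib mult.assoc)
  also have "\<dots> = pol m Q * pol (Suc m) Q * T m"
    by (simp add: distrib_left mult.assoc op_sc \<Psi>_Delta1_pol[OF assms])
  finally show ?thesis using pol_pol[OF assms, of m Q "Suc m"] by simp
qed

lemma T_pol_other: "k \<noteq> m \<Longrightarrow> k \<noteq> Suc m \<Longrightarrow> T m * pol k Q = pol k Q * T m"
proof -
  assume k: "k \<noteq> m" "k \<noteq> Suc m"
  have "T m * dpow k r - dpow k r * T m = 0" for r
    by (rule dpow_ind[of "\<lambda>r. T m * dpow k r - dpow k r * T m" k])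
      (use T_dot_other[OF k] in \<open>simp_all add: dpow_add dpow_1 left_diff_distrib mult.assoc\<close>)
  then have d: "T m * dpow k r = dpow k r * T m" for r by (simp only: right_minus_eq)
  have "T m * (tok k a * dpow k r) = tok k a * dpow k r * T m" for a r
    by (rule twisted_mult[OF _ d]) (use k T_tok[of m k a] in simp)
  then show ?thesis by (simp add: pol_unfold sum_distrib_left sum_distrib_right)
qed

end

section \<open>The action of terms and its invariance under the congruence\<close>

lemma num_black_simps [simp]:
  "num_black [] = 0" "num_black (Black # i) = Suc (num_black i)" "num_black (Red Q # i) = num_black i"
  "num_black (i @ j) = num_black i + num_black j"
  by (auto simp: num_black_def)

fun nb :: "('a::zero, 'k) mor \<Rightarrow> nat" where
  "nb (Ident i) = num_black i"
| "nb Tpos = 2" | "nb Tneg = 2" | "nb (Token a) = 1" | "nb Dot = 1" | "nb DotInv = 1"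
| "nb (Rho Q) = 1" | "nb (Lam Q) = 1"
| "nb (f \<bullet> g) = nb g" | "nb (f \<boxtimes> g) = nb f + nb g" | "nb (Zero i j) = num_black i"
| "nb (f \<boxplus> g) = nb f" | "nb (Scale c f) = nb f"

lemma inverse_twist:
  fixes a :: "'r::monoid_mult"
  assumes "a * b = 1" "b * a = 1" "a * x = y * a" shows "b * y = x * b"
proof -
  have "b * y = b * (y * a) * b" by (simp add: mult.assoc assms(1))
  also have "\<dots> = b * a * x * b" by (simp add: mult.assoc flip: assms(3))
  finally show ?thesis by (simp add: assms(2))
qed

context LAH
begin

lemma dotinv_T: "k \<noteq> i \<Longrightarrow> k \<noteq> Suc i \<Longrightarrow> T i * dotinv k = dotinv k * T i"
  by (rule inverse_twist[OF dot_dotinv T_dot_other[symmetric], symmetric])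

text \<open>The operator of a diagram whose first black strand is the strand \<open>m\<close>. Crossings with red strands
  act by \<open>1\<close> from one side and by multiplication by \<open>Q\<close> from the other.\<close>

fun act :: "('a, 'k) mor \<Rightarrow> nat \<Rightarrow> (st, 'k) lop" where
  "act (Ident i) m = 1"
| "act Tpos m = T m" | "act Tneg m = Ti m" | "act (Token a) m = tok m a"
| "act Dot m = dot m" | "act DotInv m = dotinv m" | "act (Rho Q) m = pol m Q" | "act (Lam Q) m = 1"
| "act (f \<bullet> g) m = act f m * act g m" | "act (f \<boxtimes> g) m = act f m * act g (m + nb f)"
| "act (Zero i j) m = 0" | "act (f \<boxplus> g) m = act f m + act g m" | "act (Scale c f) m = sc c * act f m"

text \<open>Words with different numbers of black letters can be joined only by means of
  \<open>Zero\<close>, which acts by 0. So whenever a term acts nontrivially, counting black letters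
  at its source gives the right position for the next tensor factor at its target as well.\<close>

lemma arrow_nb: "arrow f i j \<Longrightarrow> nb f = num_black i \<and> (num_black i = num_black j \<or> (\<forall>m. act f m = 0))"
  by (induction rule: arrow.induct) (auto simp: numeral_2_eq_2)

lemma act_term_sum: assumes "finite S" shows "act (term_sum i j S t) m = (\<Sum>x\<in>S. act (t x) m)"
proof -
  obtain xs where xs: "distinct xs" "set xs = S" "term_sum i j S t = foldr (\<lambda>x f. t x \<boxplus> f) xs (Zero i j)"
    using term_sum_cases[OF assms] .
  have "distinct xs \<Longrightarrow> act (foldr (\<lambda>x f. t x \<boxplus> f) xs (Zero i j)) m = (\<Sum>x\<in>set xs. act (t x) m)"
    by (induction xs) auto
  then show ?thesis using xs by simp
qed

lemma act_term_power: "act (term_power i f n) m = act f m ^ n"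
  by (induction n) (auto simp: term_power_Suc)

lemma dpow_nat: "dpow k (int n) = dot k ^ n" and dpow_neg_nat: "dpow k (- int n) = dotinv k ^ n"
proof -
  show "dpow k (int n) = dot k ^ n" by (induction n) (auto simp: dpow_add dpow_1)
  show "dpow k (- int n) = dotinv k ^ n"
  proof (induction n)
    case (Suc n)
    have "(dpow k (- int (Suc n)) :: (st, 'k) lop) = dpow k (- 1 + - int n)" by (rule arg_cong[of _ _ "dpow k"]) simp
    then show ?case unfolding dpow_add Suc dpow_minus_1 by simp
  qed simp
qed

lemma act_term_powi: "act f m = dot k \<Longrightarrow> act f' m = dotinv k \<Longrightarrow> act (term_powi i f f' r) m = dpow k r"
  using dpow_nat[of k "nat r"] dpow_neg_nat[of k "nat (- r)"] by (auto simp: term_powi_def act_term_power)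

lemma act_dot_powi [simp]: "act (dot_powi r) m = dpow m r"
  unfolding dot_powi_def by (rule act_term_powi) auto

lemma nb_dot_powi [simp]: "nb (dot_powi r :: ('a, 'k) mor) = 1"
  using arrow_nb[OF arrow_dot_powi] by simp

lemma act_bracket [simp]: "act (bracket f) m = pol m f"
  by (simp add: bracket_def act_term_sum pol_unfold)

lemma act_bracket_red [simp]: "act (bracket_red Q F) m = \<Psi> m F"
proof -
  have "tok m b * tok (Suc m) c * (dpow m r * dpow (Suc m) s) = tok m b * tok (Suc m) c * (dpow m r * dpow (Suc m) s)" for b c r s ..
  then show ?thesis
    by (simp add: bracket_red_def act_term_sum \<Psi>_def klin_unfold case_prod_unfold)
qed

text \<open>What the interchange law asks of a left tensor factor: it has to supercommute with the
  generators of all operators on the strands from h on. Crossings and dots are even, so only tokens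
  produce signs.\<close>

definition supercommutes_above :: "bit \<Rightarrow> nat \<Rightarrow> (st, 'k) lop \<Rightarrow> bool" where
  "supercommutes_above p h F \<longleftrightarrow> (\<forall>k\<ge>h. F * dot k = dot k * F \<and> F * dotinv k = dotinv k * F \<and> F * T k = T k * F \<and>
     (\<forall>q. \<forall>a\<in>gr q. F * tok k a = sc (koszul p q) * (tok k a * F)))"

lemma supercommutes_above_mono: "supercommutes_above p h F \<Longrightarrow> h \<le> h' \<Longrightarrow> supercommutes_above p h' F"
  unfolding supercommutes_above_def by (meson order_trans)

lemma supercommutes_above_zero [simp]: "supercommutes_above p h 0"
  by (simp add: supercommutes_above_def)

lemma supercommutes_above_mult:
  assumes F: "supercommutes_above p h F" and G: "supercommutes_above q h G"
  shows "supercommutes_above (p + q) h (F * G)"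
proof -
  have "F * G * x = x * (F * G)" if "F * x = x * F" "G * x = x * G" for x
    by (simp add: that mult.assoc) (simp add: that flip: mult.assoc)
  moreover have "F * G * tok k a = sc (koszul (p + q) r) * (tok k a * (F * G))" if "k \<ge> h" "a \<in> gr r" for k a r
  proof -
    have "F * G * tok k a = F * (sc (koszul q r) * (tok k a * G))"
      using G that unfolding supercommutes_above_def by (auto simp: mult.assoc)
    also have "\<dots> = sc (koszul q r) * (F * tok k a * G)" by (simp add: sc_left_commute[of F] mult.assoc)
    also have "F * tok k a = sc (koszul p r) * (tok k a * F)" using F that unfolding supercommutes_above_def by blast
    finally show ?thesis by (simp add: koszul_add_left sc_mult ac_simps flip: mult.assoc)
  qed
  ultimately show ?thesis using F G unfolding supercommutes_above_def by blast
qed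

lemma supercommutes_above_add:
  "supercommutes_above p h F \<Longrightarrow> supercommutes_above p h G \<Longrightarrow> supercommutes_above p h (F + G)"
  by (simp add: supercommutes_above_def distrib_left distrib_right)

lemma supercommutes_above_sc: "supercommutes_above p h F \<Longrightarrow> supercommutes_above p h (sc c * F)"
proof -
  have "supercommutes_above 0 h (sc c)" by (simp add: supercommutes_above_def sc_commute[of _ c])
  then show "supercommutes_above p h F \<Longrightarrow> supercommutes_above p h (sc c * F)"
    using supercommutes_above_mult[of 0 h "sc c" p F] by simp
qed

lemma supercommutes_above_act:
  "has_parity f p \<Longrightarrow> arrow f i j \<Longrightarrow> supercommutes_above p (m + nb f) (act f m)"
proof (induction arbitrary: i j m rule: has_parity.induct)
  case (par_Token a p)
  have "T k * tok m a = tok m a * T k" "dot k * tok m a = tok m a * dot k" "dotinv k * tok m a = tok m a * dotinv k"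
    if "m < k" for k using that by (simp_all add: T_tok dot_tok dotinv_tok)
  then show ?case using par_Token
    by (auto simp: supercommutes_above_def sc_koszul intro: tok_commute)
next
  case (par_Comp f p g q)
  from \<open>arrow (f \<bullet> g) i j\<close> obtain l where l: "arrow g i l" "arrow f l j" by cases
  have "nb f = nb g \<or> act g m = 0" using arrow_nb[OF l(1)] arrow_nb[OF l(2)] by auto
  then show ?case
    using supercommutes_above_mult[OF par_Comp.IH(1)[OF l(2), of m]] par_Comp.IH(2)[OF l(1), of m] by auto
next
  case (par_Tensor f p g q)
  from \<open>arrow (f \<boxtimes> g) i j\<close> obtain k l k' l' where "arrow f k l" "arrow g k' l'" by cases
  then show ?case
    using supercommutes_above_mult[OF supercommutes_above_mono[OF par_Tensor.IH(1), of k l m]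
       par_Tensor.IH(2)[of k' l' "m + nb f"]] by (simp add: add.assoc)
next
  case (par_Add f p g)
  from \<open>arrow (f \<boxplus> g) i j\<close> have a: "arrow f i j" "arrow g i j" by (cases; simp)+
  then have "nb g = nb f" using arrow_nb by metis
  then show ?case using par_Add.IH(1)[OF a(1), of m] par_Add.IH(2)[OF a(2), of m] by (simp add: supercommutes_above_add)
next
  case (par_Scale f p c)
  from \<open>arrow (Scale c f) i j\<close> have "arrow f i j" by cases
  then show ?case using par_Scale.IH[of i j m] by (simp add: supercommutes_above_sc)
next
  case par_Tpos
  show ?case using T_far[of m] by (auto simp: supercommutes_above_def T_dot_other T_tok dotinv_T)
next
  case par_Tneg
  have "Ti m * F = F * Ti m" if "T m * F = F * T m" for F
    by (rule inverse_twist[OF T_Ti that])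
  then show ?case using T_far[of m]
    by (auto simp: supercommutes_above_def T_dot_other T_tok dotinv_T)
next
  case par_Dot
  then show ?case by (auto simp: supercommutes_above_def dot_dot[of m] dot_tok T_dot_other dotinv_dot[of _ m])
next
  case par_DotInv
  then show ?case
    by (auto simp: supercommutes_above_def dotinv_dot dotinv_dotinv[of m] dotinv_tok dotinv_T)
next
  case (par_Rho Q)
  from \<open>arrow (Rho Q) i j\<close> have "Q \<in> E" by cases
  then show ?case by (auto simp: supercommutes_above_def pol_dot pol_dotinv pol_tok T_pol_other)
qed (auto simp: supercommutes_above_def)

lemma act_interchange:
  assumes "supercommutes_above p h F"
  shows "has_parity g q \<Longrightarrow> arrow g i j \<Longrightarrow> m \<ge> h \<Longrightarrow> F * act g m = sc (koszul p q) * (act g m * F)"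
proof (induction arbitrary: i j m rule: has_parity.induct)
  case (par_Comp f p' g q')
  from \<open>arrow (f \<bullet> g) i j\<close> obtain l where l: "arrow g i l" "arrow f l j" by cases
  have "F * act (f \<bullet> g) m = sc (koszul p p') * (act f m * (F * act g m))"
    using par_Comp.IH(1)[OF l(2) par_Comp.prems(2)] by (simp flip: mult.assoc)
  then show ?case using par_Comp.IH(2)[OF l(1) par_Comp.prems(2)]
    by (simp add: sc_left_commute[of "act f m"] koszul_add_right mult.assoc flip: sc_mult)
next
  case (par_Tensor f p' g q')
  from \<open>arrow (f \<boxtimes> g) i j\<close> obtain k l k' l' where a: "arrow f k l" "arrow g k' l'" by cases
  have "F * act (f \<boxtimes> g) m = sc (koszul p p') * (act f m * (F * act g (m + nb f)))"
    using par_Tensor.IH(1)[OF a(1) par_Tensor.prems(2)] by (simp flip: mult.assoc)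
  then show ?case using par_Tensor.IH(2)[OF a(2), of "m + nb f"] par_Tensor.prems(2)
    by (simp add: sc_left_commute[of "act f m"] koszul_add_right mult.assoc flip: sc_mult)
next
  case (par_Add f p' g)
  from \<open>arrow (f \<boxplus> g) i j\<close> have a: "arrow f i j" "arrow g i j" by (cases; simp)+
  show ?case using par_Add.IH(1)[OF a(1) par_Add.prems(2)] par_Add.IH(2)[OF a(2) par_Add.prems(2)]
    by (simp add: distrib_left distrib_right)
next
  case (par_Scale f p' c)
  from \<open>arrow (Scale c f) i j\<close> have "arrow f i j" by cases
  then show ?case using par_Scale.IH[OF _ par_Scale.prems(2)]
    by (simp add: sc_left_commute[of F] mult.assoc) (simp add: sc_mult mult.commute flip: mult.assoc)
next
  case (par_Rho Q)
  from \<open>arrow (Rho Q) i j\<close> have Q: "Q \<in> E" by cases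
  have d: "F * dpow m r - dpow m r * F = 0" for r
    by (rule dpow_ind[of "\<lambda>r. F * dpow m r - dpow m r * F" m])
      (use assms par_Rho in \<open>simp_all add: supercommutes_above_def dpow_add dpow_1 left_diff_distrib mult.assoc\<close>)
  have "F * (tok m (lookup Q r) * dpow m r) = tok m (lookup Q r) * dpow m r * F" for r
  proof (rule twisted_mult)
    show "F * tok m (lookup Q r) = tok m (lookup Q r) * F"
      using assms par_Rho(2) E_coeff_even[OF Q] unfolding supercommutes_above_def by force
    show "F * dpow m r = dpow m r * F" using d by (simp only: right_minus_eq)
  qed
  then show ?case by (simp add: pol_unfold sum_distrib_left sum_distrib_right)
next
  case par_Tneg
  have "Ti m * (F * T m) * Ti m = Ti m * (T m * F) * Ti m"
    using assms par_Tneg(2) unfolding supercommutes_above_def by auto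
  then have "Ti m * F * (T m * Ti m) = Ti m * T m * F * Ti m" by (simp only: mult.assoc)
  then show ?case by simp
qed (use assms in \<open>auto simp: supercommutes_above_def\<close>)

text \<open>The relations with content are the skein, braid and dot relations for \<open>T\<close>
  and its commutation with \<open>pol\<close>, all shown above. In \<open>lam_cross\<close> both
  sides act by \<open>T m\<close>, since \<open>Lam\<close> acts by 1.\<close>

lemma def_rel_act: "def_rel i j f g \<Longrightarrow> act f m = act g m"
proof (induction rule: def_rel.induct)
  case (cross_dot)
  have "T m * dot m = dot (Suc m) * Ti m"
    by (simp add: Ti_def T_dot_left right_diff_distrib sc_left_commute[of "dot (Suc m)"] cas_dot)
  then show ?case by simp
next
  case (red_braid Q)
  then show ?case by (simp add: T_pol_right)
next
  case (cross_rho Q)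
  then show ?case using T_pol_pol[of Q m] by (simp add: mult.assoc)
next
  case skein
  show ?case by (simp add: Ti_def sc_uminus act_term_sum B_finite cas_def)
qed (simp_all add: tok_add tok_scale tok_mult dot_tok T_tok mult.assoc pol_tok pol_dot
   flip: T_braid[unfolded mult.assoc])

lemma eqv_act: "eqv i j f g \<Longrightarrow> act f m = act g m"
proof (induction arbitrary: m rule: eqv.induct)
  case (eqv_Tensor i j f f' k l g g')
  have "nb f = nb f'" using eqv_Tensor.hyps arrow_nb eqv_arrow by metis
  then show ?case using eqv_Tensor.IH by simp
next
  case (interchange f i j f' k g' l m' g n p q)
  show ?case
  proof (cases "num_black i = num_black j")
    case True
    then have nb: "nb f = nb f'" using arrow_nb interchange(1,2) by metis
    have "act f m * act g (m + nb f') = sc (koszul p q) * (act g (m + nb f') * act f m)"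
      using act_interchange[OF supercommutes_above_act[OF interchange(5,1)] interchange(6,4)] nb by simp
    then have "sc (koszul p q) * (act f m * act g (m + nb f')) = act g (m + nb f') * act f m"
      by (simp add: sc_mult flip: mult.assoc)
    then have *: "act g (m + nb f') * act f m = sc (koszul p q) * (act f m * act g (m + nb f'))" by simp
    have "act f' m * act g (m + nb f') * (act f m * act g' (m + nb f')) =
        act f' m * (act g (m + nb f') * act f m) * act g' (m + nb f')" by (simp add: mult.assoc)
    also have "\<dots> = sc (koszul p q) * (act f' m * (act f m * act g (m + nb f')) * act g' (m + nb f'))"
      unfolding * sc_left_commute by (simp add: mult.assoc)
    finally show ?thesis using nb by (simp add: mult.assoc)
  next
    case False
    then have "act f m = 0" using arrow_nb interchange(1) by metis
    then show ?thesis by simp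
  qed
next
  case (tensor_add_left f i j g h k l)
  have "nb f = nb g" using arrow_nb tensor_add_left(1,2) by metis
  then show ?case by (simp add: distrib_right)
next
  case (eqv_def_rel i j f g)
  then show ?case by (rule def_rel_act)
qed (simp_all add: algebra_simps sc_add sc_uminus sc_left_commute[of "act f k" for f k] flip: sc_mult)

end

section \<open>Pure tensors\<close>

declare fun_upd_apply [simp del] fun_upd_same [simp] fun_upd_other [simp]
  comp_apply [simp del]

context symmetric_frobenius_superalgebra
begin

text \<open>The value at g of the linear functional that sends c X^r to h r c, for c in
  \<open>B\<close>.\<close>

definition csum :: "'a P1 \<Rightarrow> (int \<Rightarrow> 'a \<Rightarrow> 'k) \<Rightarrow> 'k" where
  "csum g h = pmsum (\<lambda>r a. \<Sum>c\<in>B. rep a c * h r c) g"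

lemma csum_additive:
  fixes h :: "int \<Rightarrow> 'a \<Rightarrow> 'k"
  shows "pm_additive (\<lambda>r a. \<Sum>c\<in>B. rep a c * h r c)"
  by unfold_locales (simp add: rep_add distrib_right sum.distrib)

lemmas csum_add = pm_additive.pmsum_add[OF csum_additive, folded csum_def]
lemmas csum_sum = pm_additive.pmsum_sum[OF csum_additive, folded csum_def]
lemmas csum_single = pm_additive.pmsum_single[OF csum_additive, folded csum_def]

lemma csum_unfold: "csum g h = (\<Sum>r\<in>keys g. \<Sum>c\<in>B. rep (lookup g r) c * h r c)"
  by (simp add: csum_def pmsum_def)

lemma csum_cong: "(\<And>r c. c \<in> B \<Longrightarrow> rep (lookup g r) c \<noteq> 0 \<Longrightarrow> h r c = h' r c) \<Longrightarrow> csum g h = csum g h'"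
  unfolding csum_unfold by (intro sum.cong refl) (metis mult_zero_left)

lemma csum_cong_even: "g \<in> P1_gr 0 \<Longrightarrow> (\<And>r c. c \<in> B \<Longrightarrow> parity c = 0 \<Longrightarrow> h r c = h' r c) \<Longrightarrow> csum g h = csum g h'"
  using rep_homogeneous unfolding P1_gr_def by (intro csum_cong) blast

lemma csum_scale_right: "csum g (\<lambda>r c. x * h r c) = x * csum g h"
  by (simp add: csum_unfold sum_distrib_left ac_simps)

lemma csum_add_right: "csum g (\<lambda>r c. h r c + h' r c) = csum g h + csum g h'"
  by (simp add: csum_unfold distrib_left sum.distrib)

lemma csum_sum_right: "csum g (\<lambda>r c. \<Sum>x\<in>I. h x r c) = (\<Sum>x\<in>I. csum g (h x))"
  by (induction I rule: infinite_finite_induct) (simp_all add: csum_add_right csum_unfold[of _ "\<lambda>_ _. 0"])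

lemma csum_swap: "csum g (\<lambda>r c. csum g' (\<lambda>r' c'. h r c r' c')) = csum g' (\<lambda>r' c'. csum g (\<lambda>r c. h r c r' c'))"
proof -
  have "csum g (\<lambda>r c. csum g' (\<lambda>r' c'. h r c r' c')) =
      (\<Sum>r'\<in>keys g'. \<Sum>c'\<in>B. csum g (\<lambda>r c. rep (lookup g' r') c' * h r c r' c'))"
    unfolding csum_unfold[of g'] by (simp add: csum_sum_right)
  then show ?thesis unfolding csum_unfold[of g'] by (simp add: csum_scale_right)
qed

lemma csum_mult_single: "csum (single s a * g) h = csum g (\<lambda>r c. \<Sum>c'\<in>B. rep (a * c) c' * h (s + r) c')"
proof -
  have "single s a * g = (\<Sum>r\<in>keys g. single (s + r) (a * lookup g r))"
    by (subst pm_expand[of g, symmetric]) (simp only: sum_distrib_left mult_single)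
  then have "csum (single s a * g) h = (\<Sum>r\<in>keys g. \<Sum>c'\<in>B. rep (a * lookup g r) c' * h (s + r) c')"
    by (simp add: csum_sum csum_single)
  also have "\<dots> = (\<Sum>r\<in>keys g. \<Sum>c'\<in>B. \<Sum>c\<in>B. rep (lookup g r) c * (rep (a * c) c' * h (s + r) c'))"
    unfolding rep_mult[of a "lookup g _"] sum_distrib_right by (simp only: mult.assoc)
  also have "\<dots> = csum g (\<lambda>r c. \<Sum>c'\<in>B. rep (a * c) c' * h (s + r) c')"
    unfolding csum_unfold sum_distrib_left by (intro sum.cong refl sum.swap)
  finally show ?thesis .
qed

text \<open>A pure tensor as a functional: the first d factors are given by f, the others are the
  basis elements described by \<beta> and \<alpha>. The factors are expanded from the last one down,
  and the basis elements chosen so far are recorded in \<beta> and \<alpha>.\<close>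

fun vecr :: "nat \<Rightarrow> (nat \<Rightarrow> 'a P1) \<Rightarrow> (nat \<Rightarrow> nat) \<Rightarrow> (nat \<Rightarrow> int) \<Rightarrow> nat perm \<Rightarrow> (st \<Rightarrow> 'k) \<Rightarrow> 'k" where
  "vecr 0 f \<beta> \<alpha> v \<phi> = \<phi> (\<beta>, \<alpha>, v)"
| "vecr (Suc d) f \<beta> \<alpha> v \<phi> = csum (f d) (\<lambda>r c. vecr d f (\<beta>(d := put 0 c)) (\<alpha>(d := r)) v \<phi>)"

declare vecr.simps [simp del]

lemma vecr_simps [simp]:
  "vecr 0 f \<beta> \<alpha> v \<phi> = \<phi> (\<beta>, \<alpha>, v)"
  "vecr (Suc d) f \<beta> \<alpha> v \<phi> = csum (f d) (\<lambda>r c. vecr d f (\<beta>(d := put 0 c)) (\<alpha>(d := r)) v \<phi>)"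
  by (simp_all only: vecr.simps)

text \<open>The vector \<open>f\<^sub>0 \<otimes> \<dots> \<otimes> f\<^sub>d\<^sub>-\<^sub>1\<close> with label \<open>v\<close>, as a functional on the functions on the basis\<close>

definition vec :: "nat \<Rightarrow> (nat \<Rightarrow> 'a P1) \<Rightarrow> nat perm \<Rightarrow> (st \<Rightarrow> 'k) \<Rightarrow> 'k" where
  "vec d f v = vecr d f (\<lambda>_. 0) (\<lambda>_. 0) v"

lemma vecr_cong: "(\<And>k. k < d \<Longrightarrow> f k = f' k) \<Longrightarrow> vecr d f = vecr d f'"
  by (induction d) (auto simp: fun_eq_iff)

lemma vecr_add: "vecr d f \<beta> \<alpha> v (\<lambda>x. \<phi> x + \<psi> x) = vecr d f \<beta> \<alpha> v \<phi> + vecr d f \<beta> \<alpha> v \<psi>"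
  by (induction d arbitrary: \<beta> \<alpha>) (simp_all add: csum_add_right)

lemma vecr_scale: "vecr d f \<beta> \<alpha> v (\<lambda>x. c * \<phi> x) = c * vecr d f \<beta> \<alpha> v \<phi>"
  by (induction d arbitrary: \<beta> \<alpha>) (simp_all add: csum_scale_right)

lemma vecr_local:
  "(\<And>\<beta>' \<alpha>'. (\<forall>k\<ge>d. \<beta>' k = \<beta> k \<and> \<alpha>' k = \<alpha> k) \<Longrightarrow> \<phi> (\<beta>', \<alpha>', v) = \<psi> (\<beta>', \<alpha>', v)) \<Longrightarrow>
    vecr d f \<beta> \<alpha> v \<phi> = vecr d f \<beta> \<alpha> v \<psi>"
proof (induction d arbitrary: \<beta> \<alpha>)
  case 0
  then show ?case by (simp add: 0)
next
  case (Suc d)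
  have "vecr d f (\<beta>(d := put 0 c)) (\<alpha>(d := r)) v \<phi> = vecr d f (\<beta>(d := put 0 c)) (\<alpha>(d := r)) v \<psi>" for r c
    by (rule Suc.IH, rule Suc.prems) auto
  then show ?case by simp
qed

lemma vecr_slot_add: "k < d \<Longrightarrow> vecr d (f(k := g + h)) \<beta> \<alpha> v \<phi> = vecr d (f(k := g)) \<beta> \<alpha> v \<phi> + vecr d (f(k := h)) \<beta> \<alpha> v \<phi>"
proof (induction d arbitrary: \<beta> \<alpha>)
  case (Suc d)
  show ?case
  proof (cases "k = d")
    case True
    have "vecr d (f(d := x)) = vecr d f" for x by (rule vecr_cong) auto
    then show ?thesis using True by (simp add: csum_add)
  qed (use Suc in \<open>simp add: csum_add_right\<close>)
qed simp

lemma vecr_slot_zero: "k < d \<Longrightarrow> vecr d (f(k := 0)) \<beta> \<alpha> v \<phi> = 0"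
  using vecr_slot_add[of k d f 0 0] by simp

lemma vecr_slot_sum: "k < d \<Longrightarrow> vecr d (f(k := \<Sum>x\<in>I. g x)) \<beta> \<alpha> v \<phi> = (\<Sum>x\<in>I. vecr d (f(k := g x)) \<beta> \<alpha> v \<phi>)"
  by (induction I rule: infinite_finite_induct) (simp_all add: vecr_slot_add vecr_slot_zero)

lemma vecr_dpow_ge: "d \<le> k \<Longrightarrow> vecr d f \<beta> \<alpha> v (app (dpow k s) \<phi>) = vecr d f \<beta> (\<alpha>(k := \<alpha> k + s)) v \<phi>"
  by (induction d arbitrary: \<beta> \<alpha>) (simp_all add: app_dpow fun_upd_twist)

lemma vecr_dpow: "k < d \<Longrightarrow> vecr d f \<beta> \<alpha> v (app (dpow k s) \<phi>) = vecr d (f(k := single s 1 * f k)) \<beta> \<alpha> v \<phi>"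
proof (induction d arbitrary: \<beta> \<alpha>)
  case (Suc d)
  show ?case
  proof (cases "k = d")
    case True
    have [simp]: "vecr d (f(d := x)) = vecr d f" for x by (rule vecr_cong) auto
    have "(\<Sum>c'\<in>B. rep c c' * h c') = h c" if "c \<in> B" for c and h :: "'a \<Rightarrow> 'k"
      using that B_finite by (simp add: rep_basis if_distrib[of "\<lambda>x. x * _"] cong: if_cong)
    then show ?thesis using True
      by (auto simp: csum_mult_single vecr_dpow_ge add.commute intro!: csum_cong)
  qed (use Suc in simp)
qed simp

lemma vecr_tok_ge:
  "d \<le> k \<Longrightarrow> (\<And>l. l < d \<Longrightarrow> f l \<in> P1_gr 0) \<Longrightarrow> vecr d f \<beta> \<alpha> v (app (tok k a) \<phi>) =
    (\<Sum>c\<in>B. rep (a * el (\<beta> k)) c * koszul (parity c + par (\<beta> k)) (\<Sum>l\<in>{d..<k}. par (\<beta> l)) *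
      vecr d f (\<beta>(k := put (\<beta> k) c)) \<alpha> v \<phi>)"
proof (induction d arbitrary: \<beta> \<alpha>)
  case 0
  then show ?case by (simp add: app_tok J_def atLeast0LessThan)
next
  case (Suc d)
  let ?s = "\<lambda>\<beta> m c. koszul (parity c + par (\<beta> k)) (\<Sum>l\<in>{m..<k}. par (\<beta> l)) :: 'k"
  have "vecr (Suc d) f \<beta> \<alpha> v (app (tok k a) \<phi>) =
      csum (f d) (\<lambda>r e. \<Sum>c\<in>B. rep (a * el (\<beta> k)) c * ?s (\<beta>(d := put 0 e)) d c *
      vecr d f (\<beta>(d := put 0 e, k := put (\<beta> k) c)) (\<alpha>(d := r)) v \<phi>)"
    using Suc.prems by (simp add: Suc.IH)
  also have "\<dots> = csum (f d) (\<lambda>r e. \<Sum>c\<in>B. rep (a * el (\<beta> k)) c * ?s \<beta> (Suc d) c *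
      vecr d f (\<beta>(k := put (\<beta> k) c, d := put 0 e)) (\<alpha>(d := r)) v \<phi>)"
  proof (rule csum_cong_even)
    fix r e assume e: "e \<in> B" "parity e = 0"
    have "(\<Sum>l\<in>{d..<k}. par ((\<beta>(d := put 0 e)) l)) = (\<Sum>l\<in>{Suc d..<k}. par (\<beta> l))"
      using e Suc.prems by (simp add: sum.atLeast_Suc_lessThan)
    then show "(\<Sum>c\<in>B. rep (a * el (\<beta> k)) c * ?s (\<beta>(d := put 0 e)) d c *
          vecr d f (\<beta>(d := put 0 e, k := put (\<beta> k) c)) (\<alpha>(d := r)) v \<phi>) =
        (\<Sum>c\<in>B. rep (a * el (\<beta> k)) c * ?s \<beta> (Suc d) c *
          vecr d f (\<beta>(k := put (\<beta> k) c, d := put 0 e)) (\<alpha>(d := r)) v \<phi>)"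
      using Suc.prems by (simp add: fun_upd_twist)
  qed (use Suc.prems in auto)
  also have "\<dots> = (\<Sum>c\<in>B. rep (a * el (\<beta> k)) c * ?s \<beta> (Suc d) c * vecr (Suc d) f (\<beta>(k := put (\<beta> k) c)) \<alpha> v \<phi>)"
    by (simp add: csum_sum_right csum_scale_right)
  finally show ?case .
qed

text \<open>The factors to the left of slot k are even, so a token, even an odd one, reaches its
  slot without a sign and acts by left multiplication there.\<close>

lemma vecr_tok:
  "k < d \<Longrightarrow> (\<And>l. l < k \<Longrightarrow> f l \<in> P1_gr 0) \<Longrightarrow>
    vecr d f \<beta> \<alpha> v (app (tok k a) \<phi>) = vecr d (f(k := single 0 a * f k)) \<beta> \<alpha> v \<phi>"
proof (induction d arbitrary: \<beta> \<alpha>)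
  case (Suc d)
  show ?case
  proof (cases "k = d")
    case True
    have [simp]: "vecr d (f(d := x)) = vecr d f" for x by (rule vecr_cong) auto
    show ?thesis using True Suc.prems
      by (auto simp: csum_mult_single vecr_tok_ge intro!: csum_cong)
  qed (use Suc in simp)
qed simp

lemma vecr_swp_ge: "d \<le> i \<Longrightarrow> vecr d f \<beta> \<alpha> v (app (swp i) \<phi>) =
    koszul (par (\<beta> i)) (par (\<beta> (Suc i))) * vecr d f (\<beta> \<circ> \<tau> i) (\<alpha> \<circ> \<tau> i) (v * Perm.swap i (Suc i)) \<phi>"
proof (induction d arbitrary: \<beta> \<alpha>)
  case (Suc d)
  then have "\<tau> i d = d" by (simp add: transpose_def)
  with Suc show ?case by (simp add: upd_comp_transpose csum_scale_right)
qed (simp add: app_swp)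

text \<open>The two factors are even, so the signed transposition has no sign. The background values
  \<beta> and \<alpha> agree at i and i + 1, so that only the factors show the exchange.\<close>

lemma vecr_swp: "Suc i < d \<Longrightarrow> f i \<in> P1_gr 0 \<Longrightarrow> f (Suc i) \<in> P1_gr 0 \<Longrightarrow>
    \<beta> i = \<beta> (Suc i) \<Longrightarrow> \<alpha> i = \<alpha> (Suc i) \<Longrightarrow>
    vecr d f \<beta> \<alpha> v (app (swp i) \<phi>) = vecr d (f \<circ> \<tau> i) \<beta> \<alpha> (v * Perm.swap i (Suc i)) \<phi>"
proof (induction d arbitrary: \<beta> \<alpha>)
  case (Suc d)
  show ?case
  proof (cases "d = Suc i")
    case True
    have c: "vecr i (f \<circ> \<tau> i) = vecr i f" by (rule vecr_cong) (simp add: transpose_def comp_apply)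
    have b: "(\<beta>(Suc i := x, i := y)) \<circ> \<tau> i = \<beta>(Suc i := y, i := x)" for x y
      by (auto simp: fun_eq_iff transpose_def Suc.prems fun_upd_apply comp_apply)
    have a: "(\<alpha>(Suc i := x, i := y)) \<circ> \<tau> i = \<alpha>(Suc i := y, i := x)" for x y
      by (auto simp: fun_eq_iff transpose_def Suc.prems fun_upd_apply comp_apply)
    have "vecr (Suc d) f \<beta> \<alpha> v (app (swp i) \<phi>) = csum (f (Suc i)) (\<lambda>r e. csum (f i) (\<lambda>r' e'.
        vecr i f (\<beta>(Suc i := put 0 e', i := put 0 e)) (\<alpha>(Suc i := r', i := r)) (v * Perm.swap i (Suc i)) \<phi>))"
      unfolding True vecr_simps using Suc.prems
      by (intro csum_cong_even) (simp_all add: vecr_swp_ge a b Suc.prems)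
    also have "\<dots> = vecr (Suc d) (f \<circ> \<tau> i) \<beta> \<alpha> (v * Perm.swap i (Suc i)) \<phi>"
      unfolding True by (subst csum_swap) (simp add: c comp_apply)
    finally show ?thesis .
  next
    case False
    then have "\<tau> i d = d" using Suc.prems by (simp add: transpose_def)
    then show ?thesis using Suc False by (simp add: comp_apply upd_comp_transpose)
  qed
qed simp

subsection \<open>Independence of pure tensors\<close>

lemma P1_independent:
  assumes "finite Y" "Y \<subseteq> B \<times> UNIV" "(\<Sum>(b, r)\<in>Y. single r (c (b, r) *s b)) = (0 :: 'a P1)" "y \<in> Y"
  shows "c y = 0"
proof -
  obtain b r where y: "y = (b, r)" by (cases y)
  have "0 = rep (lookup (\<Sum>(b, r)\<in>Y. single r (c (b, r) *s b)) r) b" using assms(3) by simp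
  also have "\<dots> = (\<Sum>x\<in>Y. rep (lookup (single (snd x) (c x *s fst x)) r) b)"
    by (simp add: lookup_sum rep_sum case_prod_unfold)
  also have "\<dots> = (\<Sum>x\<in>Y. if x = y then c y else 0)"
  proof (rule sum.cong[OF refl])
    fix x assume "x \<in> Y"
    moreover obtain a s where "x = (a, s)" by (cases x)
    ultimately show "rep (lookup (single (snd x) (c x *s fst x)) r) b = (if x = y then c y else 0)"
      using assms(2) y by (auto simp: lookup_single when_def rep_scale rep_basis)
  qed
  finally show ?thesis using assms(1,4) by simp
qed

lemma csum_eq_zero: "(\<And>r c. c \<in> B \<Longrightarrow> csum g (\<lambda>s e. of_bool (s = r \<and> e = c)) = 0) \<Longrightarrow> g = 0"
proof (rule poly_mapping_eqI)
  fix r assume *: "\<And>r c. c \<in> B \<Longrightarrow> csum g (\<lambda>s e. of_bool (s = r \<and> e = c)) = 0"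
  have "rep (lookup g r) c = 0" if "c \<in> B" for c
  proof -
    have "csum g (\<lambda>s e. of_bool (s = r \<and> e = c)) = (\<Sum>s\<in>insert r (keys g). \<Sum>e\<in>B. rep (lookup g s) e * of_bool (s = r \<and> e = c))"
      unfolding csum_unfold by (rule sum.mono_neutral_left) (auto simp: in_keys_iff)
    also have "\<dots> = (\<Sum>s\<in>insert r (keys g). if s = r then rep (lookup g r) c else 0)"
      using that B_finite by (intro sum.cong refl) (auto simp: of_bool_def if_distrib cong: if_cong)
    finally show ?thesis using * that by simp
  qed
  then show "lookup g r = lookup 0 r" by (intro rep_ext) simp
qed

text \<open>Induction on the number of factors, splitting off the last one. A test function that
  sees a single basis element in slot d leads to d factors, with coefficients that are coordinates
  of g * q d for a combination g of elements b X^r. If all these vanish, then g * q d = 0, so g = 0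
  by regularity, and the elements b X^r are independent.\<close>

lemma vecr_independent:
  assumes reg: "\<And>k. k < d \<Longrightarrow> regular (q k)"
    and "finite Z" "\<And>x. x \<in> Z \<Longrightarrow> length x = d \<and> set x \<subseteq> B \<times> UNIV"
    and "\<And>\<phi>. (\<Sum>x\<in>Z. c x * vecr d (\<lambda>k. single (snd (x ! k)) (fst (x ! k)) * q k) \<beta> \<alpha> v \<phi>) = 0"
    and "x \<in> Z"
  shows "c x = (0 :: 'k)"
  using assms
proof (induction d arbitrary: Z c \<beta> \<alpha> x)
  case 0
  then have "Z = {[]}" by auto
  then show ?case using "0.prems"(4)[of "\<lambda>_. 1"] "0.prems"(5) by simp
next
  case (Suc d)
  let ?V = "\<lambda>d x. vecr d (\<lambda>k. single (snd (x ! k)) (fst (x ! k)) * q k)"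
  define X1 where "X1 = butlast ` Z"
  define Y1 where "Y1 = last ` Z"
  define c' where "c' x = (if x \<in> Z then c x else 0)" for x
  have fin: "finite X1" "finite Y1" using Suc.prems by (auto simp: X1_def Y1_def)
  have ne: "z \<noteq> []" if "z \<in> Z" for z using Suc.prems(3)[OF that] by auto
  have Y1B: "Y1 \<subseteq> B \<times> UNIV"
  proof
    fix y assume "y \<in> Y1"
    then obtain z where z: "z \<in> Z" "y = last z" by (auto simp: Y1_def)
    then have "y \<in> set z" using ne[OF z(1)] by simp
    then show "y \<in> B \<times> UNIV" using Suc.prems(3)[OF z(1)] by blast
  qed
  have X1: "length xs = d \<and> set xs \<subseteq> B \<times> UNIV" if "xs \<in> X1" for xs
    using that Suc.prems(3) unfolding X1_def by (auto dest: in_set_butlastD)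
  have inj: "inj_on (\<lambda>(xs, y). xs @ [y]) (X1 \<times> Y1)" by (auto intro: inj_onI)
  have sub: "Z \<subseteq> (\<lambda>(xs, y). xs @ [y]) ` (X1 \<times> Y1)"
  proof
    fix z assume "z \<in> Z"
    then show "z \<in> (\<lambda>(xs, y). xs @ [y]) ` (X1 \<times> Y1)"
      using ne append_butlast_last_id[of z] unfolding X1_def Y1_def by (force simp: image_iff)
  qed
  have sum_eq: "(\<Sum>x\<in>Z. c x * h x) = (\<Sum>xs\<in>X1. \<Sum>y\<in>Y1. c' (xs @ [y]) * h (xs @ [y]))" for h
  proof -
    have "(\<Sum>x\<in>Z. c x * h x) = (\<Sum>x\<in>(\<lambda>(xs, y). xs @ [y]) ` (X1 \<times> Y1). c' x * h x)"
      using fin by (intro sum.mono_neutral_cong_left) (auto simp: c'_def sub)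
    also have "\<dots> = (\<Sum>(xs, y)\<in>X1 \<times> Y1. c' (xs @ [y]) * h (xs @ [y]))"
      by (subst sum.reindex[OF inj]) (simp add: case_prod_unfold comp_def)
    finally show ?thesis by (simp add: sum.cartesian_product)
  qed
  have last: "?V (Suc d) (xs @ [y]) \<beta> \<alpha> v \<phi> =
      csum (single (snd y) (fst y) * q d) (\<lambda>r e. ?V d xs (\<beta>(d := put 0 e)) (\<alpha>(d := r)) v \<phi>)"
    if "xs \<in> X1" for xs y \<phi>
  proof -
    have "vecr d (\<lambda>k. single (snd ((xs @ [y]) ! k)) (fst ((xs @ [y]) ! k)) * q k) = ?V d xs"
      by (rule vecr_cong) (use X1[OF that] in \<open>simp add: nth_append\<close>)
    then show ?thesis using X1[OF that] by (simp add: nth_append)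
  qed
  have zero: "(\<Sum>y\<in>Y1. c' (xs @ [y]) * csum (single (snd y) (fst y) * q d) (\<lambda>s e. of_bool (s = r \<and> e = b))) = 0"
    if xs: "xs \<in> X1" and b: "b \<in> B" for xs r b
  proof (rule Suc.IH[where Z = X1 and c = "\<lambda>xs. \<Sum>y\<in>Y1. c' (xs @ [y]) *
          csum (single (snd y) (fst y) * q d) (\<lambda>s e. of_bool (s = r \<and> e = b))"])
    fix \<phi> :: "st \<Rightarrow> 'k"
    \<comment> \<open>Restricting \<phi> to the basis element b X^r in slot d reduces the sum over
      the last factor to one coordinate.\<close>
    define \<psi> where "\<psi> = (\<lambda>(\<beta>', \<alpha>', v'). of_bool (\<beta>' d = put 0 b \<and> \<alpha>' d = r) * \<phi> (\<beta>', \<alpha>', v'))"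
    have inj_put: "put 0 e = put 0 b \<longleftrightarrow> e = b" if "e \<in> B" for e
      using el_put[OF that, of 0] el_put[OF b, of 0] by metis
    have loc: "?V d xs (\<beta>(d := put 0 e)) (\<alpha>(d := s)) v \<psi> =
        ?V d xs (\<beta>(d := put 0 b)) (\<alpha>(d := r)) v \<phi> * of_bool (s = r \<and> e = b)" if "e \<in> B" for e s xs
    proof -
      have "?V d xs (\<beta>(d := put 0 e)) (\<alpha>(d := s)) v \<psi> =
          ?V d xs (\<beta>(d := put 0 e)) (\<alpha>(d := s)) v (\<lambda>x. of_bool (s = r \<and> e = b) * \<phi> x)"
        by (rule vecr_local) (auto simp: \<psi>_def inj_put[OF that])
      then show ?thesis by (auto simp: vecr_scale)
    qed
    have "0 = (\<Sum>xs\<in>X1. \<Sum>y\<in>Y1. c' (xs @ [y]) * ?V (Suc d) (xs @ [y]) \<beta> \<alpha> v \<psi>)"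
      using Suc.prems(4)[of \<psi>] unfolding sum_eq by simp
    also have "\<dots> = (\<Sum>xs\<in>X1. \<Sum>y\<in>Y1. c' (xs @ [y]) * (?V d xs (\<beta>(d := put 0 b)) (\<alpha>(d := r)) v \<phi> *
        csum (single (snd y) (fst y) * q d) (\<lambda>s e. of_bool (s = r \<and> e = b))))"
      by (intro sum.cong refl) (simp del: vecr_simps add: last loc csum_scale_right cong: csum_cong)
    also have "\<dots> = (\<Sum>xs\<in>X1. (\<Sum>y\<in>Y1. c' (xs @ [y]) *
          csum (single (snd y) (fst y) * q d) (\<lambda>s e. of_bool (s = r \<and> e = b))) *
         ?V d xs (\<beta>(d := put 0 b)) (\<alpha>(d := r)) v \<phi>)"
      by (simp add: sum_distrib_right sum_distrib_left ac_simps)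
    finally show "(\<Sum>xs\<in>X1. (\<Sum>y\<in>Y1. c' (xs @ [y]) *
          csum (single (snd y) (fst y) * q d) (\<lambda>s e. of_bool (s = r \<and> e = b))) *
         ?V d xs (\<beta>(d := put 0 b)) (\<alpha>(d := r)) v \<phi>) = 0" by simp
  qed (use Suc.prems fin X1 xs in auto)
  have main: "c' (xs @ [y]) = 0" if xs: "xs \<in> X1" and y: "y \<in> Y1" for xs y
  proof -
    let ?g = "\<Sum>(b, r)\<in>Y1. single r (c' (xs @ [(b, r)]) *s b)"
    have "?g * q d = 0"
    proof (rule csum_eq_zero)
      fix r e assume e: "e \<in> B"
      have m: "single s (x *s b) * g = single 0 (x *s 1) * (single s b * g)" for s x b and g :: "'a P1"
        by (simp add: mult_single scale_mult_left flip: mult.assoc)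
      have cs: "csum (single 0 (x *s 1) * g) h = x * csum g h" for x g h
      proof -
        have "csum (single 0 (x *s 1) * g) h = csum g (\<lambda>r c. x * h r c)"
          unfolding csum_mult_single using B_finite
          by (intro csum_cong) (simp add: scale_mult_left rep_scale rep_basis if_distrib[of "\<lambda>x. x * _"] mult.assoc flip: sum_distrib_left cong: if_cong)
        then show ?thesis by (simp add: csum_scale_right)
      qed
      have mcs: "csum (single s (x *s b) * g) h = x * csum (single s b * g) h" for s x b g h
        unfolding m[of s x b g] cs ..
      show "csum (?g * q d) (\<lambda>s c. of_bool (s = r \<and> c = e)) = 0"
        unfolding sum_distrib_right csum_sum case_prod_unfold mcs using zero[OF xs e, of r] by simp
    qed
    moreover have "\<forall>g. g * q d = 0 \<longrightarrow> g = 0" using Suc.prems(1)[of d] unfolding regular_def by blast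
    ultimately have "?g = 0" by blast
    from P1_independent[OF fin(2) Y1B, of "\<lambda>y. c' (xs @ [y])"] this y show ?thesis by (simp add: case_prod_unfold)
  qed
  obtain xs y where "xs \<in> X1" "y \<in> Y1" "x = xs @ [y]" using sub Suc.prems(5) by auto
  then show ?case using main[of xs y] Suc.prems(5) by (simp add: c'_def)
qed

end

declare fun_upd_apply [simp] comp_apply [simp]

section \<open>Leading terms of diagrams\<close>

fun before :: "'x list \<Rightarrow> 'x \<Rightarrow> 'x \<Rightarrow> bool" where
  "before [] x y \<longleftrightarrow> False"
| "before (z # zs) x y \<longleftrightarrow> (if z = x then y \<in> set zs else before zs x y)"

lemma before_mem: "before xs x y \<Longrightarrow> x \<in> set xs \<and> y \<in> set xs"
  by (induction xs) (auto split: if_splits)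

lemma before_adjacent: "distinct (u @ a # b # v) \<Longrightarrow> before (u @ a # b # v) a b \<and> \<not> before (u @ a # b # v) b a"
  by (induction u) (auto dest: before_mem)

lemma before_swap: "distinct (u @ a # b # v) \<Longrightarrow> {x, y} \<noteq> {a, b} \<Longrightarrow>
    before (u @ b # a # v) x y = before (u @ a # b # v) x y"
  by (induction u) (auto dest: before_mem)

text \<open>The inverse of \<open>word_perm\<close>: the letters are multiplied in the opposite
  order, as \<open>swp\<close> multiplies the label on the right.\<close>

fun lab :: "nat list \<Rightarrow> nat perm" where
  "lab [] = 1" | "lab (r # rs) = lab rs * Perm.swap r (Suc r)"

lemma lab_word_perm: "Perm.apply (lab rs) (word_perm rs k) = k"
  by (induction rs arbitrary: k) (auto simp: word_perm_def apply_times Perm.swap.rep_eq)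

lemma word_perm_lab: "word_perm rs (Perm.apply (lab rs) k) = k"
  using lab_word_perm[of rs "word_perm rs (Perm.apply (lab rs) k)"]
  by (metis apply_inj lab_word_perm)

lemma lab_eq_iff: "lab rs = lab rs' \<longleftrightarrow> word_perm rs = word_perm rs'"
proof
  assume e: "word_perm rs = word_perm rs'"
  show "lab rs = lab rs'"
    by (rule perm_eqI) (metis e lab_word_perm word_perm_lab)
next
  assume e: "lab rs = lab rs'"
  show "word_perm rs = word_perm rs'"
    by (rule ext) (metis e lab_word_perm word_perm_lab)
qed

text \<open>Labels of permutations of length below l, expressed through words, which need not be
  reduced.\<close>

definition short_labels :: "nat \<Rightarrow> nat \<Rightarrow> nat perm set" where
  "short_labels d l = {lab rs | rs. length rs < l \<and> (\<forall>r\<in>set rs. Suc r < d)}"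

lemma short_labels_Suc:
  assumes "v \<in> short_labels d l" "Suc r < d"
  shows "v * Perm.swap r (Suc r) \<in> short_labels d (Suc l)" "v \<in> short_labels d (Suc l)"
proof -
  obtain rs where rs: "v = lab rs" "length rs < l" "\<forall>r\<in>set rs. Suc r < d"
    using assms(1) unfolding short_labels_def by auto
  then have "v * Perm.swap r (Suc r) = lab (r # rs)" "length (r # rs) < Suc l" "\<forall>r\<in>set (r # rs). Suc r < d"
    using assms(2) by auto
  then show "v * Perm.swap r (Suc r) \<in> short_labels d (Suc l)" unfolding short_labels_def by blast
  show "v \<in> short_labels d (Suc l)" using rs unfolding short_labels_def by (auto intro!: exI[of _ rs])
qed

lemma lab_notin_short_labels:
  assumes "reduced_expression d w rs" shows "lab rs \<notin> short_labels d (length rs)"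
proof
  assume "lab rs \<in> short_labels d (length rs)"
  then obtain rs' where "lab rs = lab rs'" "length rs' < length rs" "\<forall>r\<in>set rs'. Suc r < d"
    unfolding short_labels_def by auto
  with assms show False unfolding reduced_expression_def expression_for_def lab_eq_iff by (metis not_le)
qed

text \<open>For functionals, having only terms with labels in V means that the value depends on the
  test function at these labels only.\<close>

definition supported_on :: "nat perm set \<Rightarrow> ((st \<Rightarrow> 'k) \<Rightarrow> 'k) \<Rightarrow> bool" where
  "supported_on V u \<longleftrightarrow> (\<forall>\<phi> \<psi>. (\<forall>\<beta> \<alpha>. \<forall>v\<in>V. \<phi> (\<beta>, \<alpha>, v) = \<psi> (\<beta>, \<alpha>, v)) \<longrightarrow> u \<phi> = u \<psi>)"

definition keeps_label :: "(st, 'k::comm_ring_1) lop \<Rightarrow> bool" where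
  "keeps_label F \<longleftrightarrow> (\<forall>\<phi> \<psi> v. (\<forall>\<beta> \<alpha>. \<phi> (\<beta>, \<alpha>, v) = \<psi> (\<beta>, \<alpha>, v)) \<longrightarrow>
     (\<forall>\<beta> \<alpha>. app F \<phi> (\<beta>, \<alpha>, v) = app F \<psi> (\<beta>, \<alpha>, v)))"

lemma keeps_label_mult: "keeps_label F \<Longrightarrow> keeps_label G \<Longrightarrow> keeps_label (F * G)"
  unfolding keeps_label_def times_lop.rep_eq by blast

lemma keeps_label_sum: "(\<And>a. a \<in> I \<Longrightarrow> keeps_label (F a)) \<Longrightarrow> keeps_label (sum F I)"
  unfolding keeps_label_def app_sum_lop by (intro allI impI sum.cong refl) blast

lemma keeps_label_sc: "keeps_label (sc c)" and keeps_label_one: "keeps_label 1"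
  by (simp_all add: keeps_label_def)

lemma keeps_label_dpow: "keeps_label (dpow k r)"
  by (simp add: keeps_label_def app_dpow)

lemma supported_on_keeps_label: "supported_on V u \<Longrightarrow> keeps_label F \<Longrightarrow> supported_on V (\<lambda>\<phi>. u (app F \<phi>))"
proof -
  assume u: "supported_on V u" and F: "keeps_label F"
  show ?thesis
    unfolding supported_on_def
  proof (intro allI impI)
    fix \<phi> \<psi> :: "st \<Rightarrow> 'a"
    assume "\<forall>\<beta> \<alpha>. \<forall>v\<in>V. \<phi> (\<beta>, \<alpha>, v) = \<psi> (\<beta>, \<alpha>, v)"
    then have "\<forall>\<beta> \<alpha>. \<forall>v\<in>V. app F \<phi> (\<beta>, \<alpha>, v) = app F \<psi> (\<beta>, \<alpha>, v)"
      using F unfolding keeps_label_def by blast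
    then show "u (app F \<phi>) = u (app F \<psi>)" using u unfolding supported_on_def by blast
  qed
qed

lemma supported_on_add: "supported_on V u \<Longrightarrow> supported_on V w \<Longrightarrow> supported_on V (\<lambda>\<phi>. u \<phi> + w \<phi>)"
  unfolding supported_on_def by metis

lemma supported_on_mono: "supported_on V u \<Longrightarrow> V \<subseteq> V' \<Longrightarrow> supported_on V' u"
  unfolding supported_on_def by blast

section \<open>The commutative monoid of even central regular elements\<close>

context superalgebra
begin

lemma P1_gr_zero_mult: "f \<in> P1_gr 0 \<Longrightarrow> g \<in> P1_gr 0 \<Longrightarrow> f * g \<in> P1_gr 0"
proof -
  assume fg: "f \<in> P1_gr 0" "g \<in> P1_gr 0"
  have "f * g = (\<Sum>r\<in>keys f. \<Sum>s\<in>keys g. single (r + s) (lookup f r * lookup g s))"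
    by (subst (1) pm_expand[of f, symmetric], subst (1) pm_expand[of g, symmetric])
      (simp only: sum_product mult_single)
  moreover have "lookup f r * lookup g s \<in> gr 0" for r s
    using fg gr_mult[of "lookup f r" 0 "lookup g s" 0] by (simp add: P1_gr_def)
  moreover have "0 \<in> gr 0" using gr_subspace subspace_0 by blast
  ultimately show ?thesis
    by (simp add: P1_gr_def lookup_sum) (auto simp: lookup_single when_def intro!: subspace_sum[OF gr_subspace])
qed

lemma E_even: "Q \<in> E \<Longrightarrow> Q \<in> P1_gr 0" and E_regular: "Q \<in> E \<Longrightarrow> regular Q"
  by (auto simp: E_def P1_center_def)

lemma E_commute: "Q \<in> E \<Longrightarrow> Q' \<in> E \<Longrightarrow> Q * Q' = Q' * Q"
  using koszul_zero by (auto simp: E_def P1_center_def)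

lemma E_mult: assumes "Q \<in> E" "Q' \<in> E" shows "Q * Q' \<in> E"
proof -
  have c: "h * g = g * h" if "h \<in> E" "g \<in> P1_gr p" for h g p
    using that by (auto simp: E_def P1_center_def)
  have "Q * Q' * g = g * (Q * Q')" if "g \<in> P1_gr p" for g p
    using c[OF assms(1) that] c[OF assms(2) that] by (simp add: mult.assoc) (simp flip: mult.assoc)
  moreover have "regular (Q * Q')"
    using E_regular[OF assms(1)] E_regular[OF assms(2)] unfolding regular_def by (metis mult.assoc)
  ultimately show ?thesis
    using P1_gr_zero_mult[OF E_even E_even, OF assms] unfolding E_def P1_center_def by simp
qed

lemma E_one: "1 \<in> E"
  using gr_one gr_subspace subspace_0 by (auto simp: E_def P1_center_def P1_gr_def regular_def lookup_one when_def)

lemma E_prod_list: "set qs \<subseteq> E \<Longrightarrow> prod_list qs \<in> E"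
  by (induction qs) (auto simp: E_one E_mult)

text \<open>The factor of x stands somewhere inside the longer product. It can be brought to the
  front because elements of \<open>E\<close> commute, although \<open>P1\<close> need not be
  commutative.\<close>

lemma prod_list_filter_insert:
  assumes "distinct xs" "x \<in> set xs" "\<not> P x" "\<And>y. y \<in> set xs \<Longrightarrow> P' y \<longleftrightarrow> P y \<or> y = x"
    "\<And>y. y \<in> set xs \<Longrightarrow> P' y \<Longrightarrow> c y \<in> E"
  shows "prod_list (map c (filter P' xs)) = c x * prod_list (map c (filter P xs))"
  using assms
proof (induction xs)
  case (Cons y xs)
  show ?case
  proof (cases "y = x")
    case True
    then have "filter P' xs = filter P xs" using Cons.prems by (intro filter_cong) auto
    then show ?thesis using True Cons.prems by simp
  next
    case False
    have IH: "prod_list (map c (filter P' xs)) = c x * prod_list (map c (filter P xs))"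
      using Cons False by auto
    show ?thesis
    proof (cases "P y")
      case True
      then have "c y \<in> E" "c x \<in> E" using Cons.prems by auto
      then have "c y * c x = c x * c y" by (rule E_commute)
      then show ?thesis using True Cons.prems IH by (simp flip: mult.assoc)
    qed (use False Cons.prems IH in auto)
  qed
qed simp

end

context symmetric_frobenius_superalgebra
begin

lemma vec_supported: "supported_on {v} (vec d f v)"
  unfolding supported_on_def vec_def by (intro allI impI vecr_local) auto

lemma vec_sum: "vec d f v (\<lambda>x. \<Sum>a\<in>I. \<phi> a x) = (\<Sum>a\<in>I. vec d f v (\<phi> a))"
  unfolding vec_def
  by (induction I rule: infinite_finite_induct) (use vecr_scale[of d f _ _ v 0 "\<lambda>_. 0"] in \<open>auto simp: vecr_add\<close>)

lemma vec_pol: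
  assumes m: "m < d" and even: "\<And>l. l < m \<Longrightarrow> f l \<in> P1_gr 0"
  shows "vec d f v (app (pol m Q) \<phi>) = vec d (f(m := Q * f m)) v \<phi>"
proof -
  have e: "vec d f v (app (tok m a * dpow m r) \<phi>) = vec d (f(m := single r a * f m)) v \<phi>" for a r
  proof -
    have "vec d f v (app (tok m a * dpow m r) \<phi>) = vec d (f(m := single r 1 * f m)) v (app (tok m a) \<phi>)"
      using m by (simp add: vec_def vecr_dpow)
    also have "\<dots> = vec d (f(m := single 0 a * (single r 1 * f m))) v \<phi>"
      unfolding vec_def using m even by (subst vecr_tok) auto
    finally show ?thesis by (simp add: mult_single flip: mult.assoc)
  qed
  have "app (pol m Q) \<phi> = (\<lambda>x. \<Sum>r\<in>keys Q. app (tok m (lookup Q r) * dpow m r) \<phi> x)"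
    by (rule ext) (simp only: pol_unfold app_sum_lop)
  then have "vec d f v (app (pol m Q) \<phi>) = (\<Sum>r\<in>keys Q. vec d (f(m := single r (lookup Q r) * f m)) v \<phi>)"
    by (simp only: vec_sum e)
  also have "\<dots> = vec d (f(m := (\<Sum>r\<in>keys Q. single r (lookup Q r) * f m))) v \<phi>"
    unfolding vec_def vecr_slot_sum[OF m] ..
  also have "(\<Sum>r\<in>keys Q. single r (lookup Q r) * f m) = Q * f m"
    unfolding sum_distrib_right[symmetric] pm_expand ..
  finally show ?thesis .
qed

lemma keeps_label_tok: "keeps_label (tok k a)"
  by (simp add: keeps_label_def app_tok)

lemma keeps_label_pol: "keeps_label (pol k Q)"
  unfolding pol_unfold by (intro keeps_label_sum keeps_label_mult keeps_label_tok keeps_label_dpow)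

lemma keeps_label_cas_dem: "keeps_label (sc c * (cas p q * dem i))"
proof -
  have "keeps_label (dem i)" by (simp add: keeps_label_def app_dem)
  then show ?thesis unfolding cas_def
    by (intro keeps_label_mult keeps_label_sc keeps_label_sum keeps_label_tok)
qed

text \<open>Triangularity: a pure tensor at v, plus a remainder at labels with words shorter than l.
  That v itself is not one of these labels is a separate matter, settled by
  \<open>lab_notin_short_labels\<close> for reduced words.\<close>

definition leads :: "nat \<Rightarrow> ((st \<Rightarrow> 'k) \<Rightarrow> 'k) \<Rightarrow> (nat \<Rightarrow> 'a P1) \<Rightarrow> nat perm \<Rightarrow> nat \<Rightarrow> bool" where
  "leads d u q v l \<longleftrightarrow> (\<exists>w. (\<forall>\<phi>. u \<phi> = vec d q v \<phi> + w \<phi>) \<and> supported_on (short_labels d l) w)"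

lemma leads_cong: "leads d u q v l \<Longrightarrow> (\<And>k. k < d \<Longrightarrow> q k = q' k) \<Longrightarrow> leads d u q' v l"
  unfolding leads_def vec_def using vecr_cong[of d q q'] by metis

lemma leads_pol:
  assumes "leads d u q v l" "m < d" "\<And>k. k < m \<Longrightarrow> q k \<in> P1_gr 0"
  shows "leads d (\<lambda>\<phi>. u (app (pol m Q) \<phi>)) (q(m := Q * q m)) v l"
proof -
  obtain w where w: "\<And>\<phi>. u \<phi> = vec d q v \<phi> + w \<phi>" "supported_on (short_labels d l) w"
    using assms(1) unfolding leads_def by blast
  then show ?thesis unfolding leads_def
    by (intro exI[of _ "\<lambda>\<phi>. w (app (pol m Q) \<phi>)"])
      (use assms in \<open>auto simp: vec_pol intro: supported_on_keeps_label keeps_label_pol\<close>)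
qed

end

context LAH
begin

text \<open>The signed transposition moves the leading tensor. The Casimir and Demazure part leaves
  it at the label v, which counts as short at length l + 1. The old remainder stays at its labels or
  moves to words with one more letter.\<close>

lemma leads_T:
  assumes "leads d u q v l" "Suc r < d" "q r \<in> P1_gr 0" "q (Suc r) \<in> P1_gr 0" "v \<in> short_labels d (Suc l)"
  shows "leads d (\<lambda>\<phi>. u (app (T r) \<phi>)) (q \<circ> \<tau> r) (v * Perm.swap r (Suc r)) (Suc l)"
proof -
  let ?F = "sc z * (cas r (Suc r) * dem r)"
  obtain w where w: "\<And>\<phi>. u \<phi> = vec d q v \<phi> + w \<phi>" "supported_on (short_labels d l) w"
    using assms(1) unfolding leads_def by blast
  have "u (app (T r) \<phi>) = vec d (q \<circ> \<tau> r) (v * Perm.swap r (Suc r)) \<phi> +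
      (vec d q v (app ?F \<phi>) + w (app (T r) \<phi>))" for \<phi>
  proof -
    have "app (T r) \<phi> = (\<lambda>x. app (swp r) \<phi> x + app ?F \<phi> x)" by (rule ext) (simp add: T_def)
    then have "vec d q v (app (T r) \<phi>) = vec d q v (app (swp r) \<phi>) + vec d q v (app ?F \<phi>)"
      unfolding vec_def by (simp only: vecr_add)
    also have "vec d q v (app (swp r) \<phi>) = vec d (q \<circ> \<tau> r) (v * Perm.swap r (Suc r)) \<phi>"
      unfolding vec_def using assms by (intro vecr_swp) auto
    finally show ?thesis using w(1) by simp
  qed
  moreover have "supported_on (short_labels d (Suc l)) (\<lambda>\<phi>. vec d q v (app ?F \<phi>) + w (app (T r) \<phi>))"
  proof (rule supported_on_add)
    show "supported_on (short_labels d (Suc l)) (\<lambda>\<phi>. vec d q v (app ?F \<phi>))"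
      by (rule supported_on_keeps_label[OF supported_on_mono[OF vec_supported] keeps_label_cas_dem]) (use assms in auto)
    show "supported_on (short_labels d (Suc l)) (\<lambda>\<phi>. w (app (T r) \<phi>))"
      unfolding supported_on_def
    proof (intro allI impI)
      fix \<phi> \<psi> :: "st \<Rightarrow> 'k"
      assume eq: "\<forall>\<beta> \<alpha>. \<forall>v\<in>short_labels d (Suc l). \<phi> (\<beta>, \<alpha>, v) = \<psi> (\<beta>, \<alpha>, v)"
      have "app (T r) \<phi> (\<beta>, \<alpha>, v) = app (T r) \<psi> (\<beta>, \<alpha>, v)" if "v \<in> short_labels d l" for \<beta> \<alpha> v
      proof -
        have "app ?F \<phi> (\<beta>, \<alpha>, v) = app ?F \<psi> (\<beta>, \<alpha>, v)"
          using keeps_label_cas_dem eq short_labels_Suc(2)[OF that assms(2)] unfolding keeps_label_def by meson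
        then show ?thesis unfolding T_def plus_lop.rep_eq
          using eq short_labels_Suc(1)[OF that assms(2)] by (simp only: app_swp)
      qed
      then show "w (app (T r) \<phi>) = w (app (T r) \<psi>)" using w(2) unfolding supported_on_def by blast
    qed
  qed
  ultimately show ?thesis
    unfolding leads_def by (intro exI[of _ "\<lambda>\<phi>. vec d q v (app ?F \<phi>) + w (app (T r) \<phi>)"]) blast
qed

end

section \<open>Labelled words and their weights\<close>

definition blacks :: "('q letter \<times> nat) list \<Rightarrow> nat list" where
  "blacks L = map snd (filter (\<lambda>x. fst x = Black) L)"

definition reds :: "('q letter \<times> nat) list \<Rightarrow> ('q letter \<times> nat) list" where
  "reds L = filter (\<lambda>x. fst x \<noteq> Black) L"

lemma blacks_simps [simp]:
  "blacks [] = []" "blacks ((Black, a) # L) = a # blacks L" "blacks ((Red Q, a) # L) = blacks L"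
  "blacks (L @ L') = blacks L @ blacks L'"
  by (simp_all add: blacks_def)

lemma reds_simps [simp]:
  "reds [] = []" "reds ((Black, a) # L) = reds L" "reds ((Red Q, a) # L) = (Red Q, a) # reds L"
  "reds (L @ L') = reds L @ reds L'"
  by (simp_all add: reds_def)

lemma length_blacks: "length (blacks L) = num_black (map fst L)"
  by (induction L) (auto simp: blacks_def num_black_def)

text \<open>The first components say which positions are black and which are red; the labels of each
  kind are then filled in, in order.\<close>

lemma labelled_word_eqI:
  "map fst L = map fst L' \<Longrightarrow> blacks L = blacks L' \<Longrightarrow> reds L = reds L' \<Longrightarrow> L = L'"
proof (induction L arbitrary: L')
  case (Cons x L)
  obtain x' L'' where L': "L' = x' # L''" "fst x' = fst x" using Cons.prems(1) by (cases L') auto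
  obtain y a where x: "x = (y, a)" by (cases x)
  obtain a' where x': "x' = (y, a')" using L' x by (cases x') auto
  have "a' = a \<and> L = L''"
    using Cons.prems Cons.IH[of L''] unfolding L' x x' by (cases y) auto
  then show ?case using L' x x' by simp
qed simp

definition colour :: "'a::zero P1 letter \<times> nat \<Rightarrow> 'a P1" where
  "colour x = (case fst x of Red Q \<Rightarrow> Q | Black \<Rightarrow> 0)"

definition crossed :: "('q \<times> nat) list \<Rightarrow> ('q \<times> nat) list \<Rightarrow> nat \<Rightarrow> nat \<Rightarrow> bool" where
  "crossed L L' b a \<longleftrightarrow> before (map snd L) a b \<and> before (map snd L') b a"

text \<open>The product of the labels of the red strands that the black strand \<open>b\<close> crosses from right to left\<close>

definition weight :: "('a::ring_1 P1 letter \<times> nat) list \<Rightarrow> ('a P1 letter \<times> nat) list \<Rightarrow> nat \<Rightarrow> 'a P1" where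
  "weight L L' b = prod_list (map colour (filter (\<lambda>x. fst x \<noteq> Black \<and> crossed L L' b (snd x)) L))"

context LAH
begin

lemma weight_E: "map fst L \<in> objects \<Longrightarrow> weight L L' b \<in> E"
proof -
  assume "map fst L \<in> objects"
  then have "colour x \<in> E" if "x \<in> set L" "fst x \<noteq> Black" for x
    using that by (cases "fst x") (force simp: objects_def colour_def lists_eq_set image_iff)+
  then show ?thesis unfolding weight_def by (intro E_prod_list) auto
qed

text \<open>As \<open>cs\<close> is distinct, a red and a black strand cross at most once, so which
  of them cross is determined by the bottom and the top word. Hence the \<open>weight\<close> of a
  black strand, and with it the leading term, does not depend on the diagram between the two words.
  Red strands never cross each other, and the order of the black ones follows
  \<open>lab rs\<close>.\<close>

lemma diagram_invariant:
  assumes "diagram L L' f rs cs" "distinct (map snd L)" "map fst L \<in> objects" "distinct cs"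
    "d = num_black (map fst L)"
  shows "set L' = set L \<and> distinct (map snd L') \<and> num_black (map fst L') = d \<and> reds L' = reds L \<and>
    (\<forall>r\<in>set rs. Suc r < d) \<and> (\<forall>k<d. blacks L' ! k = blacks L ! Perm.apply (lab rs) k) \<and>
    (\<forall>Q a b. (Red Q, a) \<in> set L \<longrightarrow> (Black, b) \<in> set L \<longrightarrow>
       ((a, b) \<in> set cs \<longleftrightarrow> before (map snd L) a b \<noteq> before (map snd L') a b)) \<and>
    leads d (\<lambda>\<phi>. vec d (\<lambda>_. 1) 1 (app (act f 0) \<phi>)) (\<lambda>k. weight L L' (blacks L' ! k)) (lab rs) (length rs)"
  using assms
proof (induction rule: diagram.induct)
  case (diagram_Ident L)
  have "\<not> crossed L L b a" if "distinct (map snd L)" for a b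
  proof -
    have "\<not> (before xs a b \<and> before xs b a)" if "distinct xs" for xs :: "nat list"
      using that by (induction xs) (auto dest: before_mem)
    then show ?thesis unfolding crossed_def using diagram_Ident by blast
  qed
  then have "weight L L b = 1" for b using diagram_Ident by (simp add: weight_def)
  then show ?case using diagram_Ident
    by (auto simp: leads_def supported_on_def short_labels_def intro!: exI[of _ "\<lambda>_. 0"])
next
  case (diagram_Tpos L u a b v f rs cs)
  let ?L = "u @ (Black, a) # (Black, b) # v" and ?L' = "u @ (Black, b) # (Black, a) # v"
  let ?r = "num_black (map fst u)"
  note IH = diagram_Tpos.IH[OF diagram_Tpos.prems]
  from IH have i1: "set ?L = set L" and i2: "distinct (map snd ?L)" and i3: "num_black (map fst ?L) = d"
    and i4: "reds ?L = reds L" and i5: "\<forall>r\<in>set rs. Suc r < d"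
    and i6: "\<forall>k<d. blacks ?L ! k = blacks L ! Perm.apply (lab rs) k"
    by blast+
  have r: "Suc ?r < d" using IH by auto
  have lb: "length (blacks u) = ?r" by (rule length_blacks)
  have bl: "blacks ?L' ! k = blacks ?L ! \<tau> ?r k" for k
  proof -
    consider "k < ?r" | "k = ?r" | "k = Suc ?r" | "k > Suc ?r" by linarith
    then show ?thesis
    proof cases
      case 4
      then obtain m where "k = Suc (Suc (?r + m))" by (metis add_Suc less_imp_Suc_add)
      then show ?thesis using lb by (simp add: nth_append transpose_def)
    qed (use lb in \<open>simp_all add: nth_append transpose_def\<close>)
  qed
  have ne: "x \<noteq> y" if "(Red Q, x) \<in> set L" "(Black, y) \<in> set L" for x y Q
    using that diagram_Tpos.prems(1) by (force simp: distinct_map inj_on_def)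
  have dist: "distinct (map snd u @ a # b # map snd v)" using IH by simp
  have ab: "(Black, a) \<in> set L" "(Black, b) \<in> set L" using IH by auto
  have bef: "before (map snd ?L') x y = before (map snd ?L) x y"
    if "{x, y} \<noteq> {a, b}" for x y
    using before_swap[OF dist that] by simp
  \<comment> \<open>A red strand is neither a nor b. So a crossing of two black strands changes no
    order between a red and a black strand, and all weights persist.\<close>
  have cr: "crossed L ?L' y x = crossed L ?L y x" if "x \<noteq> a" "x \<noteq> b" for x y
    unfolding crossed_def using bef[of y x] that by auto
  have w: "weight L ?L' y = weight L ?L y" for y
    unfolding weight_def
  proof (rule arg_cong[of _ _ "\<lambda>xs. prod_list (map colour xs)"], rule filter_cong[OF refl])
    fix x assume x: "x \<in> set L"
    show "(fst x \<noteq> Black \<and> crossed L ?L' y (snd x)) = (fst x \<noteq> Black \<and> crossed L ?L y (snd x))"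
    proof (cases "fst x")
      case (Red Q)
      then have "snd x \<noteq> a" "snd x \<noteq> b" using ne[of Q "snd x"] x ab by (metis prod.collapse)+
      then show ?thesis using cr by simp
    qed simp
  qed
  have E: "weight L ?L y \<in> P1_gr 0" for y using weight_E diagram_Tpos.prems(2) E_even by blast
  have lab: "lab rs \<in> short_labels d (Suc (length rs))"
    using IH unfolding short_labels_def by blast
  have "leads d (\<lambda>\<phi>. vec d (\<lambda>_. 1) 1 (app (act f 0) (app (T ?r) \<phi>)))
      ((\<lambda>k. weight L ?L (blacks ?L ! k)) \<circ> \<tau> ?r) (lab rs * Perm.swap ?r (Suc ?r)) (Suc (length rs))"
    by (rule leads_T) (use IH r E lab in auto)
  then have ld: "leads d (\<lambda>\<phi>. vec d (\<lambda>_. 1) 1 (app (act f 0) (app (T ?r) \<phi>)))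
      (\<lambda>k. weight L ?L' (blacks ?L' ! k)) (lab (?r # rs)) (length (?r # rs))"
    unfolding w bl by (simp add: comp_def)
  have blk: "\<forall>k<d. blacks ?L' ! k = blacks L ! Perm.apply (lab (?r # rs)) k"
    using i6 r unfolding bl by (auto simp: apply_times Perm.swap.rep_eq transpose_def)
  have befo: "\<forall>Q x y. (Red Q, x) \<in> set L \<longrightarrow> (Black, y) \<in> set L \<longrightarrow>
       ((x, y) \<in> set cs \<longleftrightarrow> before (map snd L) x y \<noteq> before (map snd ?L') x y)"
  proof (intro allI impI)
    fix Q x y assume xy: "(Red Q, x) \<in> set L" "(Black, y) \<in> set L"
    then have "x \<noteq> a" "x \<noteq> b" using ne ab by blast+
    then have "{x, y} \<noteq> {a, b}" by blast
    then show "(x, y) \<in> set cs \<longleftrightarrow> before (map snd L) x y \<noteq> before (map snd ?L') x y"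
      using IH xy bef by blast
  qed
  show ?case
  proof (intro conjI)
    show "set ?L' = set L" using i1 by auto
    show "distinct (map snd ?L')" using i2 by auto
    show "num_black (map fst ?L') = d" using i3 by simp
    show "reds ?L' = reds L" using i4 by simp
    show "\<forall>r\<in>set (?r # rs). Suc r < d" using i5 r by simp
    show "\<forall>k<d. blacks ?L' ! k = blacks L ! Perm.apply (lab (?r # rs)) k"
      by (rule blk)
    show "\<forall>Q x y. (Red Q, x) \<in> set L \<longrightarrow> (Black, y) \<in> set L \<longrightarrow> ((x, y) \<in> set cs \<longleftrightarrow> before (map snd L) x y \<noteq> before (map snd ?L') x y)"
      by (rule befo)
    show "leads d (\<lambda>\<phi>. vec d (\<lambda>_. 1) 1 (app (act ((Ident (map fst u) \<boxtimes> Tpos \<boxtimes> Ident (map fst v)) \<bullet> f) 0) \<phi>)) (\<lambda>k. weight L ?L' (blacks ?L' ! k)) (lab (?r # rs)) (length (?r # rs))"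
      using ld by simp
  qed
next
  case (diagram_Rho L u Q a b v f rs cs)
  let ?L = "u @ (Red Q, a) # (Black, b) # v" and ?L' = "u @ (Black, b) # (Red Q, a) # v"
  let ?r = "num_black (map fst u)"
  have "distinct cs" using diagram_Rho.prems by simp
  note IH = diagram_Rho.IH[OF diagram_Rho.prems(1,2) this diagram_Rho.prems(4)]
  from IH have i1: "set ?L = set L" and i2: "distinct (map snd ?L)" and i3: "num_black (map fst ?L) = d"
    and i4: "reds ?L = reds L" and i5: "\<forall>r\<in>set rs. Suc r < d"
    and i6: "\<forall>k<d. blacks ?L ! k = blacks L ! Perm.apply (lab rs) k"
    by blast+
  have r: "?r < d" using IH by auto
  have lb: "length (blacks u) = ?r" by (rule length_blacks)
  have dist: "distinct (map snd u @ a # b # map snd v)" using IH by simp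
  have ab: "(Red Q, a) \<in> set L" "(Black, b) \<in> set L" using IH by auto
  have dL: "x = y" if "(l, x) \<in> set L" "(l', y) \<in> set L" "x = y \<Longrightarrow> l = l' \<Longrightarrow> False" "x = y" for x y l l' using that by simp
  have inj: "l = l'" if "(l, x) \<in> set L" "(l', x) \<in> set L" for x l l'
    using that diagram_Rho.prems(1) by (force simp: distinct_map inj_on_def)
  have bef: "before (map snd ?L') x y = before (map snd ?L) x y" if "{x, y} \<noteq> {a, b}" for x y
    using before_swap[OF dist that] by simp
  have bab: "before (map snd ?L) a b" "\<not> before (map snd ?L) b a"
    using before_adjacent[OF dist] by auto
  have bab': "before (map snd ?L') b a" "\<not> before (map snd ?L') a b"
    using before_adjacent[of "map snd u" b a "map snd v"] dist by auto
  \<comment> \<open>The pair has not crossed before, so at the bottom it stands in the same order as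
    just below this crossing.\<close>
  have "(a, b) \<notin> set cs" using diagram_Rho.prems by simp
  then have La: "before (map snd L) a b" using IH ab bab by blast
  have cr: "crossed L ?L' y x \<longleftrightarrow> crossed L ?L y x \<or> (y = b \<and> x = a)"
    if "(Red Q', x) \<in> set L" "(Black, y) \<in> set L" for x y Q'
  proof (cases "y = b \<and> x = a")
    case True
    then show ?thesis using La bab' by (simp add: crossed_def)
  next
    case False
    have "x \<noteq> b" using that(1) ab inj by blast
    then have "{y, x} \<noteq> {a, b}" using False by (auto simp: doubleton_eq_iff)
    then show ?thesis unfolding crossed_def using bef False by blast
  qed
  have w: "weight L ?L' y = (if y = b then Q * weight L ?L y else weight L ?L y)" if y: "(Black, y) \<in> set L" for y
  proof -
    have red: "fst x \<noteq> Black \<Longrightarrow> \<exists>Q'. x = (Red Q', snd x)" for x :: "'a P1 letter \<times> nat"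
      by (cases x; cases "fst x") auto
    show ?thesis
    proof (cases "y = b")
      case True
      have "weight L ?L' y = colour (Red Q, a) * weight L ?L y"
        unfolding weight_def
      proof (rule prod_list_filter_insert)
        show "distinct L" using diagram_Rho.prems(1) by (simp add: distinct_map)
        show "(fst x \<noteq> Black \<and> crossed L ?L' y (snd x)) =
            ((fst x \<noteq> Black \<and> crossed L ?L y (snd x)) \<or> x = (Red Q, a))" if x: "x \<in> set L" for x
        proof (cases "fst x = Black")
          case True
          then show ?thesis by auto
        next
          case False
          then obtain Q' where Q': "x = (Red Q', snd x)" using red by blast
          then have "snd x = a \<longleftrightarrow> x = (Red Q, a)" using inj[of "Red Q'" "snd x" "Red Q"] x ab by (metis snd_conv)
          then show ?thesis using cr[of Q' "snd x" y] Q' x y True False by metis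
        qed
        show "colour x \<in> E" if "x \<in> set L" "fst x \<noteq> Black \<and> crossed L ?L' y (snd x)" for x
          using diagram_Rho.prems(2) that
          by (cases "fst x") (force simp: objects_def colour_def lists_eq_set image_iff)+
      qed (use ab True bab in \<open>auto simp: crossed_def\<close>)
      then show ?thesis using True by (simp add: colour_def)
    next
      case False
      have "weight L ?L' y = weight L ?L y"
        unfolding weight_def
      proof (rule arg_cong[of _ _ "\<lambda>xs. prod_list (map colour xs)"], rule filter_cong[OF refl])
        fix x assume x: "x \<in> set L"
        show "(fst x \<noteq> Black \<and> crossed L ?L' y (snd x)) = (fst x \<noteq> Black \<and> crossed L ?L y (snd x))"
          using red[of x] cr[of _ "snd x" y] x y False by metis
      qed
      then show ?thesis using False by simp
    qed
  qed
  have bl: "blacks ?L' = blacks ?L" by simp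
  have mem: "(Black, blacks ?L ! k) \<in> set L" if "k < d" for k
  proof -
    have "blacks ?L ! k \<in> set (blacks ?L)" using that IH by (intro nth_mem) (simp only: length_blacks)
    then have "(Black, blacks ?L ! k) \<in> set ?L" by (auto simp: blacks_def)
    then show ?thesis using IH by blast
  qed
  have "distinct (blacks ?L)" using IH unfolding blacks_def by (meson distinct_map_filter)
  moreover have "blacks ?L ! ?r = b" using lb by (simp add: nth_append)
  moreover have "length (blacks ?L) = d" using IH by (simp only: length_blacks)
  ultimately have bk: "blacks ?L ! k = b \<longleftrightarrow> k = ?r" if "k < d" for k
    using that r by (metis nth_eq_iff_index_eq)
  have E: "weight L ?L y \<in> P1_gr 0" for y using weight_E diagram_Rho.prems(2) E_even by blast
  let ?q = "\<lambda>k. weight L ?L (blacks ?L ! k)"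
  have "leads d (\<lambda>\<phi>. vec d (\<lambda>_. 1) 1 (app (act f 0) (app (pol ?r Q) \<phi>)))
      (?q(?r := Q * ?q ?r)) (lab rs) (length rs)"
    by (rule leads_pol) (use IH r E in auto)
  then have ld: "leads d (\<lambda>\<phi>. vec d (\<lambda>_. 1) 1 (app (act f 0) (app (pol ?r Q) \<phi>)))
      (\<lambda>k. weight L ?L' (blacks ?L' ! k)) (lab rs) (length rs)"
    by (rule leads_cong) (use w[OF mem] bk in \<open>auto simp: bl simp del: blacks_simps\<close>)
  have befo: "\<forall>Q' x y. (Red Q', x) \<in> set L \<longrightarrow> (Black, y) \<in> set L \<longrightarrow>
       ((x, y) \<in> set ((a, b) # cs) \<longleftrightarrow> before (map snd L) x y \<noteq> before (map snd ?L') x y)"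
  proof (intro allI impI)
    fix Q' x y assume xy: "(Red Q', x) \<in> set L" "(Black, y) \<in> set L"
    show "(x, y) \<in> set ((a, b) # cs) \<longleftrightarrow> before (map snd L) x y \<noteq> before (map snd ?L') x y"
    proof (cases "x = a \<and> y = b")
      case True
      then show ?thesis using La bab' by simp
    next
      case False
      have "x \<noteq> b" using xy ab inj by blast
      then have "{x, y} \<noteq> {a, b}" using False by (auto simp: doubleton_eq_iff)
      then have "before (map snd ?L') x y = before (map snd ?L) x y" by (rule bef)
      moreover have "(x, y) \<in> set cs \<longleftrightarrow> before (map snd L) x y \<noteq> before (map snd ?L) x y" using IH xy by blast
      ultimately show ?thesis using False by auto
    qed
  qed
  have blk: "\<forall>k<d. blacks ?L' ! k = blacks L ! Perm.apply (lab rs) k" unfolding bl by (rule i6)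
  show ?case
  proof (intro conjI)
    show "set ?L' = set L" using i1 by auto
    show "distinct (map snd ?L')" using i2 by auto
    show "num_black (map fst ?L') = d" using i3 by simp
    show "reds ?L' = reds L" using i4 by simp
    show "\<forall>r\<in>set rs. Suc r < d" using i5  by simp
    show "\<forall>k<d. blacks ?L' ! k = blacks L ! Perm.apply (lab rs) k"
      by (rule blk)
    show "\<forall>Q x y. (Red Q, x) \<in> set L \<longrightarrow> (Black, y) \<in> set L \<longrightarrow> ((x, y) \<in> set ((a, b) # cs) \<longleftrightarrow> before (map snd L) x y \<noteq> before (map snd ?L') x y)"
      by (rule befo)
    show "leads d (\<lambda>\<phi>. vec d (\<lambda>_. 1) 1 (app (act ((Ident (map fst u) \<boxtimes> Rho Q \<boxtimes> Ident (map fst v)) \<bullet> f) 0) \<phi>)) (\<lambda>k. weight L ?L' (blacks ?L' ! k)) (lab rs) (length rs)"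
      using ld by simp
  qed
next
  case (diagram_Lam L u b Q a v f rs cs)
  let ?L = "u @ (Black, b) # (Red Q, a) # v" and ?L' = "u @ (Red Q, a) # (Black, b) # v"
  have "distinct cs" using diagram_Lam.prems by simp
  note IH = diagram_Lam.IH[OF diagram_Lam.prems(1,2) this diagram_Lam.prems(4)]
  from IH have i1: "set ?L = set L" and i2: "distinct (map snd ?L)" and i3: "num_black (map fst ?L) = d"
    and i4: "reds ?L = reds L" and i5: "\<forall>r\<in>set rs. Suc r < d"
    and i6: "\<forall>k<d. blacks ?L ! k = blacks L ! Perm.apply (lab rs) k"
    by blast+
  have dist: "distinct (map snd u @ b # a # map snd v)" using IH by simp
  have ab: "(Red Q, a) \<in> set L" "(Black, b) \<in> set L" using IH by auto
  have inj: "l = l'" if "(l, x) \<in> set L" "(l', x) \<in> set L" for x l l'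
    using that diagram_Lam.prems(1) by (force simp: distinct_map inj_on_def)
  have bef: "before (map snd ?L') x y = before (map snd ?L) x y" if "{x, y} \<noteq> {b, a}" for x y
    using before_swap[OF dist that] by simp
  have bab: "before (map snd ?L) b a" "\<not> before (map snd ?L) a b"
    using before_adjacent[OF dist] by auto
  have bab': "before (map snd ?L') a b" "\<not> before (map snd ?L') b a"
    using before_adjacent[of "map snd u" a b "map snd v"] dist by auto
  \<comment> \<open>The black strand b starts to the left of a, so this crossing adds nothing to its
    weight, in accordance with \<open>Lam\<close> acting by 1.\<close>
  have "(a, b) \<notin> set cs" using diagram_Lam.prems by simp
  then have La: "\<not> before (map snd L) a b" using IH ab bab by blast
  have cr: "crossed L ?L' y x \<longleftrightarrow> crossed L ?L y x"
    if "(Red Q', x) \<in> set L" "(Black, y) \<in> set L" for x y Q'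
  proof (cases "y = b \<and> x = a")
    case True
    then show ?thesis using La by (simp add: crossed_def)
  next
    case False
    have "x \<noteq> b" using that(1) ab inj by blast
    then have "{y, x} \<noteq> {b, a}" using False by (auto simp: doubleton_eq_iff)
    then show ?thesis unfolding crossed_def using bef by blast
  qed
  have w: "weight L ?L' y = weight L ?L y" if y: "(Black, y) \<in> set L" for y
    unfolding weight_def
  proof (rule arg_cong[of _ _ "\<lambda>xs. prod_list (map colour xs)"], rule filter_cong[OF refl])
    fix x assume x: "x \<in> set L"
    have "fst x \<noteq> Black \<Longrightarrow> \<exists>Q'. x = (Red Q', snd x)" by (cases x; cases "fst x") auto
    then show "(fst x \<noteq> Black \<and> crossed L ?L' y (snd x)) = (fst x \<noteq> Black \<and> crossed L ?L y (snd x))"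
      using cr[of _ "snd x" y] x y by metis
  qed
  have bl: "blacks ?L' = blacks ?L" by simp
  have mem: "(Black, blacks ?L ! k) \<in> set L" if "k < d" for k
  proof -
    have "blacks ?L ! k \<in> set (blacks ?L)" using that IH by (intro nth_mem) (simp only: length_blacks)
    then have "(Black, blacks ?L ! k) \<in> set ?L" by (auto simp: blacks_def)
    then show ?thesis using IH by blast
  qed
  have "leads d (\<lambda>\<phi>. vec d (\<lambda>_. 1) 1 (app (act f 0) \<phi>)) (\<lambda>k. weight L ?L (blacks ?L ! k)) (lab rs) (length rs)"
    using IH by blast
  then have ld: "leads d (\<lambda>\<phi>. vec d (\<lambda>_. 1) 1 (app (act f 0) \<phi>)) (\<lambda>k. weight L ?L' (blacks ?L' ! k)) (lab rs) (length rs)"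
    by (rule leads_cong) (use w[OF mem] in \<open>simp add: bl del: blacks_simps\<close>)
  have befo: "\<forall>Q' x y. (Red Q', x) \<in> set L \<longrightarrow> (Black, y) \<in> set L \<longrightarrow>
       ((x, y) \<in> set ((a, b) # cs) \<longleftrightarrow> before (map snd L) x y \<noteq> before (map snd ?L') x y)"
  proof (intro allI impI)
    fix Q' x y assume xy: "(Red Q', x) \<in> set L" "(Black, y) \<in> set L"
    show "(x, y) \<in> set ((a, b) # cs) \<longleftrightarrow> before (map snd L) x y \<noteq> before (map snd ?L') x y"
    proof (cases "x = a \<and> y = b")
      case True
      then show ?thesis using La bab' by simp
    next
      case False
      have "x \<noteq> b" using xy ab inj by blast
      then have "{x, y} \<noteq> {b, a}" using False by (auto simp: doubleton_eq_iff)
      then have "before (map snd ?L') x y = before (map snd ?L) x y" by (rule bef)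
      moreover have "(x, y) \<in> set cs \<longleftrightarrow> before (map snd L) x y \<noteq> before (map snd ?L) x y" using IH xy by blast
      ultimately show ?thesis using False by auto
    qed
  qed
  have blk: "\<forall>k<d. blacks ?L' ! k = blacks L ! Perm.apply (lab rs) k" unfolding bl by (rule i6)
  show ?case
  proof (intro conjI)
    show "set ?L' = set L" using i1 by auto
    show "distinct (map snd ?L')" using i2 by auto
    show "num_black (map fst ?L') = d" using i3 by simp
    show "reds ?L' = reds L" using i4 by simp
    show "\<forall>r\<in>set rs. Suc r < d" using i5  by simp
    show "\<forall>k<d. blacks ?L' ! k = blacks L ! Perm.apply (lab rs) k"
      by (rule blk)
    show "\<forall>Q x y. (Red Q, x) \<in> set L \<longrightarrow> (Black, y) \<in> set L \<longrightarrow> ((x, y) \<in> set ((a, b) # cs) \<longleftrightarrow> before (map snd L) x y \<noteq> before (map snd ?L') x y)"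
      by (rule befo)
    show "leads d (\<lambda>\<phi>. vec d (\<lambda>_. 1) 1 (app (act ((Ident (map fst u) \<boxtimes> Lam Q \<boxtimes> Ident (map fst v)) \<bullet> f) 0) \<phi>)) (\<lambda>k. weight L ?L' (blacks ?L' ! k)) (lab rs) (length rs)"
      using ld by simp
  qed
qed

end

section \<open>Independence\<close>

lemma num_black_take_black_positions:
  "k < num_black i \<Longrightarrow> num_black (take (black_positions i ! k) i) = k \<and> black_positions i ! k < length i \<and>
    i ! (black_positions i ! k) = Black"
proof (induction i arbitrary: k rule: rev_induct)
  case (snoc y i)
  have bp: "black_positions (i @ [y]) = black_positions i @ (if y = Black then [length i] else [])"
    unfolding black_positions_def by (auto simp: nth_append intro!: filter_cong)
  have len: "length (black_positions i) = num_black i" for i :: "'a obj"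
  proof -
    have "length (black_positions i) = card {p. p < length i \<and> i ! p = Black}"
      unfolding black_positions_def by (subst distinct_card[symmetric]) (auto intro!: arg_cong[of _ _ card])
    then show ?thesis by (simp add: num_black_def length_filter_conv_card eq_commute)
  qed
  show ?case
  proof (cases "k < num_black i")
    case True
    then show ?thesis using snoc.IH[OF True] by (simp add: bp nth_append len)
  next
    case False
    then have y: "y = Black" and k: "k = num_black i" using snoc.prems by (cases y; simp)+
    have "black_positions (i @ [y]) ! k = length i" using bp y k by (simp add: nth_append len)
    then show ?thesis using y k by simp
  qed
qed simp

context LAH
begin

lemma act_on_strand: "k < num_black i \<Longrightarrow> act (on_strand i k g) 0 = act g k"
  using num_black_take_black_positions[of k i] by (simp add: on_strand_def Let_def)

lemma act_tokens: "length as \<le> num_black j \<Longrightarrow>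
    act (tokens j as) 0 = foldr (\<lambda>k F. tok k (as ! k) * F) [0..<length as] 1"
proof -
  assume len: "length as \<le> num_black j"
  have *: "set ks \<subseteq> {..<num_black j} \<Longrightarrow> act (foldr (\<lambda>k f. on_strand j k (Token (as ! k)) \<bullet> f) ks (Ident j)) 0 =
      foldr (\<lambda>k F. tok k (as ! k) * F) ks 1" for ks
    by (induction ks) (auto simp: act_on_strand)
  show ?thesis unfolding tokens_def by (rule *) (use len in auto)
qed

lemma act_dots: "length \<alpha> \<le> num_black j \<Longrightarrow>
    act (dots j \<alpha>) 0 = foldr (\<lambda>k F. dpow k (\<alpha> ! k) * F) [0..<length \<alpha>] 1"
proof -
  assume len: "length \<alpha> \<le> num_black j"
  have *: "set ks \<subseteq> {..<num_black j} \<Longrightarrow>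
      act (foldr (\<lambda>k f. term_powi j (on_strand j k Dot) (on_strand j k DotInv) (\<alpha> ! k) \<bullet> f) ks (Ident j)) 0 =
      foldr (\<lambda>k F. dpow k (\<alpha> ! k) * F) ks 1" for ks
    by (induction ks) (auto simp: act_on_strand act_term_powi)
  show ?thesis unfolding dots_def by (rule *) (use len in auto)
qed

text \<open>The tokens may be odd, which would spoil the rule for slots further to the right. They
  are inserted from the last strand down, so the slots to the left of the current one still contain
  the even factors q.\<close>

lemma vec_tokens:
  assumes "n \<le> d" "\<And>k. k < d \<Longrightarrow> q k \<in> P1_gr 0"
  shows "vec d q v (app (foldr (\<lambda>k F. tok k (as ! k) * F) [n..<d] 1) \<phi>) =
    vec d (\<lambda>k. if n \<le> k \<and> k < d then single 0 (as ! k) * q k else q k) v \<phi>"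
  using assms(1)
proof (induction arbitrary: \<phi> rule: inc_induct)
  case base
  then show ?case by (simp add: vec_def cong: if_cong) (metis leD)
next
  case (step n)
  let ?q = "\<lambda>k. if Suc n \<le> k \<and> k < d then single 0 (as ! k) * q k else q k"
  have "vec d q v (app (foldr (\<lambda>k F. tok k (as ! k) * F) [n..<d] 1) \<phi>) = vec d ?q v (app (tok n (as ! n)) \<phi>)"
    using step by (simp add: upt_conv_Cons)
  also have "\<dots> = vec d (?q(n := single 0 (as ! n) * ?q n)) v \<phi>"
    unfolding vec_def using step assms(2) by (intro vecr_tok) auto
  also have "?q(n := single 0 (as ! n) * ?q n) = (\<lambda>k. if n \<le> k \<and> k < d then single 0 (as ! k) * q k else q k)"
    using step by (auto simp: fun_eq_iff)
  finally show ?case .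
qed

lemma vec_dots:
  assumes "n \<le> d"
  shows "vec d q v (app (foldr (\<lambda>k F. dpow k (\<alpha> ! k) * F) [n..<d] 1) \<phi>) =
    vec d (\<lambda>k. if n \<le> k \<and> k < d then single (\<alpha> ! k) 1 * q k else q k) v \<phi>"
  using assms
proof (induction arbitrary: \<phi> rule: inc_induct)
  case base
  then show ?case by (simp add: vec_def cong: if_cong) (metis leD)
next
  case (step n)
  let ?q = "\<lambda>k. if Suc n \<le> k \<and> k < d then single (\<alpha> ! k) 1 * q k else q k"
  have "vec d q v (app (foldr (\<lambda>k F. dpow k (\<alpha> ! k) * F) [n..<d] 1) \<phi>) = vec d ?q v (app (dpow n (\<alpha> ! n)) \<phi>)"
    using step by (simp add: upt_conv_Cons)
  also have "\<dots> = vec d (?q(n := single (\<alpha> ! n) 1 * ?q n)) v \<phi>"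
    unfolding vec_def using step by (intro vecr_dpow) auto
  also have "?q(n := single (\<alpha> ! n) 1 * ?q n) = (\<lambda>k. if n \<le> k \<and> k < d then single (\<alpha> ! k) 1 * q k else q k)"
    using step by (auto simp: fun_eq_iff)
  finally show ?case .
qed

text \<open>The image of the tensor of units with trivial label. This one vector already separates
  the elements of the basis.\<close>

definition ev :: "nat \<Rightarrow> ('a, 'k) mor \<Rightarrow> (st \<Rightarrow> 'k) \<Rightarrow> 'k" where
  "ev d f \<phi> = vec d (\<lambda>_. 1) 1 (app (act f 0) \<phi>)"

lemma ev_zero_fun: "ev d f (\<lambda>_. 0) = 0"
proof -
  have "app (act f 0) (\<lambda>_. 0) = (\<lambda>_. 0 :: 'k)" by (rule ext) simp
  then show ?thesis using vecr_scale[of d _ _ _ _ 0 "\<lambda>_. 0"] by (simp add: ev_def vec_def)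
qed

lemma ev_add: "ev d (f \<boxplus> g) \<phi> = ev d f \<phi> + ev d g \<phi>"
proof -
  have "app (act (f \<boxplus> g) 0) \<phi> = (\<lambda>x. app (act f 0) \<phi> x + app (act g 0) \<phi> x)" by (rule ext) simp
  then show ?thesis by (simp only: ev_def vec_def vecr_add)
qed

lemma ev_scale: "ev d (Scale c f) \<phi> = c * ev d f \<phi>"
proof -
  have "app (act (Scale c f) 0) \<phi> = app (act f 0) (\<lambda>x. c * \<phi> x)" by (rule ext) (simp add: sc.rep_eq)
  also have "\<dots> = (\<lambda>x. c * app (act f 0) \<phi> x)" by (rule ext) (simp add: app_scale)
  finally show ?thesis by (simp only: ev_def vec_def vecr_scale)
qed

lemma ev_eqv: "eqv i j f g \<Longrightarrow> ev d f = ev d g"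
  using eqv_act by (auto simp: ev_def)

lemma leads_basis:
  assumes "leads d (ev d f) q v l" "\<And>k. k < d \<Longrightarrow> q k \<in> P1_gr 0"
    "num_black j = d" "length as = d" "length \<alpha> = d"
  shows "leads d (ev d (tokens j as \<bullet> dots j \<alpha> \<bullet> f)) (\<lambda>k. single (\<alpha> ! k) (as ! k) * q k) v l"
proof -
  obtain w where w: "\<And>\<phi>. ev d f \<phi> = vec d q v \<phi> + w \<phi>" "supported_on (short_labels d l) w"
    using assms(1) unfolding leads_def by blast
  let ?T = "foldr (\<lambda>k F. tok k (as ! k) * F) [0..<d] 1" and ?D = "foldr (\<lambda>k F. dpow k (\<alpha> ! k) * F) [0..<d] 1"
  have keeps: "keeps_label (foldr (\<lambda>k F. G k * F) ks 1)" if "\<And>k. keeps_label (G k)" for G :: "nat \<Rightarrow> (st, 'k) lop" and ks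
    by (induction ks) (auto simp: keeps_label_one intro: keeps_label_mult that)
  have even: "single r 1 * g \<in> P1_gr 0" if "g \<in> P1_gr 0" for g r
    by (rule P1_gr_zero_mult[OF _ that]) (auto simp: P1_gr_def lookup_single when_def gr_one)
  have "ev d (tokens j as \<bullet> dots j \<alpha> \<bullet> f) \<phi> = ev d f (app (?T * ?D) \<phi>)" for \<phi>
    using assms by (simp add: ev_def act_tokens act_dots)
  moreover have "vec d q v (app (?T * ?D) \<phi>) = vec d (\<lambda>k. single (\<alpha> ! k) (as ! k) * q k) v \<phi>" for \<phi>
  proof -
    have "vec d q v (app (?T * ?D) \<phi>) = vec d (\<lambda>k. if 0 \<le> k \<and> k < d then single (\<alpha> ! k) 1 * q k else q k) v (app ?T \<phi>)"
      by (simp only: times_lop.rep_eq vec_dots[OF le0])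
    also have "\<dots> = vec d (\<lambda>k. if 0 \<le> k \<and> k < d then single 0 (as ! k) *
        (if 0 \<le> k \<and> k < d then single (\<alpha> ! k) 1 * q k else q k)
        else (if 0 \<le> k \<and> k < d then single (\<alpha> ! k) 1 * q k else q k)) v \<phi>"
      by (rule vec_tokens) (use assms(2) even in auto)
    also have "\<dots> = vec d (\<lambda>k. single (\<alpha> ! k) (as ! k) * q k) v \<phi>"
      unfolding vec_def by (subst vecr_cong[of d _ "\<lambda>k. single (\<alpha> ! k) (as ! k) * q k"])
        (simp_all add: mult_single flip: mult.assoc)
    finally show ?thesis .
  qed
  moreover have "supported_on (short_labels d l) (\<lambda>\<phi>. w (app (?T * ?D) \<phi>))"
    by (intro supported_on_keeps_label[OF w(2)] keeps_label_mult keeps keeps_label_tok keeps_label_dpow)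
  ultimately show ?thesis
    unfolding leads_def by (intro exI[of _ "\<lambda>\<phi>. w (app (?T * ?D) \<phi>)"]) (simp add: w(1))
qed

subsection \<open>Diagrams of the same permutation\<close>

definition wlab :: "(nat \<Rightarrow> nat) \<Rightarrow> nat perm" where
  "wlab w = (SOME v. \<forall>rs. word_perm rs = w \<longrightarrow> v = lab rs)"

lemma wlab_eq: "word_perm rs = w \<Longrightarrow> wlab w = lab rs"
proof -
  assume w: "word_perm rs = w"
  have "\<exists>v. \<forall>rs. word_perm rs = w \<longrightarrow> v = lab rs" using w lab_eq_iff by metis
  from someI_ex[OF this] show ?thesis using w unfolding wlab_def by blast
qed

definition len :: "nat \<Rightarrow> (nat \<Rightarrow> nat) \<Rightarrow> nat" where
  "len d w = (LEAST n. \<exists>rs. expression_for d w rs \<and> length rs = n)"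

lemma len_eq: "reduced_expression d w rs \<Longrightarrow> len d w = length rs"
  unfolding len_def reduced_expression_def by (intro Least_equality) auto

text \<open>A choice of diagram, made so that the leading term can be named as a function of i, j
  and w. \<open>leads_diagram_for\<close> shows that every other diagram has the same top
  word.\<close>

definition top_word :: "nat \<Rightarrow> 'a obj \<Rightarrow> 'a obj \<Rightarrow> (nat \<Rightarrow> nat) \<Rightarrow> ('a P1 letter \<times> nat) list" where
  "top_word d i j w = (SOME L'. \<exists>(f :: ('a, 'k) mor) rs cs. diagram (zip i [0..<length i]) L' f rs cs \<and> map fst L' = j \<and>
     reduced_expression d w rs \<and> distinct cs)"

definition qw :: "nat \<Rightarrow> 'a obj \<Rightarrow> 'a obj \<Rightarrow> (nat \<Rightarrow> nat) \<Rightarrow> nat \<Rightarrow> 'a P1" where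
  "qw d i j w k = weight (zip i [0..<length i]) (top_word d i j w) (blacks (top_word d i j w) ! k)"

lemma qw_E: "i \<in> objects \<Longrightarrow> qw d i j w k \<in> E"
  unfolding qw_def by (rule weight_E) simp

text \<open>The permutation fixes the order of the black labels at the top, and the red labels keep
  their order. So two diagrams for w have the same labelled top word, hence the same
  weights.\<close>

lemma leads_diagram_for:
  assumes f: "diagram_for d j w i f" and i: "i \<in> objects" "num_black i = d"
  shows "leads d (ev d f) (qw d i j w) (wlab w) (len d w)" "wlab w \<notin> short_labels d (len d w)"
proof -
  let ?L = "zip i [0..<length i]"
  have L: "map fst ?L = i" "distinct (map snd ?L)" by simp_all
  obtain L' rs cs where d: "diagram ?L L' f rs cs" "map fst L' = j" "reduced_expression d w rs" "distinct cs"
    using f unfolding diagram_for_def by blast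
  have "\<exists>L' (f :: ('a, 'k) mor) rs cs. diagram ?L L' f rs cs \<and> map fst L' = j \<and> reduced_expression d w rs \<and> distinct cs"
    using d by blast
  from someI_ex[OF this] obtain f2 :: "('a, 'k) mor" and rs2 cs2 where
    d2: "diagram ?L (top_word d i j w) f2 rs2 cs2" "map fst (top_word d i j w) = j"
      "reduced_expression d w rs2" "distinct cs2"
    unfolding top_word_def by blast
  note inv = diagram_invariant[OF d(1) L(2) _ d(4), of d, unfolded L(1), OF i(1) i(2)[symmetric]]
  note inv2 = diagram_invariant[OF d2(1) L(2) _ d2(4), of d, unfolded L(1), OF i(1) i(2)[symmetric]]
  from inv have b1: "\<forall>k<d. blacks L' ! k = blacks ?L ! Perm.apply (lab rs) k" "num_black (map fst L') = d"
    "reds L' = reds ?L" by blast+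
  from inv2 have b2: "\<forall>k<d. blacks (top_word d i j w) ! k = blacks ?L ! Perm.apply (lab rs2) k"
    "num_black (map fst (top_word d i j w)) = d" "reds (top_word d i j w) = reds ?L" by blast+
  have w: "word_perm rs = w" "word_perm rs2 = w"
    using d(3) d2(3) by (auto simp: reduced_expression_def expression_for_def)
  have "blacks L' = blacks (top_word d i j w)"
  proof (rule nth_equalityI)
    show "length (blacks L') = length (blacks (top_word d i j w))"
      using b1 b2 by (simp add: length_blacks)
    fix k assume "k < length (blacks L')"
    then have "k < d" using b1 by (simp add: length_blacks)
    moreover have "lab rs = lab rs2" using w lab_eq_iff by simp
    ultimately show "blacks L' ! k = blacks (top_word d i j w) ! k" using b1(1) b2(1) by simp
  qed
  moreover have "reds L' = reds (top_word d i j w)" using b1 b2 by simp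
  ultimately have L': "L' = top_word d i j w"
    by (intro labelled_word_eqI[OF trans[OF d(2) d2(2)[symmetric]]])
  have "leads d (\<lambda>\<phi>. vec d (\<lambda>_. 1) 1 (app (act f 0) \<phi>)) (\<lambda>k. weight ?L L' (blacks L' ! k)) (lab rs) (length rs)"
    using inv by blast
  moreover have "ev d f = (\<lambda>\<phi>. vec d (\<lambda>_. 1) 1 (app (act f 0) \<phi>))" by (rule ext) (simp add: ev_def)
  moreover have "qw d i j w = (\<lambda>k. weight ?L L' (blacks L' ! k))" by (rule ext) (simp add: qw_def L')
  ultimately show "leads d (ev d f) (qw d i j w) (wlab w) (len d w)"
    using len_eq[OF d(3)] wlab_eq[OF w(1)] by simp
  show "wlab w \<notin> short_labels d (len d w)"
    using lab_notin_short_labels[OF d(3)] len_eq[OF d(3)] wlab_eq[OF w(1)] by simp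
qed

definition bterm :: "'a obj \<Rightarrow> ((nat \<Rightarrow> nat) \<Rightarrow> ('a, 'k) mor) \<Rightarrow> 'a list \<times> int list \<times> (nat \<Rightarrow> nat) \<Rightarrow> ('a, 'k) mor" where
  "bterm j F = (\<lambda>(as, \<alpha>, w). tokens j as \<bullet> dots j \<alpha> \<bullet> F w)"

lemma short_labels_mono: "l \<le> l' \<Longrightarrow> short_labels d l \<subseteq> short_labels d l'"
  unfolding short_labels_def by auto

text \<open>A test function concentrated at a label that the remainder does not reach sees the
  leading tensor alone.\<close>

lemma leads_at_label:
  assumes "leads d u q v l" "v0 \<notin> short_labels d l" "u (\<lambda>_. 0) = 0"
  shows "u (\<lambda>(\<beta>, \<alpha>, v). of_bool (v = v0) * \<phi> (\<beta>, \<alpha>, v)) = of_bool (v = v0) * vec d q v \<phi>"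
proof -
  let ?\<phi> = "\<lambda>(\<beta>, \<alpha>, v). of_bool (v = v0) * \<phi> (\<beta>, \<alpha>, v)"
  obtain w where w: "\<And>\<phi>. u \<phi> = vec d q v \<phi> + w \<phi>" "supported_on (short_labels d l) w"
    using assms(1) unfolding leads_def by blast
  have "vec d q v (\<lambda>_. 0) = 0" using vecr_scale[of d _ _ _ _ 0 "\<lambda>_. 0"] by (simp add: vec_def)
  then have "w (\<lambda>_. 0) = 0" using w(1)[of "\<lambda>_. 0"] assms(3) by simp
  moreover have "w ?\<phi> = w (\<lambda>_. 0)" using w(2) assms(2) unfolding supported_on_def
    by (elim allE[of _ ?\<phi>] allE[of _ "\<lambda>_. 0"] impE) auto
  moreover have "vec d q v ?\<phi> = vec d q v (\<lambda>x. of_bool (v = v0) * \<phi> x)"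
    using vec_supported[of v d q] unfolding supported_on_def by (elim allE impE) auto
  ultimately show ?thesis using w(1)[of ?\<phi>] by (simp add: vec_def vecr_scale)
qed

text \<open>U is a remainder that shorter labels may carry: U = 0 gives independence, and for the
  difference of two diagrams of one permutation it shows that only shorter permutations enter. The
  family F is given on a set W, so that it also applies to normal forms.\<close>

lemma leading_coefficients_vanish:
  assumes i: "i \<in> objects" "num_black i = d" and j: "num_black j = d"
    and F: "\<And>w. w \<in> W \<Longrightarrow> diagram_for d j w i (F w)" and W: "\<And>w. w \<in> W \<Longrightarrow> w permutes {..<d}"
    and Ys: "finite Ys" "Ys \<subseteq> basis_index d B" "\<And>as \<alpha> w. (as, \<alpha>, w) \<in> Ys \<Longrightarrow> w \<in> W"
    and sum: "\<And>\<phi>. (\<Sum>x\<in>Ys. c x * ev d (bterm j F x) \<phi>) = U \<phi>" and U: "supported_on (short_labels d l) U"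
    and x: "(as, \<alpha>, w) \<in> Ys" "l \<le> len d w"
  shows "c (as, \<alpha>, w) = 0"
proof (rule ccontr)
  assume "c (as, \<alpha>, w) \<noteq> 0"
  define X' where "X' = {x \<in> Ys. c x \<noteq> 0}"
  \<comment> \<open>At the greatest length m that occurs with a nonzero coefficient, the label of w0
    is reached neither by the remainder of any term nor by U, so the leading terms for w0 remain
    alone.\<close>
  define m where "m = Max ((\<lambda>x. len d (snd (snd x))) ` X')"
  have X': "finite X'" "X' \<noteq> {}" "(as, \<alpha>, w) \<in> X'" using Ys x \<open>c (as, \<alpha>, w) \<noteq> 0\<close> by (auto simp: X'_def)
  have "m \<in> (\<lambda>x. len d (snd (snd x))) ` X'" unfolding m_def using X' by (intro Max_in) auto
  then obtain x0 where x0: "x0 \<in> X'" "m = len d (snd (snd x0))" by blast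
  obtain as0 \<alpha>0 w0 where x0e: "x0 = (as0, \<alpha>0, w0)" by (cases x0)
  have le: "len d (snd (snd x)) \<le> m" if "x \<in> X'" for x unfolding m_def using X' that by (intro Max_ge) auto
  have w0: "w0 \<in> W" using Ys(3) x0 by (auto simp: X'_def x0e)
  have v0: "wlab w0 \<notin> short_labels d m"
    using leads_diagram_for(2)[OF F[OF w0] i] x0 by (simp add: x0e)
  have "l \<le> m" using x(2) le[OF X'(3)] by simp
  have wlab_inj: "w1 = w2" if w12: "w1 \<in> W" "w2 \<in> W" "wlab w1 = wlab w2" for w1 w2
  proof -
    obtain rs1 rs2 where "word_perm rs1 = w1" "word_perm rs2 = w2"
      using F[OF w12(1)] F[OF w12(2)] by (auto simp: diagram_for_def reduced_expression_def expression_for_def)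
    then show ?thesis using w12(3) wlab_eq lab_eq_iff by metis
  qed
  define X0 where "X0 = {x \<in> X'. snd (snd x) = w0}"
  have zero: "(\<Sum>x\<in>X0. c x * vec d (\<lambda>k. single (fst (snd x) ! k) (fst x ! k) * qw d i j w0 k) (wlab w0) \<phi>) = 0" for \<phi>
  proof -
    let ?\<phi> = "\<lambda>(\<beta>, \<alpha>, v). of_bool (v = wlab w0) * \<phi> (\<beta>, \<alpha>, v)"
    have ev: "ev d (bterm j F x) ?\<phi> = of_bool (wlab (snd (snd x)) = wlab w0) *
        vec d (\<lambda>k. single (fst (snd x) ! k) (fst x ! k) * qw d i j (snd (snd x)) k) (wlab (snd (snd x))) \<phi>"
      if "x \<in> X'" for x
    proof (rule leads_at_label)
      obtain bs \<gamma> u where xe: "x = (bs, \<gamma>, u)" by (cases x)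
      have u: "u \<in> W" "length bs = d" "length \<gamma> = d"
        using that Ys by (auto simp: X'_def xe basis_index_def)
      show "leads d (ev d (bterm j F x)) (\<lambda>k. single (fst (snd x) ! k) (fst x ! k) * qw d i j (snd (snd x)) k)
          (wlab (snd (snd x))) (len d (snd (snd x)))"
        using leads_basis[OF leads_diagram_for(1)[OF F[OF u(1)] i] _ j u(2,3)] E_even[OF qw_E[OF i(1)]]
        by (simp add: xe bterm_def)
      show "wlab w0 \<notin> short_labels d (len d (snd (snd x)))"
        using v0 short_labels_mono[OF le[OF that]] by blast
    qed (rule ev_zero_fun)
    have "(\<Sum>x\<in>Ys. c x * ev d (bterm j F x) ?\<phi>) = (\<Sum>x\<in>X'. c x * ev d (bterm j F x) ?\<phi>)"
      using Ys(1) by (intro sum.mono_neutral_right) (auto simp: X'_def)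
    also have "\<dots> = (\<Sum>x\<in>X'. if x \<in> X0 then c x *
        vec d (\<lambda>k. single (fst (snd x) ! k) (fst x ! k) * qw d i j w0 k) (wlab w0) \<phi> else 0)"
    proof (rule sum.cong[OF refl])
      fix x assume x: "x \<in> X'"
      have "snd (snd x) \<in> W" using x Ys(3) by (cases x) (auto simp: X'_def)
      then have "wlab (snd (snd x)) = wlab w0 \<longleftrightarrow> snd (snd x) = w0" using wlab_inj w0 by blast
      then show "c x * ev d (bterm j F x) ?\<phi> = (if x \<in> X0 then c x *
        vec d (\<lambda>k. single (fst (snd x) ! k) (fst x ! k) * qw d i j w0 k) (wlab w0) \<phi> else 0)"
        unfolding ev[OF x] using x by (simp add: X0_def)
    qed
    also have "\<dots> = (\<Sum>x\<in>X0. c x * vec d (\<lambda>k. single (fst (snd x) ! k) (fst x ! k) * qw d i j w0 k) (wlab w0) \<phi>)"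
      using X'(1) by (intro sum.mono_neutral_cong_right) (auto simp: X0_def)
    finally have "\<dots> = U ?\<phi>" using sum[of ?\<phi>] by simp
    also have "U ?\<phi> = U (\<lambda>_. 0)"
      using U v0 short_labels_mono[OF \<open>l \<le> m\<close>] unfolding supported_on_def
      by (elim allE[of _ ?\<phi>] allE[of _ "\<lambda>_. 0"] impE) auto
    also have "\<dots> = 0" using sum[of "\<lambda>_. 0"] by (simp add: ev_zero_fun)
    finally show ?thesis .
  qed
  \<comment> \<open>For fixed w0 an index becomes a list of pairs of a basis element and an
    exponent, as in \<open>vecr_independent\<close>.\<close>
  define g where "g x = zip (fst x) (fst (snd x))" for x :: "'a list \<times> int list \<times> (nat \<Rightarrow> nat)"
  define h where "h y = (map fst y, map snd y, w0)" for y :: "('a \<times> int) list"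
  have lens: "length (fst x) = d \<and> length (fst (snd x)) = d \<and> set (fst x) \<subseteq> B" if "x \<in> X0" for x
    using that Ys(2) by (cases x) (auto simp: X0_def X'_def basis_index_def)
  have hg: "h (g x) = x" if "x \<in> X0" for x
    using lens[OF that] that by (cases x) (auto simp: h_def g_def X0_def)
  have "c (h (g x0)) = 0"
  proof (rule vecr_independent[of d "qw d i j w0" "g ` X0" "\<lambda>y. c (h y)" "\<lambda>_. 0" "\<lambda>_. 0" "wlab w0"])
    show "regular (qw d i j w0 k)" for k using E_regular qw_E i(1) by blast
    show "finite (g ` X0)" using X'(1) by (simp add: X0_def)
    show "length y = d \<and> set y \<subseteq> B \<times> UNIV" if y: "y \<in> g ` X0" for y
    proof -
      obtain x where x: "x \<in> X0" "y = g x" using y by auto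
      show ?thesis using lens[OF x(1)] x(2) by (auto simp: g_def dest: set_zip_leftD)
    qed
    show "g x0 \<in> g ` X0" using x0 by (auto simp: X0_def x0e)
    fix \<phi> :: "st \<Rightarrow> 'k"
    have inj: "inj_on g X0" using hg by (metis inj_onI)
    have "(\<Sum>y\<in>g ` X0. c (h y) * vecr d (\<lambda>k. single (snd (y ! k)) (fst (y ! k)) * qw d i j w0 k) (\<lambda>_. 0) (\<lambda>_. 0) (wlab w0) \<phi>) =
        (\<Sum>x\<in>X0. c x * vec d (\<lambda>k. single (fst (snd x) ! k) (fst x ! k) * qw d i j w0 k) (wlab w0) \<phi>)"
      unfolding sum.reindex[OF inj] o_def vec_def
    proof (rule sum.cong[OF refl])
      fix x assume x: "x \<in> X0"
      have "vecr d (\<lambda>k. single (snd (g x ! k)) (fst (g x ! k)) * qw d i j w0 k) =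
          vecr d (\<lambda>k. single (fst (snd x) ! k) (fst x ! k) * qw d i j w0 k)"
        using lens[OF x] by (intro vecr_cong) (simp add: g_def)
      then show "c (h (g x)) * vecr d (\<lambda>k. single (snd (g x ! k)) (fst (g x ! k)) * qw d i j w0 k) (\<lambda>_. 0) (\<lambda>_. 0) (wlab w0) \<phi> =
          c x * vecr d (\<lambda>k. single (fst (snd x) ! k) (fst x ! k) * qw d i j w0 k) (\<lambda>_. 0) (\<lambda>_. 0) (wlab w0) \<phi>"
        using hg[OF x] by simp
    qed
    then show "(\<Sum>y\<in>g ` X0. c (h y) * vecr d (\<lambda>k. single (snd (y ! k)) (fst (y ! k)) * qw d i j w0 k) (\<lambda>_. 0) (\<lambda>_. 0) (wlab w0) \<phi>) = 0"
      using zero by simp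
  qed
  moreover have "x0 \<in> X0" using x0 by (simp add: X0_def x0e)
  ultimately show False using hg x0 by (simp add: X'_def)
qed

end

section \<open>The category of classes of terms\<close>

context LAH
begin

text \<open>Source and target are computed from the term, so classes can be handled without them. An
  ill-typed term has the empty class; on well-typed terms this is \<open>cls\<close>.\<close>

definition cl :: "('a, 'k) mor \<Rightarrow> ('a, 'k) mor set" where
  "cl f = {g. eqv (dom_of f) (cod_of f) f g}"

lemma eqv_dom_cod: "eqv i j f g \<Longrightarrow> wt f \<and> wt g \<and> dom_of f = i \<and> cod_of f = j \<and> dom_of g = i \<and> cod_of g = j"
  using eqv_arrow arrow_iff by metis

lemma cl_self_iff: "f \<in> cl f \<longleftrightarrow> wt f"
  unfolding cl_def using eqv_refl[of f] eqv_dom_cod arrow_iff by blast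

lemma cl_ill_typed: "\<not> wt f \<Longrightarrow> cl f = {}"
  unfolding cl_def using eqv_dom_cod by blast

lemma cl_eqI: "eqv i j f g \<Longrightarrow> cl f = cl g"
  using eqv_dom_cod[of i j f g] unfolding cl_def by (auto intro: eqv_trans eqv_sym)

lemma cl_eq_iff: "cl f = cl g \<longleftrightarrow> (\<not> wt f \<and> \<not> wt g) \<or> eqv (dom_of f) (cod_of f) f g"
proof
  assume e: "cl f = cl g"
  show "(\<not> wt f \<and> \<not> wt g) \<or> eqv (dom_of f) (cod_of f) f g"
  proof (cases "wt g")
    case True
    then have "g \<in> cl f" using e cl_self_iff by simp
    then show ?thesis by (simp add: cl_def)
  next
    case False
    then show ?thesis using e cl_ill_typed[of g] cl_self_iff[of f] by auto
  qed
qed (auto simp: cl_ill_typed dest: cl_eqI)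

lemma cl_eqD: "cl f = cl g \<Longrightarrow> wt f = wt g \<and> (wt f \<longrightarrow> dom_of f = dom_of g \<and> cod_of f = cod_of g)"
  unfolding cl_eq_iff using eqv_dom_cod by metis

lemma cls_eq: "arrow f i j \<Longrightarrow> cls i j f = cl f"
  by (auto simp: cls_def cl_def arrow_iff)

text \<open>Sets that are not classes are sent to the class \<open>{}\<close> of the ill-typed terms. In this way most laws of
  the category hold without assumptions on the types.\<close>

definition lift1 :: "(('a, 'k) mor \<Rightarrow> ('a, 'k) mor) \<Rightarrow> ('a, 'k) mor set \<Rightarrow> ('a, 'k) mor set" where
  "lift1 op F = (if F \<in> range cl then \<Union>f\<in>F. cl (op f) else {})"

definition lift2 :: "(('a, 'k) mor \<Rightarrow> ('a, 'k) mor \<Rightarrow> ('a, 'k) mor) \<Rightarrow>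
    ('a, 'k) mor set \<Rightarrow> ('a, 'k) mor set \<Rightarrow> ('a, 'k) mor set" where
  "lift2 op F G = (if F \<in> range cl \<and> G \<in> range cl then \<Union>f\<in>F. \<Union>g\<in>G. cl (op f g) else {})"

definition comp (infixr \<open>\<star>\<close> 70) where "comp = lift2 (\<bullet>)"
definition tens2 (infixr \<open>\<bowtie>\<close> 75) where "tens2 = lift2 (\<boxtimes>)"
definition plus (infixl \<open>\<squnion>\<close> 65) where "plus = lift2 (\<boxplus>)"
definition scal :: "'k \<Rightarrow> ('a, 'k) mor set \<Rightarrow> ('a, 'k) mor set" where "scal c = lift1 (Scale c)"

lemma UN_cl_const: "(\<And>f. f \<in> F \<Longrightarrow> H f = K) \<Longrightarrow> F \<noteq> {} \<Longrightarrow> (\<Union>f\<in>F. H f) = K"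
  by auto

lemma mem_cl: "f' \<in> cl f \<Longrightarrow> eqv (dom_of f) (cod_of f) f f'"
  by (simp add: cl_def)

lemma lift1_cl:
  assumes "\<And>f. \<not> wt f \<Longrightarrow> \<not> wt (op f)"
    and "\<And>f f'. eqv (dom_of f) (cod_of f) f f' \<Longrightarrow> cl (op f') = cl (op f)"
  shows "lift1 op (cl f) = cl (op f)"
proof (cases "wt f")
  case True
  then have "cl f \<noteq> {}" using cl_self_iff by blast
  then have "(\<Union>f'\<in>cl f. cl (op f')) = cl (op f)" using assms(2) mem_cl by (intro UN_cl_const) blast
  then show ?thesis by (simp add: lift1_def)
next
  case False
  then show ?thesis using assms(1)[OF False] by (simp add: lift1_def cl_ill_typed)
qed

lemma lift2_cl:
  assumes "\<And>f g. \<not> wt f \<or> \<not> wt g \<Longrightarrow> \<not> wt (op f g)"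
    and "\<And>f f' g g'. eqv (dom_of f) (cod_of f) f f' \<Longrightarrow> eqv (dom_of g) (cod_of g) g g' \<Longrightarrow> cl (op f' g') = cl (op f g)"
  shows "lift2 op (cl f) (cl g) = cl (op f g)"
proof (cases "wt f \<and> wt g")
  case True
  then have ne: "cl f \<noteq> {}" "cl g \<noteq> {}" using cl_self_iff by blast+
  have "(\<Union>f'\<in>cl f. \<Union>g'\<in>cl g. cl (op f' g')) = cl (op f g)"
    using ne assms(2) mem_cl by (intro UN_cl_const) blast+
  then show ?thesis by (simp add: lift2_def)
next
  case False
  then show ?thesis using assms(1)[of f g] by (auto simp: lift2_def cl_ill_typed)
qed

lemma cl_Comp: "cl f \<star> cl g = cl (f \<bullet> g)"
  unfolding comp_def
proof (rule lift2_cl)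
  fix f f' g g' assume e: "eqv (dom_of f) (cod_of f) f f'" "eqv (dom_of g) (cod_of g) g g'"
  show "cl (f' \<bullet> g') = cl (f \<bullet> g)"
  proof (cases "cod_of g = dom_of f")
    case True
    then show ?thesis using cl_eqI[OF eqv_Comp[of "dom_of g" "cod_of g" g g' "cod_of f" f f']] e by simp
  next
    case False
    then have "\<not> wt (f \<bullet> g)" "\<not> wt (f' \<bullet> g')" using eqv_dom_cod[OF e(1)] eqv_dom_cod[OF e(2)] by auto
    then show ?thesis using cl_ill_typed by blast
  qed
qed auto

lemma cl_Tensor: "cl f \<bowtie> cl g = cl (f \<boxtimes> g)"
  unfolding tens2_def by (rule lift2_cl) (auto intro!: cl_eqI[OF eqv_sym, OF eqv_Tensor])

lemma cl_Add: "cl f \<squnion> cl g = cl (f \<boxplus> g)"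
  unfolding plus_def
proof (rule lift2_cl)
  fix f f' g g' assume e: "eqv (dom_of f) (cod_of f) f f'" "eqv (dom_of g) (cod_of g) g g'"
  show "cl (f' \<boxplus> g') = cl (f \<boxplus> g)"
  proof (cases "dom_of g = dom_of f \<and> cod_of g = cod_of f")
    case True
    then show ?thesis using cl_eqI[OF eqv_Add[of "dom_of f" "cod_of f" f f' g g']] e by simp
  next
    case False
    then have "\<not> wt (f \<boxplus> g)" "\<not> wt (f' \<boxplus> g')" using eqv_dom_cod[OF e(1)] eqv_dom_cod[OF e(2)] by auto
    then show ?thesis using cl_ill_typed by blast
  qed
qed auto

lemma cl_Scale: "scal c (cl f) = cl (Scale c f)"
  unfolding scal_def by (rule lift1_cl) (auto intro!: cl_eqI[OF eqv_sym, OF eqv_Scale])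

lemmas cl_ops = cl_Comp cl_Tensor cl_Add cl_Scale

lemma ops_not_class:
  "F \<notin> range cl \<Longrightarrow> F \<star> G = {}" "G \<notin> range cl \<Longrightarrow> F \<star> G = {}"
  "F \<notin> range cl \<Longrightarrow> F \<bowtie> G = {}" "G \<notin> range cl \<Longrightarrow> F \<bowtie> G = {}"
  "F \<notin> range cl \<Longrightarrow> F \<squnion> G = {}" "G \<notin> range cl \<Longrightarrow> F \<squnion> G = {}"
  "F \<notin> range cl \<Longrightarrow> scal c F = {}"
  by (auto simp: comp_def tens2_def plus_def scal_def lift1_def lift2_def)

lemma empty_ops [simp]:
  "{} \<star> G = {}" "F \<star> {} = {}" "{} \<bowtie> G = {}" "F \<bowtie> {} = {}"
  "{} \<squnion> G = {}" "F \<squnion> {} = {}" "scal c {} = {}"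
  by (auto simp: comp_def tens2_def plus_def scal_def lift1_def lift2_def)

lemma class_cases: obtains f where "F = cl f" | "F \<notin> range cl"
  by auto

lemma cl_eqI': "(wt f \<or> wt g \<Longrightarrow> eqv (dom_of f) (cod_of f) f g) \<Longrightarrow> cl f = cl g"
  using cl_eq_iff by blast

lemma comp_assoc': "(F \<star> G) \<star> H = F \<star> (G \<star> H)"
proof -
  have "cl ((f \<bullet> g) \<bullet> h) = cl (f \<bullet> (g \<bullet> h))" for f g h
    by (rule cl_eqI') (auto simp: arrow_iff intro!: comp_assoc)
  then show ?thesis by (cases F rule: class_cases; cases G rule: class_cases; cases H rule: class_cases)
    (simp_all add: cl_ops ops_not_class)
qed

lemma tens2_assoc: "(F \<bowtie> G) \<bowtie> H = F \<bowtie> (G \<bowtie> H)"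
proof -
  have "cl ((f \<boxtimes> g) \<boxtimes> h) = cl (f \<boxtimes> (g \<boxtimes> h))" for f g h
    by (rule cl_eqI') (auto simp: arrow_iff intro!: tensor_assoc)
  then show ?thesis by (cases F rule: class_cases; cases G rule: class_cases; cases H rule: class_cases)
    (simp_all add: cl_ops ops_not_class)
qed

lemma plus_assoc: "(F \<squnion> G) \<squnion> H = F \<squnion> (G \<squnion> H)"
proof -
  have "cl ((f \<boxplus> g) \<boxplus> h) = cl (f \<boxplus> (g \<boxplus> h))" for f g h
    by (rule cl_eqI') (auto simp: arrow_iff intro!: add_assoc)
  then show ?thesis by (cases F rule: class_cases; cases G rule: class_cases; cases H rule: class_cases)
    (simp_all add: cl_ops ops_not_class)
qed

lemma plus_commute: "F \<squnion> G = G \<squnion> F"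
proof -
  have "cl (f \<boxplus> g) = cl (g \<boxplus> f)" for f g
    by (rule cl_eqI') (auto simp: arrow_iff intro!: add_comm)
  then show ?thesis by (cases F rule: class_cases; cases G rule: class_cases) (simp_all add: cl_ops ops_not_class)
qed

lemma scal_scal: "scal c (scal c' F) = scal (c * c') F"
proof -
  have "cl (Scale c (Scale c' f)) = cl (Scale (c * c') f)" for f
    by (rule cl_eqI') (auto simp: arrow_iff intro!: scale_scale)
  then show ?thesis by (cases F rule: class_cases) (simp_all add: cl_ops ops_not_class)
qed

lemma scal_plus: "scal c (F \<squnion> G) = scal c F \<squnion> scal c G"
proof -
  have "cl (Scale c (f \<boxplus> g)) = cl (Scale c f \<boxplus> Scale c g)" for f g
    by (rule cl_eqI') (auto simp: arrow_iff intro!: scale_add_right)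
  then show ?thesis by (cases F rule: class_cases; cases G rule: class_cases) (simp_all add: cl_ops ops_not_class)
qed

lemma scal_add: "scal (c + c') F = scal c F \<squnion> scal c' F"
proof -
  have "cl (Scale (c + c') f) = cl (Scale c f \<boxplus> Scale c' f)" for f
    by (rule cl_eqI') (auto simp: arrow_iff intro!: scale_add_left)
  then show ?thesis by (cases F rule: class_cases) (simp_all add: cl_ops ops_not_class)
qed

lemma comp_plus_left: "(F \<squnion> G) \<star> H = F \<star> H \<squnion> G \<star> H"
proof -
  have "cl ((f \<boxplus> g) \<bullet> h) = cl (f \<bullet> h \<boxplus> g \<bullet> h)" for f g h
    by (rule cl_eqI') (auto simp: arrow_iff intro!: comp_add_left)
  then show ?thesis by (cases F rule: class_cases; cases G rule: class_cases; cases H rule: class_cases)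
    (simp_all add: cl_ops ops_not_class)
qed

lemma comp_plus_right: "H \<star> (F \<squnion> G) = H \<star> F \<squnion> H \<star> G"
proof -
  have "cl (h \<bullet> (f \<boxplus> g)) = cl (h \<bullet> f \<boxplus> h \<bullet> g)" for f g h
    by (rule cl_eqI') (auto simp: arrow_iff intro!: comp_add_right)
  then show ?thesis by (cases F rule: class_cases; cases G rule: class_cases; cases H rule: class_cases)
    (simp_all add: cl_ops ops_not_class)
qed

lemma comp_scal_left: "scal c F \<star> G = scal c (F \<star> G)"
proof -
  have "cl (Scale c f \<bullet> g) = cl (Scale c (f \<bullet> g))" for f g
    by (rule cl_eqI') (auto simp: arrow_iff intro!: comp_scale_left)
  then show ?thesis by (cases F rule: class_cases; cases G rule: class_cases) (simp_all add: cl_ops ops_not_class)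
qed

lemma comp_scal_right: "F \<star> scal c G = scal c (F \<star> G)"
proof -
  have "cl (f \<bullet> Scale c g) = cl (Scale c (f \<bullet> g))" for f g
    by (rule cl_eqI') (auto simp: arrow_iff intro!: comp_scale_right)
  then show ?thesis by (cases F rule: class_cases; cases G rule: class_cases) (simp_all add: cl_ops ops_not_class)
qed

lemma tens2_plus_left: "(F \<squnion> G) \<bowtie> H = F \<bowtie> H \<squnion> G \<bowtie> H"
proof -
  have "cl ((f \<boxplus> g) \<boxtimes> h) = cl (f \<boxtimes> h \<boxplus> g \<boxtimes> h)" for f g h
    by (rule cl_eqI') (auto simp: arrow_iff intro!: tensor_add_left)
  then show ?thesis by (cases F rule: class_cases; cases G rule: class_cases; cases H rule: class_cases)
    (simp_all add: cl_ops ops_not_class)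
qed

lemma tens2_plus_right: "H \<bowtie> (F \<squnion> G) = H \<bowtie> F \<squnion> H \<bowtie> G"
proof -
  have "cl (h \<boxtimes> (f \<boxplus> g)) = cl (h \<boxtimes> f \<boxplus> h \<boxtimes> g)" for f g h
    by (rule cl_eqI') (auto simp: arrow_iff intro!: tensor_add_right)
  then show ?thesis by (cases F rule: class_cases; cases G rule: class_cases; cases H rule: class_cases)
    (simp_all add: cl_ops ops_not_class)
qed

lemma tens2_scal_left: "scal c F \<bowtie> G = scal c (F \<bowtie> G)"
proof -
  have "cl (Scale c f \<boxtimes> g) = cl (Scale c (f \<boxtimes> g))" for f g
    by (rule cl_eqI') (auto simp: arrow_iff intro!: tensor_scale_left)
  then show ?thesis by (cases F rule: class_cases; cases G rule: class_cases) (simp_all add: cl_ops ops_not_class)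
qed

lemma tens2_scal_right: "F \<bowtie> scal c G = scal c (F \<bowtie> G)"
proof -
  have "cl (f \<boxtimes> Scale c g) = cl (Scale c (f \<boxtimes> g))" for f g
    by (rule cl_eqI') (auto simp: arrow_iff intro!: tensor_scale_right)
  then show ?thesis by (cases F rule: class_cases; cases G rule: class_cases) (simp_all add: cl_ops ops_not_class)
qed

lemmas linear_simps = comp_plus_left comp_plus_right comp_scal_left comp_scal_right
  tens2_plus_left tens2_plus_right tens2_scal_left tens2_scal_right scal_plus scal_scal

subsection \<open>Morphisms with given source and target\<close>

definition hm :: "'a obj \<Rightarrow> 'a obj \<Rightarrow> ('a, 'k) mor set set" where
  "hm i j = {cl f | f. arrow f i j}"

abbreviation idc :: "'a obj \<Rightarrow> ('a, 'k) mor set" where "idc i \<equiv> cl (Ident i)"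
abbreviation zc :: "'a obj \<Rightarrow> 'a obj \<Rightarrow> ('a, 'k) mor set" where "zc i j \<equiv> cl (Zero i j)"

lemma cl_hm: "arrow f i j \<Longrightarrow> cl f \<in> hm i j" by (auto simp: hm_def)

lemma hmE: assumes "F \<in> hm i j" obtains f where "F = cl f" "arrow f i j"
  using assms by (auto simp: hm_def)

lemma arrow_of_hm: assumes "cl h \<in> hm i j" shows "arrow h i j"
proof -
  obtain f where "cl h = cl f" "arrow f i j" using assms by (rule hmE)
  then show ?thesis using cl_eqD[of h f] by (simp add: arrow_iff)
qed

lemma hm_objects: "F \<in> hm i j \<Longrightarrow> i \<in> objects \<and> j \<in> objects"
  using wt_objects by (auto simp: hm_def arrow_iff)

lemma hm_idc: "i \<in> objects \<Longrightarrow> idc i \<in> hm i i" by (intro cl_hm arrow_Ident)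
lemma hm_zc: "i \<in> objects \<Longrightarrow> j \<in> objects \<Longrightarrow> zc i j \<in> hm i j" by (intro cl_hm arrow_Zero)

lemma hm_comp: "F \<in> hm j k \<Longrightarrow> G \<in> hm i j \<Longrightarrow> F \<star> G \<in> hm i k"
  by (elim hmE) (auto simp: cl_ops intro!: cl_hm arrow_Comp)

lemma hm_tens2: "F \<in> hm i j \<Longrightarrow> G \<in> hm k l \<Longrightarrow> F \<bowtie> G \<in> hm (i @ k) (j @ l)"
  by (elim hmE) (auto simp: cl_ops intro!: cl_hm arrow_Tensor)

lemma hm_plus: "F \<in> hm i j \<Longrightarrow> G \<in> hm i j \<Longrightarrow> F \<squnion> G \<in> hm i j"
  by (elim hmE) (auto simp: cl_ops intro!: cl_hm arrow_Add)

lemma hm_scal: "F \<in> hm i j \<Longrightarrow> scal c F \<in> hm i j"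
  by (elim hmE) (auto simp: cl_ops intro!: cl_hm arrow_Scale)

lemma idc_left: "F \<in> hm i j \<Longrightarrow> idc j \<star> F = F"
  by (elim hmE) (auto simp: cl_ops intro!: cl_eqI comp_id_left)

lemma idc_right: "F \<in> hm i j \<Longrightarrow> F \<star> idc i = F"
  by (elim hmE) (auto simp: cl_ops intro!: cl_eqI comp_id_right)

lemma plus_zc: "F \<in> hm i j \<Longrightarrow> F \<squnion> zc i j = F"
  by (elim hmE) (auto simp: cl_ops intro!: cl_eqI add_zero)

lemma plus_neg: "F \<in> hm i j \<Longrightarrow> F \<squnion> scal (- 1) F = zc i j"
  by (elim hmE) (auto simp: cl_ops intro!: cl_eqI add_neg)

lemma scal_one: "F \<in> hm i j \<Longrightarrow> scal 1 F = F"
  by (elim hmE) (auto simp: cl_ops intro!: cl_eqI scale_one)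

lemma scal_0: "F \<in> hm i j \<Longrightarrow> scal 0 F = zc i j"
  using plus_neg[of F i j] scal_add[of 1 "- 1" F] by (simp add: scal_one)

lemma eq_plusI: "F \<squnion> G = H \<Longrightarrow> F \<in> hm i j \<Longrightarrow> G \<in> hm i j \<Longrightarrow> F = H \<squnion> scal (- 1) G"
  using plus_neg[of G i j] plus_zc[of F i j] plus_assoc[of F G "scal (- 1) G"] by simp

lemma idc_tens2: "i \<in> objects \<Longrightarrow> j \<in> objects \<Longrightarrow> idc i \<bowtie> idc j = idc (i @ j)"
  by (auto simp: cl_ops intro!: cl_eqI tensor_ident)

lemma tens2_idc_Nil: assumes "F \<in> hm i j" shows "F \<bowtie> idc [] = F" "idc [] \<bowtie> F = F"
proof -
  obtain f where f: "F = cl f" "arrow f i j" using assms by (rule hmE)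
  show "F \<bowtie> idc [] = F" "idc [] \<bowtie> F = F"
    unfolding f(1) cl_ops by (rule cl_eqI, rule tensor_unit_right tensor_unit_left, rule f(2))+
qed

definition hpar :: "('a, 'k) mor set \<Rightarrow> bit \<Rightarrow> bool" where
  "hpar F p \<longleftrightarrow> (\<exists>f. F = cl f \<and> has_parity f p)"

lemma hpar_cl: "has_parity f p \<Longrightarrow> hpar (cl f) p" by (auto simp: hpar_def)

lemma interchange':
  assumes "F \<in> hm i j" "F' \<in> hm j k" "G' \<in> hm l m" "G \<in> hm m n" "hpar F p" "hpar G q"
  shows "(F' \<bowtie> G) \<star> (F \<bowtie> G') = scal (koszul p q) ((F' \<star> F) \<bowtie> (G \<star> G'))"
proof -
  obtain f where f: "F = cl f" "has_parity f p" using assms(5) by (auto simp: hpar_def)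
  obtain g where g: "G = cl g" "has_parity g q" using assms(6) by (auto simp: hpar_def)
  have t: "arrow h i' j'" if "cl h \<in> hm i' j'" for h i' j'
    using arrow_of_hm[OF that] .
  obtain f' g' where f': "F' = cl f'" "arrow f' j k" and g': "G' = cl g'" "arrow g' l m" using assms by (auto elim!: hmE)
  show ?thesis unfolding f g f' g' cl_ops
    by (rule cl_eqI, rule interchange) (use assms f g f' g' t in auto)
qed

lemma hpar_idc: "hpar (idc i) 0" by (intro hpar_cl par_Ident)

abbreviation sh :: "'a P1 letter \<Rightarrow> ('a, 'k) mor set \<Rightarrow> ('a, 'k) mor set" where "sh y F \<equiv> idc [y] \<bowtie> F"
abbreviation rw :: "('a, 'k) mor set \<Rightarrow> 'a obj \<Rightarrow> ('a, 'k) mor set" where "rw F s \<equiv> F \<bowtie> idc s"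

lemma hm_comp_iff: assumes "F \<star> G \<noteq> {}"
  obtains i j k where "F \<in> hm j k" "G \<in> hm i j"
proof -
  have "F \<in> range cl" "G \<in> range cl" using assms by (auto simp: comp_def lift2_def split: if_splits)
  then obtain f g where fg: "F = cl f" "G = cl g" by blast
  then have "wt (f \<bullet> g)" using assms cl_ill_typed cl_ops by metis
  then have "arrow f (dom_of f) (cod_of f)" "arrow g (dom_of g) (dom_of f)" by (auto simp: arrow_iff)
  then show ?thesis using that cl_hm fg by blast
qed

lemma tens2_nonempty: assumes "F \<bowtie> G \<noteq> {}"
  obtains i j k l where "F \<in> hm i j" "G \<in> hm k l"
proof -
  have "F \<in> range cl" "G \<in> range cl" using assms by (auto simp: tens2_def lift2_def split: if_splits)
  then obtain f g where fg: "F = cl f" "G = cl g" by blast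
  then have "wt (f \<boxtimes> g)" using assms cl_ill_typed cl_ops by metis
  then have "arrow f (dom_of f) (cod_of f)" "arrow g (dom_of g) (cod_of g)" by (auto simp: arrow_iff)
  then show ?thesis using that cl_hm fg by blast
qed

lemma hm_unique: "F \<in> hm i j \<Longrightarrow> F \<in> hm i' j' \<Longrightarrow> i = i' \<and> j = j'"
proof -
  assume F: "F \<in> hm i j" and F': "F \<in> hm i' j'"
  obtain f where f: "F = cl f" "arrow f i j" using F by (rule hmE)
  have "arrow f i' j'" using F' unfolding f(1) by (rule arrow_of_hm)
  then show ?thesis using f(2) by (auto simp: arrow_iff)
qed

lemma hm_nonempty: "F \<in> hm i j \<Longrightarrow> F \<noteq> {}"
  by (elim hmE) (metis arrow_iff cl_self_iff empty_iff)

lemma idc_nonempty: "idc i \<noteq> {} \<Longrightarrow> i \<in> objects"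
  by (metis cl_ill_typed wt.simps(1))

lemma hpar_ops:
  "hpar F p \<Longrightarrow> hpar G q \<Longrightarrow> hpar (F \<star> G) (p + q)" "hpar F p \<Longrightarrow> hpar G q \<Longrightarrow> hpar (F \<bowtie> G) (p + q)"
  "hpar F p \<Longrightarrow> hpar G p \<Longrightarrow> hpar (F \<squnion> G) p" "hpar F p \<Longrightarrow> hpar (scal c F) p"
proof -
  show "hpar F p \<Longrightarrow> hpar G q \<Longrightarrow> hpar (F \<star> G) (p + q)" "hpar F p \<Longrightarrow> hpar G q \<Longrightarrow> hpar (F \<bowtie> G) (p + q)"
    "hpar F p \<Longrightarrow> hpar G p \<Longrightarrow> hpar (F \<squnion> G) p" "hpar F p \<Longrightarrow> hpar (scal c F) p"
    unfolding hpar_def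
    by (elim exE conjE, rule exI, rule conjI, simp only: cl_ops, intro par_Comp par_Tensor par_Add par_Scale; assumption)+
qed

lemma plus_four: "(A \<squnion> B') \<squnion> (C \<squnion> D) = (A \<squnion> D) \<squnion> (B' \<squnion> C)"
  by (metis plus_assoc plus_commute)

lemma even_split: "arrow f i j \<Longrightarrow> has_parity f 0 \<Longrightarrow>
    \<exists>F0\<in>hm i j. \<exists>F1\<in>hm i j. hpar F0 0 \<and> hpar F1 1 \<and> cl f = F0 \<squnion> F1"
  using cl_hm[of f i j] hm_zc[of i j] hpar_cl[OF par_Zero] hpar_cl[of f 0] plus_zc[of "cl f" i j] hm_objects by metis

text \<open>The interchange law speaks of homogeneous morphisms only. Tokens split because A does,
  all other generators are even, and the operations preserve such decompositions.\<close>

lemma homogeneous_split: "arrow f i j \<Longrightarrow> \<exists>F0\<in>hm i j. \<exists>F1\<in>hm i j. hpar F0 0 \<and> hpar F1 1 \<and> cl f = F0 \<squnion> F1"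
proof (induction rule: arrow.induct)
  case (arrow_Token a)
  obtain x y where a: "x \<in> gr 0" "y \<in> gr 1" "a = x + y" by (rule gr_cases)
  have T: "arrow (Token x) [Black] [Black]" for x by (rule arrow.arrow_Token)
  have "cl (Scale 1 (Token x) \<boxplus> Scale 1 (Token y)) = cl (Token a)"
    using cl_eqI[OF eqv_def_rel[OF token_linear[of 1 x 1 y]]] a by simp
  then have "cl (Token a) = cl (Token x) \<squnion> cl (Token y)"
    using scal_one[OF cl_hm[OF T]] by (simp flip: cl_ops)
  then show ?case using a cl_hm[OF T] hpar_cl[OF par_Token] by blast
next
  case (arrow_Comp g i j f k)
  obtain F0 F1 where F: "F0 \<in> hm j k" "F1 \<in> hm j k" "hpar F0 0" "hpar F1 1" "cl f = F0 \<squnion> F1" using arrow_Comp.IH(2) by blast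
  obtain G0 G1 where G: "G0 \<in> hm i j" "G1 \<in> hm i j" "hpar G0 0" "hpar G1 1" "cl g = G0 \<squnion> G1" using arrow_Comp.IH(1) by blast
  show ?case
  proof (intro bexI conjI)
    show "hpar (F0 \<star> G0 \<squnion> F1 \<star> G1) 0" using hpar_ops(3)[of _ 0] hpar_ops(1)[OF F(3) G(3)] hpar_ops(1)[OF F(4) G(4)] by simp
    show "hpar (F1 \<star> G0 \<squnion> F0 \<star> G1) 1" using hpar_ops(3)[of _ 1] hpar_ops(1)[OF F(3) G(4)] hpar_ops(1)[OF F(4) G(3)] by simp
    show "cl (f \<bullet> g) = (F0 \<star> G0 \<squnion> F1 \<star> G1) \<squnion> (F1 \<star> G0 \<squnion> F0 \<star> G1)"
      unfolding cl_ops[symmetric] F G comp_plus_left comp_plus_right by (metis plus_four plus_commute)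
  qed (use F G in \<open>auto intro: hm_plus hm_comp\<close>)
next
  case (arrow_Tensor f i j g k l)
  obtain F0 F1 where F: "F0 \<in> hm i j" "F1 \<in> hm i j" "hpar F0 0" "hpar F1 1" "cl f = F0 \<squnion> F1" using arrow_Tensor.IH(1) by blast
  obtain G0 G1 where G: "G0 \<in> hm k l" "G1 \<in> hm k l" "hpar G0 0" "hpar G1 1" "cl g = G0 \<squnion> G1" using arrow_Tensor.IH(2) by blast
  show ?case
  proof (intro bexI conjI)
    show "hpar (F0 \<bowtie> G0 \<squnion> F1 \<bowtie> G1) 0" using hpar_ops(3)[of _ 0] hpar_ops(2)[OF F(3) G(3)] hpar_ops(2)[OF F(4) G(4)] by simp
    show "hpar (F1 \<bowtie> G0 \<squnion> F0 \<bowtie> G1) 1" using hpar_ops(3)[of _ 1] hpar_ops(2)[OF F(3) G(4)] hpar_ops(2)[OF F(4) G(3)] by simp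
    show "cl (f \<boxtimes> g) = (F0 \<bowtie> G0 \<squnion> F1 \<bowtie> G1) \<squnion> (F1 \<bowtie> G0 \<squnion> F0 \<bowtie> G1)"
      unfolding cl_ops[symmetric] F G tens2_plus_left tens2_plus_right by (metis plus_four plus_commute)
  qed (use F G in \<open>auto intro: hm_plus hm_tens2\<close>)
next
  case (arrow_Add f i j g)
  obtain F0 F1 where F: "F0 \<in> hm i j" "F1 \<in> hm i j" "hpar F0 0" "hpar F1 1" "cl f = F0 \<squnion> F1" using arrow_Add.IH(1) by blast
  obtain G0 G1 where G: "G0 \<in> hm i j" "G1 \<in> hm i j" "hpar G0 0" "hpar G1 1" "cl g = G0 \<squnion> G1" using arrow_Add.IH(2) by blast
  have "cl (f \<boxplus> g) = (F0 \<squnion> G0) \<squnion> (F1 \<squnion> G1)"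
    unfolding cl_ops[symmetric] F G by (metis plus_assoc plus_commute)
  then show ?case using F G hpar_ops(3) hm_plus by meson
next
  case (arrow_Scale f i j c)
  obtain F0 F1 where F: "F0 \<in> hm i j" "F1 \<in> hm i j" "hpar F0 0" "hpar F1 1" "cl f = F0 \<squnion> F1" using arrow_Scale.IH by blast
  have "cl (Scale c f) = scal c F0 \<squnion> scal c F1" unfolding cl_ops[symmetric] F by (rule scal_plus)
  then show ?case using F hpar_ops(4) hm_scal by meson
next
  case (arrow_Zero i j)
  then have "zc i j = zc i j \<squnion> zc i j" using plus_zc[OF hm_zc] by simp
  then show ?case using hm_zc[OF arrow_Zero] hpar_cl[OF par_Zero] by blast
qed (rule even_split; auto intro: arrow.intros has_parity.intros)+

text \<open>As the passing morphism F is even, the sign is 1 for both homogeneous parts of G, so G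
  can be arbitrary.\<close>

lemma interchange_left: assumes "F \<in> hm i j" "F' \<in> hm j k" "G' \<in> hm l m" "G \<in> hm m n" "hpar F 0"
  shows "(F' \<bowtie> G) \<star> (F \<bowtie> G') = (F' \<star> F) \<bowtie> (G \<star> G')"
proof -
  obtain g where "G = cl g" "arrow g m n" using assms by (auto elim: hmE)
  then obtain G0 G1 where G: "G0 \<in> hm m n" "G1 \<in> hm m n" "hpar G0 0" "hpar G1 1" "G = G0 \<squnion> G1"
    using homogeneous_split by blast
  have "(F' \<bowtie> H) \<star> (F \<bowtie> G') = (F' \<star> F) \<bowtie> (H \<star> G')" if "H \<in> hm m n" "hpar H q" for H q
    using interchange'[OF assms(1-3) that(1) assms(5) that(2)] hm_tens2[OF hm_comp hm_comp, OF assms(2,1) that(1) assms(3)]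
    by (simp add: scal_one)
  from this[OF G(1,3)] this[OF G(2,4)] show ?thesis unfolding G(5) by (simp add: linear_simps)
qed

lemma interchange_right: assumes "F \<in> hm i j" "F' \<in> hm j k" "G' \<in> hm l m" "G \<in> hm m n" "hpar G 0"
  shows "(F' \<bowtie> G) \<star> (F \<bowtie> G') = (F' \<star> F) \<bowtie> (G \<star> G')"
proof -
  obtain g where "F = cl g" "arrow g i j" using assms by (auto elim: hmE)
  then obtain G0 G1 where G: "G0 \<in> hm i j" "G1 \<in> hm i j" "hpar G0 0" "hpar G1 1" "F = G0 \<squnion> G1"
    using homogeneous_split by blast
  have "(F' \<bowtie> G) \<star> (H \<bowtie> G') = (F' \<star> H) \<bowtie> (G \<star> G')" if "H \<in> hm i j" "hpar H q" for H q
    using interchange'[OF that(1) assms(2-4) that(2) assms(5)] hm_tens2[OF hm_comp hm_comp, OF assms(2) that(1) assms(4,3)]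
    by (simp add: scal_one koszul_sym[of q])
  from this[OF G(1,3)] this[OF G(2,4)] show ?thesis unfolding G(5) by (simp add: linear_simps)
qed

text \<open>The law holds without typing assumptions: if one side is nonempty, its constituents are
  classes of well-typed terms and their types have to match, which gives the hypotheses of the
  interchange law; otherwise both sides are empty.\<close>

lemma tens_idc_comp: "idc i \<bowtie> (F \<star> G) = (idc i \<bowtie> F) \<star> (idc i \<bowtie> G)"
proof (cases "idc i \<bowtie> (F \<star> G) = {} \<and> (idc i \<bowtie> F) \<star> (idc i \<bowtie> G) = {}")
  case False
  have "\<exists>j k l. F \<in> hm k l \<and> G \<in> hm j k \<and> i \<in> objects"
  proof (cases "idc i \<bowtie> (F \<star> G) = {}")
    case True
    with False have ne: "(idc i \<bowtie> F) \<star> (idc i \<bowtie> G) \<noteq> {}" by blast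
    then have ne': "idc i \<bowtie> F \<noteq> {}" "idc i \<bowtie> G \<noteq> {}" by auto
    have "idc i \<noteq> {}"
    proof
      assume "idc i = {}"
      then show False using ne'(1) by simp
    qed
    then have io: "i \<in> objects" by (rule idc_nonempty)
    obtain a b where F: "F \<in> hm a b" using tens2_nonempty[OF ne'(1)] by metis
    obtain c e where G: "G \<in> hm c e" using tens2_nonempty[OF ne'(2)] by metis
    obtain a' b' c' where "idc i \<bowtie> F \<in> hm b' c'" "idc i \<bowtie> G \<in> hm a' b'" using hm_comp_iff[OF ne] by metis
    then have "i @ a = i @ e"
      using hm_tens2[OF hm_idc[OF io] F] hm_tens2[OF hm_idc[OF io] G] hm_unique by metis
    then show ?thesis using F G io by auto
  next
    case False
    then have "F \<star> G \<noteq> {}" "idc i \<noteq> {}" by auto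
    then show ?thesis using hm_comp_iff idc_nonempty by metis
  qed
  then obtain j k l where "F \<in> hm k l" "G \<in> hm j k" "i \<in> objects" by blast
  then show ?thesis
    using interchange_left[OF hm_idc hm_idc, of i G j k F l] hpar_idc idc_left[OF hm_idc, of i] by simp
qed blast

lemma comp_tens_idc: "(F \<star> G) \<bowtie> idc i = (F \<bowtie> idc i) \<star> (G \<bowtie> idc i)"
proof (cases "(F \<star> G) \<bowtie> idc i = {} \<and> (F \<bowtie> idc i) \<star> (G \<bowtie> idc i) = {}")
  case False
  have "\<exists>j k l. F \<in> hm k l \<and> G \<in> hm j k \<and> i \<in> objects"
  proof (cases "(F \<star> G) \<bowtie> idc i = {}")
    case True
    with False have ne: "(F \<bowtie> idc i) \<star> (G \<bowtie> idc i) \<noteq> {}" by blast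
    then have ne': "F \<bowtie> idc i \<noteq> {}" "G \<bowtie> idc i \<noteq> {}" by auto
    have "idc i \<noteq> {}"
    proof
      assume "idc i = {}"
      then show False using ne'(1) by simp
    qed
    then have io: "i \<in> objects" by (rule idc_nonempty)
    obtain a b where F: "F \<in> hm a b" using tens2_nonempty[OF ne'(1)] by metis
    obtain c e where G: "G \<in> hm c e" using tens2_nonempty[OF ne'(2)] by metis
    obtain a' b' c' where "F \<bowtie> idc i \<in> hm b' c'" "G \<bowtie> idc i \<in> hm a' b'" using hm_comp_iff[OF ne] by metis
    then have "a @ i = e @ i"
      using hm_tens2[OF F hm_idc[OF io]] hm_tens2[OF G hm_idc[OF io]] hm_unique by metis
    then show ?thesis using F G io by auto
  next
    case False
    then have "F \<star> G \<noteq> {}" "idc i \<noteq> {}" by auto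
    then show ?thesis using hm_comp_iff idc_nonempty by metis
  qed
  then obtain j k l where "F \<in> hm k l" "G \<in> hm j k" "i \<in> objects" by blast
  then show ?thesis
    using interchange_right[OF _ _ hm_idc hm_idc, of G j k F l i] hpar_idc idc_left[OF hm_idc, of i] by simp
qed blast

lemma rw_rw: "s \<in> objects \<Longrightarrow> t \<in> objects \<Longrightarrow> rw (rw F s) t = rw F (s @ t)"
  by (simp add: tens2_assoc idc_tens2)

lemma slide:
  assumes "F \<in> hm a b" "hpar F 0" "H \<in> hm s s'"
  shows "rw F s' \<star> (idc a \<bowtie> H) = (idc b \<bowtie> H) \<star> rw F s"
proof -
  have o: "a \<in> objects" "b \<in> objects" "s \<in> objects" "s' \<in> objects" using assms hm_objects by blast+
  have "rw F s' \<star> (idc a \<bowtie> H) = F \<bowtie> H"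
    using interchange_left[OF hm_idc assms(1) assms(3) hm_idc hpar_idc] o idc_left[OF assms(3)] idc_right[OF assms(1)] by simp
  moreover have "(idc b \<bowtie> H) \<star> rw F s = F \<bowtie> H"
    using interchange_left[OF assms(1) hm_idc hm_idc assms(3) assms(2)] o idc_left[OF assms(1)] idc_right[OF assms(3)] by simp
  ultimately show ?thesis by simp
qed

lemma slide_homogeneous:
  assumes "F \<in> hm a b" "hpar F p" "H \<in> hm s s'" "hpar H q"
  shows "(idc b \<bowtie> H) \<star> rw F s = scal (koszul p q) (rw F s' \<star> (idc a \<bowtie> H))"
proof -
  have o: "a \<in> objects" "b \<in> objects" "s \<in> objects" "s' \<in> objects" using assms hm_objects by blast+
  have "rw F s' \<star> (idc a \<bowtie> H) = F \<bowtie> H"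
    using interchange_left[OF hm_idc assms(1) assms(3) hm_idc hpar_idc] o idc_left[OF assms(3)] idc_right[OF assms(1)] by simp
  moreover have "(idc b \<bowtie> H) \<star> rw F s = scal (koszul p q) (F \<bowtie> H)"
    using interchange'[OF assms(1) hm_idc hm_idc assms(3) assms(2) assms(4)] o idc_left[OF assms(1)] idc_right[OF assms(3)] by simp
  ultimately show ?thesis by simp
qed

end

section \<open>Relations between classes\<close>

context LAH
begin

lemma rel: "def_rel i j f g \<Longrightarrow> cl f = cl g"
  by (rule cl_eqI[OF eqv_def_rel])

lemma sh_comp: "sh y (F \<star> G) = sh y F \<star> sh y G" by (rule tens_idc_comp)
lemma rw_comp: "rw (F \<star> G) s = rw F s \<star> rw G s" by (rule comp_tens_idc)

lemma sh_sh: "[y] \<in> objects \<Longrightarrow> [y'] \<in> objects \<Longrightarrow> sh y (sh y' F) = idc [y, y'] \<bowtie> F"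
  by (subst tens2_assoc[symmetric], subst idc_tens2) auto

lemma hm_sh: "F \<in> hm i j \<Longrightarrow> [y] \<in> objects \<Longrightarrow> sh y F \<in> hm (y # i) (y # j)"
  using hm_tens2[OF hm_idc, of "[y]" F i j] by simp

lemma hm_rw: "F \<in> hm i j \<Longrightarrow> s \<in> objects \<Longrightarrow> rw F s \<in> hm (i @ s) (j @ s)"
  by (rule hm_tens2[OF _ hm_idc])

lemma rw_idc: "i \<in> objects \<Longrightarrow> s \<in> objects \<Longrightarrow> rw (idc i) s = idc (i @ s)" by (rule idc_tens2)
lemma sh_idc: "[y] \<in> objects \<Longrightarrow> s \<in> objects \<Longrightarrow> sh y (idc s) = idc (y # s)" using idc_tens2[of "[y]" s] by simp

lemma idc_left_sh: "F \<in> hm i (y # j) \<Longrightarrow> rw (idc [y]) j \<star> F = F"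
  using idc_left[of F i "y # j"] rw_idc[of "[y]" j] hm_objects[of F i "y # j"] objects_Cons[of y j] by simp

text \<open>A uniform name for the crossing of neighbouring letters, the left one coming first. Red
  strands do not cross, so for two red letters the value is the empty class.\<close>

fun XX :: "'a P1 letter \<Rightarrow> 'a P1 letter \<Rightarrow> ('a, 'k) mor set" where
  "XX Black Black = cl Tpos" | "XX (Red Q) Black = cl (Rho Q)" | "XX Black (Red Q) = cl (Lam Q)"
| "XX (Red Q) (Red Q') = {}"

definition crossable :: "'a P1 letter \<Rightarrow> 'a P1 letter \<Rightarrow> bool" where
  "crossable x y \<longleftrightarrow> x = Black \<or> y = Black"

lemma XX_hm: "crossable x y \<Longrightarrow> [x] \<in> objects \<Longrightarrow> [y] \<in> objects \<Longrightarrow> XX x y \<in> hm [x, y] [y, x]"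
  by (cases x; cases y) (auto simp: crossable_def intro!: cl_hm arrow.intros)

lemma XX_par: "crossable x y \<Longrightarrow> hpar (XX x y) 0"
  by (cases x; cases y) (auto simp: crossable_def intro!: hpar_cl has_parity.intros)

inductive gen :: "('a, 'k) mor set \<Rightarrow> bit \<Rightarrow> bool" where
  gen_Token: "a \<in> gr p \<Longrightarrow> gen (cl (Token a)) p"
| gen_Dot: "gen (cl Dot) 0"
| gen_DotInv: "gen (cl DotInv) 0"

text \<open>The endomorphisms of one letter and of two letters that are generated by tokens and dots\<close>

inductive td :: "'a P1 letter \<Rightarrow> ('a, 'k) mor set \<Rightarrow> bool" where
  td_id: "td y (idc [y])"
| td_gen: "gen g p \<Longrightarrow> td Black P \<Longrightarrow> td Black (g \<star> P)"
| td_add: "td y P \<Longrightarrow> td y P' \<Longrightarrow> td y (P \<squnion> P')"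
| td_scal: "td y P \<Longrightarrow> td y (scal c P)"
| td_zero: "td y (zc [y] [y])"

inductive td2 :: "'a P1 letter \<Rightarrow> 'a P1 letter \<Rightarrow> ('a, 'k) mor set \<Rightarrow> bool" where
  td2_id: "td2 x y (idc [x, y])"
| td2_left: "gen g p \<Longrightarrow> td2 Black y W \<Longrightarrow> td2 Black y (rw g [y] \<star> W)"
| td2_right: "gen g p \<Longrightarrow> td2 x Black W \<Longrightarrow> td2 x Black (sh x g \<star> W)"
| td2_add: "td2 x y W \<Longrightarrow> td2 x y W' \<Longrightarrow> td2 x y (W \<squnion> W')"
| td2_scal: "td2 x y W \<Longrightarrow> td2 x y (scal c W)"
| td2_zero: "td2 x y (zc [x, y] [x, y])"

lemma gen_hm: "gen g p \<Longrightarrow> g \<in> hm [Black] [Black]"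
  by (induction rule: gen.induct) (auto intro!: cl_hm arrow.intros)

lemma gen_par: "gen g p \<Longrightarrow> hpar g p"
  by (induction rule: gen.induct) (auto intro!: hpar_cl has_parity.intros)

lemma td_hm: "td y P \<Longrightarrow> [y] \<in> objects \<Longrightarrow> P \<in> hm [y] [y]"
proof (induction rule: td.induct)
  case (td_gen g p P)
  then show ?case using hm_comp[OF gen_hm] by blast
qed (auto intro: hm_idc hm_plus hm_scal hm_zc)

lemma two_objects: "[x] \<in> objects \<Longrightarrow> [y] \<in> objects \<Longrightarrow> [x, y] \<in> objects"
  using objects_Cons[of x "[y]"] by simp

lemma td2_hm: "td2 x y W \<Longrightarrow> [x] \<in> objects \<Longrightarrow> [y] \<in> objects \<Longrightarrow> W \<in> hm [x, y] [x, y]"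
proof (induction rule: td2.induct)
  case (td2_left g p y W)
  then show ?case using hm_comp[OF hm_rw[OF gen_hm, of g p "[y]"]] by simp
next
  case (td2_right g p x W)
  then show ?case using hm_comp[OF hm_sh[OF gen_hm, of g p x]] by simp
qed (auto intro: hm_idc hm_plus hm_scal hm_zc two_objects)

lemma zc_comp: "F \<in> hm i j \<Longrightarrow> m \<in> objects \<Longrightarrow> zc j m \<star> F = zc i m"
  using scal_0[OF hm_comp[of "zc j m" j m F i]] scal_0[of "zc j m" j m] comp_scal_left[of 0 "zc j m" F]
    hm_zc[of j m] hm_objects[of F i j] by simp

lemma comp_zc: "F \<in> hm j m \<Longrightarrow> i \<in> objects \<Longrightarrow> F \<star> zc i j = zc i m"
  using scal_0[OF hm_comp[of F j m "zc i j" i]] scal_0[of "zc i j" i j] comp_scal_right[of F 0 "zc i j"]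
    hm_zc[of i j] hm_objects[of F j m] by simp

lemma sh_zc: "[y] \<in> objects \<Longrightarrow> i \<in> objects \<Longrightarrow> j \<in> objects \<Longrightarrow> sh y (zc i j) = zc (y # i) (y # j)"
  using scal_0[OF hm_sh[of "zc i j" i j y]] scal_0[of "zc i j" i j] tens2_scal_right[of "idc [y]" 0 "zc i j"]
    hm_zc[of i j] by simp

lemma rw_zc: "s \<in> objects \<Longrightarrow> i \<in> objects \<Longrightarrow> j \<in> objects \<Longrightarrow> rw (zc i j) s = zc (i @ s) (j @ s)"
  using scal_0[OF hm_rw[of "zc i j" i j s]] scal_0[of "zc i j" i j] tens2_scal_left[of 0 "zc i j" "idc s"]
    hm_zc[of i j] by simp

lemma zc_plus_zc: "i \<in> objects \<Longrightarrow> j \<in> objects \<Longrightarrow> zc i j \<squnion> zc i j = zc i j"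
  by (rule plus_zc[OF hm_zc])

lemma scal_zc: "i \<in> objects \<Longrightarrow> j \<in> objects \<Longrightarrow> scal c (zc i j) = zc i j"
  using scal_0[OF hm_zc, of i j] scal_scal[of c 0 "zc i j"] by simp

lemma td_mult: "td y W \<Longrightarrow> td y P \<Longrightarrow> [y] \<in> objects \<Longrightarrow> td y (W \<star> P)"
proof (induction rule: td.induct)
  case (td_id y)
  then show ?case using idc_left[OF td_hm, of y P] by simp
next
  case (td_zero y)
  then show ?case using zc_comp[OF td_hm, of y P "[y]"] by (simp add: td.td_zero)
qed (auto simp: comp_assoc' comp_plus_left comp_scal_left intro: td.intros)

lemma td2_mult: "td2 x y W \<Longrightarrow> td2 x y P \<Longrightarrow> [x] \<in> objects \<Longrightarrow> [y] \<in> objects \<Longrightarrow> td2 x y (W \<star> P)"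
proof (induction rule: td2.induct)
  case (td2_id x y)
  then show ?case using idc_left[OF td2_hm, of x y P] by simp
next
  case (td2_zero x y)
  then show ?case using zc_comp[OF td2_hm, of x y P "[x, y]"] by (simp add: td2.td2_zero two_objects)
qed (auto simp: comp_assoc' comp_plus_left comp_scal_left intro: td2.intros)

lemma td_gen1: "gen g p \<Longrightarrow> td Black g"
  using td_gen[OF _ td_id] idc_right[OF gen_hm] by metis

lemma td2_gen: assumes "gen g p" "[x] \<in> objects" shows "td2 Black x (rw g [x])" "td2 x Black (sh x g)"
  using td2_left[OF assms(1) td2_id, of x] td2_right[OF assms(1) td2_id, of x]
    idc_right[OF hm_rw[OF gen_hm[OF assms(1)] assms(2)]] idc_right[OF hm_sh[OF gen_hm[OF assms(1)] assms(2)]] by simp_all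

lemma td2_td: "td y P \<Longrightarrow> [x] \<in> objects \<Longrightarrow> [y] \<in> objects \<Longrightarrow> td2 y x (rw P [x]) \<and> td2 x y (sh x P)"
  by (induction rule: td.induct)
    (auto simp: rw_comp sh_comp rw_idc sh_idc linear_simps rw_zc sh_zc intro: td2.intros)

lemma td_token: "td Black (cl (Token a))"
proof -
  obtain x y where a: "x \<in> gr 0" "y \<in> gr 1" "a = x + y" by (rule gr_cases)
  have "cl (Scale 1 (Token x) \<boxplus> Scale 1 (Token y)) = cl (Token a)"
    using rel[OF token_linear[of 1 x 1 y]] a by simp
  then show ?thesis
    using td_add[OF td_scal td_scal, OF td_gen1 td_gen1, OF gen_Token gen_Token, OF a(1,2)] cl_ops by metis
qed

lemma td_term_power: "td Black (cl f) \<Longrightarrow> td Black (cl (term_power [Black] f n))"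
  by (induction n) (auto simp: term_power_Suc td_id cl_ops[symmetric] intro: td_mult)

lemma td_dot_powi: "td Black (cl (dot_powi r))"
  unfolding dot_powi_def term_powi_def using td_gen1[OF gen_Dot] td_gen1[OF gen_DotInv]
  by (auto intro: td_term_power)

lemma term_sum_induct:
  assumes "finite S" "P (Zero i j)" "\<And>x f. x \<in> S \<Longrightarrow> P f \<Longrightarrow> P (t x \<boxplus> f)"
  shows "P (term_sum i j S t)"
proof -
  obtain xs where xs: "set xs = S" "term_sum i j S t = foldr (\<lambda>x f. t x \<boxplus> f) xs (Zero i j)"
    using term_sum_cases[OF assms(1)] by metis
  have "set xs \<subseteq> S \<Longrightarrow> P (foldr (\<lambda>x f. t x \<boxplus> f) xs (Zero i j))"
    by (induction xs) (auto intro: assms)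
  then show ?thesis using xs by simp
qed

lemma td_bracket: "td Black (cl (bracket f))"
  unfolding bracket_def
proof (rule term_sum_induct)
  fix r g assume "td Black (cl g)"
  then show "td Black (cl (Token (lookup f r) \<bullet> dot_powi r \<boxplus> g))"
    using td_add[OF td_mult[OF td_token td_dot_powi]] by (simp add: cl_ops[symmetric])
qed (auto simp: td_zero)

text \<open>By the skein relation, the difference of the positive and the negative crossing.\<close>

definition Zc :: "('a, 'k) mor set" where
  "Zc = scal z (cl (term_sum [Black, Black] [Black, Black] B (\<lambda>b. Token b \<boxtimes> Token (dual b))))"

lemma td2_Zc: "td2 Black Black Zc"
proof -
  have "td2 Black Black (cl (term_sum [Black, Black] [Black, Black] B (\<lambda>b. Token b \<boxtimes> Token (dual b))))"
  proof (rule term_sum_induct)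
    fix b f assume b: "b \<in> B" and f: "td2 Black Black (cl f)"
    have T: "cl (Token x) \<in> hm [Black] [Black]" for x by (intro cl_hm arrow.intros)
    have o: "[Black] \<in> objects" by simp
    have "cl (Token b \<boxtimes> Token (dual b)) = rw (cl (Token b)) [Black] \<star> sh Black (cl (Token (dual b)))"
      unfolding cl_Tensor[symmetric]
      using interchange_left[OF hm_idc[OF o] T T hm_idc[OF o] hpar_idc, of b "dual b"] idc_right[OF T] idc_left[OF T] by simp
    moreover have "td2 Black Black (rw (cl (Token b)) [Black] \<star> sh Black (cl (Token (dual b))))"
      by (rule td2_mult) (use td2_td[OF td_token o o] in auto)
    ultimately show "td2 Black Black (cl (Token b \<boxtimes> Token (dual b) \<boxplus> f))"
      using td2_add[OF _ f] by (simp add: cl_Add[symmetric])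
  qed (auto simp: B_finite td2_zero)
  then show ?thesis unfolding Zc_def by (rule td2_scal)
qed

abbreviation "Tp \<equiv> cl Tpos"
abbreviation "Tn \<equiv> cl Tneg"

lemma Tp_hm: "Tp \<in> hm [Black, Black] [Black, Black]" and Tn_hm: "Tn \<in> hm [Black, Black] [Black, Black]"
  by (intro cl_hm arrow.intros)+

lemma Zc_hm: "Zc \<in> hm [Black, Black] [Black, Black]" by (rule td2_hm[OF td2_Zc]) auto

lemma Tp_Tn: "Tp \<star> Tn = idc [Black, Black]" and Tn_Tp: "Tn \<star> Tp = idc [Black, Black]"
  unfolding cl_ops by (rule rel, rule cross_inv_right cross_inv_left)+

lemma Tn_eq: "Tn = Tp \<squnion> scal (- 1) Zc" and Tp_eq: "Tp = Tn \<squnion> Zc"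
proof -
  have s: "Tp \<squnion> scal (- 1) Tn = Zc" unfolding Zc_def cl_ops by (rule rel[OF skein])
  have "Tp = Zc \<squnion> scal (- 1) (scal (- 1) Tn)" by (rule eq_plusI[OF s Tp_hm hm_scal[OF Tn_hm]])
  then show 1: "Tp = Tn \<squnion> Zc" by (simp add: scal_scal scal_one[OF Tn_hm] plus_commute)
  show "Tn = Tp \<squnion> scal (- 1) Zc" by (rule eq_plusI[OF 1[symmetric] Tn_hm Zc_hm])
qed

lemma dot_invs: "cl Dot \<star> cl DotInv = idc [Black]" "cl DotInv \<star> cl Dot = idc [Black]"
  unfolding cl_ops by (rule rel, rule dot_inv_right dot_inv_left)+

lemma rw_dot_invs: assumes "[x] \<in> objects"
  shows "rw (cl Dot) [x] \<star> rw (cl DotInv) [x] = idc [Black, x]"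
    "rw (cl DotInv) [x] \<star> rw (cl Dot) [x] = idc [Black, x]"
    "sh x (cl Dot) \<star> sh x (cl DotInv) = idc [x, Black]"
    "sh x (cl DotInv) \<star> sh x (cl Dot) = idc [x, Black]"
  using assms by (simp_all add: rw_comp[symmetric] sh_comp[symmetric] dot_invs rw_idc sh_idc)

text \<open>Turns a rule for moving a dot through a crossing into the rule for the inverse
  dot.\<close>

lemma conj_swap:
  assumes "U \<star> F = G \<star> V" "F \<star> F' = idc i" "G' \<star> G = idc j" "U \<in> hm i j" "V \<in> hm i j"
  shows "G' \<star> U = V \<star> F'"
proof -
  have "G' \<star> (U \<star> F) \<star> F' = G' \<star> U" using assms(2) idc_right[OF assms(4)] by (simp add: comp_assoc')
  moreover have "G' \<star> (G \<star> V) \<star> F' = V \<star> F'"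
    using assms(3) comp_assoc'[of G' G "V \<star> F'"] idc_left[OF assms(5)] comp_assoc'[of "idc j" V F'] by (simp add: comp_assoc')
  ultimately show ?thesis using assms(1) by simp
qed

text \<open>The correction terms that arise when tokens and dots are moved through a crossing\<close>

definition dd :: "'a P1 letter \<Rightarrow> 'a P1 letter \<Rightarrow> ('a, 'k) mor set \<Rightarrow> bool" where
  "dd x y D \<longleftrightarrow> D = zc [x, y] [y, x] \<or> (x = Black \<and> y = Black \<and> td2 Black Black D)"

lemma dd_Black: "td2 Black Black D \<Longrightarrow> dd Black Black D" by (simp add: dd_def)

lemma dd_cases:
  assumes "dd x y D"
  obtains "x = Black" "y = Black" "td2 Black Black D" | "D = zc [x, y] [y, x]" "\<not> (x = Black \<and> y = Black)"
  using assms td2_zero[of Black Black] unfolding dd_def by blast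

lemma dd_plus: "dd x y D \<Longrightarrow> dd x y D' \<Longrightarrow> [x] \<in> objects \<Longrightarrow> [y] \<in> objects \<Longrightarrow> dd x y (D \<squnion> D')"
  by (erule dd_cases; erule dd_cases) (auto simp: dd_def zc_plus_zc two_objects td2_add)

lemma dd_scal: "dd x y D \<Longrightarrow> [x] \<in> objects \<Longrightarrow> [y] \<in> objects \<Longrightarrow> dd x y (scal c D)"
  by (erule dd_cases) (auto simp: dd_def scal_zc two_objects td2_scal)

lemma dd_left: "dd x y D \<Longrightarrow> td2 y x W \<Longrightarrow> [x] \<in> objects \<Longrightarrow> [y] \<in> objects \<Longrightarrow> dd x y (W \<star> D)"
  by (erule dd_cases) (auto simp: dd_def comp_zc[OF td2_hm] two_objects td2_mult)

lemma dd_right: "dd x y D \<Longrightarrow> td2 x y W \<Longrightarrow> [x] \<in> objects \<Longrightarrow> [y] \<in> objects \<Longrightarrow> dd x y (D \<star> W)"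
  by (erule dd_cases) (auto simp: dd_def zc_comp[OF td2_hm] two_objects td2_mult)

lemma dd_zc: "dd x y (zc [x, y] [y, x])" by (simp add: dd_def)

text \<open>A dot that passes a crossing, and a token that passes it in the direction not covered by
  the relation, turn \<open>Tp\<close> into \<open>Tn\<close> or have to be treated through
  \<open>Tn\<close>. The two differ by \<open>Zc\<close>, so each correction is \<open>Zc\<close>
  times the generator.\<close>

lemma Tp_gen:
  assumes "gen g p"
  shows "(\<exists>D. td2 Black Black D \<and> Tp \<star> rw g [Black] = sh Black g \<star> Tp \<squnion> D) \<and>
    (\<exists>D. td2 Black Black D \<and> Tp \<star> sh Black g = rw g [Black] \<star> Tp \<squnion> D)"
proof -
  have o: "[Black] \<in> objects" by simp
  have Tok: "Tp \<star> rw (cl (Token a)) [Black] = sh Black (cl (Token a)) \<star> Tp" for a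
    unfolding cl_ops by (rule rel[OF cross_token])
  have Dot: "Tp \<star> rw (cl Dot) [Black] = sh Black (cl Dot) \<star> Tn"
    unfolding cl_ops by (rule rel[OF cross_dot])
  have hms: "rw g [Black] \<in> hm [Black, Black] [Black, Black]" "sh Black g \<in> hm [Black, Black] [Black, Black]"
    using hm_rw[OF gen_hm[OF assms] o] hm_sh[OF gen_hm[OF assms] o] by simp_all
  have D: "td2 Black Black (rw g [Black])" "td2 Black Black (sh Black g)" using td2_gen[OF assms o] .
  have fromTn: "Tn \<star> F = G \<star> Tp \<Longrightarrow> Tp \<star> F = G \<star> Tp \<squnion> Zc \<star> F" for F G
    by (metis Tp_eq comp_plus_left)
  have toTp: "Tp \<star> F = G \<star> Tn \<Longrightarrow> Tp \<star> F = G \<star> Tp \<squnion> scal (- 1) (G \<star> Zc)" for F G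
    by (metis Tn_eq comp_plus_right comp_scal_right)
  have Zr: "td2 Black Black F \<Longrightarrow> td2 Black Black (Zc \<star> F)"
    and Zl: "td2 Black Black F \<Longrightarrow> td2 Black Black (scal c (F \<star> Zc))" for F c
    using td2_mult[OF td2_Zc, of F] td2_scal[OF td2_mult[OF _ td2_Zc, of F]] by auto
  from assms show ?thesis
  proof cases
    case (gen_Token a)
    have "Tn \<star> sh Black g = rw g [Black] \<star> Tn"
    proof -
      have "Tn \<star> (sh Black g \<star> Tp) \<star> Tn = Tn \<star> (Tp \<star> rw g [Black]) \<star> Tn"
        using Tok[of a] gen_Token by simp
      then show ?thesis
        using Tp_Tn idc_right[OF hms(2)] idc_left[OF hms(1)] Tn_Tp comp_assoc'[of Tn Tp "rw g [Black] \<star> Tn"]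
          comp_assoc'[of "idc [Black, Black]" "rw g [Black]" Tn] by (simp add: comp_assoc')
    qed
    moreover have "rw g [Black] \<star> Tn = rw g [Black] \<star> Tp \<squnion> scal (- 1) (rw g [Black] \<star> Zc)"
      by (simp add: Tn_eq comp_plus_right comp_scal_right)
    ultimately have "Tp \<star> sh Black g = rw g [Black] \<star> Tp \<squnion> (scal (- 1) (rw g [Black] \<star> Zc) \<squnion> Zc \<star> sh Black g)"
      by (metis Tp_eq comp_plus_left plus_assoc)
    moreover have "Tp \<star> rw g [Black] = sh Black g \<star> Tp \<squnion> zc [Black, Black] [Black, Black]"
      using Tok[of a] plus_zc[OF hm_comp[OF Tp_hm hms(1)]] gen_Token by simp
    ultimately show ?thesis using td2_add[OF Zl[OF D(1)] Zr[OF D(2)]] td2_zero[of Black Black] by blast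
  next
    case gen_Dot
    have "Tn \<star> sh Black g = rw g [Black] \<star> Tp"
    proof -
      have "Tn \<star> (sh Black g \<star> Tn) \<star> Tp = Tn \<star> (Tp \<star> rw g [Black]) \<star> Tp"
        using Dot gen_Dot by simp
      then show ?thesis
        using Tn_Tp idc_right[OF hms(2)] idc_left[OF hms(1)] comp_assoc'[of Tn Tp "rw g [Black] \<star> Tp"]
          comp_assoc'[of "idc [Black, Black]" "rw g [Black]" Tp] by (simp add: comp_assoc')
    qed
    from fromTn[OF this] toTp[OF Dot] show ?thesis using Zr[OF D(2)] Zl[OF D(2)] gen_Dot by blast
  next
    case gen_DotInv
    have 1: "sh Black g \<star> Tp = Tn \<star> rw g [Black]"
      using conj_swap[OF Dot rw_dot_invs(1)[OF o] rw_dot_invs(4)[OF o] Tp_hm Tn_hm] gen_DotInv by simp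
    have "Tp \<star> sh Black g = rw g [Black] \<star> Tn"
    proof -
      have "Tp \<star> (sh Black g \<star> Tp) \<star> Tn = Tp \<star> (Tn \<star> rw g [Black]) \<star> Tn" using 1 by simp
      then show ?thesis
        using Tp_Tn idc_right[OF hms(2)] idc_left[OF hms(1)] comp_assoc'[of Tp Tn "rw g [Black] \<star> Tn"]
          comp_assoc'[of "idc [Black, Black]" "rw g [Black]" Tn] by (simp add: comp_assoc')
    qed
    from fromTn[OF 1[symmetric]] toTp[OF this] show ?thesis using Zr[OF D(1)] Zl[OF D(1)] by blast
  qed
qed

lemma XX_gen_left:
  assumes "gen g p" "[x] \<in> objects"
  shows "\<exists>D. dd Black x D \<and> XX Black x \<star> rw g [x] = sh x g \<star> XX Black x \<squnion> D"
proof (cases x)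
  case Black
  then show ?thesis using Tp_gen[OF assms(1)] dd_Black by auto
next
  case (Red Q)
  have Q: "Q \<in> E" using assms(2) Red by simp
  have X: "cl (Lam Q) \<in> hm [Black, x] [x, Black]" using XX_hm[of Black x] assms(2) Red by (simp add: crossable_def)
  have Dot: "cl (Lam Q) \<star> rw (cl Dot) [x] = sh x (cl Dot) \<star> cl (Lam Q)"
    unfolding cl_ops Red by (rule rel[OF lam_dot[OF Q]])
  have "cl (Lam Q) \<star> rw g [x] = sh x g \<star> cl (Lam Q)"
    using assms(1)
  proof cases
    case (gen_Token a)
    show ?thesis unfolding gen_Token(1) cl_ops Red by (rule rel[OF lam_token[OF Q]])
  next
    case gen_DotInv
    then show ?thesis using conj_swap[OF Dot rw_dot_invs(1)[OF assms(2)] rw_dot_invs(4)[OF assms(2)] X X] by simp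
  qed (use Dot in simp)
  moreover have "cl (Lam Q) \<star> rw g [x] \<in> hm [Black, x] [x, Black]"
    using hm_comp[OF X, of "rw g [x]"] hm_rw[OF gen_hm[OF assms(1)] assms(2)] by simp
  ultimately show ?thesis using dd_zc[of Black x] plus_zc Red by fastforce
qed

lemma XX_gen_right:
  assumes "gen g p" "[x] \<in> objects"
  shows "\<exists>D. dd x Black D \<and> XX x Black \<star> sh x g = rw g [x] \<star> XX x Black \<squnion> D"
proof (cases x)
  case Black
  then show ?thesis using Tp_gen[OF assms(1)] dd_Black by auto
next
  case (Red Q)
  have Q: "Q \<in> E" using assms(2) Red by simp
  have X: "cl (Rho Q) \<in> hm [x, Black] [Black, x]" using XX_hm[of x Black] assms(2) Red by (simp add: crossable_def)
  have Dot: "cl (Rho Q) \<star> sh x (cl Dot) = rw (cl Dot) [x] \<star> cl (Rho Q)"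
    unfolding cl_ops Red by (rule rel[OF rho_dot[OF Q]])
  have "cl (Rho Q) \<star> sh x g = rw g [x] \<star> cl (Rho Q)"
    using assms(1)
  proof cases
    case (gen_Token a)
    show ?thesis unfolding gen_Token(1) cl_ops Red by (rule rel[OF rho_token[OF Q]])
  next
    case gen_DotInv
    then show ?thesis using conj_swap[OF Dot rw_dot_invs(3)[OF assms(2)] rw_dot_invs(2)[OF assms(2)] X X] by simp
  qed (use Dot in simp)
  moreover have "cl (Rho Q) \<star> sh x g \<in> hm [x, Black] [Black, x]"
    using hm_comp[OF X, of "sh x g"] hm_sh[OF gen_hm[OF assms(1)] assms(2)] by simp
  ultimately show ?thesis using dd_zc[of x Black] plus_zc Red by fastforce
qed

lemma plus_swap: "(F \<squnion> G) \<squnion> (F' \<squnion> G') = (F \<squnion> F') \<squnion> (G \<squnion> G')"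
  by (metis plus_assoc plus_commute)

text \<open>Tokens and dots below a crossing are moved above it, one generator at a time. The
  correction has lost the crossing and consists of tokens and dots.\<close>

lemma td2_through_crossing:
  "td2 x y W \<Longrightarrow> crossable x y \<Longrightarrow> [x] \<in> objects \<Longrightarrow> [y] \<in> objects \<Longrightarrow>
    \<exists>W' D. td2 y x W' \<and> dd x y D \<and> XX x y \<star> W = W' \<star> XX x y \<squnion> D"
proof (induction rule: td2.induct)
  case (td2_id x y)
  note X = XX_hm[OF td2_id]
  have "XX x y \<star> idc [x, y] = idc [y, x] \<star> XX x y \<squnion> zc [x, y] [y, x]"
    using idc_left[OF X] idc_right[OF X] plus_zc[OF X] by simp
  then show ?case using td2.td2_id dd_zc by blast
next
  case (td2_left g p y W)
  then obtain W' D where W': "td2 y Black W'" "dd Black y D" "XX Black y \<star> W = W' \<star> XX Black y \<squnion> D" by blast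
  obtain D1 where D1: "dd Black y D1" "XX Black y \<star> rw g [y] = sh y g \<star> XX Black y \<squnion> D1"
    using XX_gen_left[OF td2_left(1) td2_left(6)] by blast
  have "XX Black y \<star> (rw g [y] \<star> W) = (sh y g \<star> W') \<star> XX Black y \<squnion> (sh y g \<star> D \<squnion> D1 \<star> W)"
    using W'(3) D1(2) comp_assoc'[of "XX Black y" "rw g [y]" W] by (simp add: comp_assoc' linear_simps plus_assoc)
  moreover have "dd Black y (sh y g \<star> D \<squnion> D1 \<star> W)"
    using td2_left W'(2) D1(1) td2_gen[OF td2_left(1)] by (intro dd_plus dd_left dd_right) auto
  ultimately show ?case using td2_right[OF td2_left(1) W'(1)] by blast
next
  case (td2_right g p x W)
  then obtain W' D where W': "td2 Black x W'" "dd x Black D" "XX x Black \<star> W = W' \<star> XX x Black \<squnion> D" by blast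
  obtain D1 where D1: "dd x Black D1" "XX x Black \<star> sh x g = rw g [x] \<star> XX x Black \<squnion> D1"
    using XX_gen_right[OF td2_right(1) td2_right(5)] by blast
  have "XX x Black \<star> (sh x g \<star> W) = (rw g [x] \<star> W') \<star> XX x Black \<squnion> (rw g [x] \<star> D \<squnion> D1 \<star> W)"
    using W'(3) D1(2) comp_assoc'[of "XX x Black" "sh x g" W] by (simp add: comp_assoc' linear_simps plus_assoc)
  moreover have "dd x Black (rw g [x] \<star> D \<squnion> D1 \<star> W)"
    using td2_right W'(2) D1(1) td2_gen[OF td2_right(1)] by (intro dd_plus dd_left dd_right) auto
  ultimately show ?case using td2_left[OF td2_right(1) W'(1)] by blast
next
  case (td2_add x y W1 W2)
  then obtain W1' D1 W2' D2 where W: "td2 y x W1'" "dd x y D1" "XX x y \<star> W1 = W1' \<star> XX x y \<squnion> D1"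
    "td2 y x W2'" "dd x y D2" "XX x y \<star> W2 = W2' \<star> XX x y \<squnion> D2" by blast
  have "XX x y \<star> (W1 \<squnion> W2) = (W1' \<squnion> W2') \<star> XX x y \<squnion> (D1 \<squnion> D2)"
    using W(3,6) plus_swap by (simp add: linear_simps)
  then show ?case using td2.td2_add[OF W(1,4)] dd_plus[OF W(2,5)] td2_add by blast
next
  case (td2_scal x y W c)
  then obtain W' D where W: "td2 y x W'" "dd x y D" "XX x y \<star> W = W' \<star> XX x y \<squnion> D" by blast
  have "XX x y \<star> scal c W = scal c W' \<star> XX x y \<squnion> scal c D"
    using W(3) by (simp add: linear_simps)
  then show ?case using td2.td2_scal[OF W(1)] dd_scal[OF W(2)] td2_scal by blast
next
  case (td2_zero x y)
  note X = XX_hm[OF td2_zero]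
  have "XX x y \<star> zc [x, y] [x, y] = zc [y, x] [y, x] \<star> XX x y \<squnion> zc [x, y] [y, x]"
    using zc_comp[OF X, of "[y, x]"] comp_zc[OF X, of "[x, y]"] td2_zero by (simp add: zc_plus_zc two_objects)
  then show ?case using td2.td2_zero dd_zc by blast
qed

text \<open>For two black strands, \<open>Tp\<close> is \<open>Tn\<close> plus \<open>Zc\<close> and
  \<open>Tn\<close> inverts \<open>Tp\<close>. For a black and a red strand, the relations replace
  the double crossing by the bracket of Q on the black strand.\<close>

lemma double_crossing:
  assumes "crossable x y" "[x] \<in> objects" "[y] \<in> objects"
  shows "\<exists>W V. td2 x y W \<and> td2 y x V \<and> (XX y x \<star> XX x y = W \<or> x = Black \<and> y = Black \<and> XX y x \<star> XX x y = W \<squnion> V \<star> XX x y)"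
proof (cases x)
  case Black
  show ?thesis
  proof (cases y)
    case y: Black
    have "Tp \<star> Tp = idc [Black, Black] \<squnion> Zc \<star> Tp" using Tp_eq Tn_Tp comp_plus_left by metis
    then show ?thesis using Black y td2_id td2_Zc by auto
  next
    case (Red Q)
    have Q: "Q \<in> E" using assms Red by simp
    have "cl (Rho Q) \<star> cl (Lam Q) = rw (cl (bracket Q)) [Red Q]" unfolding cl_ops by (rule rel[OF rho_lam[OF Q]])
    then show ?thesis using Black Red td2_td[OF td_bracket[of Q], of "Red Q"] assms td2_id[of y x] by auto
  qed
next
  case (Red Q)
  then have y: "y = Black" using assms(1) by (auto simp: crossable_def)
  have Q: "Q \<in> E" using assms Red by simp
  have "cl (Lam Q) \<star> cl (Rho Q) = sh (Red Q) (cl (bracket Q))" unfolding cl_ops by (rule rel[OF lam_rho[OF Q]])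
  then show ?thesis using y Red td2_td[OF td_bracket[of Q], of "Red Q"] assms td2_id[of y x] by auto
qed

text \<open>Letters that cross pairwise include at most one red letter, so there are four cases,
  with one defining relation each. A correction occurs only for a red strand between two black ones,
  and it contains no crossings.\<close>

lemma braid_relation:
  assumes "crossable x y" "crossable x y'" "crossable y y'" "[x] \<in> objects" "[y] \<in> objects" "[y'] \<in> objects"
  shows "\<exists>D. (D = zc [x, y, y'] [y', y, x] \<or> (\<exists>Q. x = Black \<and> y = Red Q \<and> y' = Black \<and>
      D = scal z (cl (bracket_red Q (Delta1 (P2_first Q)))))) \<and>
    rw (XX y y') [x] \<star> (sh y (XX x y') \<star> rw (XX x y) [y']) =
    sh y' (XX x y) \<star> (rw (XX x y') [y] \<star> sh x (XX y y')) \<squnion> D"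
    (is "\<exists>D. _ \<and> ?L = ?R \<squnion> D")
proof -
  have L: "?L \<in> hm [x, y, y'] [y', y, x]"
    using hm_rw[OF XX_hm, of y y' "[x]"] hm_sh[OF XX_hm, of x y' y] hm_rw[OF XX_hm, of x y "[y']"] assms
    by (auto intro!: hm_comp)
  have eq: "?L = ?R \<Longrightarrow> ?thesis" using plus_zc[OF L] by metis
  consider "x = Black" "y = Black" "y' = Black" | Q where "x = Red Q" "y = Black" "y' = Black"
    | Q where "x = Black" "y = Red Q" "y' = Black" | Q where "x = Black" "y = Black" "y' = Red Q"
    using assms(1-3) by (cases x; cases y; cases y') (auto simp: crossable_def)
  then show ?thesis
  proof cases
    case 1
    show ?thesis by (rule eq) (unfold 1 XX.simps cl_ops, rule rel[OF braid])
  next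
    case (2 Q)
    then have Q: "Q \<in> E" using assms by simp
    show ?thesis by (rule eq) (unfold 2 XX.simps cl_ops, rule rel[OF cross_rho[OF Q]])
  next
    case (3 Q)
    then have Q: "Q \<in> E" using assms by simp
    have "?L = ?R \<squnion> scal z (cl (bracket_red Q (Delta1 (P2_first Q))))"
      unfolding 3 XX.simps cl_ops by (rule rel[OF red_braid[OF Q]])
    then show ?thesis using 3 by blast
  next
    case (4 Q)
    then have Q: "Q \<in> E" using assms by simp
    show ?thesis by (rule eq) (unfold 4 XX.simps cl_ops, rule rel[OF lam_cross[OF Q]])
  qed
qed

end

section \<open>Factorization of morphisms\<close>

context LAH
begin

text \<open>\<open>pull y i i' C\<close>: the letter \<open>y\<close> is moved to the front of the word \<open>i\<close>.\<close>

inductive pull :: "'a P1 letter \<Rightarrow> 'a obj \<Rightarrow> 'a obj \<Rightarrow> ('a, 'k) mor set \<Rightarrow> bool" where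
  pull_base: "y # i' \<in> objects \<Longrightarrow> pull y (y # i') i' (idc (y # i'))"
| pull_step: "pull y i i' C \<Longrightarrow> crossable x y \<Longrightarrow> [x] \<in> objects \<Longrightarrow>
    pull y (x # i) (x # i') (rw (XX x y) i' \<star> sh x C)"

lemma pull_objects: "pull y i i' C \<Longrightarrow> [y] \<in> objects \<and> i' \<in> objects \<and> i \<in> objects \<and> length i = Suc (length i')"
  by (induction rule: pull.induct) (metis objects_Cons length_Cons)+

lemma pull_hm: "pull y i i' C \<Longrightarrow> C \<in> hm i (y # i')"
proof (induction rule: pull.induct)
  case (pull_step y i i' C x)
  then show ?case using hm_rw[OF XX_hm, of x y i'] hm_sh[OF pull_step(4), of x] pull_objects[OF pull_step(1)]
    by (auto intro!: hm_comp)
qed (rule hm_idc)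

text \<open>\<open>fac i j F\<close>: in \<open>F\<close>, one strand is first moved to the left end, where it stays; the morphism \<open>H\<close> of the
  remaining strands is arbitrary. The point is that every morphism is of this form.\<close>

inductive fac :: "'a obj \<Rightarrow> 'a obj \<Rightarrow> ('a, 'k) mor set \<Rightarrow> bool" where
  fac_base: "pull y i i' C \<Longrightarrow> td y P \<Longrightarrow> H \<in> hm i' j' \<Longrightarrow> fac i (y # j') (rw P j' \<star> (sh y H \<star> C))"
| fac_nil: "fac [] [] (idc [])"
| fac_add: "fac i j F \<Longrightarrow> fac i j G \<Longrightarrow> fac i j (F \<squnion> G)"
| fac_scal: "fac i j F \<Longrightarrow> fac i j (scal c F)"
| fac_zero: "i \<in> objects \<Longrightarrow> j \<in> objects \<Longrightarrow> fac i j (zc i j)"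

lemma fac_hm: "fac i j F \<Longrightarrow> F \<in> hm i j"
proof (induction rule: fac.induct)
  case (fac_base y i i' C P H j')
  note o = pull_objects[OF fac_base(1)] hm_objects[OF fac_base(3)]
  have "rw P j' \<in> hm (y # j') (y # j')" using hm_rw[OF td_hm[OF fac_base(2)], of j'] o by simp
  then show ?case using hm_comp[OF hm_sh[OF fac_base(3), of y] pull_hm[OF fac_base(1)]] o by (auto intro: hm_comp)
qed (auto intro: hm_idc hm_plus hm_scal hm_zc)

lemma fac_objects: "fac i (y # j) F \<Longrightarrow> i \<in> objects \<and> [y] \<in> objects \<and> j \<in> objects"
  using hm_objects[OF fac_hm] objects_Cons[of y j] by blast

lemma fac_td: "td y W \<Longrightarrow> fac i (y # j) F \<Longrightarrow> fac i (y # j) (rw W j \<star> F)"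
proof -
  assume W: "td y W"
  have "fac i t F \<Longrightarrow> t = y # j \<Longrightarrow> fac i t (rw W j \<star> F)" for t
  proof (induction rule: fac.induct)
    case (fac_base y' i i' C P H j')
    then have "td y (W \<star> P)" using W pull_objects td_mult by auto
    then have "fac i (y # j) (rw (W \<star> P) j \<star> (sh y H \<star> C))" using fac.fac_base fac_base by blast
    then show ?case using fac_base(4) by (simp add: rw_comp comp_assoc')
  next
    case (fac_zero i t)
    then have "[y] \<in> objects" "j \<in> objects" using objects_Cons[of y j] by auto
    then have "rw W j \<in> hm t t" using hm_rw[OF td_hm[OF W], of j] fac_zero by simp
    then show ?case using comp_zc fac_zero fac.fac_zero by simp
  qed (auto simp: linear_simps intro: fac_add fac_scal)
  then show "fac i (y # j) F \<Longrightarrow> fac i (y # j) (rw W j \<star> F)" by blast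
qed

text \<open>A token on the front strand supercommutes with G on the others. The sign depends on the
  parity of each generator, so P, which need not be homogeneous, becomes another combination
  P'.\<close>

lemma td_slide: "td y P \<Longrightarrow> [y] \<in> objects \<Longrightarrow> G \<in> hm s s' \<Longrightarrow> hpar G q \<Longrightarrow>
    \<exists>P'. td y P' \<and> sh y G \<star> rw P s = rw P' s' \<star> sh y G"
proof (induction rule: td.induct)
  case (td_id y)
  note o = hm_objects[OF td_id(2)]
  have "sh y G \<star> rw (idc [y]) s = rw (idc [y]) s' \<star> sh y G"
    using idc_left[OF hm_sh[OF td_id(2,1)]] idc_right[OF hm_sh[OF td_id(2,1)]] o td_id(1) by (simp add: rw_idc)
  then show ?case using td.td_id by blast
next
  case (td_gen g p P)
  then obtain P' where P': "td Black P'" "sh Black G \<star> rw P s = rw P' s' \<star> sh Black G" by blast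
  have "sh Black G \<star> rw (g \<star> P) s = (sh Black G \<star> rw g s) \<star> rw P s" by (simp add: rw_comp comp_assoc')
  also have "\<dots> = scal (koszul p q) (rw g s' \<star> sh Black G) \<star> rw P s"
    using slide_homogeneous[OF gen_hm[OF td_gen(1)] gen_par[OF td_gen(1)] td_gen(5,6)] by simp
  also have "\<dots> = rw (scal (koszul p q) (g \<star> P')) s' \<star> sh Black G"
    by (simp add: linear_simps rw_comp comp_assoc' P'(2))
  finally show ?case using td_scal[OF td.td_gen[OF td_gen(1) P'(1)]] by blast
next
  case (td_add y P Q)
  then obtain P' Q' where P': "td y P'" "sh y G \<star> rw P s = rw P' s' \<star> sh y G"
    "td y Q'" "sh y G \<star> rw Q s = rw Q' s' \<star> sh y G" by blast
  have "sh y G \<star> rw (P \<squnion> Q) s = rw (P' \<squnion> Q') s' \<star> sh y G" using P' by (simp add: linear_simps)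
  then show ?case using td.td_add[OF P'(1,3)] by blast
next
  case (td_scal y P c)
  then obtain P' where P': "td y P'" "sh y G \<star> rw P s = rw P' s' \<star> sh y G" by blast
  have "sh y G \<star> rw (scal c P) s = rw (scal c P') s' \<star> sh y G" using P' by (simp add: linear_simps)
  then show ?case using td.td_scal[OF P'(1)] by blast
next
  case (td_zero y)
  note o = hm_objects[OF td_zero(2)] and G = hm_sh[OF td_zero(2,1)]
  have "sh y G \<star> rw (zc [y] [y]) s = rw (zc [y] [y]) s' \<star> sh y G"
    using comp_zc[OF G, of "y # s"] zc_comp[OF G, of "y # s'"] o td_zero(1) hm_objects[OF G] by (simp add: rw_zc)
  then show ?case using td.td_zero by blast
qed

text \<open>A morphism that misses the front strand slides past P and is absorbed by H, which is
  arbitrary. Sliding requires a parity, hence the split into an even and an odd part.\<close>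

lemma fac_sh: assumes "G \<in> hm j j'" "fac i (y # j) F" shows "fac i (y # j') (sh y G \<star> F)"
proof -
  have h: "fac i t F \<Longrightarrow> t = y # j \<Longrightarrow> fac i (y # j') (sh y G \<star> F)" if G: "G \<in> hm j j'" "hpar G q" for G q t
  proof (induction rule: fac.induct)
    case (fac_base y' i i' C P H s)
    note o = pull_objects[OF fac_base(1)]
    have e: "y' = y" "s = j" using fac_base by auto
    obtain P' where P': "td y P'" "sh y G \<star> rw P j = rw P' j' \<star> sh y G"
      using td_slide[OF fac_base(2) _ G[folded e(2)]] o e by blast
    have "fac i (y # j') (rw P' j' \<star> (sh y (G \<star> H) \<star> C))"
      using fac.fac_base[OF fac_base(1)[unfolded e] P'(1) hm_comp[OF G(1)]] fac_base(3) e by blast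
    moreover have "sh y G \<star> (rw P j \<star> (sh y H \<star> C)) = rw P' j' \<star> (sh y (G \<star> H) \<star> C)"
      using P'(2) comp_assoc'[of "sh y G" "rw P j"] by (simp add: sh_comp comp_assoc')
    ultimately show ?case using e by simp
  next
    case (fac_zero i t)
    then have o: "[y] \<in> objects" "y # j' \<in> objects" using objects_Cons[of y j] objects_Cons[of y j'] hm_objects[OF G(1)] by auto
    then show ?case using comp_zc[OF hm_sh[OF G(1) o(1)]] fac_zero fac.fac_zero by simp
  qed (auto simp: linear_simps intro: fac_add fac_scal)
  obtain g where g: "G = cl g" "arrow g j j'" using assms(1) by (rule hmE)
  then obtain G0 G1 where G: "G0 \<in> hm j j'" "G1 \<in> hm j j'" "hpar G0 0" "hpar G1 1" "G = G0 \<squnion> G1"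
    using homogeneous_split by metis
  then show ?thesis using h[OF G(1,3) assms(2)] h[OF G(2,4) assms(2)] by (simp add: linear_simps fac_add)
qed

lemma fac_idc_left: "fac i (y # j) F \<Longrightarrow> idc (y # j) \<star> F = F"
  by (rule idc_left[OF fac_hm])

lemma fac_td2: "td2 x y W \<Longrightarrow> fac i (x # y # s) F \<Longrightarrow> fac i (x # y # s) (rw W s \<star> F)"
proof (induction rule: td2.induct)
  case (td2_id x y)
  have "[x, y] \<in> objects" "s \<in> objects"
    using fac_objects[OF td2_id] objects_Cons[of y s] objects_Cons[of x "[y]"] by auto
  then show ?case using fac_idc_left[OF td2_id] td2_id by (simp add: rw_idc)
next
  case (td2_left g p y W)
  have o: "[y] \<in> objects" "s \<in> objects" using fac_objects[OF td2_left(4)] objects_Cons[of y s] by auto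
  show ?case using fac_td[OF td_gen1[OF td2_left(1)] td2_left(3)[OF td2_left(4)]] o
    by (simp add: rw_comp rw_rw comp_assoc')
next
  case (td2_right g p x W)
  have o: "s \<in> objects" using fac_objects[OF td2_right(4)] by auto
  have "rw g s \<in> hm (Black # s) (Black # s)" using hm_rw[OF gen_hm[OF td2_right(1)] o] by simp
  from fac_sh[OF this td2_right(3)[OF td2_right(4)]] show ?case
    by (simp add: rw_comp tens2_assoc comp_assoc')
next
  case (td2_zero x y)
  have o: "[x, y] \<in> objects" "s \<in> objects" "i \<in> objects"
    using fac_objects[OF td2_zero] objects_Cons[of y s] objects_Cons[of x "[y]"] by auto
  then show ?case using zc_comp[OF fac_hm[OF td2_zero], of "x # y # s"] hm_objects[OF fac_hm[OF td2_zero]] fac_zero[of i "x # y # s"]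
    by (simp add: rw_zc)
qed (auto simp: linear_simps intro: fac_add fac_scal)

lemma fac_dd: assumes "dd x y D" "fac i (x # y # s) F" shows "fac i (y # x # s) (rw D s \<star> F)"
  using assms(1)
proof (cases rule: dd_cases)
  case 1
  then show ?thesis using fac_td2[of x y D] assms(2) by simp
next
  case 2
  have o: "[x] \<in> objects" "[y] \<in> objects" "s \<in> objects" "i \<in> objects"
    using fac_objects[OF assms(2)] objects_Cons[of y s] by auto
  then have o': "y # x # s \<in> objects" using objects_Cons[of y "x # s"] objects_Cons[of x s] by simp
  show ?thesis using zc_comp[OF fac_hm[OF assms(2)] o'] o fac_zero[OF o(4) o'] by (simp add: 2 rw_zc two_objects)
qed

lemma fac_pull: assumes "pull y i i' C" "H \<in> hm i' j" shows "fac i (y # j) (sh y H \<star> C)"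
  using fac_base[OF assms(1) td_id assms(2)] idc_left_sh[OF hm_comp[OF hm_sh[OF assms(2)] pull_hm[OF assms(1)]]]
    pull_objects[OF assms(1)] by simp

lemma fac_pull1: assumes "pull y i i' C" shows "fac i (y # i') C"
  using fac_pull[OF assms hm_idc] pull_objects[OF assms] idc_left[OF pull_hm[OF assms]] by (simp add: sh_idc)

lemma fac_sh_hm: assumes "[x] \<in> objects" "H \<in> hm i j" shows "fac (x # i) (x # j) (sh x H)"
  using fac_pull[OF pull_base assms(2), of x] idc_right[OF hm_sh[OF assms(2,1)]] hm_objects[OF hm_sh[OF assms(2,1)]] by simp

lemma fac_idc: "i \<in> objects \<Longrightarrow> fac i i (idc i)"
proof (cases i)
  case (Cons x j)
  assume "i \<in> objects"
  then have o: "[x] \<in> objects" "j \<in> objects" using Cons objects_Cons[of x j] by auto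
  show ?thesis using fac_sh_hm[OF o(1) hm_idc[OF o(2)]] o by (simp add: sh_idc Cons)
qed (simp add: fac_nil)

lemma crossing_slide:
  assumes "crossable x y" "[x] \<in> objects" "[y] \<in> objects" "H \<in> hm s s'"
  shows "rw (XX x y) s' \<star> sh x (sh y H) = sh y (sh x H) \<star> rw (XX x y) s"
  using slide[OF XX_hm XX_par assms(4), OF assms(1-3,1)] assms by (simp add: sh_sh)

lemma crossing_hm:
  "crossable x y \<Longrightarrow> [x] \<in> objects \<Longrightarrow> [y] \<in> objects \<Longrightarrow> s \<in> objects \<Longrightarrow> rw (XX x y) s \<in> hm (x # y # s) (y # x # s)"
  using hm_rw[OF XX_hm, of x y s] by simp

text \<open>Once tokens, dots and H have been moved out of the way, crossing x prolongs the pull of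
  y by one step. In the correction term the crossing is lost and x itself is the strand at the
  front.\<close>

lemma fac_cross_sh:
  assumes "crossable x y" "[x] \<in> objects" "fac i (y # s) F"
  shows "fac (x # i) (y # x # s) (rw (XX x y) s \<star> sh x F)"
proof -
  have "fac i t F \<Longrightarrow> t = y # s \<Longrightarrow> fac (x # i) (y # x # s) (rw (XX x y) s \<star> sh x F)" for t
  proof (induction rule: fac.induct)
    case (fac_base y' i i' C P H s')
    note o = pull_objects[OF fac_base(1)] hm_objects[OF fac_base(3)]
    have e: "y' = y" "s' = s" using fac_base(4) by auto
    have oy: "[y] \<in> objects" using o e by simp
    have C: "pull y i i' C" and P: "td y P" and H: "H \<in> hm i' s" using fac_base e by auto
    obtain W D where W: "td2 y x W" "dd x y D" "XX x y \<star> sh x P = W \<star> XX x y \<squnion> D"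
      using td2_through_crossing[OF conjunct2[OF td2_td[OF P assms(2) oy]] assms(1,2) oy] by blast
    have C': "pull y (x # i) (x # i') (rw (XX x y) i' \<star> sh x C)" by (rule pull_step[OF C assms(1,2)])
    have 1: "fac (x # i) (y # x # s) (rw W s \<star> (sh y (sh x H) \<star> (rw (XX x y) i' \<star> sh x C)))"
      by (rule fac_td2[OF W(1) fac_pull[OF C' hm_sh[OF H assms(2)]]])
    have "sh y H \<star> C \<in> hm i (y # s)" using hm_comp[OF hm_sh[OF H oy] pull_hm[OF C]] .
    then have 2: "fac (x # i) (y # x # s) (rw D s \<star> sh x (sh y H \<star> C))"
      by (rule fac_dd[OF W(2) fac_sh_hm[OF assms(2)]])
    have "rw (XX x y) s \<star> sh x (rw P s \<star> (sh y H \<star> C)) = rw (XX x y \<star> sh x P) s \<star> (sh x (sh y H) \<star> sh x C)"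
      by (simp add: sh_comp rw_comp tens2_assoc comp_assoc')
    also have "\<dots> = rw W s \<star> ((rw (XX x y) s \<star> sh x (sh y H)) \<star> sh x C) \<squnion> rw D s \<star> sh x (sh y H \<star> C)"
      by (simp add: W(3) linear_simps rw_comp sh_comp comp_assoc')
    also have "\<dots> = rw W s \<star> (sh y (sh x H) \<star> (rw (XX x y) i' \<star> sh x C)) \<squnion> rw D s \<star> sh x (sh y H \<star> C)"
      using crossing_slide[OF assms(1,2) oy H] by (simp add: comp_assoc')
    finally show ?case using fac_add[OF 1 2] e by simp
  next
    case (fac_zero i t)
    then have o: "[y] \<in> objects" "s \<in> objects" using objects_Cons[of y s] by auto
    have X: "rw (XX x y) s \<in> hm (x # t) (y # x # s)" using crossing_hm[OF assms(1,2) o] fac_zero by simp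
    have o': "x # i \<in> objects" using assms(2) fac_zero(1) objects_Cons by blast
    show ?case using comp_zc[OF X o'] fac_zero assms(2) hm_objects[OF X] o' fac.fac_zero by (simp add: sh_zc)
  qed (auto simp: linear_simps intro: fac_add fac_scal)
  then show ?thesis using assms(3) by blast
qed

lemma fac_tens:
  assumes "td y P" "G \<in> hm j j'" "fac i (y # j @ s) F"
  shows "fac i (y # j' @ s) (rw (P \<bowtie> G) s \<star> F)"
proof -
  have o: "[y] \<in> objects" "s \<in> objects" "j \<in> objects" "j' \<in> objects"
    using fac_objects[OF assms(3)] hm_objects[OF assms(2)] by auto
  have P: "P \<in> hm [y] [y]" by (rule td_hm[OF assms(1) o(1)])
  have "P \<bowtie> G = rw P j' \<star> sh y G"
    using interchange_left[OF hm_idc[OF o(1)] P assms(2) hm_idc[OF o(4)] hpar_idc] idc_right[OF P] idc_left[OF assms(2)] by simp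
  then have "rw (P \<bowtie> G) s \<star> F = rw P (j' @ s) \<star> (sh y (rw G s) \<star> F)"
    using o by (simp add: rw_comp tens2_assoc idc_tens2 comp_assoc')
  then show ?thesis using fac_td[OF assms(1) fac_sh[OF hm_rw[OF assms(2) o(2)] assms(3)]] by simp
qed

lemma fac_bracket_red:
  assumes "fac i (Black # Red Q # Black # s) F"
  shows "fac i (Black # Red Q # Black # s) (rw (cl (bracket_red Q f)) s \<star> F)"
  unfolding bracket_red_def
proof (rule term_sum_induct)
  have o: "i \<in> objects" "Q \<in> E" "s \<in> objects" using fac_objects[OF assms] by auto
  show "fac i (Black # Red Q # Black # s) (rw (zc [Black, Red Q, Black] [Black, Red Q, Black]) s \<star> F)"
    using zc_comp[OF fac_hm[OF assms], of "Black # Red Q # Black # s"] o by (simp add: rw_zc fac_zero)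
  fix x :: "'a \<times> 'a \<times> int \<times> int" and h assume h: "fac i (Black # Red Q # Black # s) (rw (cl h) s \<star> F)"
  obtain b c r r' where x: "x = (b, c, r, r')" by (cases x)
  have G: "sh (Red Q) (cl (Token c)) \<in> hm [Red Q, Black] [Red Q, Black]"
    "sh (Red Q) (cl (dot_powi r')) \<in> hm [Red Q, Black] [Red Q, Black]"
    using hm_sh[OF td_hm[OF td_token[of c]], of "Red Q"] hm_sh[OF td_hm[OF td_dot_powi[of r']], of "Red Q"] o by simp_all
  have s: "Black # Red Q # Black # s = Black # [Red Q, Black] @ s" by simp
  have "fac i (Black # [Red Q, Black] @ s) (rw (cl (Token b) \<bowtie> sh (Red Q) (cl (Token c))) s \<star>
      (rw (cl (dot_powi r) \<bowtie> sh (Red Q) (cl (dot_powi r'))) s \<star> F))"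
    by (rule fac_tens[OF td_token G(1)], rule fac_tens[OF td_dot_powi G(2)]) (use assms in simp)
  from fac_add[OF fac_scal[OF this] h[unfolded s]]
  show "fac i (Black # Red Q # Black # s) (rw (cl ((case x of (b, c, r, s) \<Rightarrow> Scale (lookup f (b, c, r, s))
        ((Token b \<boxtimes> Ident [Red Q] \<boxtimes> Token c) \<bullet> (dot_powi r \<boxtimes> Ident [Red Q] \<boxtimes> dot_powi s))) \<boxplus> h)) s \<star> F)"
    by (simp add: x cl_ops[symmetric] linear_simps rw_comp comp_assoc')
qed simp

text \<open>After the double crossing is resolved, at most one crossing is left, and for this the
  claim is a hypothesis.\<close>

lemma fac_double:
  assumes "crossable x y" "fac i (x # y # s) F" "fac i (y # x # s) (rw (XX x y) s \<star> F)"
  shows "fac i (x # y # s) (rw (XX y x) s \<star> (rw (XX x y) s \<star> F))"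
proof -
  have o: "[x] \<in> objects" "[y] \<in> objects" using fac_objects[OF assms(2)] objects_Cons[of y s] by auto
  obtain W V where W: "td2 x y W" "td2 y x V"
    "XX y x \<star> XX x y = W \<or> x = Black \<and> y = Black \<and> XX y x \<star> XX x y = W \<squnion> V \<star> XX x y"
    using double_crossing[OF assms(1) o] by blast
  have "rw (XX y x) s \<star> (rw (XX x y) s \<star> F) = rw (XX y x \<star> XX x y) s \<star> F" by (simp add: rw_comp comp_assoc')
  moreover from W(3) have "fac i (x # y # s) (rw (XX y x \<star> XX x y) s \<star> F)"
  proof (elim disjE conjE)
    assume e: "x = Black" "y = Black" "XX y x \<star> XX x y = W \<squnion> V \<star> XX x y"
    show ?thesis using fac_add[OF fac_td2[OF W(1) assms(2)]] fac_td2[OF W(2) assms(3)] e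
      by (simp add: linear_simps rw_comp comp_assoc')
  qed (use fac_td2[OF W(1) assms(2)] in simp)
  ultimately show ?thesis by simp
qed

text \<open>The strands y and y' are pulled to the front and then cross, so y' becomes the front
  strand. Induction on the pull of y: the crossing of y and y' is moved down past the strands x that
  both have passed, until it is the first of the crossings with y or resolves a double
  crossing.\<close>

lemma fac_two_pulls:
  "pull y i i' C \<Longrightarrow> pull y' i' r C' \<Longrightarrow> crossable y y' \<Longrightarrow>
    fac i (y' # y # r) (rw (XX y y') r \<star> (sh y C' \<star> C))"
proof (induction arbitrary: r C' rule: pull.induct)
  case (pull_base y i')
  \<comment> \<open>Here y stood at the front from the beginning, so crossing it is one more step in
    the pull of y'.\<close>
  note C' = pull_hm[OF pull_base(2)]
  have o: "[y] \<in> objects" using pull_base(1) objects_Cons by blast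
  have "rw (XX y y') r \<star> (sh y C' \<star> idc (y # i')) = rw (XX y y') r \<star> sh y C'"
    using idc_right[OF hm_sh[OF C' o]] by simp
  then show ?case using fac_pull1[OF pull_step[OF pull_base(2,3) o]] by simp
next
  case (pull_step y i i' C x)
  note o = pull_objects[OF pull_step(1)]
  have C: "C \<in> hm i (y # i')" by (rule pull_hm[OF pull_step(1)])
  from pull_step(5) show ?case
  proof (cases rule: pull.cases)
    \<comment> \<open>Here y' is the strand x that y has passed last, so the two cross
      twice.\<close>
    case (pull_base)
    have X: "rw (XX x y) i' \<star> sh x C \<in> hm (x # i) (y # x # i')"
      by (rule pull_hm[OF pull.pull_step[OF pull_step(1-3)]])
    have "crossable x y" using pull_step by simp
    have "fac (x # i) (x # y # i') (rw (XX y x) i' \<star> (rw (XX x y) i' \<star> sh x C))"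
      by (rule fac_double[OF pull_step(2) fac_sh_hm[OF pull_step(3) C] fac_pull1[OF pull.pull_step[OF pull_step(1-3)]]])
    moreover have "sh y (idc (x # i')) = idc (y # x # i')" using o pull_step by (simp add: sh_idc pull_base)
    ultimately show ?thesis using pull_base idc_left[OF X] by simp
  next
    case (pull_step r' C2)
    note p = pull_step
    note hyp = \<open>pull y i i' C\<close> \<open>crossable x y\<close> \<open>[x] \<in> objects\<close> \<open>crossable y y'\<close>
    have C2: "C2 \<in> hm i' (y' # r')" and o2: "[y'] \<in> objects" "r' \<in> objects"
      using pull_hm[OF p(3)] pull_objects[OF p(3)] by auto
    have oy: "[y] \<in> objects" using o by simp
    let ?Y = "sh x (sh y C2 \<star> C)"
    have K: "sh y C2 \<star> C \<in> hm i (y # y' # r')" by (rule hm_comp[OF hm_sh[OF C2 oy] C])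
    have Y: "fac (x # i) (x # y # y' # r') ?Y" by (rule fac_sh_hm[OF hyp(3) K])
    \<comment> \<open>Both y and y' have passed x. Up to D they may cross first and pass x
      afterwards, and the crossing then falls under the induction hypothesis.\<close>
    obtain D where D: "D = zc [x, y, y'] [y', y, x] \<or> (\<exists>Q. x = Black \<and> y = Red Q \<and> y' = Black \<and>
        D = scal z (cl (bracket_red Q (Delta1 (P2_first Q)))))"
      "rw (XX y y') [x] \<star> (sh y (XX x y') \<star> rw (XX x y) [y']) =
        sh y' (XX x y) \<star> (rw (XX x y') [y] \<star> sh x (XX y y')) \<squnion> D"
      using braid_relation[OF hyp(2) p(4) hyp(4,3) oy o2(1)] by blast
    have ot: "x # i \<in> objects" "y' # y # x # r' \<in> objects" "[x, y, y'] \<in> objects" "[y', y, x] \<in> objects"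
      using hyp(3) o o2 oy objects_Cons[of x i] objects_Cons[of y' "y # x # r'"] objects_Cons[of y "x # r'"] objects_Cons[of x r']
        two_objects objects_Cons[of x "[y, y']"] objects_Cons[of y' "[y, x]"] by auto
    have FD: "fac (x # i) (y' # y # x # r') (rw D r' \<star> ?Y)"
      using D(1)
    proof (elim disjE exE conjE)
      assume "D = zc [x, y, y'] [y', y, x]"
      then show ?thesis using zc_comp[OF fac_hm[OF Y] ot(2)] fac_zero[OF ot(1,2)] ot o2 by (simp add: rw_zc)
    next
      fix Q assume e: "x = Black" "y = Red Q" "y' = Black" "D = scal z (cl (bracket_red Q (Delta1 (P2_first Q))))"
      then show ?thesis using fac_scal[OF fac_bracket_red[OF Y[unfolded e]]] by (simp add: linear_simps)
    qed
    have FR: "fac (x # i) (y' # y # x # r') (sh y' (rw (XX x y) r') \<star> (rw (XX x y') (y # r') \<star> sh x (rw (XX y y') r' \<star> (sh y C2 \<star> C))))"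
      by (rule fac_sh[OF crossing_hm[OF hyp(2,3) oy o2(2)]], rule fac_cross_sh[OF p(4) hyp(3)],
          rule \<open>\<And>C' r. pull y' i' r C' \<Longrightarrow> crossable y y' \<Longrightarrow> fac i (y' # y # r) (rw (XX y y') r \<star> (sh y C' \<star> C))\<close>[OF p(3) hyp(4)])
    have "rw (XX y y') r \<star> (sh y C' \<star> (rw (XX x y) i' \<star> sh x C)) =
      rw (XX y y') (x # r') \<star> (sh y (rw (XX x y') r') \<star> ((sh y (sh x C2) \<star> rw (XX x y) i') \<star> sh x C))"
      using p by (simp add: sh_comp comp_assoc')
    also have "\<dots> = rw (XX y y') (x # r') \<star> (sh y (rw (XX x y') r') \<star> (rw (XX x y) (y' # r') \<star> ?Y))"
      unfolding crossing_slide[OF hyp(2,3) oy C2, symmetric] by (simp add: sh_comp comp_assoc')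
    also have "\<dots> = rw (rw (XX y y') [x] \<star> (sh y (XX x y') \<star> rw (XX x y) [y'])) r' \<star> ?Y"
      using o2 hyp(3) by (simp add: rw_comp tens2_assoc idc_tens2 comp_assoc')
    also have "\<dots> = sh y' (rw (XX x y) r') \<star> (rw (XX x y') (y # r') \<star> sh x (rw (XX y y') r' \<star> (sh y C2 \<star> C))) \<squnion> rw D r' \<star> ?Y"
      unfolding D(2) using o2 oy by (simp add: linear_simps sh_comp rw_comp tens2_assoc idc_tens2 comp_assoc')
    finally show ?thesis using fac_add[OF FR FD] p by simp
  qed
qed

text \<open>The morphism H on the remaining strands has a shorter source, so it is factorized by
  hypothesis. Both strands that meet in the crossing are then pulled ones.\<close>

lemma fac_front:
  assumes IH: "\<And>i' j' H. length i' < length i \<Longrightarrow> H \<in> hm i' j' \<Longrightarrow> fac i' j' H"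
    and F: "fac i (y # y' # s) F" and cr: "crossable y y'"
  shows "fac i (y' # y # s) (rw (XX y y') s \<star> F)"
proof -
  have o: "i \<in> objects" "[y] \<in> objects" "[y'] \<in> objects" "s \<in> objects"
    using fac_objects[OF F] objects_Cons[of y' s] by auto
  have X: "rw (XX y y') s \<in> hm (y # y' # s) (y' # y # s)" by (rule crossing_hm[OF cr o(2,3,4)])
  have inner: "fac i' t H \<Longrightarrow> t = y' # s \<Longrightarrow> pull y i i' C \<Longrightarrow>
      fac i (y' # y # s) (rw (XX y y') s \<star> (rw P (y' # s) \<star> (sh y H \<star> C)))" if P: "td y P" for i' C P t H
  proof (induction rule: fac.induct)
    case (fac_base y1 i' r C' P' H s')
    have e: "y1 = y'" "s' = s" using fac_base(4) by auto
    note b = fac_base(1-3)[unfolded e]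
    have "td2 y y' (rw P [y'] \<star> sh y P')"
      using td2_mult[OF conjunct1[OF td2_td[OF P o(3,2)]] conjunct2[OF td2_td[OF b(2) o(2,3)]] o(2,3)] .
    from td2_through_crossing[OF this cr o(2,3)] obtain W D where
      W: "td2 y' y W" "dd y y' D" "XX y y' \<star> (rw P [y'] \<star> sh y P') = W \<star> XX y y' \<squnion> D" by blast
    have C: "C \<in> hm i (y # i')" and C': "C' \<in> hm i' (y' # r)" using pull_hm fac_base(5) b by auto
    have 1: "fac i (y' # y # s) (rw W s \<star> (sh y' (sh y H) \<star> (rw (XX y y') r \<star> (sh y C' \<star> C))))"
      by (rule fac_td2[OF W(1) fac_sh[OF hm_sh[OF b(3) o(2)] fac_two_pulls[OF fac_base(5) b(1) cr]]])
    have 2: "fac i (y' # y # s) (rw D s \<star> (sh y (sh y' H \<star> C') \<star> C))"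
      by (rule fac_dd[OF W(2) fac_pull[OF fac_base(5) hm_comp[OF hm_sh[OF b(3) o(3)] C']]])
    have "rw (XX y y') s \<star> (rw P (y' # s) \<star> (sh y (rw P' s \<star> (sh y' H \<star> C')) \<star> C)) =
      rw (XX y y' \<star> (rw P [y'] \<star> sh y P')) s \<star> (sh y (sh y' H) \<star> (sh y C' \<star> C))"
      using o by (simp add: sh_comp rw_comp tens2_assoc idc_tens2 comp_assoc')
    also have "\<dots> = rw W s \<star> ((rw (XX y y') s \<star> sh y (sh y' H)) \<star> (sh y C' \<star> C)) \<squnion> rw D s \<star> (sh y (sh y' H \<star> C') \<star> C)"
      by (simp add: W(3) linear_simps rw_comp sh_comp comp_assoc')
    also have "\<dots> = rw W s \<star> (sh y' (sh y H) \<star> (rw (XX y y') r \<star> (sh y C' \<star> C))) \<squnion> rw D s \<star> (sh y (sh y' H \<star> C') \<star> C)"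
      using crossing_slide[OF cr o(2,3) b(3)] by (simp add: comp_assoc')
    finally show ?case using fac_add[OF 1 2] e by simp
  next
    case (fac_zero i' t)
    note C = pull_hm[OF fac_zero(4)]
    have Pm: "rw P t \<in> hm (y # t) (y # t)" using hm_rw[OF td_hm[OF P o(2)] fac_zero(2)] by simp
    show ?case using zc_comp[OF C, of "y # t"] comp_zc[OF Pm o(1)] comp_zc[OF X o(1)] fac_zero o hm_objects[OF X] hm_objects[OF Pm] fac.fac_zero[of i "y' # y # s"]
      by (simp add: sh_zc)
  qed (auto simp: linear_simps intro: fac_add fac_scal)
  have "fac i0 t F \<Longrightarrow> i0 = i \<Longrightarrow> t = y # y' # s \<Longrightarrow> fac i (y' # y # s) (rw (XX y y') s \<star> F)" for t i0
  proof (induction rule: fac.induct)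
    case (fac_base y1 i1 i' C P H j')
    have "length i' < length i" using pull_objects[OF fac_base(1)] fac_base(4) by simp
    from inner[OF _ IH[OF this fac_base(3)]] show ?case using fac_base by simp
  next
    case (fac_zero i1 t)
    then show ?case using comp_zc[OF X o(1)] hm_objects[OF X] fac.fac_zero[of i "y' # y # s"] o by simp
  qed (auto simp: linear_simps intro: fac_add fac_scal)
  then show ?thesis using F by blast
qed

text \<open>The identity on v on the right lets the induction pass through tensor products: f (x) g
  is f (x) 1 after 1 (x) g, and the latter misses the front strand unless the source of f is
  empty.\<close>

lemma fac_arrow:
  assumes IH: "\<And>i' j' H. length i' < length i \<Longrightarrow> H \<in> hm i' j' \<Longrightarrow> fac i' j' H"
  shows "arrow f a b \<Longrightarrow> fac i (a @ v) F \<Longrightarrow> fac i (b @ v) (rw (cl f) v \<star> F)"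
proof (induction arbitrary: v F rule: arrow.induct)
  case (arrow_Ident a)
  then show ?case using idc_left[OF fac_hm[OF arrow_Ident(2)]] hm_objects[OF fac_hm[OF arrow_Ident(2)]] by (simp add: rw_idc)
next
  case arrow_Tpos
  then show ?case using fac_front[OF IH, where y=Black and y'=Black and s=v and F=F] by (simp add: crossable_def)
next
  case arrow_Tneg
  have "fac i (Black # Black # v) (rw Tp v \<star> F)"
    using fac_front[OF IH, where y=Black and y'=Black and s=v and F=F] arrow_Tneg by (simp add: crossable_def)
  moreover have "fac i (Black # Black # v) (rw Zc v \<star> F)" using fac_td2[OF td2_Zc] arrow_Tneg by simp
  ultimately show ?case using fac_add[OF _ fac_scal] by (simp add: Tn_eq linear_simps)
next
  case (arrow_Token x)
  then show ?case using fac_td[OF td_token] by simp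
next
  case arrow_Dot
  then show ?case using fac_td[OF td_gen1[OF gen_Dot]] by simp
next
  case arrow_DotInv
  then show ?case using fac_td[OF td_gen1[OF gen_DotInv]] by simp
next
  case (arrow_Rho Q)
  then show ?case using fac_front[OF IH, where y="Red Q" and y'=Black and s=v and F=F] by (simp add: crossable_def)
next
  case (arrow_Lam Q)
  then show ?case using fac_front[OF IH, where y=Black and y'="Red Q" and s=v and F=F] by (simp add: crossable_def)
next
  case (arrow_Comp g a b f c)
  then show ?case by (simp add: cl_Comp[symmetric] rw_comp comp_assoc')
next
  case (arrow_Tensor f a b g c e)
  have h: "cl f \<in> hm a b" "cl g \<in> hm c e" using cl_hm arrow_Tensor by auto
  have o: "a \<in> objects" "e \<in> objects" "v \<in> objects"
    using hm_objects[OF h(1)] hm_objects[OF h(2)] hm_objects[OF fac_hm[OF arrow_Tensor(5)]] by auto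
  have "cl f \<bowtie> cl g = rw (cl f) e \<star> (idc a \<bowtie> cl g)"
    using interchange_left[OF hm_idc[OF o(1)] h(1) h(2) hm_idc[OF o(2)] hpar_idc] idc_right[OF h(1)] idc_left[OF h(2)] by simp
  then have "rw (cl (f \<boxtimes> g)) v \<star> F = rw (cl f) (e @ v) \<star> ((idc a \<bowtie> rw (cl g) v) \<star> F)"
    using o by (simp add: cl_Tensor[symmetric] rw_comp tens2_assoc idc_tens2 comp_assoc')
  moreover have "fac i (a @ e @ v) ((idc a \<bowtie> rw (cl g) v) \<star> F)"
  proof (cases a)
    case Nil
    then show ?thesis using arrow_Tensor(4)[of v F] arrow_Tensor(5) tens2_idc_Nil(2)[OF hm_rw[OF h(2) o(3)]] by simp
  next
    case (Cons x a')
    then have ox: "[x] \<in> objects" "a' \<in> objects" using o objects_Cons by blast+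
    have "idc a \<bowtie> rw (cl g) v = sh x (idc a' \<bowtie> rw (cl g) v)"
      using idc_tens2[OF ox] by (simp add: Cons tens2_assoc[symmetric])
    moreover have "idc a' \<bowtie> rw (cl g) v \<in> hm (a' @ c @ v) (a' @ e @ v)"
      by (rule hm_tens2[OF hm_idc[OF ox(2)] hm_rw[OF h(2) o(3)]])
    ultimately show ?thesis using fac_sh[of _ "a' @ c @ v" "a' @ e @ v" i x F] arrow_Tensor(5) Cons by simp
  qed
  ultimately show ?case using arrow_Tensor(3)[of "e @ v"] by simp
next
  case (arrow_Zero a b)
  note o = hm_objects[OF fac_hm[OF arrow_Zero(3)]]
  then show ?case using zc_comp[OF fac_hm[OF arrow_Zero(3)], of "b @ v"] arrow_Zero by (simp add: rw_zc fac_zero)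
next
  case (arrow_Add f a b g)
  then show ?case by (simp add: cl_Add[symmetric] linear_simps fac_add)
next
  case (arrow_Scale f a b c)
  then show ?case by (simp add: cl_Scale[symmetric] linear_simps fac_scal)
qed

theorem hm_fac: "F \<in> hm i j \<Longrightarrow> fac i j F"
proof (induction "length i" arbitrary: i j F rule: less_induct)
  case less
  obtain f where f: "F = cl f" "arrow f i j" using less(2) by (rule hmE)
  have o: "i \<in> objects" using hm_objects[OF less(2)] by blast
  have "fac i (j @ []) (rw (cl f) [] \<star> idc i)"
    by (rule fac_arrow[OF less(1) f(2)]) (use fac_idc[OF o] in auto)
  then show ?case using tens2_idc_Nil(1)[OF less(2)] idc_right[OF less(2)] f by simp
qed

end

section \<open>Normal forms span\<close>

lemma black_positions_Cons:
  "black_positions (y # j) = (if y = Black then [0] else []) @ map Suc (black_positions j)"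
proof -
  have "black_positions (y # j) = filter (\<lambda>p. (y # j) ! p = Black) (0 # map Suc [0..<length j])"
    unfolding black_positions_def by (simp add: upt_conv_Cons map_Suc_upt del: upt_Suc)
  also have "\<dots> = (if y = Black then [0] else []) @ map Suc (black_positions j)"
    by (simp add: filter_map black_positions_def comp_def)
  finally show ?thesis .
qed

context LAH
begin

lemma sh_idc': "sh y (idc u) = idc (y # u)"
proof (cases "y # u \<in> objects")
  case True
  then show ?thesis using sh_idc[of y u] objects_Cons[of y u] by auto
next
  case False
  then have "\<not> wt (Ident [y] \<boxtimes> Ident u)" "\<not> wt (Ident (y # u))" using objects_Cons[of y u] by auto
  then show ?thesis unfolding cl_ops using cl_ill_typed by simp
qed

lemma cl_on_strand_front:
  assumes "cl g \<in> hm [Black] [Black]" "j \<in> objects"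
  shows "cl (on_strand (Black # j) 0 g) = rw (cl g) j"
proof -
  have "cl (on_strand (Black # j) 0 g) = idc [] \<bowtie> rw (cl g) j"
    by (simp add: on_strand_def black_positions_Cons cl_Tensor)
  then show ?thesis using tens2_idc_Nil(2)[OF hm_rw[OF assms]] by simp
qed

lemma cl_on_strand_shift:
  assumes "k < num_black j"
  shows "cl (on_strand (y # j) (if y = Black then Suc k else k) g) = sh y (cl (on_strand j k g))"
proof -
  define p where "p = black_positions j ! k"
  have "length (black_positions j) = num_black j"
  proof (induction j)
    case (Cons x j)
    then show ?case by (cases x) (simp_all add: black_positions_Cons)
  qed (simp add: black_positions_def)
  then have "black_positions (y # j) ! (if y = Black then Suc k else k) = Suc p"
    using assms by (auto simp: black_positions_Cons p_def)
  then have "cl (on_strand (y # j) (if y = Black then Suc k else k) g) = idc (y # take p j) \<bowtie> cl g \<bowtie> idc (drop (Suc p) j)"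
    unfolding on_strand_def cl_Tensor by (simp add: Let_def)
  moreover have "cl (on_strand j k g) = idc (take p j) \<bowtie> cl g \<bowtie> idc (drop (Suc p) j)"
    unfolding on_strand_def cl_Tensor by (simp add: p_def Let_def)
  ultimately show ?thesis by (simp only: sh_idc'[of y "take p j", symmetric] tens2_assoc)
qed

lemma cl_foldr_shift:
  "(\<And>k. k \<in> set ks \<Longrightarrow> cl (u (s k)) = sh y (cl (v k))) \<Longrightarrow>
    cl (foldr (\<lambda>k f. u k \<bullet> f) (map s ks) (Ident (y # j))) = sh y (cl (foldr (\<lambda>k f. v k \<bullet> f) ks (Ident j)))"
  by (induction ks) (auto simp: sh_idc' cl_Comp[symmetric] sh_comp)

lemma cl_term_power_shift: "cl f = sh y (cl g) \<Longrightarrow> cl (term_power (y # j) f n) = sh y (cl (term_power j g n))"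
  by (induction n) (auto simp: term_power_Suc sh_idc' cl_Comp[symmetric] sh_comp)

lemma cl_term_powi_shift:
  "cl f = sh y (cl g) \<Longrightarrow> cl f' = sh y (cl g') \<Longrightarrow> cl (term_powi (y # j) f f' m) = sh y (cl (term_powi j g g' m))"
  by (auto simp: term_powi_def cl_term_power_shift)

lemma cl_term_power_front: "j \<in> objects \<Longrightarrow> cl f = rw (cl g) j \<Longrightarrow>
    cl (term_power (Black # j) f n) = rw (cl (term_power [Black] g n)) j"
  by (induction n) (auto simp: term_power_Suc rw_idc cl_Comp[symmetric] rw_comp)

lemma cl_dots_front:
  assumes "j \<in> objects"
  shows "cl (term_powi (Black # j) (on_strand (Black # j) 0 Dot) (on_strand (Black # j) 0 DotInv) m) = rw (cl (dot_powi m)) j"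
  using assms cl_term_power_front[OF assms cl_on_strand_front[OF gen_hm[OF gen_Dot] assms]]
    cl_term_power_front[OF assms cl_on_strand_front[OF gen_hm[OF gen_DotInv] assms]]
  by (auto simp: term_powi_def dot_powi_def)

lemma hpar_dot_powi: "hpar (cl (dot_powi r)) 0"
proof -
  have "hpar (cl (term_power [Black] f n)) 0" if "hpar (cl f) 0" for f n
    by (induction n) (use that hpar_idc hpar_ops(1)[of _ 0 _ 0] in \<open>auto simp: term_power_Suc cl_Comp[symmetric]\<close>)
  then show ?thesis using gen_par[OF gen_Dot] gen_par[OF gen_DotInv] by (simp add: dot_powi_def term_powi_def)
qed

text \<open>The class of \<open>tokens j as \<bullet> dots j \<alpha>\<close>\<close>

fun tdw :: "'a obj \<Rightarrow> 'a list \<Rightarrow> int list \<Rightarrow> ('a, 'k) mor set" where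
  "tdw [] as \<alpha> = idc []"
| "tdw (Red Q # j) as \<alpha> = sh (Red Q) (tdw j as \<alpha>)"
| "tdw (Black # j) (a # as) (r # \<alpha>) = rw (cl (Token a) \<star> cl (dot_powi r)) j \<star> sh Black (tdw j as \<alpha>)"
| "tdw (Black # j) [] \<alpha> = {}"
| "tdw (Black # j) (a # as) [] = {}"

lemma token_hm: "cl (Token a) \<in> hm [Black] [Black]" and dot_powi_hm: "cl (dot_powi r) \<in> hm [Black] [Black]"
  using arrow_dot_powi by (auto intro: cl_hm arrow.intros)

lemma cl_tokens_dots:
  "j \<in> objects \<Longrightarrow> length as = num_black j \<Longrightarrow> length \<alpha> = num_black j \<Longrightarrow>
    cl (tokens j as) \<in> hm j j \<and> cl (dots j \<alpha>) \<in> hm j j \<and> cl (tokens j as) \<star> cl (dots j \<alpha>) = tdw j as \<alpha>"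
proof (induction j arbitrary: as \<alpha>)
  case Nil
  then show ?case using hm_idc[of "[]"] idc_left[OF hm_idc, of "[]"] by (simp add: tokens_def dots_def)
next
  case (Cons y j)
  show ?case
  proof (cases y)
    case (Red Q)
    have l: "length as = num_black j" "length \<alpha> = num_black j" "j \<in> objects" "[y] \<in> objects"
      using Cons.prems Red by auto
    note IH = Cons.IH[OF l(3,1,2)]
    have s: "cl (on_strand (y # j) k g) = sh y (cl (on_strand j k g))" if "k < num_black j" for k g
      using cl_on_strand_shift[OF that, of y g] Red by simp
    have 1: "cl (tokens (y # j) as) = sh y (cl (tokens j as))"
      using cl_foldr_shift[of "[0..<length as]" "\<lambda>k. on_strand (y # j) k (Token (as ! k))" "\<lambda>k. k" y
          "\<lambda>k. on_strand j k (Token (as ! k))" j] l s by (simp add: tokens_def)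
    have 2: "cl (dots (y # j) \<alpha>) = sh y (cl (dots j \<alpha>))"
      using cl_foldr_shift[of "[0..<length \<alpha>]" "\<lambda>k. term_powi (y # j) (on_strand (y # j) k Dot) (on_strand (y # j) k DotInv) (\<alpha> ! k)" "\<lambda>k. k" y
          "\<lambda>k. term_powi j (on_strand j k Dot) (on_strand j k DotInv) (\<alpha> ! k)" j] l s by (simp add: dots_def cl_term_powi_shift)
    show ?thesis unfolding 1 2 using IH hm_sh[of _ j j y] l(4) Red by (auto simp: sh_comp[symmetric])
  next
    case Black
    obtain a as' where as: "as = a # as'" using Cons.prems Black by (cases as) auto
    obtain r \<alpha>' where \<alpha>: "\<alpha> = r # \<alpha>'" using Cons.prems Black by (cases \<alpha>) auto
    have l: "length as' = num_black j" "length \<alpha>' = num_black j" "j \<in> objects" "[y] \<in> objects"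
      using Cons.prems Black as \<alpha> by auto
    note IH = Cons.IH[OF l(3,1,2)]
    have s: "cl (on_strand (Black # j) (Suc k) g) = sh Black (cl (on_strand j k g))" if "k < num_black j" for k g
      using cl_on_strand_shift[OF that, of Black g] by simp
    have 1: "cl (tokens (y # j) as) = rw (cl (Token a)) j \<star> sh Black (cl (tokens j as'))"
      using cl_foldr_shift[of "[0..<length as']" "\<lambda>k. on_strand (y # j) k (Token (as ! k))" Suc y
          "\<lambda>k. on_strand j k (Token (as' ! k))" j] l s cl_on_strand_front[OF token_hm l(3)] Black
      by (simp add: tokens_def as upt_conv_Cons map_Suc_upt cl_Comp[symmetric] del: upt_Suc)
    have 2: "cl (dots (y # j) \<alpha>) = rw (cl (dot_powi r)) j \<star> sh Black (cl (dots j \<alpha>'))"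
      using cl_foldr_shift[of "[0..<length \<alpha>']" "\<lambda>k. term_powi (y # j) (on_strand (y # j) k Dot) (on_strand (y # j) k DotInv) (\<alpha> ! k)" Suc y
          "\<lambda>k. term_powi j (on_strand j k Dot) (on_strand j k DotInv) (\<alpha>' ! k)" j] l s cl_dots_front[OF l(3)] Black
      by (simp add: dots_def \<alpha> upt_conv_Cons map_Suc_upt cl_Comp[symmetric] cl_term_powi_shift del: upt_Suc)
    have h: "rw (cl (Token a)) j \<in> hm (y # j) (y # j)" "rw (cl (dot_powi r)) j \<in> hm (y # j) (y # j)"
      "sh Black (cl (tokens j as')) \<in> hm (y # j) (y # j)" "sh Black (cl (dots j \<alpha>')) \<in> hm (y # j) (y # j)"
      using hm_rw[OF token_hm l(3)] hm_rw[OF dot_powi_hm l(3)] hm_sh[of _ j j Black] IH Black by auto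
    \<comment> \<open>Dots are even, so those on the first strand pass the tokens on the others.
      This regroups all tokens followed by all dots into contributions of single strands.\<close>
    have "rw (cl (dot_powi r)) j \<star> sh Black (cl (tokens j as')) = sh Black (cl (tokens j as')) \<star> rw (cl (dot_powi r)) j"
      using slide[OF dot_powi_hm hpar_dot_powi] IH by blast
    then have "cl (tokens (y # j) as) \<star> cl (dots (y # j) \<alpha>) =
      rw (cl (Token a)) j \<star> ((rw (cl (dot_powi r)) j \<star> sh Black (cl (tokens j as'))) \<star> sh Black (cl (dots j \<alpha>')))"
      unfolding 1 2 by (simp add: comp_assoc')
    also have "\<dots> = rw (cl (Token a) \<star> cl (dot_powi r)) j \<star> sh Black (cl (tokens j as') \<star> cl (dots j \<alpha>'))"
      by (simp add: rw_comp sh_comp comp_assoc')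
    also have "\<dots> = tdw (y # j) as \<alpha>" using IH Black as \<alpha> by simp
    finally show ?thesis using h unfolding 1 2 by (auto intro: hm_comp)
  qed
qed

text \<open>The span as a closure under the linear operations, which suits inductions;
  \<open>sp_combination\<close> turns it into a finite sum.\<close>

inductive sp :: "('a, 'k) mor set set \<Rightarrow> 'a obj \<Rightarrow> 'a obj \<Rightarrow> ('a, 'k) mor set \<Rightarrow> bool" for S i j where
  sp_zero: "sp S i j (zc i j)"
| sp_base: "F \<in> S \<Longrightarrow> sp S i j F"
| sp_add: "sp S i j F \<Longrightarrow> sp S i j G \<Longrightarrow> sp S i j (F \<squnion> G)"
| sp_scal: "sp S i j F \<Longrightarrow> sp S i j (scal c F)"

lemma sp_mono: "sp S i j F \<Longrightarrow> (\<And>G. G \<in> S \<Longrightarrow> sp S' i j G) \<Longrightarrow> sp S' i j F"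
  by (induction rule: sp.induct) (auto intro: sp.intros)

lemma sp_linear_map:
  assumes "sp S i j F" "\<And>F G. op (F \<squnion> G) = op F \<squnion> op G" "\<And>c F. op (scal c F) = scal c (op F)" "op (zc i j) = zc i' j'"
    "\<And>F. F \<in> S \<Longrightarrow> sp S' i' j' (op F)"
  shows "sp S' i' j' (op F)"
  using assms(1) by (induction rule: sp.induct) (auto simp: assms(2-4) intro: sp.intros assms(5))

definition td_basis :: "('a, 'k) mor set set" where
  "td_basis = {cl (Token b) \<star> cl (dot_powi r) | b r. b \<in> B}"

lemma token_lin: "cl (Token (l *s a + m *s b)) = scal l (cl (Token a)) \<squnion> scal m (cl (Token b))"
  unfolding cl_ops by (rule rel[OF token_linear, symmetric])

lemma sp_token: "sp td_basis [Black] [Black] (cl (Token a) \<star> cl (dot_powi r))"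
proof -
  have h: "cl (Token a) \<star> cl (dot_powi r) \<in> hm [Black] [Black]" for a by (rule hm_comp[OF token_hm dot_powi_hm])
  have "a \<in> span B" using B_span by simp
  then show ?thesis
  proof (induction rule: span_induct_alt)
    case base
    have "cl (Token 0) \<star> cl (dot_powi r) = scal 0 (cl (Token 0) \<star> cl (dot_powi r)) \<squnion> scal 0 (cl (Token 0) \<star> cl (dot_powi r))"
      using token_lin[of 0 0 0 0] by (simp add: linear_simps[symmetric])
    then have "cl (Token 0) \<star> cl (dot_powi r) = zc [Black] [Black]" using scal_0[OF h] zc_plus_zc by simp
    then show ?case using sp_zero by simp
  next
    case (step c b a)
    have "cl (Token (c *s b + a)) \<star> cl (dot_powi r) = scal c (cl (Token b) \<star> cl (dot_powi r)) \<squnion> cl (Token a) \<star> cl (dot_powi r)"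
      using token_lin[of c b 1 a] scal_one[OF h] by (simp add: linear_simps)
    moreover have "cl (Token b) \<star> cl (dot_powi r) \<in> td_basis" using step(1) unfolding td_basis_def by blast
    ultimately show ?case using sp_add[OF sp_scal[OF sp_base] step(2)] by simp
  qed
qed

lemma dot_powi_Suc: "cl Dot \<star> cl (dot_powi r) = cl (dot_powi (r + 1))" "cl DotInv \<star> cl (dot_powi r) = cl (dot_powi (r - 1))"
proof -
  have c: "cl f \<star> (cl f' \<star> cl (term_power [Black] g n)) = cl (term_power [Black] g n)"
    if "cl f \<star> cl f' = idc [Black]" "cl g \<in> hm [Black] [Black]" for f f' g n
  proof -
    have "cl (term_power [Black] g n) \<in> hm [Black] [Black]"
      by (induction n) (use that hm_idc in \<open>auto simp: term_power_Suc cl_Comp[symmetric] intro: hm_comp\<close>)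
    then show ?thesis using that idc_left comp_assoc' by metis
  qed
  note h = gen_hm[OF gen_Dot] gen_hm[OF gen_DotInv]
  show "cl Dot \<star> cl (dot_powi r) = cl (dot_powi (r + 1))"
  proof (cases "r < 0")
    case True
    then obtain n where n: "nat (- r) = Suc n" "nat (- r - 1) = n" by (metis Suc_nat_eq_nat_zadd1 diff_add_cancel neg_0_less_iff_less zle_diff1_eq add.commute)
    then show ?thesis using c[OF dot_invs(1) h(2), of n] True
      by (cases "r = -1") (auto simp: dot_powi_def term_powi_def term_power_Suc cl_Comp[symmetric])
  next
    case False
    then have "nat (r + 1) = Suc (nat r)" by simp
    then show ?thesis using False by (simp add: dot_powi_def term_powi_def term_power_Suc cl_Comp[symmetric])
  qed
  show "cl DotInv \<star> cl (dot_powi r) = cl (dot_powi (r - 1))"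
  proof (cases "r \<le> 0")
    case True
    then have "nat (- (r - 1)) = Suc (nat (- r))" by simp
    then show ?thesis using True by (cases "r = 0") (auto simp: dot_powi_def term_powi_def term_power_Suc cl_Comp[symmetric])
  next
    case False
    then have n: "nat r = Suc (nat (r - 1))" by simp
    then show ?thesis using c[OF dot_invs(2) h(1), of "nat (r - 1)"] False
      by (auto simp: dot_powi_def term_powi_def n term_power_Suc cl_Comp[symmetric])
  qed
qed

lemma token_commutes:
  shows "cl Dot \<star> cl (Token a) = cl (Token a) \<star> cl Dot" "cl DotInv \<star> cl (Token a) = cl (Token a) \<star> cl DotInv"
proof -
  show 1: "cl Dot \<star> cl (Token a) = cl (Token a) \<star> cl Dot"
    unfolding cl_ops by (rule rel[OF token_dot, symmetric])
  show "cl DotInv \<star> cl (Token a) = cl (Token a) \<star> cl DotInv"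
    by (rule conj_swap[OF 1[symmetric] dot_invs(1) dot_invs(2) token_hm token_hm])
qed

text \<open>On a single strand tokens commute with dots, so left multiplication by a generator
  preserves the span of the elements b X^r.\<close>

lemma sp_td: "td Black P \<Longrightarrow> sp td_basis [Black] [Black] P"
proof -
  have mult: "sp td_basis [Black] [Black] (g \<star> P)" if g: "gen g p" and P: "sp td_basis [Black] [Black] P" for g p P
  proof (rule sp_linear_map[OF P, where op = "\<lambda>P. g \<star> P"])
    show "g \<star> zc [Black] [Black] = zc [Black] [Black]" by (rule comp_zc[OF gen_hm[OF g]]) simp
    fix F assume "F \<in> td_basis"
    then obtain b r where F: "F = cl (Token b) \<star> cl (dot_powi r)" unfolding td_basis_def by blast
    from g show "sp td_basis [Black] [Black] (g \<star> F)"
    proof cases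
      case (gen_Token a)
      have "cl (Token a) \<star> cl (Token b) = cl (Token (a * b))" unfolding cl_ops by (rule rel[OF token_mult])
      then show ?thesis using sp_token[of "a * b" r] comp_assoc' by (metis F gen_Token(1))
    next
      case gen_Dot
      have "g \<star> F = cl (Token b) \<star> (cl Dot \<star> cl (dot_powi r))"
        using token_commutes(1)[of b] by (simp add: F gen_Dot comp_assoc'[symmetric])
      then show ?thesis using sp_token[of b "r + 1"] dot_powi_Suc(1) by simp
    next
      case gen_DotInv
      have "g \<star> F = cl (Token b) \<star> (cl DotInv \<star> cl (dot_powi r))"
        using token_commutes(2)[of b] by (simp add: F gen_DotInv comp_assoc'[symmetric])
      then show ?thesis using sp_token[of b "r - 1"] dot_powi_Suc(2) by simp
    qed
  qed (simp_all add: linear_simps)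
  have "cl (Token 1) \<star> cl (dot_powi 0) = idc [Black]"
  proof -
    have "cl (Token 1) = idc [Black]" by (rule rel[OF token_one])
    then show ?thesis using idc_left[OF hm_idc, of "[Black]"] by (simp add: dot_powi_def term_powi_def)
  qed
  then have one: "sp td_basis [Black] [Black] (idc [Black])" using sp_token[of 1 0] by simp
  have "td y P \<Longrightarrow> y = Black \<Longrightarrow> sp td_basis [Black] [Black] P" for y
  proof (induction rule: td.induct)
    case (td_gen g p P)
    then show ?case using mult by blast
  qed (auto intro: one sp_zero sp_add sp_scal)
  then show "td Black P \<Longrightarrow> sp td_basis [Black] [Black] P" by blast
qed

lemma sp_td_Red: "td y P \<Longrightarrow> y = Red Q \<Longrightarrow> sp {idc [y]} [y] [y] P"
  by (induction rule: td.induct) (auto intro: sp.intros)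

text \<open>A pull in which the strands carry labels. A word may contain a letter several times, and
  the label says which occurrence is pulled.\<close>

inductive lpull :: "'a P1 letter \<times> nat \<Rightarrow> ('a P1 letter \<times> nat) list \<Rightarrow> ('a P1 letter \<times> nat) list \<Rightarrow> ('a, 'k) mor set \<Rightarrow> bool"
  for yb where
  lpull_base: "lpull yb (yb # L) L (idc (map fst (yb # L)))"
| lpull_step: "lpull yb L L1 C \<Longrightarrow> crossable (fst xa) (fst yb) \<Longrightarrow>
    lpull yb (xa # L) (xa # L1) (rw (XX (fst xa) (fst yb)) (map fst L1) \<star> sh (fst xa) C)"

text \<open>Iterated pulls: L' lists the strands in the order in which they are pulled, which is
  their order at the top. For distinct labels the normal form is determined by L and L'.\<close>

inductive nf :: "('a P1 letter \<times> nat) list \<Rightarrow> ('a P1 letter \<times> nat) list \<Rightarrow> ('a, 'k) mor set \<Rightarrow> bool" where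
  nf_nil: "nf [] [] (idc [])"
| nf_step: "lpull yb L L1 C \<Longrightarrow> nf L1 L' N \<Longrightarrow> nf L (yb # L') (sh (fst yb) N \<star> C)"

lemma lpull_mset: "lpull yb L L1 C \<Longrightarrow> mset L = add_mset yb (mset L1)"
  by (induction rule: lpull.induct) auto

lemma nf_mset: "nf L L' N \<Longrightarrow> mset L' = mset L"
  by (induction rule: nf.induct) (auto simp: lpull_mset)

lemma lpull_unique: "lpull yb L L1 C \<Longrightarrow> lpull yb L L1' C' \<Longrightarrow> distinct L \<Longrightarrow> L1 = L1' \<and> C = C'"
proof (induction arbitrary: L1' C' rule: lpull.induct)
  case (lpull_base L)
  from lpull_base(1) show ?case
  proof cases
    case (lpull_step L1'' C)
    then have "yb \<in># mset L" using lpull_mset by fastforce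
    then show ?thesis using lpull_base by simp
  qed auto
next
  case (lpull_step L L1 C xa)
  from lpull_step(4) show ?case
  proof cases
    case lpull_base
    have "yb \<in># mset L" using lpull_mset[OF lpull_step(1)] by simp
    then show ?thesis using lpull_step(5) lpull_base by simp
  next
    case (lpull_step L1'' C'')
    then show ?thesis using \<open>\<And>L1' C'. lpull yb L L1' C' \<Longrightarrow> distinct L \<Longrightarrow> L1 = L1' \<and> C = C'\<close>[of L1'' C''] \<open>distinct (xa # L)\<close> by auto
  qed
qed

lemma nf_unique: "nf L L' N \<Longrightarrow> nf L L' N' \<Longrightarrow> distinct L \<Longrightarrow> N = N'"
proof (induction arbitrary: N' rule: nf.induct)
  case nf_nil
  then show ?case by (cases rule: nf.cases) auto
next
  case (nf_step yb L L1 C L' N)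
  from nf_step(4) obtain L1' C' N1 where e: "lpull yb L L1' C'" "nf L1' L' N1" "N' = sh (fst yb) N1 \<star> C'"
    by (cases rule: nf.cases) auto
  have "distinct L1"
    using lpull_mset[OF nf_step(1)] nf_step(5) by (metis distinct.simps(2) mset.simps(2) mset_eq_imp_distinct_iff)
  then show ?case using lpull_unique[OF nf_step(1) e(1) nf_step(5)] nf_step(3) e by auto
qed

lemma pull_lpull: "pull y i i' C \<Longrightarrow> map fst L = i \<Longrightarrow> \<exists>b L1. lpull (y, b) L L1 C \<and> map fst L1 = i'"
proof (induction arbitrary: L rule: pull.induct)
  case (pull_base y i')
  then obtain b L1 where "L = (y, b) # L1" "map fst L1 = i'" by (cases L) auto
  then show ?case using lpull_base[of "(y, b)" L1] by auto
next
  case (pull_step y i i' C x)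
  then obtain a L0 where L: "L = (x, a) # L0" "map fst L0 = i" by (cases L) auto
  obtain b L1 where p: "lpull (y, b) L0 L1 C" "map fst L1 = i'" using pull_step L by blast
  then show ?case using lpull_step[OF p(1), of "(x, a)"] pull_step(2) L
    by (intro exI[of _ b] exI[of _ "(x, a) # L1"]) auto
qed

lemma lpull_pull: "lpull yb L L1 C \<Longrightarrow> map fst L \<in> objects \<Longrightarrow> pull (fst yb) (map fst L) (map fst L1) C"
proof (induction rule: lpull.induct)
  case (lpull_base L)
  then show ?case using pull_base[of "fst yb" "map fst L"] by simp
next
  case (lpull_step L L1 C xa)
  then show ?case using pull_step[of "fst yb" "map fst L" "map fst L1" C "fst xa"] objects_Cons[of "fst xa" "map fst L"] by simp
qed

lemma nf_hm: "nf L L' N \<Longrightarrow> map fst L \<in> objects \<Longrightarrow> N \<in> hm (map fst L) (map fst L')"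
proof (induction rule: nf.induct)
  case nf_nil
  then show ?case using hm_idc[of "[]"] by simp
next
  case (nf_step yb L L1 C L' N)
  note p = lpull_pull[OF nf_step(1,4)]
  show ?case using hm_comp[OF hm_sh[OF nf_step(3)] pull_hm[OF p]] pull_objects[OF p] by simp
qed

definition NF :: "('a P1 letter \<times> nat) list \<Rightarrow> 'a obj \<Rightarrow> ('a, 'k) mor set set" where
  "NF L j = {tdw j as \<alpha> \<star> N | as \<alpha> N L'. length as = num_black j \<and> set as \<subseteq> B \<and> length \<alpha> = num_black j \<and>
     nf L L' N \<and> map fst L' = j}"

text \<open>In a factorization, H is expanded by induction on the length of the source. The part P
  on the front strand is a combination of elements b X^r if the strand is black, and a multiple of
  the identity if it is red.\<close>

theorem hm_sp_NF: "F \<in> hm i j \<Longrightarrow> map fst L = i \<Longrightarrow> sp (NF L j) i j F"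
proof (induction "length i" arbitrary: i j F L rule: less_induct)
  case less
  have "fac i0 j F \<Longrightarrow> i0 = i \<Longrightarrow> sp (NF L j) i j F" for i0 j F
  proof (induction rule: fac.induct)
    case (fac_base y i0 i' C P H j')
    then have C: "pull y i i' C" by simp
    note o = pull_objects[OF C]
    obtain b L1 where L1: "lpull (y, b) L L1 C" "map fst L1 = i'" using pull_lpull[OF C less(3)] by blast
    have H: "sp (NF L1 j') i' j' H" using less(1)[OF _ fac_base(3) L1(2)] o by simp
    have oy: "[y] \<in> objects" and oj: "j' \<in> objects" using o hm_objects[OF fac_base(3)] by auto
    have Cz: "sh y (zc i' j') \<star> C = zc i (y # j')"
      using zc_comp[OF pull_hm[OF C], of "y # j'"] oy oj o objects_Cons[of y j'] by (simp add: sh_zc)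
    have step: "sp (NF L (y # j')) i (y # j') (rw P j' \<star> (sh y G \<star> C))" if "G \<in> NF L1 j'" for G
    proof -
      obtain as \<alpha> N L' where G: "G = tdw j' as \<alpha> \<star> N" "length as = num_black j'" "set as \<subseteq> B" "length \<alpha> = num_black j'"
        "nf L1 L' N" "map fst L' = j'" using \<open>G \<in> NF L1 j'\<close> unfolding NF_def by blast
      have nf: "nf L ((y, b) # L') (sh y N \<star> C)" using nf_step[OF L1(1) G(5)] by simp
      have Gh: "sh y G \<star> C \<in> hm i (y # j')"
      proof -
        have "N \<in> hm i' j'" using nf_hm[OF G(5)] L1(2) G(6) o by simp
        then have "G \<in> hm i' j'" unfolding G(1)
          using cl_tokens_dots[OF oj G(2,4)] hm_comp by metis
        then show ?thesis using hm_comp[OF hm_sh[OF _ oy] pull_hm[OF C]] by blast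
      qed
      have z: "rw (zc [y] [y]) j' \<star> (sh y G \<star> C) = zc i (y # j')"
        using zc_comp[OF Gh, of "y # j'"] oy oj objects_Cons[of y j'] by (simp add: rw_zc)
      show ?thesis
      proof (cases y)
        case Black
        have "sp (NF L (y # j')) i (y # j') ((\<lambda>P. rw P j' \<star> (sh y G \<star> C)) P)"
        proof (rule sp_linear_map[OF sp_td[of P]])
          show "td Black P" using fac_base(2) Black by simp
          fix F assume "F \<in> td_basis"
          then obtain a r where F: "F = cl (Token a) \<star> cl (dot_powi r)" "a \<in> B" unfolding td_basis_def by blast
          have "rw F j' \<star> (sh y G \<star> C) = tdw (y # j') (a # as) (r # \<alpha>) \<star> (sh y N \<star> C)"
            using Black by (simp add: F G(1) sh_comp comp_assoc')
          moreover have "\<dots> \<in> NF L (y # j')"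
            unfolding NF_def using nf G F(2) Black
            by (intro CollectI exI[of _ "a # as"] exI[of _ "r # \<alpha>"] exI[of _ "sh y N \<star> C"] exI[of _ "(y, b) # L'"]) auto
          ultimately show "sp (NF L (y # j')) i (y # j') (rw F j' \<star> (sh y G \<star> C))" using sp_base by simp
        qed (use z Black in \<open>simp_all add: linear_simps\<close>)
        then show ?thesis by simp
      next
        case (Red Q)
        have "sp (NF L (y # j')) i (y # j') ((\<lambda>P. rw P j' \<star> (sh y G \<star> C)) P)"
        proof (rule sp_linear_map[OF sp_td_Red[OF fac_base(2) Red]])
          fix F assume "F \<in> {idc [y]}"
          then have "rw F j' \<star> (sh y G \<star> C) = tdw (y # j') as \<alpha> \<star> (sh y N \<star> C)"
            using idc_left_sh[OF Gh] Red by (simp add: G(1) sh_comp comp_assoc')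
          moreover have "\<dots> \<in> NF L (y # j')"
            unfolding NF_def using nf G Red
            by (intro CollectI exI[of _ "as"] exI[of _ "\<alpha>"] exI[of _ "sh y N \<star> C"] exI[of _ "(y, b) # L'"]) auto
          ultimately show "sp (NF L (y # j')) i (y # j') (rw F j' \<star> (sh y G \<star> C))" using sp_base by simp
        qed (use z in \<open>simp_all add: linear_simps\<close>)
        then show ?thesis by simp
      qed
    qed
    have "sp (NF L (y # j')) i (y # j') ((\<lambda>H. rw P j' \<star> (sh y H \<star> C)) H)"
    proof (rule sp_linear_map[OF H])
      have "rw P j' \<in> hm (y # j') (y # j')" using hm_rw[OF td_hm[OF fac_base(2) oy] oj] by simp
      then show "rw P j' \<star> (sh y (zc i' j') \<star> C) = zc i (y # j')" using Cz comp_zc o by simp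
    qed (use step in \<open>simp_all add: linear_simps\<close>)
    then show ?case by simp
  next
    case fac_nil
    have "tdw [] [] [] \<star> idc [] = idc []" using idc_left[OF hm_idc, of "[]"] by simp
    moreover have "tdw [] [] [] \<star> idc [] \<in> NF [] []"
      unfolding NF_def using nf_nil by (intro CollectI exI[of _ "[]"] exI[of _ "idc []"]) auto
    ultimately show ?case using less(3) fac_nil sp_base by auto
  qed (auto intro: sp.intros)
  then show ?case using hm_fac[OF less(2)] by blast
qed

end

section \<open>Normal forms are diagrams\<close>

fun invs :: "nat list \<Rightarrow> nat" where
  "invs [] = 0" | "invs (x # xs) = length (filter (\<lambda>y. y < x) xs) + invs xs"

lemma invs_swap: "invs (u @ b # a # v) \<le> Suc (invs (u @ a # b # v))"
  by (induction u) auto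

lemma invs_sorted: "sorted_wrt (<) xs \<Longrightarrow> invs xs = 0"
  by (induction xs) (auto simp: filter_empty_conv)

lemma invs_transpose:
  assumes "Suc r < length ys" "length xs = length ys" "\<And>k. k < length ys \<Longrightarrow> xs ! k = ys ! transpose r (Suc r) k"
  shows "invs xs \<le> Suc (invs ys)"
proof -
  let ?v = "drop (Suc (Suc r)) ys"
  have ys: "take r ys @ ys ! r # ys ! Suc r # ?v = ys"
    using assms(1) by (simp add: Cons_nth_drop_Suc)
  have "xs = take r ys @ ys ! Suc r # ys ! r # ?v"
  proof (rule nth_equalityI)
    show l: "length xs = length (take r ys @ ys ! Suc r # ys ! r # ?v)" using assms(1,2) by simp
    fix k assume k: "k < length xs"
    consider "k < r" | "k = r" | "k = Suc r" | m where "k = Suc (Suc (r + m))"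
      by (metis add_Suc less_imp_Suc_add linorder_neqE_nat not_less_eq)
    then show "xs ! k = (take r ys @ ys ! Suc r # ys ! r # ?v) ! k"
      by cases (use assms k in \<open>auto simp: nth_append transpose_def min_def\<close>)
  qed
  then show ?thesis using invs_swap[of "take r ys" "ys ! Suc r" "ys ! r" ?v] ys by simp
qed

text \<open>Each letter exchanges two neighbouring entries and so adds at most one inversion, and
  the sorted list has none.\<close>

lemma invs_le_length:
  assumes "sorted_wrt (<) xs"
  shows "\<forall>r\<in>set rs. Suc r < length xs \<Longrightarrow> invs (map (\<lambda>k. xs ! Perm.apply (lab rs) k) [0..<length xs]) \<le> length rs"
proof (induction rs)
  case Nil
  have "map (\<lambda>k. xs ! Perm.apply (lab []) k) [0..<length xs] = xs" by (simp add: map_nth)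
  then show ?case using invs_sorted[OF assms] by simp
next
  case (Cons r rs)
  have "invs (map (\<lambda>k. xs ! Perm.apply (lab (r # rs)) k) [0..<length xs]) \<le>
      Suc (invs (map (\<lambda>k. xs ! Perm.apply (lab rs) k) [0..<length xs]))"
  proof (rule invs_transpose[of r])
    fix k assume k: "k < length (map (\<lambda>k. xs ! Perm.apply (lab rs) k) [0..<length xs])"
    then have "transpose r (Suc r) k < length xs" using Cons.prems by (auto simp: transpose_def)
    then show "map (\<lambda>k. xs ! Perm.apply (lab (r # rs)) k) [0..<length xs] ! k =
      map (\<lambda>k. xs ! Perm.apply (lab rs) k) [0..<length xs] ! transpose r (Suc r) k"
      using k by (simp add: apply_times Perm.swap.rep_eq)
  qed (use Cons.prems in auto)
  then show ?case using Cons by fastforce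
qed

text \<open>The number of inversions of ys is a lower bound for the length of every expression of
  the same permutation, and \<open>rs\<close> attains it.\<close>

lemma reduced_expressionI:
  assumes "\<forall>r\<in>set rs. Suc r < d" "length xs = d" "sorted_wrt (<) xs" "length ys = d"
    "\<forall>k<d. ys ! k = xs ! Perm.apply (lab rs) k" "length rs = invs ys"
  shows "reduced_expression d (word_perm rs) rs"
  unfolding reduced_expression_def
proof (intro conjI allI impI)
  show "expression_for d (word_perm rs) rs" using assms(1) by (simp add: expression_for_def)
  fix rs' assume rs': "expression_for d (word_perm rs) rs'"
  then have "lab rs' = lab rs" by (simp add: expression_for_def lab_eq_iff)
  then have "ys = map (\<lambda>k. xs ! Perm.apply (lab rs') k) [0..<length xs]"
    using assms by (intro nth_equalityI) auto
  then show "length rs \<le> length rs'"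
    using invs_le_length[OF assms(3), of rs'] rs' assms(2,6) by (simp add: expression_for_def)
qed

lemma word_perm_permutes: "\<forall>r\<in>set rs. Suc r < d \<Longrightarrow> word_perm rs permutes {..<d}"
proof (induction rs)
  case (Cons r rs)
  have "transpose r (Suc r) permutes {..<d}" using Cons.prems by (intro permutes_swap_id) auto
  moreover have "word_perm (r # rs) = transpose r (Suc r) \<circ> word_perm rs" by (simp add: word_perm_def)
  ultimately show ?case using Cons permutes_compose by (metis list.set_intros(2))
qed (simp add: word_perm_def permutes_id)

lemma mset_blacks: "mset (blacks L) = image_mset snd (filter_mset (\<lambda>x. fst x = Black) (mset L))"
  by (simp add: blacks_def)

context LAH
begin

text \<open>Normal forms are classes while diagrams are terms; this relates the two.\<close>

definition dg :: "('a P1 letter \<times> nat) list \<Rightarrow> ('a P1 letter \<times> nat) list \<Rightarrow> ('a, 'k) mor set \<Rightarrow>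
    nat list \<Rightarrow> (nat \<times> nat) list \<Rightarrow> bool" where
  "dg L L' F rs cs \<longleftrightarrow> (\<exists>f. diagram L L' f rs cs \<and> cl f = F)"

lemma sh_tens: "idc (x # u) \<bowtie> H = sh x (idc u \<bowtie> H)"
  by (simp only: sh_idc'[of x u, symmetric] tens2_assoc)

text \<open>A black strand added on the left raises the number of black strands to the left of every
  crossing by one, hence the \<open>Suc\<close>.\<close>

lemma diagram_shift:
  "diagram L L' f rs cs \<Longrightarrow> dg ((x, a) # L) ((x, a) # L') (sh x (cl f)) (if x = Black then map Suc rs else rs) cs"
proof (induction rule: diagram.induct)
  case (diagram_Ident L)
  have "cl (Ident (map fst ((x, a) # L))) = sh x (cl (Ident (map fst L)))" by (simp add: sh_idc')
  then show ?case unfolding dg_def using diagram.diagram_Ident[of "(x, a) # L"] by auto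
next
  case (diagram_Tpos L u c b v f rs cs)
  obtain f' where f': "diagram ((x, a) # L) (((x, a) # u) @ (Black, c) # (Black, b) # v) f' (if x = Black then map Suc rs else rs) cs"
    "cl f' = sh x (cl f)" using diagram_Tpos(2) unfolding dg_def by auto
  have "cl ((Ident (map fst ((x, a) # u)) \<boxtimes> Tpos \<boxtimes> Ident (map fst v)) \<bullet> f') =
      sh x (cl ((Ident (map fst u) \<boxtimes> Tpos \<boxtimes> Ident (map fst v)) \<bullet> f))"
    by (simp add: cl_ops[symmetric] sh_tens[of x "map fst u"] sh_comp f'(2))
  then show ?case unfolding dg_def
    using diagram.diagram_Tpos[OF f'(1)] by (cases x) (auto intro!: exI)
next
  case (diagram_Rho L u Q c b v f rs cs)
  obtain f' where f': "diagram ((x, a) # L) (((x, a) # u) @ (Red Q, c) # (Black, b) # v) f' (if x = Black then map Suc rs else rs) cs"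
    "cl f' = sh x (cl f)" using diagram_Rho(2) unfolding dg_def by auto
  have "cl ((Ident (map fst ((x, a) # u)) \<boxtimes> Rho Q \<boxtimes> Ident (map fst v)) \<bullet> f') =
      sh x (cl ((Ident (map fst u) \<boxtimes> Rho Q \<boxtimes> Ident (map fst v)) \<bullet> f))"
    by (simp add: cl_ops[symmetric] sh_tens[of x "map fst u"] sh_comp f'(2))
  then show ?case unfolding dg_def
    using diagram.diagram_Rho[OF f'(1)] by (auto intro!: exI)
next
  case (diagram_Lam L u b Q c v f rs cs)
  obtain f' where f': "diagram ((x, a) # L) (((x, a) # u) @ (Black, b) # (Red Q, c) # v) f' (if x = Black then map Suc rs else rs) cs"
    "cl f' = sh x (cl f)" using diagram_Lam(2) unfolding dg_def by auto
  have "cl ((Ident (map fst ((x, a) # u)) \<boxtimes> Lam Q \<boxtimes> Ident (map fst v)) \<bullet> f') =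
      sh x (cl ((Ident (map fst u) \<boxtimes> Lam Q \<boxtimes> Ident (map fst v)) \<bullet> f))"
    by (simp add: cl_ops[symmetric] sh_tens[of x "map fst u"] sh_comp f'(2))
  then show ?case unfolding dg_def
    using diagram.diagram_Lam[OF f'(1)] by (auto intro!: exI)
qed

lemma dg_shift: "dg L L' F rs cs \<Longrightarrow> dg ((x, a) # L) ((x, a) # L') (sh x F) (if x = Black then map Suc rs else rs) cs"
  using diagram_shift unfolding dg_def[of L L'] by blast

lemma diagram_comp:
  "diagram L' L'' g rs' cs' \<Longrightarrow> diagram L L' f rs cs \<Longrightarrow> cl f \<in> hm i (map fst L') \<Longrightarrow>
    dg L L'' (cl g \<star> cl f) (rs' @ rs) (cs' @ cs)"
proof (induction rule: diagram.induct)
  case (diagram_Ident L')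
  then show ?case unfolding dg_def using idc_left by auto
next
  case (diagram_Tpos L' u c b v g rs' cs')
  then obtain h where h: "diagram L (u @ (Black, c) # (Black, b) # v) h (rs' @ rs) (cs' @ cs)" "cl h = cl g \<star> cl f"
    unfolding dg_def by auto
  show ?case unfolding dg_def
    using diagram.diagram_Tpos[OF h(1)] h(2) by (auto simp: cl_Comp[symmetric] comp_assoc' intro!: exI)
next
  case (diagram_Rho L' u Q c b v g rs' cs')
  then obtain h where h: "diagram L (u @ (Red Q, c) # (Black, b) # v) h (rs' @ rs) (cs' @ cs)" "cl h = cl g \<star> cl f"
    unfolding dg_def by auto
  show ?case unfolding dg_def
    using diagram.diagram_Rho[OF h(1)] h(2) by (auto simp: cl_Comp[symmetric] comp_assoc' intro!: exI)
next
  case (diagram_Lam L' u b Q c v g rs' cs')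
  then obtain h where h: "diagram L (u @ (Black, b) # (Red Q, c) # v) h (rs' @ rs) (cs' @ cs)" "cl h = cl g \<star> cl f"
    unfolding dg_def by auto
  show ?case unfolding dg_def
    using diagram.diagram_Lam[OF h(1)] h(2) by (auto simp: cl_Comp[symmetric] comp_assoc' intro!: exI)
qed

lemma dg_comp:
  "dg L' L'' G rs' cs' \<Longrightarrow> dg L L' F rs cs \<Longrightarrow> F \<in> hm i (map fst L') \<Longrightarrow> dg L L'' (G \<star> F) (rs' @ rs) (cs' @ cs)"
  using diagram_comp unfolding dg_def[of L' L''] dg_def[of L L'] by blast

lemma dg_cross:
  assumes "dg L ((x, a) # (y, b) # v) F rs cs" "crossable x y" "[x] \<in> objects" "[y] \<in> objects" "map fst v \<in> objects"
  shows "dg L ((y, b) # (x, a) # v) (rw (XX x y) (map fst v) \<star> F) (if x = Black \<and> y = Black then 0 # rs else rs)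
    ((if x \<noteq> Black then [(a, b)] else if y \<noteq> Black then [(b, a)] else []) @ cs)"
proof -
  obtain f where f: "diagram L ([] @ (x, a) # (y, b) # v) f rs cs" "cl f = F" using assms(1) unfolding dg_def by auto
  have X: "idc [] \<bowtie> rw (XX x y) (map fst v) = rw (XX x y) (map fst v)"
    by (rule tens2_idc_Nil(2)[OF crossing_hm[OF assms(2-5)]])
  consider "x = Black" "y = Black" | Q where "x = Red Q" "y = Black" | Q where "x = Black" "y = Red Q"
    using assms(2) by (cases x; cases y) (auto simp: crossable_def)
  then show ?thesis
  proof cases
    case 1
    show ?thesis unfolding dg_def
      using diagram_Tpos[OF f(1)[unfolded 1]] X 1 f(2) by (auto simp: cl_ops[symmetric] num_black_def intro!: exI)
  next
    case (2 Q)
    show ?thesis unfolding dg_def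
      using diagram_Rho[OF f(1)[unfolded 2]] X 2 f(2) by (auto simp: cl_ops[symmetric] intro!: exI)
  next
    case (3 Q)
    show ?thesis unfolding dg_def
      using diagram_Lam[OF f(1)[unfolded 3]] X 3 f(2) by (auto simp: cl_ops[symmetric] intro!: exI)
  qed
qed

text \<open>Labels increase along the bottom, so the black strands passed by a pulled black strand
  are those with smaller labels: as many as the inversions it starts in the top word. Every crossing
  with a red strand involves the pulled strand, so no pair is repeated by later pulls of other
  strands.\<close>

lemma lpull_dg:
  "lpull yb L L1 C \<Longrightarrow> map fst L \<in> objects \<Longrightarrow> sorted_wrt (<) (map snd L) \<Longrightarrow>
    sorted_wrt (<) (map snd L1) \<and> (\<exists>rs cs. dg L (yb # L1) C rs cs \<and> distinct cs \<and>
      set cs \<subseteq> {(p, q). p \<in> snd ` set L \<and> q \<in> snd ` set L \<and> (p = snd yb \<or> q = snd yb)} \<and>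
      length rs = (if fst yb = Black then length (filter (\<lambda>c. c < snd yb) (blacks L1)) else 0))"
proof (induction rule: lpull.induct)
  case (lpull_base L)
  have "dg (yb # L) (yb # L) (idc (map fst (yb # L))) [] []" unfolding dg_def using diagram_Ident by blast
  moreover have "filter (\<lambda>c. c < snd yb) (blacks L) = []"
    using lpull_base(2) unfolding filter_empty_conv blacks_def by (auto dest: order.strict_trans)
  ultimately show ?case using lpull_base(2) by (intro conjI exI[of _ "[]"]) auto
next
  case (lpull_step L L1 C xa)
  obtain x a where xa: "xa = (x, a)" by (cases xa)
  obtain y b where yb: "yb = (y, b)" by (cases yb)
  have o: "map fst L \<in> objects" "[x] \<in> objects" using lpull_step(4) objects_Cons[of x "map fst L"] xa by auto
  have s: "sorted_wrt (<) (map snd L)" "\<forall>c\<in>snd ` set L. a < c" using lpull_step(5) xa by auto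
  obtain rs cs where IH: "sorted_wrt (<) (map snd L1)" "dg L (yb # L1) C rs cs" "distinct cs"
      "set cs \<subseteq> {(p, q). p \<in> snd ` set L \<and> q \<in> snd ` set L \<and> (p = snd yb \<or> q = snd yb)}"
      "length rs = (if fst yb = Black then length (filter (\<lambda>c. c < snd yb) (blacks L1)) else 0)"
    using lpull_step(3)[OF o(1) s(1)] by blast
  have m: "set L = insert yb (set L1)" using lpull_mset[OF lpull_step(1)] by (metis set_mset_add_mset_insert set_mset_mset)
  have p: "pull y (map fst L) (map fst L1) C" using lpull_pull[OF lpull_step(1) o(1)] yb by simp
  have oy: "[y] \<in> objects" "map fst L1 \<in> objects" using pull_objects[OF p] by auto
  have cr: "crossable x y" using lpull_step(2) xa yb by simp
  let ?rs = "if x = Black then map Suc rs else rs"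
  let ?c = "if x \<noteq> Black then [(a, b)] else if y \<noteq> Black then [(b, a)] else []"
  have D: "dg ((x, a) # L) ((y, b) # (x, a) # L1) (rw (XX x y) (map fst L1) \<star> sh x C) (if x = Black \<and> y = Black then 0 # ?rs else ?rs) (?c @ cs)"
    by (rule dg_cross[OF _ cr o(2) oy]) (use dg_shift[OF IH(2), of x a] yb in simp)
  have ab: "a < b" "b \<in> snd ` set L" "a \<notin> snd ` set L" using s(2) m yb by force+
  have d: "distinct (?c @ cs)" using IH(3,4) ab(3) by auto
  have sub: "set (?c @ cs) \<subseteq> {(p, q). p \<in> snd ` set (xa # L) \<and> q \<in> snd ` set (xa # L) \<and> (p = snd yb \<or> q = snd yb)}"
    using IH(4) ab(2) xa yb by auto
  have len: "length (if x = Black \<and> y = Black then 0 # ?rs else ?rs) =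
      (if fst yb = Black then length (filter (\<lambda>c. c < snd yb) (blacks (xa # L1))) else 0)"
    using IH(5) ab(1) cr by (cases x; cases y) (auto simp: xa yb crossable_def)
  have "sorted_wrt (<) (map snd (xa # L1))" using IH(1) s(2) m xa by auto
  moreover have "dg (xa # L) (yb # xa # L1) (rw (XX (fst xa) (fst yb)) (map fst L1) \<star> sh (fst xa) C)
      (if x = Black \<and> y = Black then 0 # ?rs else ?rs) (?c @ cs)"
    using D xa yb by simp
  ultimately show ?case using d sub len by blast
qed

lemma nf_dg:
  "nf L L' N \<Longrightarrow> map fst L \<in> objects \<Longrightarrow> sorted_wrt (<) (map snd L) \<Longrightarrow>
    \<exists>rs cs. dg L L' N rs cs \<and> distinct cs \<and> set cs \<subseteq> snd ` set L \<times> snd ` set L \<and> length rs = invs (blacks L')"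
proof (induction rule: nf.induct)
  case nf_nil
  have "dg [] [] (idc []) [] []" unfolding dg_def using diagram_Ident[of "[]"] by auto
  then show ?case by (intro exI[of _ "[]"]) auto
next
  case (nf_step yb L L1 C L' N)
  obtain y b where yb: "yb = (y, b)" by (cases yb)
  obtain rs cs where 1: "sorted_wrt (<) (map snd L1)" "dg L (yb # L1) C rs cs" "distinct cs"
      "set cs \<subseteq> {(p, q). p \<in> snd ` set L \<and> q \<in> snd ` set L \<and> (p = snd yb \<or> q = snd yb)}"
      "length rs = (if fst yb = Black then length (filter (\<lambda>c. c < snd yb) (blacks L1)) else 0)"
    using lpull_dg[OF nf_step(1,4,5)] by blast
  note p = lpull_pull[OF nf_step(1,4)]
  obtain rs' cs' where 2: "dg L1 L' N rs' cs'" "distinct cs'" "set cs' \<subseteq> snd ` set L1 \<times> snd ` set L1" "length rs' = invs (blacks L')"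
    using nf_step(3)[OF _ 1(1)] pull_objects[OF p] by blast
  let ?rs = "if y = Black then map Suc rs' else rs'"
  have D: "dg L (yb # L') (sh (fst yb) N \<star> C) (?rs @ rs) (cs' @ cs)"
    using dg_comp[OF dg_shift[OF 2(1), of y b]] 1(2) pull_hm[OF p] yb by fastforce
  have m: "mset L = add_mset yb (mset L1)" by (rule lpull_mset[OF nf_step(1)])
  have "distinct (map snd L)" using nf_step(5) by (simp add: strict_sorted_iff)
  then have "distinct (map snd (yb # L1))" using m by (metis mset.simps(2) mset_eq_imp_distinct_iff mset_map)
  then have b: "b \<notin> snd ` set L1" using yb by simp
  have sL: "set L = insert yb (set L1)" using m by (metis set_mset_add_mset_insert set_mset_mset)
  have d: "distinct (cs' @ cs)" using 1(3,4) 2(2,3) b yb by auto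
  have sub: "set (cs' @ cs) \<subseteq> snd ` set L \<times> snd ` set L" using 1(4) 2(3) sL by auto
  have "mset (blacks L') = mset (blacks L1)" using nf_mset[OF nf_step(2)] by (simp add: mset_blacks)
  then have "length (filter (\<lambda>c. c < b) (blacks L')) = length (filter (\<lambda>c. c < b) (blacks L1))"
    by (metis mset_filter size_mset)
  then have len: "length (?rs @ rs) = invs (blacks (yb # L'))"
    using 1(5) 2(4) by (cases y) (auto simp: yb)
  show ?case using D d sub len by blast
qed

lemma nf_diagram_for:
  assumes i: "i \<in> objects" "num_black i = d" and nf: "nf (zip i [0..<length i]) L' N"
  shows "\<exists>f rs. cl f = N \<and> diagram_for d (map fst L') (word_perm rs) i f \<and> word_perm rs permutes {..<d} \<and>
    length (blacks L') = d \<and> (\<forall>k<d. blacks L' ! k = blacks (zip i [0..<length i]) ! Perm.apply (lab rs) k) \<and>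
    reds L' = reds (zip i [0..<length i])"
proof -
  let ?L = "zip i [0..<length i]"
  have L: "map fst ?L = i" "map snd ?L = [0..<length i]" by simp_all
  have s: "sorted_wrt (<) (map snd ?L)" unfolding L(2) by (rule sorted_wrt_upt)
  obtain f rs cs where f: "diagram ?L L' f rs cs" "cl f = N" "distinct cs" "length rs = invs (blacks L')"
    using nf_dg[OF nf _ s] i(1) L(1) unfolding dg_def by auto
  have inv: "num_black (map fst L') = d" "reds L' = reds ?L" "\<forall>r\<in>set rs. Suc r < d"
      "\<forall>k<d. blacks L' ! k = blacks ?L ! Perm.apply (lab rs) k"
    using diagram_invariant[OF f(1) _ _ f(3), of d] L i by auto
  have sb: "sorted_wrt (<) (blacks ?L)"
    using s unfolding blacks_def sorted_wrt_map by (rule sorted_wrt_filter)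
  have lb: "length (blacks ?L) = d" "length (blacks L') = d" using length_blacks[of ?L] length_blacks[of L'] L i inv(1) by auto
  have "reduced_expression d (word_perm rs) rs"
    by (rule reduced_expressionI[OF inv(3) lb(1) sb lb(2) inv(4) f(4)])
  then have "diagram_for d (map fst L') (word_perm rs) i f"
    unfolding diagram_for_def using f by blast
  then show ?thesis using f(2) word_perm_permutes[OF inv(3)] lb(2) inv by blast
qed

lemma nf_unique_perm:
  assumes i: "i \<in> objects" "num_black i = d"
    and nf: "nf (zip i [0..<length i]) L' N" "nf (zip i [0..<length i]) L'' N'" and "map fst L' = map fst L''"
    and rs: "\<forall>k<d. blacks L' ! k = blacks (zip i [0..<length i]) ! Perm.apply (lab rs) k"
      "\<forall>k<d. blacks L'' ! k = blacks (zip i [0..<length i]) ! Perm.apply (lab rs') k" "word_perm rs = word_perm rs'"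
    and "length (blacks L') = d" "length (blacks L'') = d" "reds L' = reds L''"
  shows "N = N'"
proof -
  have "blacks L' = blacks L''" using assms lab_eq_iff[of rs rs'] by (intro nth_equalityI) auto
  then have "L' = L''" using labelled_word_eqI assms by blast
  moreover have "distinct (zip i [0..<length i])" by (rule distinct_zipI2) simp
  ultimately show ?thesis using nf_unique nf by blast
qed

end

section \<open>The basis\<close>

context LAH
begin

section \<open>The module of morphisms and evaluation on it\<close>

lemma Hom_simps:
  shows carrier_Hom: "carrier (Hom i j) = hm i j"
    and add_Hom: "F \<in> hm i j \<Longrightarrow> G \<in> hm i j \<Longrightarrow> F \<oplus>\<^bsub>Hom i j\<^esub> G = F \<squnion> G"
    and smult_Hom: "F \<in> hm i j \<Longrightarrow> c \<odot>\<^bsub>Hom i j\<^esub> F = scal c F"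
    and zero_Hom: "i \<in> objects \<Longrightarrow> j \<in> objects \<Longrightarrow> \<zero>\<^bsub>Hom i j\<^esub> = zc i j"
proof -
  have "{f. arrow f i j} // {(f, g). eqv i j f g} = (\<lambda>f. cls i j f) ` {f. arrow f i j}"
    unfolding quotient_def cls_def by blast
  also have "\<dots> = hm i j" unfolding hm_def using cls_eq by auto
  finally show "carrier (Hom i j) = hm i j" by (simp add: Hom_def)
  have mem: "arrow f' i j \<and> cl f' = F" if F: "F \<in> hm i j" and f': "f' \<in> F" for F f'
  proof -
    obtain f where f: "F = cl f" "arrow f i j" using F by (rule hmE)
    then have "eqv i j f f'" using mem_cl f' arrow_iff by metis
    then show ?thesis using eqv_arrow cl_eqI f by metis
  qed
  show "F \<oplus>\<^bsub>Hom i j\<^esub> G = F \<squnion> G" if F: "F \<in> hm i j" and G: "G \<in> hm i j"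
  proof -
    have "cls i j (f \<boxplus> g) = F \<squnion> G" if "f \<in> F" "g \<in> G" for f g
      using mem[OF F that(1)] mem[OF G that(2)] cls_eq[OF arrow_Add, of f i j g] by (metis cl_Add)
    then have "(\<Union>f\<in>F. \<Union>g\<in>G. cls i j (f \<boxplus> g)) = F \<squnion> G"
      by (intro UN_cl_const hm_nonempty[OF F] hm_nonempty[OF G])
    then show ?thesis by (simp add: Hom_def)
  qed
  show "c \<odot>\<^bsub>Hom i j\<^esub> F = scal c F" if F: "F \<in> hm i j"
  proof -
    have "cls i j (Scale c f) = scal c F" if "f \<in> F" for f
      using mem[OF F that] cls_eq[OF arrow_Scale, of f i j c] by (metis cl_Scale)
    then have "(\<Union>f\<in>F. cls i j (Scale c f)) = scal c F" by (intro UN_cl_const hm_nonempty[OF F])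
    then show ?thesis by (simp add: Hom_def)
  qed
  show "\<zero>\<^bsub>Hom i j\<^esub> = zc i j" if "i \<in> objects" "j \<in> objects"
    using cls_eq[OF arrow_Zero[OF that]] by (simp add: Hom_def)
qed

abbreviation "K \<equiv> (ring_of_type_algebra :: 'k ring)"

lemma K_simps: "carrier K = UNIV" "\<zero>\<^bsub>K\<^esub> = 0" "\<one>\<^bsub>K\<^esub> = 1" "a \<oplus>\<^bsub>K\<^esub> b = a + b" "a \<otimes>\<^bsub>K\<^esub> b = a * b"
  by (simp_all add: ring_of_type_algebra_def)

lemma module_Hom:
  assumes "i \<in> objects" "j \<in> objects" shows "Module.module K (Hom i j)"
proof (rule moduleI)
  show "cring K" by (rule cring_from_type_algebra)
  show "abelian_group (Hom i j)"
  proof (rule abelian_groupI)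
    fix F assume F: "F \<in> carrier (Hom i j)"
    then show "\<zero>\<^bsub>Hom i j\<^esub> \<oplus>\<^bsub>Hom i j\<^esub> F = F"
      using plus_zc[of F i j] by (simp add: carrier_Hom add_Hom zero_Hom[OF assms] hm_zc assms plus_commute)
    fix G assume "G \<in> carrier (Hom i j)"
    then show "F \<oplus>\<^bsub>Hom i j\<^esub> G = G \<oplus>\<^bsub>Hom i j\<^esub> F"
      using F plus_commute[of F G] by (simp add: carrier_Hom add_Hom)
  next
    fix F assume F: "F \<in> carrier (Hom i j)"
    show "\<exists>G\<in>carrier (Hom i j). G \<oplus>\<^bsub>Hom i j\<^esub> F = \<zero>\<^bsub>Hom i j\<^esub>"
      using F plus_neg[of F i j] hm_scal[of F i j "- 1"]
      by (intro bexI[of _ "scal (- 1) F"]) (auto simp: carrier_Hom add_Hom zero_Hom[OF assms] plus_commute)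
  qed (auto simp: carrier_Hom add_Hom zero_Hom[OF assms] hm_zc assms hm_plus plus_assoc)
qed (auto simp: carrier_Hom add_Hom smult_Hom K_simps hm_scal hm_plus scal_add scal_plus scal_scal scal_one)

lemma combination_hm:
  assumes "i \<in> objects" "j \<in> objects" "\<And>x. x \<in> Y \<Longrightarrow> t x \<in> hm i j"
  shows "(\<lambda>x. c x \<odot>\<^bsub>Hom i j\<^esub> t x) \<in> Y \<rightarrow> carrier (Hom i j)"
  using assms hm_scal by (auto simp: carrier_Hom smult_Hom)

lemma combination_insert:
  assumes "i \<in> objects" "j \<in> objects" "\<And>y. y \<in> insert x Y \<Longrightarrow> t y \<in> hm i j" "finite Y" "x \<notin> Y"
  shows "(\<Oplus>\<^bsub>Hom i j\<^esub>y\<in>insert x Y. c y \<odot>\<^bsub>Hom i j\<^esub> t y) = scal (c x) (t x) \<squnion> (\<Oplus>\<^bsub>Hom i j\<^esub>y\<in>Y. c y \<odot>\<^bsub>Hom i j\<^esub> t y)"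
    "(\<Oplus>\<^bsub>Hom i j\<^esub>y\<in>Y. c y \<odot>\<^bsub>Hom i j\<^esub> t y) \<in> hm i j"
proof -
  interpret M: Module.module K "Hom i j" by (rule module_Hom[OF assms(1,2)])
  have h: "(\<lambda>y. c y \<odot>\<^bsub>Hom i j\<^esub> t y) \<in> Y \<rightarrow> carrier (Hom i j)" by (rule combination_hm[OF assms(1,2)]) (use assms in auto)
  show s: "(\<Oplus>\<^bsub>Hom i j\<^esub>y\<in>Y. c y \<odot>\<^bsub>Hom i j\<^esub> t y) \<in> hm i j" using M.finsum_closed[OF h] by (simp add: carrier_Hom)
  show "(\<Oplus>\<^bsub>Hom i j\<^esub>y\<in>insert x Y. c y \<odot>\<^bsub>Hom i j\<^esub> t y) = scal (c x) (t x) \<squnion> (\<Oplus>\<^bsub>Hom i j\<^esub>y\<in>Y. c y \<odot>\<^bsub>Hom i j\<^esub> t y)"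
    using M.finsum_insert[OF assms(4,5) h] assms(3)[of x] hm_scal[of "t x" i j "c x"] s
    by (simp add: carrier_Hom smult_Hom add_Hom)
qed

text \<open>Coefficients are attached to indices rather than to vectors, so t may take a value more
  than once.\<close>

lemma sp_combination:
  assumes o: "i \<in> objects" "j \<in> objects" and t: "\<And>x. x \<in> I \<Longrightarrow> t x \<in> hm i j" and F: "sp (t ` I) i j F"
  shows "\<exists>Y c. finite Y \<and> Y \<subseteq> I \<and> F = (\<Oplus>\<^bsub>Hom i j\<^esub>x\<in>Y. c x \<odot>\<^bsub>Hom i j\<^esub> t x)"
  using F
proof (induction rule: sp.induct)
  interpret M: Module.module K "Hom i j" by (rule module_Hom[OF o])
  {
    case sp_zero
    show ?case using o by (intro exI[of _ "{}"]) (simp add: zero_Hom)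
  next
    case (sp_base F)
    then obtain x where x: "x \<in> I" "F = t x" by blast
    have "(\<Oplus>\<^bsub>Hom i j\<^esub>y\<in>{x}. 1 \<odot>\<^bsub>Hom i j\<^esub> t y) = F"
      using combination_insert(1)[OF o, of x "{}" t "\<lambda>_. 1"] t[OF x(1)] x(2) scal_one plus_zc o by (simp add: zero_Hom)
    then show ?case using x(1) by (intro exI[of _ "{x}"] exI[of _ "\<lambda>_. 1"]) auto
  next
    case (sp_add F G)
    then obtain Y1 c1 Y2 c2 where Y: "finite Y1" "Y1 \<subseteq> I" "F = (\<Oplus>\<^bsub>Hom i j\<^esub>x\<in>Y1. c1 x \<odot>\<^bsub>Hom i j\<^esub> t x)"
      "finite Y2" "Y2 \<subseteq> I" "G = (\<Oplus>\<^bsub>Hom i j\<^esub>x\<in>Y2. c2 x \<odot>\<^bsub>Hom i j\<^esub> t x)" by blast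
    \<comment> \<open>Both families of coefficients are extended by 0 to the union of the index
      sets, where they can be added.\<close>
    let ?e = "\<lambda>Y c x. if x \<in> Y then c x else 0"
    have ext: "(\<Oplus>\<^bsub>Hom i j\<^esub>x\<in>Y. c x \<odot>\<^bsub>Hom i j\<^esub> t x) = (\<Oplus>\<^bsub>Hom i j\<^esub>x\<in>Y1 \<union> Y2. ?e Y c x \<odot>\<^bsub>Hom i j\<^esub> t x)"
      if "Y \<subseteq> Y1 \<union> Y2" for Y c
    proof (rule M.add.finprod_mono_neutral_cong_left)
      fix x assume "x \<in> Y1 \<union> Y2 - Y"
      then show "?e Y c x \<odot>\<^bsub>Hom i j\<^esub> t x = \<zero>\<^bsub>Hom i j\<^esub>"
        using scal_0[OF t] Y o by (auto simp: smult_Hom t zero_Hom)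
    next
      have "(\<lambda>x. ?e Y c x \<odot>\<^bsub>Hom i j\<^esub> t x) \<in> Y1 \<union> Y2 \<rightarrow> carrier (Hom i j)"
        by (rule combination_hm[OF o]) (use t Y in auto)
      then show "(\<lambda>x. ?e Y c x \<odot>\<^bsub>Hom i j\<^esub> t x) \<in> Y1 \<union> Y2 \<rightarrow> carrier (Hom i j)" .
    qed (use that Y in auto)
    have h: "(\<lambda>x. c x \<odot>\<^bsub>Hom i j\<^esub> t x) \<in> Y1 \<union> Y2 \<rightarrow> carrier (Hom i j)" for c
      by (rule combination_hm[OF o]) (use t Y in auto)
    have "F \<squnion> G = F \<oplus>\<^bsub>Hom i j\<^esub> G"
    proof -
      have "F \<in> hm i j" "G \<in> hm i j"
        using M.finsum_closed[OF combination_hm[OF o, of Y1 t c1]] M.finsum_closed[OF combination_hm[OF o, of Y2 t c2]] t Y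
        by (auto simp: carrier_Hom)
      then show ?thesis by (simp add: add_Hom)
    qed
    also have "\<dots> = (\<Oplus>\<^bsub>Hom i j\<^esub>x\<in>Y1 \<union> Y2. ?e Y1 c1 x \<odot>\<^bsub>Hom i j\<^esub> t x \<oplus>\<^bsub>Hom i j\<^esub> ?e Y2 c2 x \<odot>\<^bsub>Hom i j\<^esub> t x)"
      unfolding Y(3,6) ext[of Y1 c1, OF Un_upper1] ext[of Y2 c2, OF Un_upper2] by (rule M.finsum_addf[OF h h, symmetric])
    also have "\<dots> = (\<Oplus>\<^bsub>Hom i j\<^esub>x\<in>Y1 \<union> Y2. (?e Y1 c1 x + ?e Y2 c2 x) \<odot>\<^bsub>Hom i j\<^esub> t x)"
    proof (rule M.finsum_cong'[OF refl h])
      fix x assume "x \<in> Y1 \<union> Y2"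
      then have tx: "t x \<in> hm i j" using Y t by auto
      show "?e Y1 c1 x \<odot>\<^bsub>Hom i j\<^esub> t x \<oplus>\<^bsub>Hom i j\<^esub> ?e Y2 c2 x \<odot>\<^bsub>Hom i j\<^esub> t x = (?e Y1 c1 x + ?e Y2 c2 x) \<odot>\<^bsub>Hom i j\<^esub> t x"
        by (simp only: smult_Hom[OF tx] add_Hom[OF hm_scal[OF tx] hm_scal[OF tx]] scal_add)
    qed
    finally show ?case using Y by (intro exI[of _ "Y1 \<union> Y2"] exI[of _ "\<lambda>x. ?e Y1 c1 x + ?e Y2 c2 x"]) simp
  next
    case (sp_scal F a)
    then obtain Y c where Y: "finite Y" "Y \<subseteq> I" "F = (\<Oplus>\<^bsub>Hom i j\<^esub>x\<in>Y. c x \<odot>\<^bsub>Hom i j\<^esub> t x)" by blast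
    have h: "(\<lambda>x. c x \<odot>\<^bsub>Hom i j\<^esub> t x) \<in> Y \<rightarrow> carrier (Hom i j)" for c
      by (rule combination_hm[OF o]) (use t Y in auto)
    have "scal a F = a \<odot>\<^bsub>Hom i j\<^esub> F" using M.finsum_closed[OF h, of c] Y(3) by (simp add: carrier_Hom smult_Hom)
    also have "\<dots> = (\<Oplus>\<^bsub>Hom i j\<^esub>x\<in>Y. a \<odot>\<^bsub>Hom i j\<^esub> (c x \<odot>\<^bsub>Hom i j\<^esub> t x))"
      unfolding Y(3) by (rule M.finsum_smult_ldistr[OF Y(1) _ h]) (simp add: K_simps)
    also have "\<dots> = (\<Oplus>\<^bsub>Hom i j\<^esub>x\<in>Y. (a * c x) \<odot>\<^bsub>Hom i j\<^esub> t x)"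
      by (rule M.finsum_cong'[OF refl h]) (use Y t hm_scal in \<open>auto simp: smult_Hom scal_scal\<close>)
    finally show ?case using Y by (intro exI[of _ Y] exI[of _ "\<lambda>x. a * c x"]) simp
  }
qed

lemma sp_combination_closed:
  assumes "i \<in> objects" "j \<in> objects"
  shows "finite Y \<Longrightarrow> (\<And>x. x \<in> Y \<Longrightarrow> t x \<in> hm i j) \<Longrightarrow> (\<And>x. x \<in> Y \<Longrightarrow> sp S i j (scal (c x) (t x))) \<Longrightarrow>
    sp S i j (\<Oplus>\<^bsub>Hom i j\<^esub>x\<in>Y. c x \<odot>\<^bsub>Hom i j\<^esub> t x)"
proof (induction Y rule: finite_induct)
  case empty
  interpret M: Module.module K "Hom i j" by (rule module_Hom[OF assms])
  show ?case using sp_zero by (simp add: zero_Hom assms)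
next
  case (insert x Y)
  then show ?case using combination_insert(1)[OF assms, of x Y t c] by (simp add: sp_add)
qed

text \<open>Evaluation of a class through a representative; by \<open>ev_eqv\<close> the choice does
  not matter.\<close>

definition evc :: "nat \<Rightarrow> ('a, 'k) mor set \<Rightarrow> (st \<Rightarrow> 'k) \<Rightarrow> 'k" where
  "evc d F = ev d (SOME f. cl f = F \<and> wt f)"

lemma evc_cl: "wt f \<Longrightarrow> evc d (cl f) = ev d f"
proof -
  assume f: "wt f"
  have "\<exists>g. cl g = cl f \<and> wt g" using f by blast
  then have g: "cl (SOME g. cl g = cl f \<and> wt g) = cl f" "wt (SOME g. cl g = cl f \<and> wt g)"
    using someI_ex[of "\<lambda>g. cl g = cl f \<and> wt g"] by blast+
  show ?thesis unfolding evc_def using iffD1[OF cl_eq_iff g(1)] g(2) ev_eqv by blast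
qed

lemma evc_linear:
  assumes "F \<in> hm i j" "G \<in> hm i j"
  shows "evc d (F \<squnion> G) \<phi> = evc d F \<phi> + evc d G \<phi>" "evc d (scal c F) \<phi> = c * evc d F \<phi>"
proof -
  obtain f g where f: "F = cl f" "arrow f i j" and g: "G = cl g" "arrow g i j" using assms by (auto elim!: hmE)
  then show "evc d (F \<squnion> G) \<phi> = evc d F \<phi> + evc d G \<phi>" "evc d (scal c F) \<phi> = c * evc d F \<phi>"
    by (auto simp: cl_ops evc_cl arrow_iff ev_add ev_scale)
qed

lemma evc_zc: "i \<in> objects \<Longrightarrow> j \<in> objects \<Longrightarrow> evc d (zc i j) \<phi> = 0"
  using evc_linear(2)[OF hm_zc[of i j] hm_zc[of i j], where c = 0] scal_zc[of i j 0] by simp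

lemma evc_combination:
  assumes "i \<in> objects" "j \<in> objects"
  shows "finite Y \<Longrightarrow> (\<And>x. x \<in> Y \<Longrightarrow> t x \<in> hm i j) \<Longrightarrow>
    evc d (\<Oplus>\<^bsub>Hom i j\<^esub>x\<in>Y. c x \<odot>\<^bsub>Hom i j\<^esub> t x) \<phi> = (\<Sum>x\<in>Y. c x * evc d (t x) \<phi>)"
proof (induction Y rule: finite_induct)
  case empty
  interpret M: Module.module K "Hom i j" by (rule module_Hom[OF assms])
  show ?case by (simp add: zero_Hom assms evc_zc)
next
  case (insert x Y)
  note c = combination_insert[OF assms, of x Y t c]
  have t: "t x \<in> hm i j" using insert by simp
  show ?case using c insert evc_linear(1)[OF hm_scal[OF t] c(2)] evc_linear(2)[OF t t] by simp
qed

lemma diagram_arrow: "diagram L L' f rs cs \<Longrightarrow> map fst L \<in> objects \<Longrightarrow> arrow f (map fst L) (map fst L')"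
proof (induction rule: diagram.induct)
  case (diagram_Ident L)
  then show ?case using arrow_Ident by blast
next
  case (diagram_Tpos L u a b v f rs cs)
  then have f: "arrow f (map fst L) (map fst (u @ (Black, a) # (Black, b) # v))" by blast
  then show ?case using hm_objects[OF cl_hm[OF f]] by (auto simp: arrow_iff)
next
  case (diagram_Rho L u Q a b v f rs cs)
  then have f: "arrow f (map fst L) (map fst (u @ (Red Q, a) # (Black, b) # v))" by blast
  then show ?case using hm_objects[OF cl_hm[OF f]] by (auto simp: arrow_iff)
next
  case (diagram_Lam L u b Q a v f rs cs)
  then have f: "arrow f (map fst L) (map fst (u @ (Black, b) # (Red Q, a) # v))" by blast
  then show ?case using hm_objects[OF cl_hm[OF f]] by (auto simp: arrow_iff)
qed

text \<open>The two subwords give lower bounds for the numbers of black and of nonblack letters, and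
  the length of the word is the sum of these bounds.\<close>

lemma num_black_shuffle: assumes "i \<in> shuffle_words d Qs" shows "i \<in> objects" "num_black i = d"
proof -
  have i: "i \<in> objects" "length i = d + length Qs" "subseq (replicate d Black) i" "subseq (map Red Qs) i"
    using assms by (auto simp: shuffle_words_def)
  then show "i \<in> objects" by simp
  have "subseq (filter ((=) Black) (replicate d Black)) (filter ((=) Black) i)" by (rule subseq_filter[OF i(3)])
  then have 1: "d \<le> num_black i" using list_emb_length by (fastforce simp: num_black_def)
  have "subseq (filter (\<lambda>x. Black \<noteq> x) (map Red Qs)) (filter (\<lambda>x. Black \<noteq> x) i)" by (rule subseq_filter[OF i(4)])
  moreover have "filter (\<lambda>x. Black \<noteq> x) (map Red Qs) = map Red Qs" by (simp add: filter_id_conv)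
  ultimately have "length Qs \<le> length (filter (\<lambda>x. Black \<noteq> x) i)" using list_emb_length by fastforce
  then show "num_black i = d" using 1 i(2) sum_length_filter_compl[of "(=) Black" i] by (simp add: num_black_def)
qed

section \<open>The proposed basis for fixed source and target\<close>

context
  fixes i j :: "'a obj" and d :: nat and T :: "(nat \<Rightarrow> nat) \<Rightarrow> ('a, 'k) mor"
  assumes i: "i \<in> objects" "num_black i = d" and j: "j \<in> objects" "num_black j = d"
    and T: "\<And>w. w permutes {..<d} \<Longrightarrow> diagram_for d j w i (T w)"
begin

abbreviation "I \<equiv> basis_index d B"

lemma bterm_arrow:
  assumes "(as, \<alpha>, w) \<in> I" "diagram_for d j w i (F w)" shows "arrow (bterm j F (as, \<alpha>, w)) i j"
proof -
  have l: "length as = num_black j" "length \<alpha> = num_black j" using assms(1) j by (auto simp: basis_index_def)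
  have "arrow (tokens j as) j j" "arrow (dots j \<alpha>) j j" using cl_tokens_dots[OF j(1) l] arrow_of_hm by auto
  moreover obtain L rs cs where "diagram (zip i [0..<length i]) L (F w) rs cs" "map fst L = j"
    using assms(2) unfolding diagram_for_def by blast
  then have "arrow (F w) i j" using diagram_arrow[of "zip i [0..<length i]" L "F w"] i(1) by simp
  ultimately show ?thesis unfolding bterm_def by (auto intro: arrow_Comp)
qed

lemma I_perm: "(as, \<alpha>, w) \<in> I \<Longrightarrow> w permutes {..<d}" by (simp add: basis_index_def)

lemma T_arrow: "x \<in> I \<Longrightarrow> arrow (bterm j T x) i j"
proof (cases x)
  case (fields as \<alpha> w)
  then show "x \<in> I \<Longrightarrow> arrow (bterm j T x) i j"
    using bterm_arrow[of as \<alpha> w T] T[of w] I_perm[of as \<alpha> w] by simp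
qed

lemma basis_element_eq: "x \<in> I \<Longrightarrow> basis_element j i T x = cl (bterm j T x)"
  using cls_eq[OF T_arrow, of x] by (cases x) (simp add: basis_element_def bterm_def)

lemma basis_hm: "x \<in> I \<Longrightarrow> basis_element j i T x \<in> hm i j"
  using cl_hm[OF T_arrow[of x]] basis_element_eq[of x] by simp

lemma coefficients_vanish:
  assumes "finite Y" "Y \<subseteq> I" "\<And>\<phi>. (\<Sum>x\<in>Y. c x * ev d (bterm j T x) \<phi>) = 0" "x \<in> Y"
  shows "c x = 0"
proof -
  obtain as \<alpha> w where x: "x = (as, \<alpha>, w)" by (cases x)
  have "c (as, \<alpha>, w) = 0"
    by (rule leading_coefficients_vanish[OF i j(2), where W = "{w. w permutes {..<d}}" and U = "\<lambda>_. 0" and l = 0 and Ys = Y and F = T])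
      (use assms T I_perm x in \<open>auto simp: supported_on_def\<close>)
  then show ?thesis using x by simp
qed

text \<open>Two indices with the same element would give a relation with the coefficients 1 and -1,
  which independence of the indexed family excludes.\<close>

lemma basis_inj: "inj_on (basis_element j i T) I"
proof (rule inj_onI, rule ccontr)
  fix x y assume xy: "x \<in> I" "y \<in> I" "basis_element j i T x = basis_element j i T y" "x \<noteq> y"
  define c :: "'a list \<times> int list \<times> (nat \<Rightarrow> nat) \<Rightarrow> 'k" where "c u = (if u = x then 1 else - 1)" for u
  have "cl (bterm j T x) = cl (bterm j T y)" using xy basis_element_eq by simp
  then have "ev d (bterm j T x) = ev d (bterm j T y)"
    using evc_cl[of "bterm j T x" d] evc_cl[of "bterm j T y" d] T_arrow[OF xy(1)] T_arrow[OF xy(2)] by (simp add: arrow_iff)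
  then have sum: "(\<Sum>u\<in>{x, y}. c u * ev d (bterm j T u) \<phi>) = 0" for \<phi> using xy(4) by (simp add: c_def)
  have "c x = 0" by (rule coefficients_vanish[OF _ _ sum]) (use xy in auto)
  then show False by (simp add: c_def)
qed

lemma basis_indep: "lin_indep K (Hom i j) (basis_element j i T ` I)"
  unfolding lin_indep_def
proof (intro allI impI ballI)
  interpret M: Module.module K "Hom i j" by (rule module_Hom[OF i(1) j(1)])
  fix S c v assume S: "finite S" "S \<subseteq> basis_element j i T ` I"
    and z: "(\<Oplus>\<^bsub>Hom i j\<^esub>v\<in>S. c v \<odot>\<^bsub>Hom i j\<^esub> v) = \<zero>\<^bsub>Hom i j\<^esub>" and v: "v \<in> S"
  obtain Y where Y: "Y \<subseteq> I" "finite Y" "S = basis_element j i T ` Y" using finite_subset_image[OF S] by blast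
  let ?t = "basis_element j i T"
  have t: "?t x \<in> hm i j" "?t x = cl (bterm j T x)" if "x \<in> Y" for x
    using subsetD[OF Y(1) that] basis_element_eq[of x] basis_hm[of x] by auto
  have "(\<Oplus>\<^bsub>Hom i j\<^esub>v\<in>S. c v \<odot>\<^bsub>Hom i j\<^esub> v) = (\<Oplus>\<^bsub>Hom i j\<^esub>x\<in>Y. c (?t x) \<odot>\<^bsub>Hom i j\<^esub> ?t x)"
    unfolding Y(3)
  proof (rule M.finsum_reindex)
    show "(\<lambda>v. c v \<odot>\<^bsub>Hom i j\<^esub> v) \<in> ?t ` Y \<rightarrow> carrier (Hom i j)"
      by (rule combination_hm[OF i(1) j(1)]) (use t in auto)
    show "inj_on ?t Y" using inj_on_subset[OF basis_inj Y(1)] .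
  qed
  then have e: "(\<Oplus>\<^bsub>Hom i j\<^esub>x\<in>Y. c (?t x) \<odot>\<^bsub>Hom i j\<^esub> ?t x) = zc i j"
    using z zero_Hom[OF i(1) j(1)] by metis
  have "evc d (\<Oplus>\<^bsub>Hom i j\<^esub>x\<in>Y. c (?t x) \<odot>\<^bsub>Hom i j\<^esub> ?t x) \<phi> = 0" for \<phi>
    unfolding e by (rule evc_zc[OF i(1) j(1)])
  then have "(\<Sum>x\<in>Y. c (?t x) * evc d (?t x) \<phi>) = 0" for \<phi>
    using evc_combination[OF i(1) j(1) Y(2), of ?t d "\<lambda>x. c (?t x)" \<phi>] t by simp
  moreover have "evc d (?t x) = ev d (bterm j T x)" if "x \<in> Y" for x
    using evc_cl[of "bterm j T x"] T_arrow[of x] Y(1) that t(2)[OF that] by (auto simp: arrow_iff)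
  ultimately have "(\<Sum>x\<in>Y. c (?t x) * ev d (bterm j T x) \<phi>) = 0" for \<phi> by simp
  then have "c (?t x) = 0" if "x \<in> Y" for x using coefficients_vanish[OF Y(2,1), of "\<lambda>x. c (?t x)"] that by blast
  then show "c v = \<zero>\<^bsub>K\<^esub>" using v Y(3) by (auto simp: K_simps)
qed

text \<open>These data determine the labelled top word, hence the normal form, so w has at most one
  (\<open>normal_unique\<close>).\<close>

definition normal :: "(nat \<Rightarrow> nat) \<Rightarrow> ('a, 'k) mor set \<Rightarrow> bool" where
  "normal w N \<longleftrightarrow> (\<exists>L' rs. nf (zip i [0..<length i]) L' N \<and> map fst L' = j \<and> word_perm rs = w \<and>
    length (blacks L') = d \<and> (\<forall>k<d. blacks L' ! k = blacks (zip i [0..<length i]) ! Perm.apply (lab rs) k) \<and>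
    reds L' = reds (zip i [0..<length i]))"

lemma normal_unique: "normal w N \<Longrightarrow> normal w N' \<Longrightarrow> N = N'"
proof -
  assume "normal w N" "normal w N'"
  then obtain L1 rs1 L2 rs2 where
    n1: "nf (zip i [0..<length i]) L1 N" "map fst L1 = j" "word_perm rs1 = w" "length (blacks L1) = d"
      "\<forall>k<d. blacks L1 ! k = blacks (zip i [0..<length i]) ! Perm.apply (lab rs1) k" "reds L1 = reds (zip i [0..<length i])"
    and n2: "nf (zip i [0..<length i]) L2 N'" "map fst L2 = j" "word_perm rs2 = w" "length (blacks L2) = d"
      "\<forall>k<d. blacks L2 ! k = blacks (zip i [0..<length i]) ! Perm.apply (lab rs2) k" "reds L2 = reds (zip i [0..<length i])"
    unfolding normal_def by blast
  show "N = N'"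
    by (rule nf_unique_perm[OF i n1(1) n2(1) _ n1(5) n2(5)]) (use n1 n2 in simp_all)
qed

text \<open>The permutations that come with a normal form; \<open>U\<close> fixes a diagram for the
  normal form of each.\<close>

definition W :: "(nat \<Rightarrow> nat) set" where
  "W = {w. w permutes {..<d} \<and> (\<exists>f. diagram_for d j w i f \<and> normal w (cl f))}"

definition U :: "(nat \<Rightarrow> nat) \<Rightarrow> ('a, 'k) mor" where
  "U w = (SOME f. diagram_for d j w i f \<and> normal w (cl f))"

lemma U: "w \<in> W \<Longrightarrow> diagram_for d j w i (U w) \<and> normal w (cl (U w))"
  unfolding W_def U_def by (rule someI_ex) blast

abbreviation "IW \<equiv> {x \<in> I. snd (snd x) \<in> W}"

lemma U_arrow: "x \<in> IW \<Longrightarrow> arrow (bterm j U x) i j"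
  using bterm_arrow U by (cases x) auto

lemma hm_sp_U: assumes "F \<in> hm i j" shows "sp ((\<lambda>x. cl (bterm j U x)) ` IW) i j F"
proof (rule sp_mono)
  show "sp (NF (zip i [0..<length i]) j) i j F" by (rule hm_sp_NF[OF assms]) simp
  fix G assume "G \<in> NF (zip i [0..<length i]) j"
  then obtain as \<alpha> N L' where G: "G = tdw j as \<alpha> \<star> N" "length as = num_black j" "set as \<subseteq> B" "length \<alpha> = num_black j"
    "nf (zip i [0..<length i]) L' N" "map fst L' = j" unfolding NF_def by blast
  obtain f rs where f: "cl f = N" "diagram_for d (map fst L') (word_perm rs) i f" "word_perm rs permutes {..<d}"
    "length (blacks L') = d" "\<forall>k<d. blacks L' ! k = blacks (zip i [0..<length i]) ! Perm.apply (lab rs) k"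
    "reds L' = reds (zip i [0..<length i])" using nf_diagram_for[OF i G(5)] by blast
  have n: "normal (word_perm rs) N" unfolding normal_def using G f by blast
  then have w: "word_perm rs \<in> W" using f G(6) unfolding W_def by auto
  then have N: "N = cl (U (word_perm rs))" using U normal_unique n by blast
  have "G = cl (bterm j U (as, \<alpha>, word_perm rs))"
    using cl_tokens_dots[OF j(1) G(2,4)] G(1) N by (simp add: bterm_def cl_Comp[symmetric] comp_assoc'[symmetric])
  moreover have "(as, \<alpha>, word_perm rs) \<in> IW" using G j f(3) w by (simp add: basis_index_def)
  ultimately show "sp ((\<lambda>x. cl (bterm j U x)) ` IW) i j G" by (intro sp_base) blast
qed

text \<open>Induction on the length of the permutation, for all tokens and dots at once, because
  those in the expansion of the difference are not under control.\<close>

lemma sp_U: "x \<in> IW \<Longrightarrow> sp (basis_element j i T ` I) i j (cl (bterm j U x))"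
proof (induction "len d (snd (snd x))" arbitrary: x rule: less_induct)
  case less
  obtain as \<alpha> w where x: "x = (as, \<alpha>, w)" by (cases x)
  have w: "w \<in> W" "w permutes {..<d}" "x \<in> I" "length as = d" "length \<alpha> = d"
    using less(2) x by (auto simp: basis_index_def)
  let ?u = "bterm j U x" and ?t = "bterm j T x"
  have arr: "arrow ?u i j" "arrow ?t i j" using U_arrow[OF less(2)] T_arrow[OF w(3)] .
  \<comment> \<open>The leading tensors of the two terms coincide and cancel, so G acts by the
    difference of two remainders at short labels.\<close>
  define G where "G = cl ?u \<squnion> scal (- 1) (cl ?t)"
  have G: "G \<in> hm i j" unfolding G_def using cl_hm arr hm_plus hm_scal by blast
  have tU: "cl (bterm j U y) \<in> hm i j" if "y \<in> IW" for y using U_arrow[OF that] cl_hm by blast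
  obtain Y c where Y: "finite Y" "Y \<subseteq> IW" "G = (\<Oplus>\<^bsub>Hom i j\<^esub>y\<in>Y. c y \<odot>\<^bsub>Hom i j\<^esub> cl (bterm j U y))"
    using sp_combination[OF i(1) j(1) tU hm_sp_U[OF G]] by blast
  have even: "qw d i j w k \<in> P1_gr 0" for k by (rule E_even[OF qw_E[OF i(1)]])
  let ?q = "\<lambda>k. single (\<alpha> ! k) (as ! k) * qw d i j w k"
  have lu: "leads d (ev d ?u) ?q (wlab w) (len d w)"
    using leads_basis[OF leads_diagram_for(1)[OF conjunct1[OF U[OF w(1)]] i] even j(2) w(4,5)] by (simp add: x bterm_def)
  have lt: "leads d (ev d ?t) ?q (wlab w) (len d w)"
    using leads_basis[OF leads_diagram_for(1)[OF T[OF w(2)] i] even j(2) w(4,5)] by (simp add: x bterm_def)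
  obtain w1 where w1: "\<And>\<phi>. ev d ?u \<phi> = vec d ?q (wlab w) \<phi> + w1 \<phi>" "supported_on (short_labels d (len d w)) w1"
    using lu unfolding leads_def by blast
  obtain w2 where w2: "\<And>\<phi>. ev d ?t \<phi> = vec d ?q (wlab w) \<phi> + w2 \<phi>" "supported_on (short_labels d (len d w)) w2"
    using lt unfolding leads_def by blast
  have evG: "evc d G \<phi> = w1 \<phi> - w2 \<phi>" for \<phi>
  proof -
    have "evc d G \<phi> = evc d (cl ?u) \<phi> + (- 1) * evc d (cl ?t) \<phi>"
      unfolding G_def using evc_linear(1)[OF cl_hm[OF arr(1)] hm_scal[OF cl_hm[OF arr(2)]]]
        evc_linear(2)[OF cl_hm[OF arr(2)] cl_hm[OF arr(2)]] by simp
    then show ?thesis using arr w1(1) w2(1) by (simp add: evc_cl arrow_iff)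
  qed
  have supp: "supported_on (short_labels d (len d w)) (\<lambda>\<phi>. w1 \<phi> - w2 \<phi>)"
    unfolding supported_on_def
  proof (intro allI impI)
    fix \<phi> \<psi> :: "st \<Rightarrow> 'k" assume e: "\<forall>\<beta> \<alpha>. \<forall>v\<in>short_labels d (len d w). \<phi> (\<beta>, \<alpha>, v) = \<psi> (\<beta>, \<alpha>, v)"
    have "w1 \<phi> = w1 \<psi>" using w1(2)[unfolded supported_on_def, rule_format, of \<phi> \<psi>] e by blast
    moreover have "w2 \<phi> = w2 \<psi>" using w2(2)[unfolded supported_on_def, rule_format, of \<phi> \<psi>] e by blast
    ultimately show "w1 \<phi> - w2 \<phi> = w1 \<psi> - w2 \<psi>" by simp
  qed
  have sum: "(\<Sum>y\<in>Y. c y * ev d (bterm j U y) \<phi>) = w1 \<phi> - w2 \<phi>" for \<phi>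
  proof -
    have "(\<Sum>y\<in>Y. c y * ev d (bterm j U y) \<phi>) = (\<Sum>y\<in>Y. c y * evc d (cl (bterm j U y)) \<phi>)"
    proof (rule sum.cong[OF refl])
      fix y assume "y \<in> Y"
      then have "arrow (bterm j U y) i j" using U_arrow[of y] Y(2) by blast
      then have "wt (bterm j U y)" by (simp add: arrow_iff)
      then show "c y * ev d (bterm j U y) \<phi> = c y * evc d (cl (bterm j U y)) \<phi>" by (simp add: evc_cl)
    qed
    also have "\<dots> = evc d G \<phi>"
      unfolding Y(3) by (rule evc_combination[OF i(1) j(1) Y(1), symmetric]) (use tU Y(2) in blast)
    finally show ?thesis using evG by simp
  qed
  \<comment> \<open>The remainder of G plays the role of U in
    \<open>leading_coefficients_vanish\<close>, so only strictly shorter permutations are left for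
    the induction hypothesis.\<close>
  have van: "c y = 0" if y: "y \<in> Y" "len d w \<le> len d (snd (snd y))" for y
  proof -
    obtain as' \<alpha>' v where ye: "y = (as', \<alpha>', v)" by (cases y)
    have "c (as', \<alpha>', v) = 0"
    proof (rule leading_coefficients_vanish[OF i j(2) _ _ Y(1) _ _ sum supp])
      show "diagram_for d j w i (U w)" "w permutes {..<d}" if "w \<in> W" for w
        using U[OF that] that by (simp_all add: W_def)
      show "Y \<subseteq> I" using Y(2) by blast
      show "w \<in> W" if "(as, \<alpha>, w) \<in> Y" for as \<alpha> w using Y(2) that by auto
      show "(as', \<alpha>', v) \<in> Y" "len d w \<le> len d v" using y ye by simp_all
    qed
    then show ?thesis by (simp add: ye)
  qed
  have "sp (basis_element j i T ` I) i j G"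
    unfolding Y(3)
  proof (rule sp_combination_closed[OF i(1) j(1) Y(1)])
    fix y assume y: "y \<in> Y"
    then have yW: "y \<in> IW" using Y(2) by blast
    show "cl (bterm j U y) \<in> hm i j" by (rule tU[OF yW])
    show "sp (basis_element j i T ` I) i j (scal (c y) (cl (bterm j U y)))"
    proof (cases "len d w \<le> len d (snd (snd y))")
      case True
      then show ?thesis using van[OF y] scal_0[OF tU[OF yW]] sp_zero by simp
    next
      case False
      then show ?thesis using sp_scal less(1)[OF _ yW] x by simp
    qed
  qed
  moreover have "cl ?u = G \<squnion> scal (- 1) (scal (- 1) (cl ?t))"
    by (rule eq_plusI[OF G_def[symmetric] cl_hm[OF arr(1)] hm_scal[OF cl_hm[OF arr(2)]]])
  moreover have "sp (basis_element j i T ` I) i j (cl ?t)" using basis_element_eq[OF w(3)] w(3) by (intro sp_base) auto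
  ultimately show ?case by (simp add: sp_add sp_scal)
qed

lemma basis_generates: "generates K (Hom i j) (basis_element j i T ` I)"
  unfolding generates_def
proof
  fix F assume "F \<in> carrier (Hom i j)"
  then have "F \<in> hm i j" by (simp add: carrier_Hom)
  then have "sp (basis_element j i T ` I) i j F"
  proof (rule sp_mono[OF hm_sp_U])
    fix G assume "G \<in> (\<lambda>x. cl (bterm j U x)) ` IW"
    then obtain x where "x \<in> IW" "G = cl (bterm j U x)" by (rule imageE)
    then show "sp (basis_element j i T ` I) i j G" using sp_U by simp
  qed
  then have "sp ((\<lambda>v. v) ` basis_element j i T ` I) i j F" by simp
  moreover have "v \<in> hm i j" if "v \<in> basis_element j i T ` I" for v
    using that basis_hm by blast
  ultimately obtain Y c where "finite Y" "Y \<subseteq> basis_element j i T ` I" "F = (\<Oplus>\<^bsub>Hom i j\<^esub>v\<in>Y. c v \<odot>\<^bsub>Hom i j\<^esub> v)"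
    using sp_combination[OF i(1) j(1), of "basis_element j i T ` I" "\<lambda>v. v" F] by blast
  then show "\<exists>Y c. finite Y \<and> Y \<subseteq> basis_element j i T ` I \<and> c \<in> Y \<rightarrow> carrier K \<and>
      F = (\<Oplus>\<^bsub>Hom i j\<^esub>v\<in>Y. c v \<odot>\<^bsub>Hom i j\<^esub> v)" by (auto simp: K_simps)
qed

theorem basis_theorem:
  "inj_on (basis_element j i T) I \<and> module_basis K (Hom i j) (basis_element j i T ` I)"
  unfolding module_basis_def using basis_inj basis_indep basis_generates basis_hm
  by (auto simp: carrier_Hom)

end

end

theorem theorem7p10:
  fixes scale :: "'k::comm_ring_1 \<Rightarrow> 'a::ring_1 \<Rightarrow> 'a"
    and gr :: "bit \<Rightarrow> 'a set" and tr :: "'a \<Rightarrow> 'k" and B :: "'a set" and dual :: "'a \<Rightarrow> 'a"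
    and z :: 'k
    and d :: nat and Qs :: "'a P1 list"
    and T :: "'a obj \<Rightarrow> (nat \<Rightarrow> nat) \<Rightarrow> 'a obj \<Rightarrow> ('a, 'k) mor"
    and i j :: "'a obj"
  assumes "symmetric_frobenius_superalgebra scale gr tr B dual"
    and "set Qs \<subseteq> superalgebra.E gr"
    and "\<And>i' j' w. i' \<in> superalgebra.shuffle_words gr d Qs \<Longrightarrow>
           j' \<in> superalgebra.shuffle_words gr d Qs \<Longrightarrow> w permutes {..<d} \<Longrightarrow>
           diagram_for d j' w i' (T j' w i')"
    and "i \<in> superalgebra.shuffle_words gr d Qs"
    and "j \<in> superalgebra.shuffle_words gr d Qs"
  shows "inj_on (LAH.basis_element scale gr B dual z j i (\<lambda>w. T j w i)) (basis_index d B)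
       \<and> module_basis ring_of_type_algebra (LAH.Hom scale gr B dual z i j)
           (LAH.basis_element scale gr B dual z j i (\<lambda>w. T j w i) ` basis_index d B)"
proof -
  interpret LAH scale gr tr B dual z by (rule LAH.intro[OF assms(1)])
  show ?thesis
    using basis_theorem[OF num_black_shuffle[OF assms(4)] num_black_shuffle[OF assms(5)] assms(3)[OF assms(4,5)]] .
qed

end
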